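(* Let $u$ be a positive integer. There is an algorithm that, given a set $S \subseteq [u]$ of $n$ elements, computes in $O\bigl(\sqrt{n \log n}\, u \log u\bigr)$ time the set $\mathcal{S}_u(S) = \{\, \sum_{y \in Y} y \mid Y \subseteq S \,\} \cap [u]$ of all subset sums of $S$ up to $u$.
   Context: For a real number $u \ge 0$, $[u]$ denotes the set of integers $\{0, 1, \ldots, \lceil u \rceil\}$. For a finite set $X \subset \mathbb{N}$, $\Sigma X = \sum_{x \in X} x$ (with $\Sigma \emptyset = 0$), and $\mathcal{S}_u(X) = \{\Sigma Y \mid Y \subseteq X\} \cap [u]$ is the set of all subset sums of $X$ that are at most $u$. Running times are measured in the standard RAM model of computation with arithmetic on integers of the relevant size in constant time. *)

theory Defs
  imports Complex_Main
begin

definition upto_set :: "real \<Rightarrow> nat set" where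
  "upto_set u = {0..nat \<lceil>u\<rceil>}"

definition subset_sums :: "real \<Rightarrow> nat set \<Rightarrow> nat set" where
  "subset_sums u X = {\<Sum>Y | Y. Y \<subseteq> X} \<inter> upto_set u"

datatype instr =
    Const nat int
  | Add nat nat nat
  | Sub nat nat nat
  | Mul nat nat nat
  | Div nat nat nat
  | Mod nat nat nat
  | Load nat nat
  | Store nat nat
  | Jz nat nat
  | Jneg nat nat
  | Jmp nat

type_synonym prog = "instr list"
type_synonym config = "nat \<times> (nat \<Rightarrow> int)"

fun exec :: "instr \<Rightarrow> config \<Rightarrow> config" where
  "exec (Const r c) (pc, m) = (Suc pc, m(r := c))"
| "exec (Add r a b) (pc, m) = (Suc pc, m(r := m a + m b))"
| "exec (Sub r a b) (pc, m) = (Suc pc, m(r := m a - m b))"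
| "exec (Mul r a b) (pc, m) = (Suc pc, m(r := m a * m b))"
| "exec (Div r a b) (pc, m) = (Suc pc, m(r := m a div m b))"
| "exec (Mod r a b) (pc, m) = (Suc pc, m(r := m a mod m b))"
| "exec (Load r a) (pc, m) = (Suc pc, m(r := m (nat (m a))))"
| "exec (Store r a) (pc, m) = (Suc pc, m(nat (m a) := m r))"
| "exec (Jz r l) (pc, m) = ((if m r = 0 then l else Suc pc), m)"
| "exec (Jneg r l) (pc, m) = ((if m r < 0 then l else Suc pc), m)"
| "exec (Jmp l) (pc, m) = (l, m)"

definition halted :: "prog \<Rightarrow> config \<Rightarrow> bool" where
  "halted P c \<longleftrightarrow> length P \<le> fst c"

definition step :: "prog \<Rightarrow> config \<Rightarrow> config" where
  "step P c = (if halted P c then c else exec (P ! fst c) c)"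

definition run :: "prog \<Rightarrow> nat \<Rightarrow> config \<Rightarrow> config" where
  "run P t c = (step P ^^ t) c"

definition init_mem :: "nat \<Rightarrow> nat list \<Rightarrow> nat \<Rightarrow> int" where
  "init_mem u xs a =
     (if a = 0 then int u
      else if a = 1 then int (length xs)
      else if a - 2 < length xs then int (xs ! (a - 2))
      else 0)"

definition init_config :: "nat \<Rightarrow> nat list \<Rightarrow> config" where
  "init_config u xs = (0, init_mem u xs)"

end

theory Submission
  imports Defs
begin

text \<open>
  Split the input into its residue classes modulo \<open>b \<approx> sqrt (n log n)\<close>. An element of class \<open>l\<close> is \<open>y * b + l\<close>,
  so the sum of \<open>c\<close> such elements is \<open>s * b + c * l\<close> with \<open>s \<le> u / b\<close>, and it suffices to know the pairs \<open>(c, s)\<close>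
  attained by subsets of the class. A pair is encoded as \<open>c * W + s\<close>; the set of codes is computed by merging
  halves, each merge being one convolution of 0/1 sequences, which costs \<open>O((u / b) n log n log u)\<close> over all classes.
  Combining the \<open>b\<close> classes takes \<open>b\<close> further convolutions of length \<open>O(u)\<close>, at a cost of \<open>O(b u log u)\<close>.

  Convolutions use a fast Fourier transform in fixed-point complex arithmetic with \<open>O(log u)\<close> bits. Its steps split
  \<open>X^(2*m) - r\<^sup>2\<close> into \<open>(X^m - r) * (X^m + r)\<close>; visiting the roots \<open>r\<close> in bit-reversed order makes the table
  of roots independent of the length, and the inverse transform undoes the steps one by one. The entries of the
  convolution are integers, so rounding recovers them exactly once the accumulated error is below \<open>1 / 2\<close>.

  The program is written in a small language of while loops over integer variables and arrays, whose big-step semantics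
  counts steps and bounds all stored values, and is compiled to the machine. Arrays are interleaved above a base
  address kept in register 0, which makes them disjoint for all index ranges.
\<close>

subsection \<open>A while language\<close>

text \<open>The result concerns one fixed machine program whose cells stay polynomial in
  \<open>u\<close>, so even the roots of unity must be produced by integer instructions with a
  proved error. The two costs, of the merges and of the combination of classes, balance when
  \<open>b ^ 2\<close> is about \<open>n log n\<close>; this is the origin of
  \<open>bl (n * lg)\<close>. Cardinalities are recorded because the residue \<open>l\<close>
  contributes \<open>c * l\<close> to a sum.

  Two losses dictate the precision. The sine of a small angle comes from a square root near 0, which
  keeps only half of the digits: at scale \<open>T ^ 32\<close> a single root is good to about
  \<open>1 / T ^ 16\<close>, and the table, built by repeated multiplication, to
  \<open>1 / T ^ 13\<close>. A butterfly at most about triples the error, so a transform of length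
  up to \<open>T\<close> loses a factor \<open>T ^ 2\<close>, as \<open>3 < 2 ^ 2\<close>. The other
  powers of \<open>T\<close> pay for the size of the entries and leave an error of at most 1 / 4 for
  rounding.

  The empty input is answered separately: the claimed time is then a constant, and \<open>b\<close>
  would be 0.\<close>

datatype var = Vu | Vn | Vi | Vpw | Vlg | Vb | Vq | Vw | Vnn | Vtl | Vs | Vcs | Vsn | Vk | Vx | Vr
  | Vt | Vcl | Vcnt | Vm | Vd | Ve | Vp | VN | Vh

datatype arr = SV | RAW | XS | QS | ZS | ACC | XR | XI | YR | YI | BR | BI | GR | GI

datatype bop = Plus | Minus | Times | Quot | Rem

datatype exp = N int | V var | Bop bop exp exp | Ld arr exp

datatype com = Assign var exp (infix \<open>::=\<close> 62) | Sto arr exp exp | Seq com com (infixr \<open>;;\<close> 60)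
  | While exp exp com

type_synonym st = "(var \<Rightarrow> int) \<times> (arr \<Rightarrow> nat \<Rightarrow> int)"

fun bopv :: "bop \<Rightarrow> int \<Rightarrow> int \<Rightarrow> int" where
  "bopv Plus x y = x + y"
| "bopv Minus x y = x - y"
| "bopv Times x y = x * y"
| "bopv Quot x y = x div y"
| "bopv Rem x y = x mod y"

fun aval :: "exp \<Rightarrow> st \<Rightarrow> int" where
  "aval (N c) s = c"
| "aval (V x) s = fst s x"
| "aval (Bop f e1 e2) s = bopv f (aval e1 s) (aval e2 s)"
| "aval (Ld k e) s = snd s k (nat (aval e s))"

text \<open>\<open>lm\<close> bounds the indices into \<open>RAW\<close>, the only array that is not laid out above the base address.\<close>
definition idx_ok :: "int \<Rightarrow> arr \<Rightarrow> int \<Rightarrow> bool" where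
  "idx_ok lm k i \<longleftrightarrow> 0 \<le> i \<and> (k = RAW \<longrightarrow> i < lm)"

fun eok :: "int \<Rightarrow> exp \<Rightarrow> st \<Rightarrow> bool" where
  "eok lm (N c) s = True"
| "eok lm (V x) s = True"
| "eok lm (Bop f e1 e2) s = (eok lm e1 s \<and> eok lm e2 s)"
| "eok lm (Ld k e) s = (eok lm e s \<and> idx_ok lm k (aval e s))"

definition upd :: "arr \<Rightarrow> nat \<Rightarrow> int \<Rightarrow> (arr \<Rightarrow> nat \<Rightarrow> int) \<Rightarrow> arr \<Rightarrow> nat \<Rightarrow> int" where
  "upd k i x a = a(k := (a k)(i := x))"

text \<open>Only stored values are held to \<open>B\<close>; what an expression passes through
  during evaluation is bounded afterwards from its shape by \<open>aval_bound\<close>. An assignment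
  costs 1 whatever its expression, because the program text is fixed and \<open>ccom_correct\<close>
  pays with the length of the code.\<close>

inductive big :: "int \<Rightarrow> int \<Rightarrow> com \<Rightarrow> st \<Rightarrow> nat \<Rightarrow> st \<Rightarrow> bool" for B lm where
  Assign: "\<lbrakk>eok lm e (v, a); \<bar>aval e (v, a)\<bar> \<le> B\<rbrakk>
    \<Longrightarrow> big B lm (x ::= e) (v, a) 1 (v(x := aval e (v, a)), a)"
| Sto: "\<lbrakk>eok lm i (v, a); eok lm e (v, a); idx_ok lm k (aval i (v, a)); \<bar>aval e (v, a)\<bar> \<le> B\<rbrakk>
    \<Longrightarrow> big B lm (Sto k i e) (v, a) 1 (v, upd k (nat (aval i (v, a))) (aval e (v, a)) a)"
| Seq: "\<lbrakk>big B lm c s t s'; big B lm c' s' t' s''\<rbrakk> \<Longrightarrow> big B lm (c ;; c') s (t + t') s''"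
| WhileF: "\<lbrakk>eok lm e s; eok lm e' s; \<not> aval e s < aval e' s\<rbrakk> \<Longrightarrow> big B lm (While e e' c) s 1 s"
| WhileT: "\<lbrakk>eok lm e s; eok lm e' s; aval e s < aval e' s; big B lm c s t s';
    big B lm (While e e' c) s' t' s''\<rbrakk> \<Longrightarrow> big B lm (While e e' c) s (Suc (t + t')) s''"

subsection \<open>Compilation\<close>

text \<open>Register 0 holds the base address, the registers below \<open>TB\<close> the variables, and those from \<open>TB\<close> to \<open>RB - 1\<close>
  are temporaries.\<close>
abbreviation (input) TB :: nat where "TB \<equiv> 32"
abbreviation (input) RB :: nat where "RB \<equiv> 64"

fun vreg :: "var \<Rightarrow> nat" where
  "vreg Vu = 1" | "vreg Vn = 2" | "vreg Vi = 3" | "vreg Vpw = 4" | "vreg Vlg = 5" | "vreg Vb = 6"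
| "vreg Vq = 7" | "vreg Vw = 8" | "vreg Vnn = 9" | "vreg Vtl = 10" | "vreg Vs = 11" | "vreg Vcs = 12"
| "vreg Vsn = 13" | "vreg Vk = 14" | "vreg Vx = 15" | "vreg Vr = 16" | "vreg Vt = 17"
| "vreg Vcl = 18" | "vreg Vcnt = 19" | "vreg Vm = 20" | "vreg Vd = 21" | "vreg Ve = 22"
| "vreg Vp = 23" | "vreg VN = 24" | "vreg Vh = 25"

fun kof :: "arr \<Rightarrow> nat" where
  "kof SV = 0" | "kof RAW = 15" | "kof XS = 1" | "kof QS = 2" | "kof ZS = 3" | "kof ACC = 4"
| "kof XR = 5" | "kof XI = 6" | "kof YR = 7" | "kof YI = 8" | "kof BR = 9" | "kof BI = 10"
| "kof GR = 11" | "kof GI = 12"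

lemma vreg_inj: "vreg x = vreg y \<longleftrightarrow> x = y"
  by (cases x; cases y; simp)

lemma vreg_bounds: "0 < vreg x" "vreg x < TB"
  by (cases x; simp)+

lemma kof_inj: "kof x = kof y \<longleftrightarrow> x = y"
  by (cases x; cases y; simp)

lemma kof_less: "kof k < 16"
  by (cases k; simp)

text \<open>\<open>RAW\<close> is the stretch of input cells from register 64 on, which stays in
  place: the tail of the input is read there and the tail of the output is written there.
  \<open>SV\<close> has offset 0, so its cell \<open>j\<close> is the address
  \<open>base + 16 * j\<close> to which register \<open>j\<close> is saved at the start for
  \<open>2 \<le> j < 64\<close>; cell 0 receives \<open>n\<close>.\<close>

definition addr :: "nat \<Rightarrow> arr \<Rightarrow> nat \<Rightarrow> nat" where
  "addr base k i = (if k = RAW then RB + i else base + 16 * i + kof k)"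

fun bopi :: "bop \<Rightarrow> nat \<Rightarrow> nat \<Rightarrow> nat \<Rightarrow> instr" where
  "bopi Plus = Add" | "bopi Minus = Sub" | "bopi Times = Mul" | "bopi Quot = Div" | "bopi Rem = Mod"

definition caddr :: "nat \<Rightarrow> arr \<Rightarrow> instr list" where
  "caddr d k = (if k = RAW then [Const (Suc d) (int RB), Add d d (Suc d)]
     else [Const (Suc d) 16, Mul d d (Suc d), Add d d 0, Const (Suc d) (int (kof k)), Add d d (Suc d)])"

fun cexp :: "nat \<Rightarrow> exp \<Rightarrow> instr list" where
  "cexp d (N c) = [Const d c]"
| "cexp d (V x) = [Const d 0, Add d d (vreg x)]"
| "cexp d (Bop f e1 e2) = cexp d e1 @ cexp (Suc d) e2 @ [bopi f d d (Suc d)]"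
| "cexp d (Ld k e) = cexp d e @ caddr d k @ [Load d d]"

text \<open>The temporaries form a stack of height \<open>d\<close>, and a load needs one more cell
  for its address. Staying below \<open>RB\<close> keeps the stack out of \<open>RAW\<close>;
  constants up to 64 are within every admissible \<open>B\<close>.\<close>

fun ewf :: "nat \<Rightarrow> exp \<Rightarrow> bool" where
  "ewf d (N c) = (\<bar>c\<bar> \<le> 64 \<and> d < RB)"
| "ewf d (V x) = (d < RB)"
| "ewf d (Bop f e1 e2) = (ewf d e1 \<and> ewf (Suc d) e2)"
| "ewf d (Ld k e) = (ewf d e \<and> Suc d < RB)"

text \<open>Counts leaves and loads. By \<open>bopv_bound\<close> an operation at worst multiplies,
  so an expression over values up to \<open>B\<close> stays within \<open>B ^ wt e\<close>.\<close>

fun wt :: "exp \<Rightarrow> nat" where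
  "wt (N c) = 1"
| "wt (V x) = 1"
| "wt (Bop f e1 e2) = wt e1 + wt e2"
| "wt (Ld k e) = Suc (wt e)"

definition cguard :: "exp \<Rightarrow> exp \<Rightarrow> instr list" where
  "cguard e e' = cexp TB e @ cexp (Suc TB) e' @ [Sub TB TB (Suc TB)]"

fun ccom :: "nat \<Rightarrow> com \<Rightarrow> instr list" where
  "ccom pc (x ::= e) = cexp TB e @ [Const (Suc TB) 0, Add (vreg x) TB (Suc TB)]"
| "ccom pc (Sto k i e) = cexp TB i @ caddr TB k @ cexp (Suc TB) e @ [Store (Suc TB) TB]"
| "ccom pc (c ;; c') = (let p = ccom pc c in p @ ccom (pc + length p) c')"
| "ccom pc (While e e' c) =
     (let q = pc + length (cguard e e') + 2; p = ccom q c in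
      cguard e e' @ [Jneg TB q, Jmp (q + length p + 1)] @ p @ [Jmp pc])"

fun cwf :: "com \<Rightarrow> bool" where
  "cwf (x ::= e) = ewf TB e"
| "cwf (Sto k i e) = (ewf TB i \<and> ewf (Suc TB) e)"
| "cwf (c ;; c') = (cwf c \<and> cwf c')"
| "cwf (While e e' c) = (ewf TB e \<and> ewf (Suc TB) e' \<and> cwf c)"

fun cwt :: "com \<Rightarrow> nat" where
  "cwt (x ::= e) = wt e"
| "cwt (Sto k i e) = wt i + wt e"
| "cwt (c ;; c') = cwt c + cwt c'"
| "cwt (While e e' c) = wt e + wt e' + cwt c"

section \<open>Machine runs and jump-free code\<close>

definition bdd :: "int \<Rightarrow> (nat \<Rightarrow> int) \<Rightarrow> bool" where
  "bdd M m \<longleftrightarrow> (\<forall>x. \<bar>m x\<bar> \<le> M)"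

definition reach :: "prog \<Rightarrow> int \<Rightarrow> config \<Rightarrow> nat \<Rightarrow> config \<Rightarrow> bool" where
  "reach P M c t c' \<longleftrightarrow> run P t c = c' \<and> (\<forall>t'\<le>t. bdd M (snd (run P t' c)))"

lemma reach_refl: "bdd M (snd c) \<Longrightarrow> reach P M c 0 c"
  by (simp add: reach_def run_def)

lemma run_add: "run P (s + t) c = run P t (run P s c)"
  unfolding run_def by (subst add.commute) (simp add: funpow_add)

lemma reach_trans:
  assumes "reach P M c s c'" "reach P M c' t c''"
  shows "reach P M c (s + t) c''"
proof -
  have c': "run P s c = c'" and c'': "run P t c' = c''" using assms by (simp_all add: reach_def)
  have "bdd M (snd (run P t' c))" if "t' \<le> s + t" for t'
  proof (cases "t' \<le> s")
    case True
    then show ?thesis using assms(1) by (simp add: reach_def)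
  next
    case False
    define r where "r = t' - s"
    have r: "t' = s + r" "r \<le> t" using False that by (simp_all add: r_def)
    show ?thesis using assms(2) r(2) unfolding r(1) run_add c' reach_def by simp
  qed
  moreover have "run P (s + t) c = c''" unfolding run_add c' c'' ..
  ultimately show ?thesis unfolding reach_def by blast
qed

lemma reach_step:
  assumes "bdd M m" "pc < length P" "exec (P ! pc) (pc, m) = (pc', m')" "bdd M m'"
  shows "reach P M (pc, m) 1 (pc', m')"
proof -
  have 1: "run P 1 (pc, m) = (pc', m')" using assms(2,3) by (simp add: run_def step_def halted_def)
  have "bdd M (snd (run P t' (pc, m)))" if "t' \<le> 1" for t'
  proof (cases "t' = 0")
    case True then show ?thesis using assms(1) by (simp add: run_def)
  next
    case False
    then have "t' = 1" using that by linarith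
    then show ?thesis using 1 assms(4) by simp
  qed
  then show ?thesis using 1 by (simp only: reach_def) blast
qed

fun code_at :: "prog \<Rightarrow> nat \<Rightarrow> instr list \<Rightarrow> bool" where
  "code_at P pc [] = True"
| "code_at P pc (i # is) = (pc < length P \<and> P ! pc = i \<and> code_at P (Suc pc) is)"

lemma code_at_append:
  "code_at P pc (is @ js) \<longleftrightarrow> code_at P pc is \<and> code_at P (pc + length is) js"
  by (induction "is" arbitrary: pc) auto

lemma code_at_middle: "code_at (A @ is @ C) (length A) is"
proof (induction "is" arbitrary: A)
  case (Cons i "is")
  from Cons[of "A @ [i]"] show ?case by (simp add: nth_append)
qed simp

fun linear :: "instr \<Rightarrow> bool" where
  "linear (Jz r l) = False" | "linear (Jneg r l) = False" | "linear (Jmp l) = False"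
| "linear i = True"

text \<open>For a jump-free instruction the program counter does not matter.\<close>
definition mex :: "instr \<Rightarrow> (nat \<Rightarrow> int) \<Rightarrow> nat \<Rightarrow> int" where
  "mex i m = snd (exec i (0, m))"

lemma exec_linear: "linear i \<Longrightarrow> exec i (pc, m) = (Suc pc, mex i m)"
  by (cases i) (auto simp: mex_def)

text \<open>Jump-free code is described without a program counter, so that facts about it can be
  concatenated freely; \<open>sl_reach\<close> then places it in a program.\<close>

inductive sl :: "int \<Rightarrow> instr list \<Rightarrow> (nat \<Rightarrow> int) \<Rightarrow> (nat \<Rightarrow> int) \<Rightarrow> bool" for M where
  sl_Nil: "sl M [] m m"
| sl_Cons: "linear i \<Longrightarrow> bdd M (mex i m) \<Longrightarrow> sl M is (mex i m) m' \<Longrightarrow> sl M (i # is) m m'"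

lemma sl_append: "sl M is m m' \<Longrightarrow> sl M js m' m'' \<Longrightarrow> sl M (is @ js) m m''"
  by (induction rule: sl.induct) (auto intro: sl.intros)

lemma sl_bdd: "sl M is m m' \<Longrightarrow> bdd M m \<Longrightarrow> bdd M m'"
  by (induction rule: sl.induct) auto

lemma sl_reach:
  "sl M is m m' \<Longrightarrow> bdd M m \<Longrightarrow> code_at P pc is \<Longrightarrow> reach P M (pc, m) (length is) (pc + length is, m')"
proof (induction arbitrary: pc rule: sl.induct)
  case (sl_Nil m) then show ?case by (simp add: reach_refl)
next
  case (sl_Cons i m "is" m')
  have "reach P M (pc, m) 1 (Suc pc, mex i m)"
    using sl_Cons by (intro reach_step) (auto simp: exec_linear)
  from reach_trans[OF this sl_Cons.IH] sl_Cons.hyps sl_Cons.prems show ?case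
    by auto
qed

lemma bdd_upd: "bdd M m \<Longrightarrow> \<bar>x\<bar> \<le> M \<Longrightarrow> bdd M (m(r := x))"
  by (auto simp: bdd_def)

text \<open>Nothing is claimed about \<open>RAW\<close> from \<open>lm\<close> on, where its
  addresses may run into the interleaved arrays.\<close>

definition rep :: "nat \<Rightarrow> int \<Rightarrow> st \<Rightarrow> (nat \<Rightarrow> int) \<Rightarrow> bool" where
  "rep base lm s m \<longleftrightarrow> m 0 = int base \<and> (\<forall>x. m (vreg x) = fst s x) \<and>
     (\<forall>k i. (k = RAW \<longrightarrow> int i < lm) \<longrightarrow> m (addr base k i) = snd s k i)"

definition sbound :: "int \<Rightarrow> st \<Rightarrow> bool" where
  "sbound B s \<longleftrightarrow> (\<forall>x. \<bar>fst s x\<bar> \<le> B) \<and> (\<forall>k i. \<bar>snd s k i\<bar> \<le> B)"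

lemma abs_div_le: "\<bar>x div y\<bar> \<le> \<bar>x\<bar>" for x y :: int
proof (cases "y = 0")
  case False
  have *: "\<bar>x div y\<bar> \<le> \<bar>x\<bar>" if "0 < y" for x y :: int
  proof (cases "0 \<le> x")
    case True
    then show ?thesis using that by (simp add: pos_imp_zdiv_nonneg_iff zdiv_mono2[of x 1 y, simplified])
  next
    case False
    then have "x div y < 0" using that by (simp add: neg_imp_zdiv_neg_iff pos_imp_zdiv_neg_iff)
    moreover have "x \<le> x div y"
      using False that zdiv_mono2_neg[of x 1 y] by simp
    ultimately show ?thesis using False by simp
  qed
  show ?thesis
  proof (cases "0 < y")
    case False
    then have "0 < - y" using \<open>y \<noteq> 0\<close> by simp
    from *[OF this, of "- x"] show ?thesis by simp
  qed (use * in simp)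
qed simp

lemma abs_mod_le: "\<bar>x mod y\<bar> \<le> \<bar>x\<bar> + \<bar>y\<bar>" for x y :: int
proof (cases "y = 0")
  case False
  then show ?thesis
  proof (cases "0 < y")
    case True then show ?thesis using pos_mod_bound[of y x] pos_mod_sign[of y x] by linarith
  next
    case False
    then have "y < 0" using \<open>y \<noteq> 0\<close> by simp
    then show ?thesis using neg_mod_bound[of y x] neg_mod_sign[of y x] by linarith
  qed
qed simp

text \<open>For \<open>X, Y \<ge> 2\<close> also \<open>X + Y \<le> X * Y\<close>, so the product
  covers sums, differences and remainders, and a quotient never exceeds its dividend in absolute
  value.\<close>

lemma bopv_bound:
  assumes "\<bar>x\<bar> \<le> X" "\<bar>y\<bar> \<le> Y" "2 \<le> X" "2 \<le> Y"
  shows "\<bar>bopv f x y\<bar> \<le> X * Y"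
proof -
  have "0 \<le> (X - 2) * (Y - 2)" "0 \<le> (X - 1) * (Y - 1)" using assms by auto
  then have s: "X + Y \<le> X * Y" using assms by (simp add: algebra_simps)
  show ?thesis
  proof (cases f)
    case Times
    have "\<bar>x * y\<bar> \<le> X * Y" unfolding abs_mult using assms by (intro mult_mono) auto
    then show ?thesis using Times by simp
  next
    case Quot
    then show ?thesis using s abs_div_le[of x y] assms by simp
  next
    case Rem
    then show ?thesis using s abs_mod_le[of x y] assms by simp
  qed (use s assms in auto)
qed

lemma wt_pos: "0 < wt e" by (induction e) auto

lemma aval_bound:
  assumes "sbound B s" "64 \<le> B"
  shows "ewf d e \<Longrightarrow> \<bar>aval e s\<bar> \<le> B ^ wt e"
proof (induction e arbitrary: d)
  case (Bop f e1 e2)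
  have "B \<le> B ^ wt e" for e using assms wt_pos[of e] by (intro self_le_power) auto
  then have "2 \<le> B ^ wt e" for e using assms(2) order_trans[of 2 B "B ^ wt e"] by simp
  moreover have "\<bar>aval e1 s\<bar> \<le> B ^ wt e1" "\<bar>aval e2 s\<bar> \<le> B ^ wt e2"
    using Bop.IH(1)[of d] Bop.IH(2)[of "Suc d"] Bop.prems by simp_all
  ultimately show ?case by (simp add: power_add bopv_bound)
next
  case (Ld k e)
  have "B \<le> B ^ wt (Ld k e)" using assms by (intro self_le_power) auto
  moreover have "\<bar>aval (Ld k e) s\<bar> \<le> B" using assms by (simp add: sbound_def)
  ultimately show ?case by linarith
qed (use assms in \<open>auto simp: sbound_def\<close>)

section \<open>Simulation of expressions, guards and assignments\<close>

lemma mex_bopi: "linear (bopi f d x y)" "mex (bopi f d x y) m = m(d := bopv f (m x) (m y))"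
  by (cases f; simp add: mex_def)+

lemma mex_simps:
  "mex (Const r c) m = m(r := c)" "mex (Add r x y) m = m(r := m x + m y)"
  "mex (Sub r x y) m = m(r := m x - m y)"
  "mex (Mul r x y) m = m(r := m x * m y)" "mex (Load r x) m = m(r := m (nat (m x)))"
  "mex (Div r x y) m = m(r := m x div m y)"
  "mex (Store r x) m = m(nat (m x) := m r)"
  by (simp_all add: mex_def)

text \<open>The licence of code running at stack height \<open>d\<close>: it may change only the
  temporaries from \<open>d\<close> up. Variables and arrays survive, and so do the operands waiting
  on the stack below.\<close>

definition tagree :: "nat \<Rightarrow> (nat \<Rightarrow> int) \<Rightarrow> (nat \<Rightarrow> int) \<Rightarrow> bool" where
  "tagree d m m' \<longleftrightarrow> (\<forall>x. x < d \<or> RB \<le> x \<longrightarrow> m' x = m x)"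

lemma rep_tagree: "rep base lm s m \<Longrightarrow> tagree d m m' \<Longrightarrow> TB \<le> d \<Longrightarrow> RB \<le> base \<Longrightarrow> rep base lm s m'"
proof -
  assume A: "rep base lm s m" "tagree d m m'" "TB \<le> d" "RB \<le> base"
  have "vreg x < d" for x using vreg_bounds(2)[of x] A(3) by linarith
  moreover have "RB \<le> addr base k i" for k i using A(4) by (simp add: addr_def)
  ultimately show ?thesis using A(1-3) by (simp add: rep_def tagree_def)
qed

text \<open>The origin of the \<open>+ 3\<close> in the memory bounds: computing an address
  multiplies by 16 and adds the base, in all at most a factor 18, which \<open>B ^ 3\<close>
  absorbs.\<close>

lemma addr_bound:
  assumes "\<bar>i\<bar> \<le> B ^ w" "64 \<le> B" "int base \<le> B" "1 \<le> w"
  shows "16 * \<bar>i\<bar> + int base + 64 \<le> B ^ (w + 3)"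
proof -
  have 1: "B ^ 1 \<le> B ^ w" using assms by (intro power_increasing) auto
  then have Bw: "B \<le> B ^ w" by simp
  have "16 * \<bar>i\<bar> + int base + 64 \<le> 18 * B ^ w" using assms Bw by linarith
  also have "\<dots> \<le> B ^ 3 * B ^ w"
  proof (rule mult_right_mono)
    have "B ^ 1 \<le> B ^ 3" using assms by (intro power_increasing) auto
    then show "18 \<le> B ^ 3" using assms by simp
  qed (use assms in simp)
  finally show ?thesis by (simp add: power_add mult.commute)
qed

lemma caddr_sl:
  assumes "bdd M m" "m d = i" "idx_ok lm k i" "16 * \<bar>i\<bar> + int base + 64 \<le> M" "m 0 = int base"
    "TB \<le> d" "Suc d < RB"
  shows "\<exists>m'. sl M (caddr d k) m m' \<and> m' d = int (addr base k (nat i)) \<and> tagree d m m'"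
proof -
  have i: "0 \<le> i" "int (nat i) = i" using assms by (auto simp: idx_ok_def)
  have k: "kof k < 16" by (rule kof_less)
  have M: "64 \<le> M" "\<bar>m d + 64\<bar> \<le> M" "\<bar>m d * 16\<bar> \<le> M" "\<bar>m d * 16 + int base\<bar> \<le> M"
    "\<bar>m d * 16 + int base + int (kof k)\<bar> \<le> M" "\<bar>int (kof k)\<bar> \<le> M" "16 \<le> M"
    using assms(2,4) i k by linarith+
  show ?thesis
  proof (cases "k = RAW")
    case True
    let ?m1 = "m(Suc d := int RB)"
    let ?m2 = "?m1(d := ?m1 d + ?m1 (Suc d))"
    have "sl M (caddr d k) m ?m2" unfolding caddr_def using True assms(1,5,6) M
      by (auto intro!: sl.intros bdd_upd simp: mex_simps)
    moreover have "tagree d m ?m2" using assms by (auto simp: tagree_def)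
    moreover have "?m2 d = int (addr base k (nat i))" using True i assms by (simp add: addr_def)
    ultimately show ?thesis by blast
  next
    case False
    let ?m1 = "m(Suc d := 16)"
    let ?m2 = "?m1(d := ?m1 d * ?m1 (Suc d))"
    let ?m3 = "?m2(d := ?m2 d + ?m2 0)"
    let ?m4 = "?m3(Suc d := int (kof k))"
    let ?m5 = "?m4(d := ?m4 d + ?m4 (Suc d))"
    have "sl M (caddr d k) m ?m5" unfolding caddr_def using False assms(1,5,6) M
      by (auto intro!: sl.intros bdd_upd simp: mex_simps)
    moreover have "tagree d m ?m5" using assms by (auto simp: tagree_def)
    moreover have "?m5 d = int (addr base k (nat i))" using False i assms by (simp add: addr_def)
    ultimately show ?thesis by blast
  qed
qed

lemma ewf_less: "ewf d e \<Longrightarrow> d < RB"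
  by (induction e arbitrary: d) auto

lemma power_le_bound: "B ^ n \<le> (M::int) \<Longrightarrow> m \<le> n \<Longrightarrow> 64 \<le> B \<Longrightarrow> B ^ m \<le> M"
  by (meson order_trans power_increasing one_le_numeral)

lemma bdd_nonneg: "bdd M m \<Longrightarrow> 0 \<le> M"
  unfolding bdd_def by (meson abs_ge_zero order_trans)

lemma sl_single: "linear i \<Longrightarrow> bdd M (mex i m) \<Longrightarrow> sl M [i] m (mex i m)"
  by (intro sl.intros)

text \<open>Induction over the expression at every stack height. The second operand is evaluated at
  \<open>Suc d\<close> and by \<open>tagree (Suc d)\<close> cannot disturb the first, which waits in
  \<open>d\<close>.\<close>

lemma cexp_sl:
  assumes "sbound B s" "64 \<le> B" "int base \<le> B" "RB \<le> base"
  shows "\<lbrakk>ewf d e; eok lm e s; rep base lm s m; bdd M m; B ^ (wt e + 3) \<le> M; TB \<le> d\<rbrakk>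
    \<Longrightarrow> \<exists>m'. sl M (cexp d e) m m' \<and> m' d = aval e s \<and> tagree d m m'"
proof (induction e arbitrary: d m)
  case (N c)
  have "B ^ 1 \<le> M" by (rule power_le_bound[OF N.prems(5)]) (use assms(2) in auto)
  then have "\<bar>c\<bar> \<le> M" using N.prems(1) assms(2) by simp
  then have "bdd M (mex (Const d c) m)" unfolding mex_simps by (rule bdd_upd[OF N.prems(4)])
  then have "sl M (cexp d (N c)) m (mex (Const d c) m)" unfolding cexp.simps by (intro sl_single) auto
  moreover have "tagree d m (mex (Const d c) m)" using N.prems(1) by (auto simp: tagree_def mex_simps)
  moreover have "mex (Const d c) m d = aval (N c) s" by (simp add: mex_simps)
  ultimately show ?case by blast
next
  case (V x)
  have 1: "m (vreg x) = fst s x" using V.prems(3) by (simp add: rep_def)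
  have 2: "vreg x \<noteq> d" using V.prems(6) vreg_bounds[of x] by linarith
  have 3: "\<bar>m (vreg x)\<bar> \<le> M" using V.prems(4) by (simp add: bdd_def)
  let ?m1 = "mex (Const d 0) m"
  let ?m = "mex (Add d d (vreg x)) ?m1"
  have em: "?m = m(d := m (vreg x))" using 2 by (simp add: mex_simps)
  have b1: "bdd M ?m1" unfolding mex_simps
    by (rule bdd_upd[OF V.prems(4)]) (simp add: bdd_nonneg[OF V.prems(4)])
  have b2: "bdd M ?m" unfolding em by (rule bdd_upd[OF V.prems(4) 3])
  have "sl M (cexp d (V x)) m ?m" unfolding cexp.simps by (intro sl.intros b1 b2) auto
  moreover have "tagree d m ?m" using V.prems(1) unfolding em by (auto simp: tagree_def)
  moreover have "?m d = aval (V x) s" unfolding em using 1 by simp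
  ultimately show ?case by blast
next
  case (Bop f e1 e2)
  have le: "B ^ (wt e1 + 3) \<le> M" "B ^ (wt e2 + 3) \<le> M" "B ^ wt (Bop f e1 e2) \<le> M"
    by (rule power_le_bound[OF Bop.prems(5)]; use assms(2) in simp)+
  have wf: "ewf d e1" "ewf (Suc d) e2" and ok: "eok lm e1 s" "eok lm e2 s" using Bop.prems(1,2) by auto
  obtain m1 where m1: "sl M (cexp d e1) m m1" "m1 d = aval e1 s" "tagree d m m1"
    using Bop.IH(1)[OF wf(1) ok(1) Bop.prems(3,4) le(1) Bop.prems(6)] by blast
  have b1: "bdd M m1" using m1(1) Bop.prems(4) by (rule sl_bdd)
  have r1: "rep base lm s m1" by (rule rep_tagree[OF Bop.prems(3) m1(3) Bop.prems(6) assms(4)])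
  obtain m2 where m2: "sl M (cexp (Suc d) e2) m1 m2" "m2 (Suc d) = aval e2 s" "tagree (Suc d) m1 m2"
    using Bop.IH(2)[OF wf(2) ok(2) r1 b1 le(2)] Bop.prems(6) le_SucI by blast
  have b2: "bdd M m2" using m2(1) b1 by (rule sl_bdd)
  have m2d: "m2 d = aval e1 s" using m1(2) m2(3) by (simp add: tagree_def)
  let ?m = "mex (bopi f d d (Suc d)) m2"
  have em: "?m = m2(d := aval (Bop f e1 e2) s)" unfolding mex_bopi m2d m2(2) by simp
  have "\<bar>aval (Bop f e1 e2) s\<bar> \<le> M" using aval_bound[OF assms(1,2) Bop.prems(1)] le(3) by linarith
  then have "bdd M ?m" unfolding em by (rule bdd_upd[OF b2])
  then have "sl M [bopi f d d (Suc d)] m2 ?m" using mex_bopi(1) by (intro sl_single)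
  then have "sl M (cexp d (Bop f e1 e2)) m ?m" unfolding cexp.simps using m1(1) m2(1) by (meson sl_append)
  moreover have "tagree d m ?m" unfolding em
    using m1(3) m2(3) ewf_less[OF wf(1)] by (auto simp: tagree_def)
  moreover have "?m d = aval (Bop f e1 e2) s" unfolding em by simp
  ultimately show ?case by blast
next
  case (Ld k e)
  have le: "B ^ (wt e + 3) \<le> M"
    by (rule power_le_bound[OF Ld.prems(5)]) (use assms(2) in simp)+
  have wf: "ewf d e" "Suc d < RB" and ok: "eok lm e s" "idx_ok lm k (aval e s)" using Ld.prems(1,2) by auto
  obtain m1 where m1: "sl M (cexp d e) m m1" "m1 d = aval e s" "tagree d m m1"
    using Ld.IH[OF wf(1) ok(1) Ld.prems(3,4) le Ld.prems(6)] by blast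
  have b1: "bdd M m1" using m1(1) Ld.prems(4) by (rule sl_bdd)
  have r1: "rep base lm s m1" by (rule rep_tagree[OF Ld.prems(3) m1(3) Ld.prems(6) assms(4)])
  have "\<bar>aval e s\<bar> \<le> B ^ wt e" by (rule aval_bound[OF assms(1,2) wf(1)])
  then have ab: "16 * \<bar>aval e s\<bar> + int base + 64 \<le> M"
    using assms(2,3) wt_pos[of e] le addr_bound[of "aval e s" B "wt e" base] by linarith
  have "m1 0 = int base" using r1 by (simp add: rep_def)
  from caddr_sl[OF b1 m1(2) ok(2) ab this Ld.prems(6) wf(2)]
  obtain m2 where m2: "sl M (caddr d k) m1 m2" "m2 d = int (addr base k (nat (aval e s)))" "tagree d m1 m2"
    by blast
  have b2: "bdd M m2" using m2(1) b1 by (rule sl_bdd)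
  have r2: "rep base lm s m2" by (rule rep_tagree[OF r1 m2(3) Ld.prems(6) assms(4)])
  have ld: "m2 (addr base k (nat (aval e s))) = aval (Ld k e) s"
    using r2 ok(2) by (auto simp: rep_def idx_ok_def)
  let ?m = "mex (Load d d) m2"
  have em: "?m = m2(d := aval (Ld k e) s)" unfolding mex_simps m2(2) ld[symmetric] by simp
  have "\<bar>aval (Ld k e) s\<bar> \<le> M" unfolding ld[symmetric] using b2 by (simp add: bdd_def)
  then have "bdd M ?m" unfolding em by (rule bdd_upd[OF b2])
  then have "sl M [Load d d] m2 ?m" by (intro sl_single) auto
  then have "sl M (cexp d (Ld k e)) m ?m" unfolding cexp.simps using m1(1) m2(1) by (meson sl_append)
  moreover have "tagree d m ?m" unfolding em using m1(3) m2(3) wf(2) by (auto simp: tagree_def)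
  moreover have "?m d = aval (Ld k e) s" unfolding em by simp
  ultimately show ?case by blast
qed

text \<open>Above the base, the residue modulo 16 identifies the array since
  \<open>kof k < 16\<close>, and the quotient gives the index. The cells of \<open>RAW\<close> in
  question all lie below the base.\<close>

lemma addr_inj:
  assumes "addr base k i = addr base k' i'" "k = RAW \<longrightarrow> RB + int i < base" "k' = RAW \<longrightarrow> RB + int i' < base"
  shows "k = k' \<and> i = i'"
proof -
  have *: "kof k = kof k' \<and> i = i'" if "16 * i + kof k = 16 * i' + kof k'"
    using that kof_less[of k] kof_less[of k'] by presburger
  show ?thesis using assms * by (auto simp: addr_def kof_inj split: if_splits)
qed

lemma big_sbound: "big B lm c s t s' \<Longrightarrow> sbound B s \<Longrightarrow> sbound B s'"
  by (induction rule: big.induct) (auto simp: sbound_def upd_def)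

lemma cguard_sl:
  assumes "sbound B s" "64 \<le> B" "int base \<le> B" "RB \<le> base"
    and "ewf TB e" "ewf (Suc TB) e'" "eok lm e s" "eok lm e' s" "rep base lm s m" "bdd M m"
    and "B ^ (wt e + wt e' + 3) \<le> M"
  shows "\<exists>m'. sl M (cguard e e') m m' \<and> m' TB = aval e s - aval e' s \<and> rep base lm s m' \<and> bdd M m'"
proof -
  have le: "B ^ (wt e + 3) \<le> M" "B ^ (wt e' + 3) \<le> M" "B ^ (wt e + wt e') \<le> M"
    by (rule power_le_bound[OF assms(11)]; use assms in simp)+
  obtain m1 where m1: "sl M (cexp TB e) m m1" "m1 TB = aval e s" "tagree TB m m1"
    using cexp_sl[OF assms(1-5,7,9,10) le(1)] by blast
  have b1: "bdd M m1" using m1(1) assms(10) by (rule sl_bdd)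
  have r1: "rep base lm s m1" using rep_tagree[OF assms(9) m1(3) _ assms(4)] by simp
  obtain m2 where m2: "sl M (cexp (Suc TB) e') m1 m2" "m2 (Suc TB) = aval e' s" "tagree (Suc TB) m1 m2"
    using cexp_sl[OF assms(1-4,6,8) r1 b1 le(2)] by (meson le_SucI order_refl)
  have b2: "bdd M m2" using m2(1) b1 by (rule sl_bdd)
  have m2t: "m2 TB = aval e s" using m1(2) m2(3) by (simp add: tagree_def)
  let ?m = "mex (Sub TB TB (Suc TB)) m2"
  have "\<bar>aval (Bop Minus e e') s\<bar> \<le> B ^ wt (Bop Minus e e')"
    by (rule aval_bound[OF assms(1,2), of TB]) (simp add: assms(5) assms(6)[simplified])
  then have "\<bar>aval e s - aval e' s\<bar> \<le> M" using le(3) by simp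
  then have "bdd M ?m" unfolding mex_simps m2(2) m2t by (rule bdd_upd[OF b2])
  then have "sl M [Sub TB TB (Suc TB)] m2 ?m" by (intro sl_single) auto
  then have s: "sl M (cguard e e') m ?m" unfolding cguard_def using m1(1) m2(1) by (meson sl_append)
  have "tagree TB m ?m" using m1(3) m2(3) unfolding mex_simps tagree_def by fastforce
  then have "rep base lm s ?m" using rep_tagree[OF assms(9) _ _ assms(4)] by simp
  moreover have "?m TB = aval e s - aval e' s" using m2(2) m2t by (simp add: mex_simps)
  ultimately show ?thesis using s sl_bdd[OF s assms(10)] by blast
qed

lemma assign_sl:
  assumes "sbound B (v, a)" "64 \<le> B" "int base \<le> B" "RB \<le> base"
    and "ewf TB e" "eok lm e (v, a)" "rep base lm (v, a) m" "bdd M m" "B ^ (wt e + 3) \<le> M"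
  shows "\<exists>m'. sl M (ccom pc (x ::= e)) m m' \<and> rep base lm (v(x := aval e (v, a)), a) m'"
proof -
  obtain m1 where m1: "sl M (cexp TB e) m m1" "m1 TB = aval e (v, a)" "tagree TB m m1"
    using cexp_sl[OF assms(1-9)] by blast
  have b1: "bdd M m1" using m1(1) assms(8) by (rule sl_bdd)
  have r1: "rep base lm (v, a) m1" using rep_tagree[OF assms(7) m1(3) _ assms(4)] by simp
  let ?m1 = "mex (Const (Suc TB) 0) m1"
  let ?m = "mex (Add (vreg x) TB (Suc TB)) ?m1"
  have e1: "?m1 = m1(Suc TB := 0)" by (simp add: mex_simps)
  have e2: "?m = (m1(Suc TB := 0))(vreg x := aval e (v, a))" by (simp add: mex_simps m1(2))
  have b2: "bdd M ?m1" unfolding e1 by (rule bdd_upd[OF b1]) (simp add: bdd_nonneg[OF b1])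
  have "\<bar>m1 TB\<bar> \<le> M" using b1 by (simp add: bdd_def)
  then have b3: "bdd M ?m" unfolding e2 by (intro bdd_upd) (simp_all add: m1(2) b1 bdd_nonneg[OF b1])
  have "sl M [Const (Suc TB) 0, Add (vreg x) TB (Suc TB)] m1 ?m"
    by (intro sl.intros b2 b3) auto
  then have "sl M (ccom pc (x ::= e)) m ?m" using m1(1) unfolding ccom.simps by (meson sl_append)
  moreover have "rep base lm (v(x := aval e (v, a)), a) ?m"
  proof -
    have 1: "vreg y \<noteq> Suc TB" for y using vreg_bounds[of y] by simp
    have 2: "addr base k i \<noteq> Suc TB" "addr base k i \<noteq> vreg y" for k i y
      using vreg_bounds[of y] assms(4) by (auto simp: addr_def)
    show ?thesis unfolding rep_def e2
    proof (intro conjI allI impI)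
      show "(m1(Suc TB := 0, vreg x := aval e (v, a))) 0 = int base"
        using r1 vreg_bounds(1)[of x] by (simp add: rep_def)
      show "(m1(Suc TB := 0, vreg x := aval e (v, a))) (vreg y) = fst (v(x := aval e (v, a)), a) y" for y
        using r1 1 by (simp add: rep_def vreg_inj)
      show "(m1(Suc TB := 0, vreg x := aval e (v, a))) (addr base k i) = snd (v(x := aval e (v, a)), a) k i"
        if "k = RAW \<longrightarrow> int i < lm" for k i
        using r1 2 that by (simp add: rep_def)
    qed
  qed
  ultimately show ?thesis by blast
qed

lemma sto_sl:
  assumes "sbound B (v, a)" "64 \<le> B" "int base \<le> B" "RB \<le> base" "int RB + lm \<le> int base"
    and "ewf TB i" "ewf (Suc TB) e" "eok lm i (v, a)" "eok lm e (v, a)" "idx_ok lm k (aval i (v, a))"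
    and "rep base lm (v, a) m" "bdd M m" "B ^ (wt i + wt e + 3) \<le> M"
  shows "\<exists>m'. sl M (ccom pc (Sto k i e)) m m' \<and>
    rep base lm (v, upd k (nat (aval i (v, a))) (aval e (v, a)) a) m'"
proof -
  have le: "B ^ (wt i + 3) \<le> M" "B ^ (wt e + 3) \<le> M"
    by (rule power_le_bound[OF assms(13)]; use assms(2) in simp)+
  obtain m1 where m1: "sl M (cexp TB i) m m1" "m1 TB = aval i (v, a)" "tagree TB m m1"
    using cexp_sl[OF assms(1-4,6,8,11,12) le(1)] by blast
  have b1: "bdd M m1" using m1(1) assms(12) by (rule sl_bdd)
  have r1: "rep base lm (v, a) m1" using rep_tagree[OF assms(11) m1(3) _ assms(4)] by simp
  have "\<bar>aval i (v,a)\<bar> \<le> B ^ wt i" by (rule aval_bound[OF assms(1,2,6)])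
  then have ab: "16 * \<bar>aval i (v,a)\<bar> + int base + 64 \<le> M"
    using assms(2,3) wt_pos[of i] le(1) addr_bound[of "aval i (v,a)" B "wt i" base] by linarith
  have "m1 0 = int base" using r1 by (simp add: rep_def)
  from caddr_sl[OF b1 m1(2) assms(10) ab this]
  obtain m2 where m2: "sl M (caddr TB k) m1 m2" "m2 TB = int (addr base k (nat (aval i (v,a))))" "tagree TB m1 m2"
    by auto
  have b2: "bdd M m2" using m2(1) b1 by (rule sl_bdd)
  have r2: "rep base lm (v,a) m2" using rep_tagree[OF r1 m2(3) _ assms(4)] by simp
  obtain m3 where m3: "sl M (cexp (Suc TB) e) m2 m3" "m3 (Suc TB) = aval e (v, a)" "tagree (Suc TB) m2 m3"
    using cexp_sl[OF assms(1-4,7,9) r2 b2 le(2)] by (meson le_SucI order_refl)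
  have b3: "bdd M m3" using m3(1) b2 by (rule sl_bdd)
  have r3: "rep base lm (v,a) m3" using rep_tagree[OF r2 m3(3) _ assms(4)] by simp
  let ?A = "addr base k (nat (aval i (v,a)))"
  have m3t: "m3 TB = int ?A" using m3(3) m2(2) by (simp add: tagree_def)
  let ?m = "mex (Store (Suc TB) TB) m3"
  have em: "?m = m3(?A := aval e (v, a))" unfolding mex_simps m3t m3(2) by simp
  have "bdd M ?m" unfolding em using b3 m3(2) by (metis bdd_def bdd_upd)
  then have "sl M [Store (Suc TB) TB] m3 ?m" by (intro sl_single) auto
  then have "sl M (ccom pc (Sto k i e)) m ?m" unfolding ccom.simps using m1(1) m2(1) m3(1)
    by (meson sl_append)
  moreover have "rep base lm (v, upd k (nat (aval i (v, a))) (aval e (v, a)) a) ?m"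
  proof -
    have A: "?A \<ge> RB" using assms(4) by (simp add: addr_def)
    have 1: "vreg y \<noteq> ?A" for y using vreg_bounds[of y] A by linarith
    have 2: "k' = k \<and> i' = nat (aval i (v,a))" if "addr base k' i' = ?A" "k' = RAW \<longrightarrow> int i' < lm" for k' i'
      using addr_inj[OF that(1)] that(2) assms(5,10) by (auto simp: idx_ok_def)
    show ?thesis unfolding rep_def em
    proof (intro conjI allI impI)
      show "(m3(?A := aval e (v, a))) 0 = int base" using r3 A by (simp add: rep_def)
      show "(m3(?A := aval e (v, a))) (vreg y) = fst (v, upd k (nat (aval i (v, a))) (aval e (v, a)) a) y" for y
        using r3 1[of y] by (simp add: rep_def)
      show "(m3(?A := aval e (v, a))) (addr base k' i') = snd (v, upd k (nat (aval i (v, a))) (aval e (v, a)) a) k' i'"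
        if "k' = RAW \<longrightarrow> int i' < lm" for k' i'
        using r3 2[OF _ that] that by (auto simp: rep_def upd_def)
    qed
  qed
  ultimately show ?thesis by blast
qed

lemma code_at_While:
  "code_at P pc (ccom pc (While e e' c)) \<longleftrightarrow>
    (let g = cguard e e'; q = pc + length g + 2 in
     code_at P pc g \<and> code_at P (pc + length g) [Jneg TB q, Jmp (q + length (ccom q c) + 1)] \<and>
     code_at P q (ccom q c) \<and> code_at P (q + length (ccom q c)) [Jmp pc])"
proof -
  have "x + length [i, j] = x + 2" for x :: nat and i j :: instr by simp
  then show ?thesis unfolding ccom.simps Let_def code_at_append by (simp only:)
qed

text \<open>A unit of source cost pays for one pass over the code of a construct, at most
  \<open>K\<close> instructions. Nested code is charged to its own units, so the same
  \<open>K\<close> serves at every depth.\<close>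

theorem ccom_correct:
  assumes "64 \<le> B" "int base \<le> B" "RB \<le> base" "int RB + lm \<le> int base"
  shows "\<lbrakk>big B lm c s t s'; sbound B s; cwf c; code_at P pc (ccom pc c); rep base lm s m; bdd M m;
      B ^ (cwt c + 3) \<le> M; length (ccom pc c) \<le> K\<rbrakk>
    \<Longrightarrow> \<exists>t' m'. reach P M (pc, m) t' (pc + length (ccom pc c), m') \<and> t' \<le> K * t \<and> rep base lm s' m' \<and> bdd M m'"
proof (induction arbitrary: pc m rule: big.induct)
  case (Assign e v a x)
  note pr = Assign.prems
  obtain m' where m': "sl M (ccom pc (x ::= e)) m m'" "rep base lm (v(x := aval e (v, a)), a) m'"
    using assign_sl[OF pr(1) assms(1-3) _ Assign.hyps(1) pr(4,5)] pr(2,6) unfolding cwf.simps cwt.simps by blast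
  show ?case using sl_reach[OF m'(1) pr(5,3)] sl_bdd[OF m'(1) pr(5)] m'(2) pr(7)
    unfolding mult_1_right by blast
next
  case (Sto i v a e k)
  note pr = Sto.prems
  obtain m' where m': "sl M (ccom pc (Sto k i e)) m m'"
    "rep base lm (v, upd k (nat (aval i (v, a))) (aval e (v, a)) a) m'"
    using sto_sl[OF pr(1) assms _ _ Sto.hyps(1,2,3) pr(4,5)] pr(2,6) unfolding cwf.simps cwt.simps by blast
  show ?case using sl_reach[OF m'(1) pr(5,3)] sl_bdd[OF m'(1) pr(5)] m'(2) pr(7)
    unfolding mult_1_right by blast
next
  case (Seq c s t s' c' t' s'')
  note pr = Seq.prems
  let ?p = "pc + length (ccom pc c)"
  have ca: "code_at P pc (ccom pc c)" "code_at P ?p (ccom ?p c')"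
    using pr(3) by (auto simp: Let_def code_at_append)
  have len: "length (ccom pc (c ;; c')) = length (ccom pc c) + length (ccom ?p c')" by (simp add: Let_def)
  have le: "B ^ (cwt c + 3) \<le> M" "B ^ (cwt c' + 3) \<le> M"
    by (rule power_le_bound[OF pr(6)]; use assms(1) in simp)+
  have K: "length (ccom pc c) \<le> K" "length (ccom ?p c') \<le> K" using pr(7) len by linarith+
  have wf: "cwf c" "cwf c'" using pr(2) by auto
  obtain t1 m1 where 1: "reach P M (pc, m) t1 (?p, m1)" "t1 \<le> K * t" "rep base lm s' m1" "bdd M m1"
    using Seq.IH(1)[OF pr(1) wf(1) ca(1) pr(4,5) le(1) K(1)] by blast
  obtain t2 m2 where 2: "reach P M (?p, m1) t2 (?p + length (ccom ?p c'), m2)" "t2 \<le> K * t'" "rep base lm s'' m2" "bdd M m2"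
    using Seq.IH(2)[OF big_sbound[OF Seq.hyps(1) pr(1)] wf(2) ca(2) 1(3,4) le(2) K(2)] by blast
  have "t1 + t2 \<le> K * (t + t')" using 1(2) 2(2) by (simp add: algebra_simps)
  then show ?case using reach_trans[OF 1(1) 2(1)] 2(3,4) unfolding len add.assoc[symmetric] by blast
next
  case (WhileF e s e' c)
  note pr = WhileF.prems
  let ?g = "cguard e e'"
  let ?q = "pc + length ?g + 2"
  have ca: "code_at P pc ?g" "code_at P (pc + length ?g) [Jneg TB ?q, Jmp (?q + length (ccom ?q c) + 1)]"
    using pr(3) unfolding code_at_While Let_def by blast+
  have le: "B ^ (wt e + wt e' + 3) \<le> M"
    by (rule power_le_bound[OF pr(6)]; use assms(1) in simp)
  have wf: "ewf TB e" "ewf (Suc TB) e'" using pr(2) by auto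
  obtain m1 where m1: "sl M ?g m m1" "m1 TB = aval e s - aval e' s" "rep base lm s m1" "bdd M m1"
    using cguard_sl[OF pr(1) assms(1-3) wf WhileF.hyps(1,2) pr(4,5) le] by blast
  have r1: "reach P M (pc, m) (length ?g) (pc + length ?g, m1)" by (rule sl_reach[OF m1(1) pr(5) ca(1)])
  have j: "pc + length ?g < length P" "P ! (pc + length ?g) = Jneg TB ?q"
    "Suc (pc + length ?g) < length P" "P ! Suc (pc + length ?g) = Jmp (?q + length (ccom ?q c) + 1)"
    using ca(2) unfolding code_at.simps by blast+
  have r2: "reach P M (pc + length ?g, m1) 1 (Suc (pc + length ?g), m1)"
    by (rule reach_step[OF m1(4) j(1) _ m1(4)]) (use m1(2) WhileF.hyps(3) in \<open>simp add: j(2)\<close>)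
  have r3: "reach P M (Suc (pc + length ?g), m1) 1 (?q + length (ccom ?q c) + 1, m1)"
    by (rule reach_step[OF m1(4) j(3) _ m1(4)]) (simp only: j(4) exec.simps)
  have len: "length (ccom pc (While e e' c)) = length ?g + 2 + length (ccom ?q c) + 1" by (simp add: Let_def)
  have pcq: "pc + length (ccom pc (While e e' c)) = ?q + length (ccom ?q c) + 1" using len by linarith
  have "length ?g + 1 + 1 \<le> K * 1" using len pr(7) by linarith
  then show ?case using reach_trans[OF reach_trans[OF r1 r2] r3] m1(3,4) unfolding pcq by blast
next
  case (WhileT e s e' c t s' t' s'')
  note pr = WhileT.prems
  let ?g = "cguard e e'"
  let ?q = "pc + length ?g + 2"
  have ca: "code_at P pc ?g" "code_at P (pc + length ?g) [Jneg TB ?q, Jmp (?q + length (ccom ?q c) + 1)]"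
    "code_at P ?q (ccom ?q c)" "code_at P (?q + length (ccom ?q c)) [Jmp pc]"
    using pr(3) unfolding code_at_While Let_def by blast+
  have le: "B ^ (wt e + wt e' + 3) \<le> M" "B ^ (cwt c + 3) \<le> M"
    by (rule power_le_bound[OF pr(6)]; use assms(1) in simp)+
  have wf: "ewf TB e" "ewf (Suc TB) e'" "cwf c" using pr(2) by auto
  obtain m1 where m1: "sl M ?g m m1" "m1 TB = aval e s - aval e' s" "rep base lm s m1" "bdd M m1"
    using cguard_sl[OF pr(1) assms(1-3) wf(1,2) WhileT.hyps(1,2) pr(4,5) le(1)] by blast
  have len: "length (ccom pc (While e e' c)) = length ?g + 2 + length (ccom ?q c) + 1" by (simp add: Let_def)
  have K: "length (ccom ?q c) \<le> K" using len pr(7) by linarith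
  have r1: "reach P M (pc, m) (length ?g) (pc + length ?g, m1)" by (rule sl_reach[OF m1(1) pr(5) ca(1)])
  have j: "pc + length ?g < length P" "P ! (pc + length ?g) = Jneg TB ?q"
    "Suc (pc + length ?g) < length P" "P ! Suc (pc + length ?g) = Jmp (?q + length (ccom ?q c) + 1)"
    using ca(2) unfolding code_at.simps by blast+
  have r2: "reach P M (pc + length ?g, m1) 1 (?q, m1)"
    by (rule reach_step[OF m1(4) j(1) _ m1(4)]) (use m1(2) WhileT.hyps(3) in \<open>simp add: j(2)\<close>)
  obtain t1 m2 where 1: "reach P M (?q, m1) t1 (?q + length (ccom ?q c), m2)" "t1 \<le> K * t" "rep base lm s' m2" "bdd M m2"
    using WhileT.IH(1)[OF pr(1) wf(3) ca(3) m1(3,4) le(2) K] by blast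
  have j': "?q + length (ccom ?q c) < length P" "P ! (?q + length (ccom ?q c)) = Jmp pc"
    using ca(4) unfolding code_at.simps by blast+
  have r3: "reach P M (?q + length (ccom ?q c), m2) 1 (pc, m2)"
    by (rule reach_step[OF 1(4) j'(1) _ 1(4)]) (simp only: j'(2) exec.simps)
  obtain t2 m3 where 2: "reach P M (pc, m2) t2 (pc + length (ccom pc (While e e' c)), m3)" "t2 \<le> K * t'" "rep base lm s'' m3" "bdd M m3"
    using WhileT.IH(2)[OF big_sbound[OF WhileT.hyps(4) pr(1)] pr(2,3) 1(3,4) pr(6,7)] by blast
  note R = reach_trans[OF reach_trans[OF reach_trans[OF reach_trans[OF r1 r2] 1(1)] r3] 2(1)]
  \<comment> \<open>The unit added by \<open>WhileT\<close> pays for the guard and the two jumps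
    around the body; the body and the remaining iterations are paid by induction.\<close>
  have "length ?g + 1 + t1 + 1 + t2 \<le> K * Suc (t + t')"
  proof -
    have "K * Suc (t + t') = K + K * t + K * t'" by (simp add: algebra_simps)
    moreover have "length ?g + 1 + 1 \<le> K" using pr(7) len by linarith
    ultimately show ?thesis using 1(2) 2(2) by linarith
  qed
  then show ?case using R 2(3,4) by blast
qed

subsection \<open>Roots of unity in bit-reversed order\<close>

text \<open>The half-angle formulas: \<open>cw k\<close> and \<open>sw k\<close> are the cosine and
  sine of \<open>pi / 2 ^ (k + 1)\<close>. In this form the program can compute them with integer
  square roots.\<close>

fun cw :: "nat \<Rightarrow> real" where
  "cw 0 = 0"
| "cw (Suc k) = sqrt ((1 + cw k) / 2)"

fun sw :: "nat \<Rightarrow> real" where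
  "sw 0 = 1"
| "sw (Suc k) = sqrt ((1 - cw k) / 2)"

definition om :: "nat \<Rightarrow> complex" where
  "om k = Complex (cw k) (sw k)"

lemma cw_bounds: "0 \<le> cw k \<and> cw k \<le> 1"
proof (induction k)
  case (Suc k)
  then have "0 \<le> (1 + cw k) / 2" "(1 + cw k) / 2 \<le> 1" by auto
  then show ?case unfolding cw.simps by (simp only: real_sqrt_ge_zero real_sqrt_le_1_iff simp_thms)
qed simp

lemma sw_nonneg: "0 \<le> sw k"
proof (cases k)
  case (Suc n)
  show ?thesis unfolding Suc sw.simps using cw_bounds[of n] by (intro real_sqrt_ge_zero) auto
qed simp

lemma cw_sw_power2: "(cw (Suc k))\<^sup>2 = (1 + cw k) / 2" "(sw (Suc k))\<^sup>2 = (1 - cw k) / 2"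
  unfolding cw.simps sw.simps by (rule real_sqrt_pow2, use cw_bounds[of k] in simp)+

lemma cw_sw: "(cw k)\<^sup>2 + (sw k)\<^sup>2 = 1"
proof (cases k)
  case (Suc n)
  show ?thesis unfolding Suc cw_sw_power2 by (simp add: field_simps)
qed simp

lemma norm_om: "cmod (om k) = 1"
  by (simp add: om_def cmod_def cw_sw)

lemma om_0: "om 0 = \<i>"
  by (simp add: om_def complex_eq_iff)

lemma om_square: "om (Suc k) ^ 2 = om k"
proof -
  let ?c = "cw (Suc k)" and ?s = "sw (Suc k)"
  have "(2 * ?c * ?s)\<^sup>2 = 4 * ((1 + cw k) / 2) * ((1 - cw k) / 2)"
    unfolding power_mult_distrib cw_sw_power2 by simp
  also have "\<dots> = (sw k)\<^sup>2" using cw_sw[of k] by (simp add: power2_eq_square field_simps)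
  \<comment> \<open>Both sides are nonnegative, so equality of their squares suffices.\<close>
  finally have "2 * ?c * ?s = sw k"
    using cw_bounds[of "Suc k"] sw_nonneg[of "Suc k"] sw_nonneg[of k]
    by (metis mult_nonneg_nonneg power2_eq_imp_eq zero_le_numeral)
  moreover have "?c\<^sup>2 - ?s\<^sup>2 = cw k" unfolding cw_sw_power2 by (simp add: field_simps)
  moreover have "Re (Complex x y ^ 2) = x\<^sup>2 - y\<^sup>2" "Im (Complex x y ^ 2) = 2 * x * y" for x y
    by (simp_all add: power2_eq_square)
  ultimately show ?thesis unfolding om_def complex_eq_iff by (simp only: complex.sel simp_thms)
qed

text \<open>\<open>gh 0 t\<close> is the product of \<open>om i\<close> over the bits \<open>i\<close> of \<open>t\<close>, that is, \<open>exp (\<i> \<pi> r)\<close> where the binary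
  expansion of \<open>r\<close> after the point is \<open>t\<close> read backwards.\<close>
fun gh :: "nat \<Rightarrow> nat \<Rightarrow> complex" where
  "gh j t = (if t = 0 then 1 else (if odd t then om j else 1) * gh (Suc j) (t div 2))"

declare gh.simps [simp del]

definition g :: "nat \<Rightarrow> complex" where "g = gh 0"

text \<open>The constant of block \<open>t\<close>: the blocks \<open>2 * t\<close> and
  \<open>2 * t + 1\<close> receive the two square roots \<open>g t\<close> and \<open>- g t\<close>
  of \<open>cc t\<close>.\<close>

definition cc :: "nat \<Rightarrow> complex" where
  "cc t = (if even t then g (t div 2) else - g (t div 2))"

lemma gh_square: "gh (Suc j) t ^ 2 = gh j t"
proof (induction t arbitrary: j rule: less_induct)
  case (less t)
  show ?case
  proof (cases "t = 0")
    case False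
    then have "t div 2 < t" by simp
    then have "gh (Suc (Suc j)) (t div 2) ^ 2 = gh (Suc j) (t div 2)" by (rule less)
    then show ?thesis using False om_square[of j]
      by (simp add: gh.simps[of j t] gh.simps[of "Suc j" t] power_mult_distrib)
  qed (simp add: gh.simps[of _ 0])
qed

lemma norm_gh: "cmod (gh j t) = 1"
proof (induction t arbitrary: j rule: less_induct)
  case (less t)
  show ?case
  proof (cases "t = 0")
    case False
    then have "cmod (gh (Suc j) (t div 2)) = 1" by (intro less) simp
    then show ?thesis using False by (simp add: gh.simps[of j t] norm_mult norm_om)
  qed (simp add: gh.simps[of _ 0])
qed

text \<open>The top bit contributes just one factor. With \<open>j = 0\<close> this says that the
  table of roots is doubled by appending \<open>om k\<close> times its old contents.\<close>

lemma gh_high: "r < 2 ^ k \<Longrightarrow> gh j (2 ^ k + r) = om (j + k) * gh j r"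
proof (induction k arbitrary: j r)
  case 0
  then show ?case by (simp add: gh.simps[of _ 0] gh.simps[of _ "Suc 0"])
next
  case (Suc k)
  have d: "(2 ^ Suc k + r) div 2 = 2 ^ k + r div 2" by simp
  have o: "odd (2 ^ Suc k + r) = odd r" by simp
  have "gh j (2 ^ Suc k + r) = (if odd r then om j else 1) * gh (Suc j) (2 ^ k + r div 2)"
    unfolding gh.simps[of j "2 ^ Suc k + r"] d o by simp
  also have "gh (Suc j) (2 ^ k + r div 2) = om (j + Suc k) * gh (Suc j) (r div 2)"
    using Suc by simp
  also have "(if odd r then om j else 1) * (om (j + Suc k) * gh (Suc j) (r div 2)) = om (j + Suc k) * gh j r"
    by (cases "r = 0") (simp_all add: gh.simps[of j r] gh.simps[of _ 0])
  finally show ?case .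
qed

lemma g_0: "g 0 = 1" by (simp add: g_def gh.simps[of _ 0])

lemma norm_g: "cmod (g t) = 1" by (simp add: g_def norm_gh)

lemma g_high: "r < 2 ^ k \<Longrightarrow> g (2 ^ k + r) = om k * g r"
  using gh_high[of r k 0] by (simp add: g_def)

text \<open>Squaring moves every bit one place down by \<open>gh_square\<close>; the lowest bit,
  standing for \<open>om 0 = \<i>\<close>, turns into the sign in \<open>cc\<close>.\<close>

lemma g_square: "g t ^ 2 = cc t"
proof (cases "t = 0")
  case True
  then show ?thesis by (simp add: cc_def g_0)
next
  case False
  have "g t = (if odd t then om 0 else 1) * gh (Suc 0) (t div 2)"
    using False unfolding g_def by (simp add: gh.simps[of 0 t])
  then show ?thesis by (simp add: power_mult_distrib gh_square om_0 cc_def g_def)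
qed

lemma norm_cc: "cmod (cc t) = 1"
  by (simp add: cc_def norm_g)

text \<open>Squaring halves the index, so \<open>h\<close> squarings lead to
  \<open>cc 0 = 1\<close>.\<close>

lemma cc_root: "t < 2 ^ h \<Longrightarrow> cc t ^ (2 ^ h) = 1"
proof (induction h arbitrary: t)
  case 0
  then show ?case by (simp add: cc_def g_0)
next
  case (Suc h)
  have "cc t ^ 2 = cc (t div 2)" by (simp add: cc_def[of t] g_square)
  then have "cc t ^ (2 ^ Suc h) = cc (t div 2) ^ (2 ^ h)" by (simp add: power_mult)
  then show ?case using Suc by simp
qed

subsection \<open>The exact transform\<close>

text \<open>Block \<open>t\<close>, of size \<open>m\<close>, holds the remainder of the polynomial \<open>\<Sum>i<q*m. a i * X^i\<close> modulo \<open>X^m - cc t\<close>.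
  A forward step splits \<open>X^(2*m) - (g t)\<^sup>2\<close> into \<open>(X^m - g t) * (X^m + g t)\<close>.\<close>
definition blk :: "(nat \<Rightarrow> complex) \<Rightarrow> nat \<Rightarrow> nat \<Rightarrow> nat \<Rightarrow> nat \<Rightarrow> complex" where
  "blk a m q t j = (\<Sum>r<q. a (j + r * m) * cc t ^ r)"

text \<open>Interpolates between the input, \<open>ex a n 1\<close>, and the discrete Fourier
  transform, \<open>ex a 1 n\<close>, whose entries are the values of the polynomial at the roots
  \<open>cc i\<close>.\<close>

definition ex :: "(nat \<Rightarrow> complex) \<Rightarrow> nat \<Rightarrow> nat \<Rightarrow> nat \<Rightarrow> complex" where
  "ex a m q i = blk a m q (i div m) (i mod m)"

lemma sum_even_odd: "(\<Sum>r<2 * q. f r) = (\<Sum>r<q. f (2 * r)) + (\<Sum>r<q. f (2 * r + 1))"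
  for f :: "nat \<Rightarrow> 'a::comm_monoid_add"
  by (induction q) (auto simp: ac_simps)

text \<open>Sort the terms by the parity of \<open>r\<close>. As
  \<open>cc (2 * t + h) ^ 2 = cc t\<close>, the even ones form the coarse block at \<open>j\<close>,
  and the odd ones the coarse block at \<open>j + m\<close> times \<open>g t\<close> up to
  sign.\<close>

lemma blk_split:
  assumes h: "h < 2"
  shows "blk a m (2 * q) (2 * t + h) j =
    blk a (2 * m) q t j + (1 - 2 * of_nat h) * (g t * blk a (2 * m) q t (j + m))"
proof -
  define s where "s = (1 - 2 * of_nat h :: complex)"
  have c: "cc (2 * t + h) = s * g t" using h by (auto simp: cc_def s_def less_2_cases_iff)
  have s2: "s ^ 2 = 1" using h by (auto simp: s_def less_2_cases_iff)
  have c2: "(s * g t) ^ (2 * r) = cc t ^ r" for r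
    by (simp add: power_mult power_mult_distrib s2 g_square)
  have "blk a m (2 * q) (2 * t + h) j = (\<Sum>r<q. a (j + 2 * r * m) * (s * g t) ^ (2 * r)) +
     (\<Sum>r<q. a (j + (2 * r + 1) * m) * (s * g t) ^ (2 * r + 1))"
    unfolding blk_def sum_even_odd c ..
  also have "(\<Sum>r<q. a (j + 2 * r * m) * (s * g t) ^ (2 * r)) = blk a (2 * m) q t j"
    unfolding blk_def c2 by (simp add: mult.commute mult.left_commute)
  also have "(\<Sum>r<q. a (j + (2 * r + 1) * m) * (s * g t) ^ (2 * r + 1)) = s * (g t * blk a (2 * m) q t (j + m))"
    unfolding blk_def sum_distrib_left power_add c2 by (intro sum.cong) (auto simp: algebra_simps)
  finally show ?thesis by (simp add: s_def)
qed

text \<open>The positions that a butterfly combines are \<open>lo m i\<close> and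
  \<open>lo m i + m\<close>; \<open>hi m i\<close> tells which of the two is
  \<open>i\<close>.\<close>

definition lo :: "nat \<Rightarrow> nat \<Rightarrow> nat" where
  "lo m i = i div (2 * m) * (2 * m) + i mod m"

definition hi :: "nat \<Rightarrow> nat \<Rightarrow> nat" where
  "hi m i = i div m mod 2"

lemma hi_less: "hi m i < 2" by (simp add: hi_def)

lemma lo_bounds:
  assumes "i < 2 * m * q"
  shows "lo m i + m < 2 * m * q" "i div (2 * m) < q"
proof -
  have m: "0 < m" using assms by (cases m) auto
  show t: "i div (2 * m) < q" using assms m by (simp add: less_mult_imp_div_less mult.commute)
  have "lo m i + m < i div (2 * m) * (2 * m) + 2 * m" using m by (simp add: lo_def)
  also have "\<dots> = (i div (2 * m) + 1) * (2 * m)" by simp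
  also have "\<dots> \<le> q * (2 * m)" using t by (intro mult_le_mono) auto
  finally show "lo m i + m < 2 * m * q" by (simp add: mult.commute)
qed

lemma lo_div_mod:
  assumes "0 < m"
  shows "lo m i div (2 * m) = i div (2 * m)" "lo m i mod (2 * m) = i mod m"
    "(lo m i + m) div (2 * m) = i div (2 * m)" "(lo m i + m) mod (2 * m) = i mod m + m"
proof -
  have "i mod m < 2 * m" "i mod m + m < 2 * m" using assms mod_less_divisor[OF assms, of i] by linarith+
  then have "i mod m div (2 * m) = 0" "i mod m mod (2 * m) = i mod m"
    "(i mod m + m) div (2 * m) = 0" "(i mod m + m) mod (2 * m) = i mod m + m" by (simp_all only: div_less mod_less)
  then show "lo m i div (2 * m) = i div (2 * m)" "lo m i mod (2 * m) = i mod m"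
    "(lo m i + m) div (2 * m) = i div (2 * m)" "(lo m i + m) mod (2 * m) = i mod m + m"
    unfolding lo_def add.assoc using assms by simp_all
qed

lemma ex_split:
  assumes "0 < m"
  shows "ex a m (2 * q) i = ex a (2 * m) q (lo m i) +
    (1 - 2 * of_nat (hi m i)) * (g (i div (2 * m)) * ex a (2 * m) q (lo m i + m))"
proof -
  have "i div m = 2 * (i div (2 * m)) + hi m i"
    by (simp add: hi_def mult.commute[of 2 m] div_mult2_eq)
  then show ?thesis unfolding ex_def lo_div_mod[OF assms] using blk_split[OF hi_less[of m i], of a m q "i div (2 * m)" "i mod m"] by simp
qed

lemma norm_ex:
  assumes "\<And>i. cmod (a i) \<le> A"
  shows "cmod (ex a m q i) \<le> real q * A"
proof -
  have "cmod (ex a m q i) \<le> (\<Sum>r<q. A)" unfolding ex_def blk_def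
    by (rule sum_norm_le) (simp add: norm_mult norm_power norm_cc assms)
  then show ?thesis by simp
qed

section \<open>Cyclic convolution under the transform\<close>

definition cyc :: "nat \<Rightarrow> (nat \<Rightarrow> 'a) \<Rightarrow> (nat \<Rightarrow> 'a) \<Rightarrow> nat \<Rightarrow> 'a::comm_semiring_1" where
  "cyc n a b i = (\<Sum>j<n. \<Sum>k<n. if (j + k) mod n = i then a j * b k else 0)"

text \<open>Since \<open>cc i ^ n = 1\<close>, wrapping an index around modulo \<open>n\<close> does
  not change the power of \<open>cc i\<close>, and the double sum factors.\<close>

lemma ex_cyc:
  assumes n: "n = 2 ^ h" and i: "i < n"
  shows "ex (cyc n a b) 1 n i = ex a 1 n i * ex b 1 n i"
proof -
  have c: "cc i ^ n = 1" using cc_root i n by simp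
  have pm: "cc i ^ (x mod n) = cc i ^ x" for x
  proof -
    have "cc i ^ x = cc i ^ (n * (x div n) + x mod n)" by simp
    then show ?thesis unfolding power_add power_mult c by simp
  qed
  have "ex (cyc n a b) 1 n i = (\<Sum>r<n. \<Sum>j<n. \<Sum>k<n. if (j + k) mod n = r then a j * b k * cc i ^ r else 0)"
    unfolding ex_def blk_def cyc_def by (simp add: sum_distrib_right if_distrib[of "\<lambda>x. x * _"] cong: if_cong)
  also have "\<dots> = (\<Sum>j<n. \<Sum>r<n. \<Sum>k<n. if (j + k) mod n = r then a j * b k * cc i ^ r else 0)"
    by (rule sum.swap)
  also have "\<dots> = (\<Sum>j<n. \<Sum>k<n. \<Sum>r<n. if (j + k) mod n = r then a j * b k * cc i ^ r else 0)"
    by (rule sum.cong[OF refl], rule sum.swap)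
  also have "\<dots> = (\<Sum>j<n. \<Sum>k<n. a j * b k * cc i ^ ((j + k) mod n))"
    using i by (intro sum.cong refl) (simp add: sum.delta)
  also have "\<dots> = (\<Sum>j<n. \<Sum>k<n. (a j * cc i ^ j) * (b k * cc i ^ k))"
    unfolding pm by (simp add: power_add ac_simps)
  also have "\<dots> = ex a 1 n i * ex b 1 n i"
    unfolding ex_def blk_def by (simp add: sum_product)
  finally show ?thesis .
qed

lemma ex_one: "i < n \<Longrightarrow> ex a n 1 i = a i"
  by (simp add: ex_def blk_def)

subsection \<open>Fixed-point arithmetic\<close>

definition zc :: "real \<Rightarrow> int \<Rightarrow> int \<Rightarrow> complex" where
  "zc S x y = Complex (real_of_int x / S) (real_of_int y / S)"

lemma zc_add: "zc S (x + x') (y + y') = zc S x y + zc S x' y'"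
  and zc_diff: "zc S (x - x') (y - y') = zc S x y - zc S x' y'"
  and zc_scale: "zc S (k * x) (k * y) = of_int k * zc S x y"
  and zc_cnj: "zc S x (- y) = cnj (zc S x y)"
  by (simp_all add: zc_def complex_eq_iff add_divide_distrib diff_divide_distrib)

lemma div_error:
  fixes x :: int and S :: nat
  assumes "0 < S"
  shows "\<bar>real_of_int (x div int S) - real_of_int x / real S\<bar> \<le> 1"
proof -
  have "real_of_int (x div int S) = of_int \<lfloor>real_of_int x / real S\<rfloor>"
    using floor_divide_of_int_eq[of x "int S", where ?'a = real] by simp
  then show ?thesis by linarith
qed

text \<open>The only rounding in the product is one floor per coordinate, each off by at most one
  unit \<open>1 / S\<close>.\<close>

lemma zc_mult:
  fixes S :: nat
  assumes "0 < S"
  shows "cmod (zc S ((x * x' - y * y') div int S) ((x * y' + y * x') div int S) - zc S x y * zc S x' y') \<le> 2 / S"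
proof -
  let ?u = "x * x' - y * y'" and ?v = "x * y' + y * x'"
  let ?d = "zc S (?u div int S) (?v div int S) - zc S x y * zc S x' y'"
  have "Re ?d = (real_of_int (?u div int S) - real_of_int ?u / S) / S"
    using assms by (simp add: zc_def field_simps)
  then have r: "\<bar>Re ?d\<bar> \<le> 1 / S"
    using div_error[OF assms, of ?u] assms by (simp add: abs_divide divide_right_mono)
  have "Im ?d = (real_of_int (?v div int S) - real_of_int ?v / S) / S"
    using assms by (simp add: zc_def field_simps)
  then have "\<bar>Im ?d\<bar> \<le> 1 / S"
    using div_error[OF assms, of ?v] assms by (simp add: abs_divide divide_right_mono)
  with r have "\<bar>Re ?d\<bar> + \<bar>Im ?d\<bar> \<le> 2 / S" by simp
  then show ?thesis using cmod_le[of ?d] by linarith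
qed

lemma prod_error:
  fixes z z' w w' :: complex
  assumes "cmod (z' - z) \<le> d" "cmod (w' - w) \<le> e" "cmod z \<le> M" "cmod w \<le> L"
  shows "cmod (z' * w' - z * w) \<le> d * (L + e) + e * M"
proof -
  have "z' * w' - z * w = (z' - z) * w' + (w' - w) * z" by (simp add: algebra_simps)
  then have "cmod (z' * w' - z * w) \<le> cmod (z' - z) * cmod w' + cmod (w' - w) * cmod z"
    using norm_triangle_ineq[of "(z' - z) * w'" "(w' - w) * z"] by (simp add: norm_mult)
  moreover have "cmod w' \<le> L + e" using assms(2,4) norm_triangle_sub[of w' w] by linarith
  then have "cmod (z' - z) * cmod w' \<le> d * (L + e)"
    using assms(1) by (intro mult_mono) (auto intro: order_trans[OF norm_ge_zero])
  moreover have "cmod (w' - w) * cmod z \<le> e * M"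
    using assms(2,3) by (intro mult_mono) (auto intro: order_trans[OF norm_ge_zero])
  ultimately show ?thesis by linarith
qed

lemma zc_mult_error:
  fixes S :: nat
  assumes "0 < S" "cmod (zc S x y - z) \<le> d" "cmod (zc S x' y' - w) \<le> e" "cmod z \<le> M" "cmod w \<le> L"
  shows "cmod (zc S ((x * x' - y * y') div int S) ((x * y' + y * x') div int S) - z * w)
    \<le> d * (L + e) + e * M + 2 / S"
proof -
  let ?p = "zc S ((x * x' - y * y') div int S) ((x * y' + y * x') div int S)"
  have "?p - z * w = (?p - zc S x y * zc S x' y') + (zc S x y * zc S x' y' - z * w)" by simp
  then have "cmod (?p - z * w) \<le> cmod (?p - zc S x y * zc S x' y') + cmod (zc S x y * zc S x' y' - z * w)"
    by (simp only: norm_triangle_ineq)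
  then show ?thesis using zc_mult[OF assms(1), of x x' y y'] prod_error[OF assms(2-5)] by linarith
qed

text \<open>Accuracy implies size: a stored integer is bounded by the exact value plus the error,
  rescaled. This is what keeps the numbers of the program polynomial.\<close>

lemma zc_int_bound:
  assumes "0 < S" "cmod (zc S x y - z) \<le> d" "cmod z \<le> M"
  shows "\<bar>real_of_int x\<bar> \<le> S * (M + d)" "\<bar>real_of_int y\<bar> \<le> S * (M + d)"
proof -
  have "cmod (zc S x y) \<le> M + d" using assms(2,3) norm_triangle_sub[of "zc S x y" z] by linarith
  then have "\<bar>real_of_int x / S\<bar> \<le> M + d" "\<bar>real_of_int y / S\<bar> \<le> M + d"
    using abs_Re_le_cmod[of "zc S x y"] abs_Im_le_cmod[of "zc S x y"] by (auto simp: zc_def)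
  then show "\<bar>real_of_int x\<bar> \<le> S * (M + d)" "\<bar>real_of_int y\<bar> \<le> S * (M + d)"
    using assms(1) by (simp_all add: abs_divide field_simps)
qed

section \<open>Butterflies and their errors\<close>

definition apx :: "nat \<Rightarrow> real \<Rightarrow> nat \<Rightarrow> (nat \<Rightarrow> int) \<Rightarrow> (nat \<Rightarrow> int) \<Rightarrow> (nat \<Rightarrow> complex) \<Rightarrow> bool" where
  "apx S d n x y e \<longleftrightarrow> (\<forall>i<n. cmod (zc S (x i) (y i) - e i) \<le> d)"

text \<open>The sign is applied after the division, so both members of a pair use the same rounded
  product.\<close>

definition fR :: "int \<Rightarrow> nat \<Rightarrow> (nat \<Rightarrow> int) \<Rightarrow> (nat \<Rightarrow> int) \<Rightarrow> (nat \<Rightarrow> int) \<Rightarrow> (nat \<Rightarrow> int) \<Rightarrow> nat \<Rightarrow> int" where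
  "fR S m gr gi x y i = x (lo m i) + (1 - 2 * int (hi m i)) *
     ((gr (i div (2 * m)) * x (lo m i + m) - gi (i div (2 * m)) * y (lo m i + m)) div S)"

definition fI :: "int \<Rightarrow> nat \<Rightarrow> (nat \<Rightarrow> int) \<Rightarrow> (nat \<Rightarrow> int) \<Rightarrow> (nat \<Rightarrow> int) \<Rightarrow> (nat \<Rightarrow> int) \<Rightarrow> nat \<Rightarrow> int" where
  "fI S m gr gi x y i = y (lo m i) + (1 - 2 * int (hi m i)) *
     ((gr (i div (2 * m)) * y (lo m i + m) + gi (i div (2 * m)) * x (lo m i + m)) div S)"

text \<open>The factor 3 is one error from the lower entry and \<open>1 + e \<le> 2\<close> errors
  from the product with the root. \<open>\<eta>\<close> collects what is not proportional to
  \<open>d\<close>: table error times the size of the entries, and rounding.\<close>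

lemma forward_step:
  assumes S: "0 < S" and m: "0 < m" and x: "apx S d (2 * m * q) x y (ex a (2 * m) q)"
    and gt: "apx S e T gr gi g" and T: "q \<le> T" and e: "0 \<le> e" "e \<le> 1" and d: "0 \<le> d"
    and M: "\<And>i. cmod (ex a (2 * m) q i) \<le> M" and eta: "e * M + 2 / S \<le> \<eta>"
  shows "apx S (3 * d + \<eta>) (2 * m * q) (fR (int S) m gr gi x y) (fI (int S) m gr gi x y) (ex a m (2 * q))"
  unfolding apx_def
proof (intro allI impI)
  fix i assume i: "i < 2 * m * q"
  note b = lo_bounds[OF i]
  let ?l = "lo m i" and ?t = "i div (2 * m)" and ?k = "1 - 2 * int (hi m i)"
  let ?p = "(gr ?t * x (?l + m) - gi ?t * y (?l + m)) div int S"
  let ?p' = "(gr ?t * y (?l + m) + gi ?t * x (?l + m)) div int S"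
  let ?E = "ex a (2 * m) q"
  have k: "cmod (of_int ?k) = 1" using hi_less[of m i] by (auto simp: less_2_cases_iff)
  have 1: "cmod (zc S (x ?l) (y ?l) - ?E ?l) \<le> d" "cmod (zc S (x (?l + m)) (y (?l + m)) - ?E (?l + m)) \<le> d"
    using x b(1) by (auto simp: apx_def)
  have 2: "cmod (zc S (gr ?t) (gi ?t) - g ?t) \<le> e" using gt b(2) T by (auto simp: apx_def)
  have p: "cmod (zc S ?p ?p' - g ?t * ?E (?l + m)) \<le> d * (1 + e) + e * M + 2 / S"
    using zc_mult_error[OF S 1(2) 2 M, of 1] by (simp add: norm_g mult.commute add.commute)
  have "zc S (fR (int S) m gr gi x y i) (fI (int S) m gr gi x y i) - ex a m (2 * q) i =
     (zc S (x ?l) (y ?l) - ?E ?l) + of_int ?k * (zc S ?p ?p' - g ?t * ?E (?l + m))"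
    unfolding fR_def fI_def zc_add zc_scale ex_split[OF m] by (simp add: algebra_simps)
  then have "cmod (zc S (fR (int S) m gr gi x y i) (fI (int S) m gr gi x y i) - ex a m (2 * q) i) \<le>
     cmod (zc S (x ?l) (y ?l) - ?E ?l) + cmod (of_int ?k * (zc S ?p ?p' - g ?t * ?E (?l + m)))"
    by (simp only: norm_triangle_ineq)
  also have "cmod (of_int ?k * (zc S ?p ?p' - g ?t * ?E (?l + m))) = cmod (zc S ?p ?p' - g ?t * ?E (?l + m))"
    unfolding norm_mult k by simp
  finally have "cmod (zc S (fR (int S) m gr gi x y i) (fI (int S) m gr gi x y i) - ex a m (2 * q) i)
    \<le> d + (d * (1 + e) + e * M + 2 / S)" using 1(1) p by linarith
  moreover have "d * e \<le> d * 1" using e d by (intro mult_left_mono) auto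
  ultimately show "cmod (zc S (fR (int S) m gr gi x y i) (fI (int S) m gr gi x y i) - ex a m (2 * q) i) \<le> 3 * d + \<eta>"
    using eta by (simp add: algebra_simps)
qed

text \<open>Sum and difference of a pair undo the forward step up to a factor 2, and the root is
  removed by its conjugate, as it has modulus 1. Nothing is halved here; the powers of 2 are left to
  the final rounding.\<close>

definition iR :: "int \<Rightarrow> nat \<Rightarrow> (nat \<Rightarrow> int) \<Rightarrow> (nat \<Rightarrow> int) \<Rightarrow> (nat \<Rightarrow> int) \<Rightarrow> (nat \<Rightarrow> int) \<Rightarrow> nat \<Rightarrow> int" where
  "iR S m gr gi x y i = (1 - int (hi m i)) * (x (lo m i) + x (lo m i + m)) + int (hi m i) *
     (((x (lo m i) - x (lo m i + m)) * gr (i div (2 * m)) + (y (lo m i) - y (lo m i + m)) * gi (i div (2 * m))) div S)"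

definition iI :: "int \<Rightarrow> nat \<Rightarrow> (nat \<Rightarrow> int) \<Rightarrow> (nat \<Rightarrow> int) \<Rightarrow> (nat \<Rightarrow> int) \<Rightarrow> (nat \<Rightarrow> int) \<Rightarrow> nat \<Rightarrow> int" where
  "iI S m gr gi x y i = (1 - int (hi m i)) * (y (lo m i) + y (lo m i + m)) + int (hi m i) *
     (((y (lo m i) - y (lo m i + m)) * gr (i div (2 * m)) - (x (lo m i) - x (lo m i + m)) * gi (i div (2 * m))) div S)"

lemma lo_lo: assumes "0 < m" shows "lo m (lo m i) = lo m i" "lo m (lo m i + m) = lo m i"
    "hi m (lo m i) = 0" "hi m (lo m i + m) = 1"
proof -
  have m: "i mod m < m" using assms by simp
  have "(i div (2 * m) * (2 * m) + i mod m) mod m = i mod m"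
    by (simp add: mult.assoc[symmetric])
  then have 1: "lo m i mod m = i mod m" by (simp add: lo_def)
  then have 2: "(lo m i + m) mod m = i mod m" by simp
  show "lo m (lo m i) = lo m i" "lo m (lo m i + m) = lo m i"
    unfolding lo_def[of m "lo m i"] lo_def[of m "lo m i + m"] lo_div_mod[OF assms] 1 2
    by (simp_all add: lo_def)
  have "lo m i div m = 2 * (i div (2 * m))"
  proof -
    have "lo m i = m * (2 * (i div (2 * m))) + i mod m" by (simp add: lo_def)
    then show ?thesis using assms m by simp
  qed
  then show "hi m (lo m i) = 0" "hi m (lo m i + m) = 1" using assms by (simp_all add: hi_def)
qed

lemma lo_hi: "i = lo m i + hi m i * m"
proof -
  have "i = m * (i div m) + i mod m" by simp
  also have "i div m = 2 * (i div (2 * m)) + hi m i"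
    by (simp add: hi_def mult.commute[of 2 m] div_mult2_eq)
  finally show ?thesis by (simp add: lo_def algebra_simps)
qed

text \<open>The scalar \<open>s\<close> carries the accumulated powers of 2. Here the factor 3 comes
  from the difference, whose error is \<open>2 * d\<close>, times
  \<open>1 + e \<le> 3 / 2\<close>.\<close>

lemma inverse_step:
  assumes S: "0 < S" and m: "0 < m" and x: "apx S d (2 * m * q) x y (\<lambda>i. s * ex a m (2 * q) i)"
    and gt: "apx S e T gr gi g" and T: "q \<le> T" and e: "0 \<le> e" "e \<le> 1 / 2" and d: "0 \<le> d"
    and M: "\<And>i. cmod (s * ex a m (2 * q) i) \<le> M" and eta: "2 * e * M + 2 / S \<le> \<eta>"
  shows "apx S (3 * d + \<eta>) (2 * m * q) (iR (int S) m gr gi x y) (iI (int S) m gr gi x y)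
    (\<lambda>i. (2 * s) * ex a (2 * m) q i)"
  unfolding apx_def
proof (intro allI impI)
  fix i assume i: "i < 2 * m * q"
  note b = lo_bounds[OF i]
  let ?l = "lo m i" and ?t = "i div (2 * m)" and ?h = "hi m i"
  let ?E = "\<lambda>i. s * ex a m (2 * q) i"
  let ?z = "zc S (iR (int S) m gr gi x y i) (iI (int S) m gr gi x y i)"
  note ll = lo_lo[OF m, of i]
  have t: "?l div (2 * m) = ?t" "(?l + m) div (2 * m) = ?t" using lo_div_mod[OF m] by auto
  have M0: "0 \<le> M" using M[of 0] norm_ge_zero order_trans by blast
  have eta0: "0 \<le> \<eta>" 
  proof -
    have "0 \<le> 2 * (e * M)" "0 \<le> 2 / real S" using mult_nonneg_nonneg[OF e(1) M0] by simp_all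
    then have "0 \<le> 2 * e * M + 2 / S" by (simp only: mult.assoc add_nonneg_nonneg)
    then show ?thesis using eta by linarith
  qed
  have E1: "?E ?l + ?E (?l + m) = 2 * s * ex a (2 * m) q ?l"
    unfolding ex_split[OF m, of a q] ll t by (simp add: algebra_simps)
  have E2: "?E ?l - ?E (?l + m) = 2 * s * (g ?t * ex a (2 * m) q (?l + m))"
    unfolding ex_split[OF m, of a q] ll t by (simp add: algebra_simps)
  have gg: "g ?t * cnj (g ?t) = 1" by (simp add: complex_norm_square[symmetric] norm_g)
  have E3: "(?E ?l - ?E (?l + m)) * cnj (g ?t) = 2 * s * ex a (2 * m) q (?l + m)"
    unfolding E2 using gg by (simp add: mult.assoc mult.left_commute)
  have 1: "cmod (zc S (x ?l) (y ?l) - ?E ?l) \<le> d" "cmod (zc S (x (?l + m)) (y (?l + m)) - ?E (?l + m)) \<le> d"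
    using x b(1) by (auto simp: apx_def)
  have "zc S (gr ?t) (- gi ?t) - cnj (g ?t) = cnj (zc S (gr ?t) (gi ?t) - g ?t)" by (simp add: zc_cnj)
  then have "cmod (zc S (gr ?t) (- gi ?t) - cnj (g ?t)) = cmod (zc S (gr ?t) (gi ?t) - g ?t)"
    by (simp only: complex_mod_cnj)
  then have 2: "cmod (zc S (gr ?t) (- gi ?t) - cnj (g ?t)) \<le> e" using gt b(2) T by (auto simp: apx_def)
  have de: "d * e \<le> d * (1 / 2)" using e d by (intro mult_left_mono) auto
  show "cmod (?z - (2 * s) * ex a (2 * m) q i) \<le> 3 * d + \<eta>"
  proof (cases "?h = 0")
    case True
    then have "i = ?l" using lo_hi[of i m] by simp
    then have ei: "2 * s * ex a (2 * m) q i = ?E ?l + ?E (?l + m)" using E1 by simp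
    have "?z - 2 * s * ex a (2 * m) q i = (zc S (x ?l) (y ?l) - ?E ?l) + (zc S (x (?l + m)) (y (?l + m)) - ?E (?l + m))"
      unfolding ei iR_def iI_def True by (simp add: zc_add)
    then have "cmod (?z - 2 * s * ex a (2 * m) q i) \<le> d + d" using norm_triangle_mono[OF 1] by simp
    then show ?thesis using d eta0 by linarith
  next
    case False
    then have h: "?h = 1" using hi_less[of m i] by linarith
    then have "i = ?l + m" using lo_hi[of i m] by simp
    then have ei: "2 * s * ex a (2 * m) q i = (?E ?l - ?E (?l + m)) * cnj (g ?t)" using E3 by simp
    have "zc S (x ?l - x (?l + m)) (y ?l - y (?l + m)) - (?E ?l - ?E (?l + m)) =
      (zc S (x ?l) (y ?l) - ?E ?l) - (zc S (x (?l + m)) (y (?l + m)) - ?E (?l + m))" by (simp add: zc_diff)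
    then have 3: "cmod (zc S (x ?l - x (?l + m)) (y ?l - y (?l + m)) - (?E ?l - ?E (?l + m))) \<le> d + d"
      using norm_triangle_le_diff[OF add_mono[OF 1]] by (simp only:)
    have 4: "cmod (?E ?l - ?E (?l + m)) \<le> M + M" by (rule norm_triangle_le_diff[OF add_mono[OF M M]])
    have 5: "?z = zc S (((x ?l - x (?l + m)) * gr ?t - (y ?l - y (?l + m)) * (- gi ?t)) div int S)
        (((x ?l - x (?l + m)) * (- gi ?t) + (y ?l - y (?l + m)) * gr ?t) div int S)"
      unfolding iR_def iI_def h by simp
    have "cmod (?z - (?E ?l - ?E (?l + m)) * cnj (g ?t)) \<le> (d + d) * (1 + e) + e * (M + M) + 2 / S"
      unfolding 5 by (rule zc_mult_error[OF S 3 2 4]) (simp add: norm_g)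
    then show ?thesis unfolding ei using eta de by (simp add: algebra_simps)
  qed
qed

subsection \<open>Accuracy of the root table\<close>

text \<open>As \<open>X\<close> and \<open>r\<close> are integers,
  \<open>X + 1 \<le> (r + 1) * (r + 1)\<close>, and this extra 1 makes up for the half that may be
  lost in \<open>Y div 2\<close>.\<close>

lemma floor_sqrt_error:
  fixes r X Y :: int
  assumes "0 \<le> r" "r * r \<le> X" "X < (r + 1) * (r + 1)" "X = Y div 2" "0 \<le> Y"
  shows "\<bar>real_of_int r - sqrt (real_of_int Y / 2)\<bar> \<le> 2"
proof -
  let ?y = "real_of_int Y / 2"
  have XY: "real_of_int X \<le> ?y" "?y \<le> real_of_int X + 1" using assms(4) by linarith+
  have "real_of_int (r * r) \<le> real_of_int X" "real_of_int (X + 1) \<le> real_of_int ((r + 1) * (r + 1))"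
    using assms(2,3) by linarith+
  then have 1: "(real_of_int r)\<^sup>2 \<le> ?y" "?y \<le> (real_of_int r + 1)\<^sup>2"
    using XY by (auto simp: power2_eq_square)
  have "real_of_int r \<le> sqrt ?y" using 1(1) by (rule real_le_rsqrt)
  moreover have "sqrt ?y \<le> real_of_int r + 1" using 1(2) assms(1) by (intro real_le_lsqrt) auto
  ultimately show ?thesis by linarith
qed

lemma sqrt_scale: "0 \<le> S \<Longrightarrow> sqrt (S * S * z) = S * sqrt z"
  by (simp add: real_sqrt_mult)

text \<open>Away from 0 the square root does not enlarge errors. This serves the cosines, as
  \<open>(1 + cw k) / 2 \<ge> 1 / 2\<close>.\<close>

lemma sqrt_diff_linear:
  assumes "1 / 2 \<le> a" "1 / 2 \<le> b"
  shows "\<bar>sqrt a - sqrt b\<bar> \<le> \<bar>a - b\<bar>"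
proof -
  have h: "1 / 2 \<le> sqrt x" if "1 / 2 \<le> x" for x :: real
    using that by (intro real_le_rsqrt) (simp add: power2_eq_square)
  have "a - b = (sqrt a - sqrt b) * (sqrt a + sqrt b)" using assms by (simp add: algebra_simps)
  then have "\<bar>a - b\<bar> = \<bar>sqrt a - sqrt b\<bar> * (sqrt a + sqrt b)"
    using assms by (simp add: abs_mult)
  moreover have "\<bar>sqrt a - sqrt b\<bar> * 1 \<le> \<bar>sqrt a - sqrt b\<bar> * (sqrt a + sqrt b)"
    using h[OF assms(1)] h[OF assms(2)] by (intro mult_left_mono) auto
  ultimately have "\<bar>sqrt a - sqrt b\<bar> * 1 \<le> \<bar>a - b\<bar>" by (simp only:)
  then show ?thesis by simp
qed

text \<open>Down to 0 the square root is only its own modulus of continuity. This is the price for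
  the sines: half of the digits are lost.\<close>

lemma sqrt_diff_sqrt:
  assumes "0 \<le> a" "0 \<le> b"
  shows "\<bar>sqrt a - sqrt b\<bar> \<le> sqrt \<bar>a - b\<bar>"
proof -
  have *: "sqrt x \<le> sqrt y + sqrt \<bar>x - y\<bar>" if "0 \<le> x" "0 \<le> y" for x y
  proof -
    have "sqrt x \<le> sqrt (y + \<bar>x - y\<bar>)" by simp
    also have "\<dots> \<le> sqrt y + sqrt \<bar>x - y\<bar>" using that by (intro sqrt_add_le_add_sqrt) auto
    finally show ?thesis .
  qed
  show ?thesis using *[OF assms] *[OF assms(2,1)] by (simp add: abs_le_iff abs_minus_commute)
qed

text \<open>With \<open>w * w\<close> as the scale, cosines are accurate to the last digits but
  sines only to half of them, since these come from a square root near 0. The recursion feeds on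
  cosines alone, so the loss does not spread.\<close>

definition root_ok :: "nat \<Rightarrow> nat \<Rightarrow> int \<Rightarrow> int \<Rightarrow> bool" where
  "root_ok w k c s \<longleftrightarrow> 0 \<le> c \<and> c \<le> int (w * w) \<and> 0 \<le> s \<and> s \<le> int (w * w) \<and>
     \<bar>real_of_int c / real (w * w) - cw k\<bar> \<le> 4 / real (w * w) \<and>
     \<bar>real_of_int s / real (w * w) - sw k\<bar> \<le> 4 / real w"

lemma root_ok_0: "0 < w \<Longrightarrow> root_ok w 0 0 (int (w * w))"
  by (simp add: root_ok_def)

lemma floor_sqrt_le:
  fixes r X S :: int
  assumes "0 \<le> r" "r * r \<le> X" "X \<le> S * S" "0 \<le> S"
  shows "r \<le> S"
proof (rule ccontr)
  assume "\<not> r \<le> S"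
  then have "S * S < r * r" using assms(4) by (intro mult_strict_mono') auto
  then show False using assms(2,3) by linarith
qed

text \<open>The tolerance of the cosine reproduces itself: the error \<open>4 / R\<close> of
  \<open>c\<close> is halved in \<open>(1 + z) / 2\<close>, not enlarged by the root, and rounding
  adds \<open>2 / R\<close> again.\<close>

lemma root_ok_Suc:
  fixes w :: nat
  assumes w: "2 \<le> w" and ok: "root_ok w k c s" and S: "S = int (w * w)"
    and r: "0 \<le> r" "r * r \<le> S * (S + c) div 2" "S * (S + c) div 2 < (r + 1) * (r + 1)"
    and r': "0 \<le> r'" "r' * r' \<le> S * (S - c) div 2" "S * (S - c) div 2 < (r' + 1) * (r' + 1)"
  shows "root_ok w (Suc k) r r'"
proof -
  define R where "R = real (w * w)"
  have R: "real_of_int S = R" by (simp add: R_def S)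
  have R0: "0 < R" using w by (simp add: R_def)
  have c: "0 \<le> c" "c \<le> S" using ok by (auto simp: root_ok_def S)
  define z where "z = real_of_int c / R"
  have z: "0 \<le> z" "z \<le> 1" using c R0 R by (auto simp: z_def field_simps)
  have zc: "\<bar>z - cw k\<bar> \<le> 4 / R" using ok by (simp add: root_ok_def z_def R_def)
  have S0: "0 \<le> S" by (simp add: S)
  have SS: "S * (S + c) div 2 \<le> S * S" "S * (S - c) div 2 \<le> S * S"
  proof -
    have "S * (S + c) \<le> S * (2 * S)" "S * (S - c) \<le> S * (2 * S)"
      using c S0 by (intro mult_left_mono; linarith)+
    then show "S * (S + c) div 2 \<le> S * S" "S * (S - c) div 2 \<le> S * S" by linarith+
  qed
  have Y: "0 \<le> S * (S + c)" "0 \<le> S * (S - c)" using c S0 by auto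
  have e1: "sqrt (real_of_int (S * (S + c)) / 2) = R * sqrt ((1 + z) / 2)"
  proof -
    have "real_of_int (S * (S + c)) / 2 = R * R * ((1 + z) / 2)" using R R0 by (simp add: z_def field_simps)
    then show ?thesis using sqrt_scale[of R "(1 + z) / 2"] R0 by (simp only: less_imp_le)
  qed
  have e2: "sqrt (real_of_int (S * (S - c)) / 2) = R * sqrt ((1 - z) / 2)"
  proof -
    have "real_of_int (S * (S - c)) / 2 = R * R * ((1 - z) / 2)" using R R0 by (simp add: z_def field_simps)
    then show ?thesis using sqrt_scale[of R "(1 - z) / 2"] R0 by (simp only: less_imp_le)
  qed
  have sc: "\<bar>real_of_int q / R - y\<bar> \<le> 2 / R" if "\<bar>real_of_int q - R * y\<bar> \<le> 2" for q y
  proof -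
    have "real_of_int q / R - y = (real_of_int q - R * y) / R" using R0 by (simp add: field_simps)
    then show ?thesis using that R0 by (simp add: abs_divide divide_right_mono)
  qed
  have 1: "\<bar>real_of_int r / R - sqrt ((1 + z) / 2)\<bar> \<le> 2 / R"
    using floor_sqrt_error[OF r refl Y(1)] unfolding e1 by (rule sc)
  have 2: "\<bar>real_of_int r' / R - sqrt ((1 - z) / 2)\<bar> \<le> 2 / R"
    using floor_sqrt_error[OF r' refl Y(2)] unfolding e2 by (rule sc)
  have 3: "\<bar>sqrt ((1 + z) / 2) - cw (Suc k)\<bar> \<le> 2 / R"
  proof -
    have "\<bar>sqrt ((1 + z) / 2) - sqrt ((1 + cw k) / 2)\<bar> \<le> \<bar>(1 + z) / 2 - (1 + cw k) / 2\<bar>"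
      using z cw_bounds[of k] by (intro sqrt_diff_linear) auto
    also have "\<dots> = \<bar>z - cw k\<bar> / 2" by (simp add: diff_divide_distrib[symmetric])
    finally show ?thesis using zc by simp
  qed
  have 4: "\<bar>sqrt ((1 - z) / 2) - sw (Suc k)\<bar> \<le> 2 / real w"
  proof -
    have "\<bar>sqrt ((1 - z) / 2) - sqrt ((1 - cw k) / 2)\<bar> \<le> sqrt \<bar>(1 - z) / 2 - (1 - cw k) / 2\<bar>"
      using z cw_bounds[of k] by (intro sqrt_diff_sqrt) auto
    also have "\<bar>(1 - z) / 2 - (1 - cw k) / 2\<bar> = \<bar>z - cw k\<bar> / 2"
      by (simp add: diff_divide_distrib[symmetric] abs_minus_commute)
    also have "sqrt (\<bar>z - cw k\<bar> / 2) \<le> sqrt ((2 / real w)\<^sup>2)"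
    proof (rule real_sqrt_le_mono)
      have "\<bar>z - cw k\<bar> / 2 \<le> 2 / R" using zc by simp
      also have "\<dots> \<le> (2 / real w)\<^sup>2" using w by (simp add: R_def power2_eq_square field_simps)
      finally show "\<bar>z - cw k\<bar> / 2 \<le> (2 / real w)\<^sup>2" .
    qed
    also have "\<dots> = 2 / real w" by simp
    finally show ?thesis by simp
  qed
  have "2 / R \<le> 2 / real w" using w by (simp add: R_def field_simps)
  then have "\<bar>real_of_int r' / R - sw (Suc k)\<bar> \<le> 4 / real w" using 2 4 by linarith
  moreover have "\<bar>real_of_int r / R - cw (Suc k)\<bar> \<le> 4 / R" using 1 3 by linarith
  moreover have "r \<le> S" "r' \<le> S" using floor_sqrt_le[OF r(1,2) SS(1) S0] floor_sqrt_le[OF r'(1,2) SS(2) S0] by auto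
  ultimately show ?thesis using r(1) r'(1) unfolding root_ok_def R_def S by simp
qed

lemma root_ok_om:
  assumes "root_ok w k c s" "2 \<le> w"
  shows "cmod (zc (w * w) c s - om k) \<le> 8 / real w"
proof -
  have "cmod (zc (w * w) c s - om k) \<le> \<bar>real_of_int c / real (w * w) - cw k\<bar> + \<bar>real_of_int s / real (w * w) - sw k\<bar>"
    using cmod_le[of "zc (w * w) c s - om k"] by (simp add: zc_def om_def)
  also have "\<dots> \<le> 4 / real (w * w) + 4 / real w" using assms(1) by (intro add_mono) (auto simp: root_ok_def)
  also have "4 / real (w * w) \<le> 4 / real w" using assms(2) by (simp add: field_simps)
  finally show ?thesis by simp
qed

text \<open>The error \<open>8 / w\<close> of \<open>om k\<close>, enlarged by
  \<open>1 + ?E \<le> 2\<close>, adds at most \<open>16 / w\<close> to the old error, and rounding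
  at most \<open>2 / w\<close>. So the error grows only linearly in the number of doublings; 24
  leaves some room.\<close>

lemma table_step:
  fixes w :: nat
  assumes w: "2 \<le> w" and ok: "root_ok w k c s" and t: "apx (w * w) (24 * real k / real w) (2 ^ k) gr gi g"
    and k: "24 * k \<le> w" and S: "S = int (w * w)"
    and gr': "\<And>i. i < 2 ^ k \<Longrightarrow> gr' i = gr i" "\<And>i. i < 2 ^ k \<Longrightarrow> gr' (2 ^ k + i) = (c * gr i - s * gi i) div S"
    and gi': "\<And>i. i < 2 ^ k \<Longrightarrow> gi' i = gi i" "\<And>i. i < 2 ^ k \<Longrightarrow> gi' (2 ^ k + i) = (c * gi i + s * gr i) div S"
  shows "apx (w * w) (24 * real (Suc k) / real w) (2 ^ Suc k) gr' gi' g"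
  unfolding apx_def
proof (intro allI impI)
  fix i :: nat assume i: "i < 2 ^ Suc k"
  let ?E = "24 * real k / real w"
  have w0: "0 < real w" "0 < w * w" using w by auto
  have E: "?E + 24 / real w = 24 * real (Suc k) / real w" by (simp add: add_divide_distrib[symmetric])
  have E1: "?E \<le> 1" using k w0 by (simp add: field_simps)
  show "cmod (zc (w * w) (gr' i) (gi' i) - g i) \<le> 24 * real (Suc k) / real w"
  proof (cases "i < 2 ^ k")
    case True
    then have "cmod (zc (w * w) (gr' i) (gi' i) - g i) \<le> ?E" using t gr'(1) gi'(1) by (simp add: apx_def)
    then show ?thesis using E w0 by (smt (verit) divide_nonneg_pos)
  next
    case False
    then obtain r where r: "i = 2 ^ k + r" "r < 2 ^ k" using i
      by (metis add_diff_inverse_nat add_less_cancel_left mult_2 power_Suc)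
    have "cmod (zc (w * w) (gr r) (gi r) - g r) \<le> ?E" using t r by (simp add: apx_def)
    from zc_mult_error[OF w0(2) root_ok_om[OF ok w] this, of 1 1]
    have "cmod (zc (w * w) (gr' i) (gi' i) - g i) \<le> 8 / real w * (1 + ?E) + ?E * 1 + 2 / real (w * w)"
      unfolding r(1) gr'(2)[OF r(2)] gi'(2)[OF r(2)] g_high[OF r(2)] S by (simp add: norm_om norm_g)
    moreover have "8 / real w * (1 + ?E) \<le> 8 / real w * 2" using E1 w0 by (intro mult_left_mono) auto
    moreover have "2 / real (w * w) \<le> 2 / real w" using w by (simp add: field_simps)
    moreover have "8 / real w * 2 + 2 / real w \<le> 24 / real w" using w0 by (simp add: field_simps)
    ultimately show ?thesis using E by linarith
  qed
qed

subsection \<open>Error budget of a convolution\<close>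

text \<open>Throughout, \<open>T\<close> is the length of the root table and \<open>T ^ 32\<close> the fixed-point scale.\<close>

definition table_ok :: "nat \<Rightarrow> (nat \<Rightarrow> int) \<Rightarrow> (nat \<Rightarrow> int) \<Rightarrow> bool" where
  "table_ok T gr gi \<longleftrightarrow> 8 \<le> T \<and> apx (T ^ 32) (1 / real T ^ 13) T gr gi g"

lemma apx_mono: "apx S d n x y e \<Longrightarrow> d \<le> d' \<Longrightarrow> apx S d' n x y e"
  unfolding apx_def by (meson order_trans)

lemma recip_power:
  assumes "8 \<le> T" "a \<le> b"
  shows "1 / real T ^ b \<le> 1 / real T ^ a"
proof -
  have "real T ^ a \<le> real T ^ b" using assms by (intro power_increasing) auto
  then show ?thesis using assms by (intro divide_left_mono) auto
qed

lemma recip_power_Suc: "8 \<le> T \<Longrightarrow> 8 * (1 / real T ^ Suc a) \<le> 1 / real T ^ a"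
  by (simp add: field_simps)

lemma recip_mult: "0 < T \<Longrightarrow> real T ^ a * (1 / real T ^ (a + b)) = 1 / real T ^ b"
  by (simp add: power_add)

text \<open>Turns the growth \<open>3 ^ l\<close> of the error over \<open>l\<close> levels into a
  power of \<open>T\<close>, by \<open>3 \<le> 2 ^ 2\<close>.\<close>

lemma three_power:
  assumes "2 ^ h \<le> (T::nat)" "l \<le> h"
  shows "3 ^ l \<le> real T ^ 2"
proof -
  have "(3::real) ^ l \<le> 4 ^ l" by (intro power_mono) auto
  also have "\<dots> \<le> 4 ^ h" using assms(2) by (intro power_increasing) auto
  also have "(4::real) ^ h = (2 ^ h) ^ 2" by (simp add: power2_eq_square power_mult_distrib[symmetric])
  also have "\<dots> \<le> real T ^ 2" using assms(1) by (intro power_mono) (simp_all add: of_nat_le_iff[symmetric] del: of_nat_le_iff)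
  finally show ?thesis .
qed

text \<open>A solution of \<open>e 0 = 0\<close> and \<open>3 * e l + p \<le> e (l + 1)\<close>,
  where \<open>p = 1 / T ^ 11\<close> bounds what a level adds.\<close>

definition eF :: "nat \<Rightarrow> nat \<Rightarrow> real" where
  "eF T l = 3 ^ l * (1 / real T ^ 11) - 1 / real T ^ 11"

text \<open>The analogue for the inverse transform, which starts from the error
  \<open>1 / T ^ 7\<close> of the pointwise product and adds \<open>1 / T ^ 10\<close> per
  level.\<close>

definition eI :: "nat \<Rightarrow> nat \<Rightarrow> real" where
  "eI T l = 3 ^ l * (1 / real T ^ 7 + 1 / real T ^ 10) - 1 / real T ^ 10"

lemma eF_bounds:
  assumes "8 \<le> T" "2 ^ h \<le> T" "l \<le> h"
  shows "0 \<le> eF T l" "eF T l \<le> 1 / real T ^ 9"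
proof -
  have "1 * (1 / real T ^ 11) \<le> 3 ^ l * (1 / real T ^ 11)" by (intro mult_right_mono) auto
  then show "0 \<le> eF T l" by (simp add: eF_def)
  have "3 ^ l * (1 / real T ^ 11) \<le> real T ^ 2 * (1 / real T ^ 11)"
    using three_power[OF assms(2,3)] by (intro mult_right_mono) auto
  also have "\<dots> = real T ^ 2 * (1 / real T ^ (2 + 9))" by simp
  also have "\<dots> = 1 / real T ^ 9" using assms(1) by (intro recip_mult) auto
  finally have *: "3 ^ l * (1 / real T ^ 11) \<le> 1 / real T ^ 9" .
  have "A - p \<le> q" if "A \<le> q" "0 \<le> p" for A p q :: real using that by simp
  from this[OF *, of "1 / real T ^ 11"] show "eF T l \<le> 1 / real T ^ 9" unfolding eF_def by simp
qed

lemma recip_small: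
  assumes "8 \<le> T" "0 < a"
  shows "1 / real T ^ a \<le> 1 / 8"
proof -
  have "1 / real T ^ a \<le> 1 / real T ^ 1" using assms by (intro recip_power) auto
  also have "\<dots> \<le> 1 / 8" using assms(1) by (simp add: field_simps)
  finally show ?thesis .
qed

lemma eI_bounds:
  assumes "8 \<le> T" "2 ^ h \<le> T" "l \<le> h"
  shows "0 \<le> eI T l" "eI T l \<le> 1 / 4"
proof -
  have "1 * (1 / real T ^ 7 + 1 / real T ^ 10) \<le> 3 ^ l * (1 / real T ^ 7 + 1 / real T ^ 10)"
    by (intro mult_right_mono) auto
  moreover have "0 \<le> A - q" if "1 * (p + q) \<le> A" "0 \<le> p" for A p q :: real using that by simp
  ultimately show "0 \<le> eI T l" unfolding eI_def by (simp only: zero_le_divide_1_iff zero_le_power of_nat_0_le_iff)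
  have "1 / real T ^ 10 \<le> 1 / real T ^ 7" by (rule recip_power) (use assms in auto)
  then have "3 ^ l * (1 / real T ^ 7 + 1 / real T ^ 10) \<le> real T ^ 2 * (2 * (1 / real T ^ 7))"
    using three_power[OF assms(2,3)] by (intro mult_mono) auto
  also have "\<dots> = 2 * (real T ^ 2 * (1 / real T ^ (2 + 5)))" by simp
  also have "\<dots> = 2 * (1 / real T ^ 5)" using assms(1) by (subst recip_mult) auto
  also have "\<dots> \<le> 1 / 4" using recip_small[OF assms(1), of 5] by simp
  finally have *: "3 ^ l * (1 / real T ^ 7 + 1 / real T ^ 10) \<le> 1 / 4" .
  have "A - p \<le> q" if "A \<le> q" "0 \<le> p" for A p q :: real using that by simp
  from this[OF *, of "1 / real T ^ 10"] show "eI T l \<le> 1 / 4" unfolding eI_def by simp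
qed

lemma budget_sum: "s \<le> p \<Longrightarrow> 8 * p \<le> r \<Longrightarrow> 0 \<le> p \<Longrightarrow> p + 2 * s \<le> r \<and> 2 * p + 2 * s \<le> (r::real)"
  by linarith

text \<open>With coefficients at most 1, the entries of a transform of length
  \<open>n \<le> T\<close> are at most \<open>T\<close>. The table error then contributes
  \<open>1 / T ^ 12\<close>, which together with rounding stays below
  \<open>1 / T ^ 11\<close>.\<close>

lemma forward_level:
  assumes tab: "table_ok T gr gi" and n: "n = 2 ^ h" "n \<le> T" and q: "q = 2 ^ l" "2 * m * q = n"
    and a: "\<And>i. cmod (a i) \<le> 1" and x: "apx (T ^ 32) (eF T l) n x y (ex a (2 * m) q)"
  shows "apx (T ^ 32) (eF T (Suc l)) n (fR (int (T ^ 32)) m gr gi x y) (fI (int (T ^ 32)) m gr gi x y) (ex a m (2 * q))"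
proof -
  have T: "8 \<le> T" and g: "apx (T ^ 32) (1 / real T ^ 13) T gr gi g" using tab by (auto simp: table_ok_def)
  have n0: "0 < n" using n by simp
  then have m: "0 < m" and qn: "q \<le> n" using q(2) by (auto intro: Nat.gr0I)
  have "2 ^ l \<le> (2::nat) ^ h" using qn n q(1) by simp
  then have l: "l \<le> h" by simp
  have M: "cmod (ex a (2 * m) q i) \<le> real T" for i
    using norm_ex[of a 1 "2 * m" q i] a qn n(2) by simp
  have "1 / real T ^ 13 * real T = 1 / real T ^ 12" using recip_mult[of T 1 12] T by (simp add: mult.commute)
  moreover have "1 / real T ^ 32 \<le> 1 / real T ^ 12" by (rule recip_power) (use T in auto)
  moreover have "8 * (1 / real T ^ 12) \<le> 1 / real T ^ 11" using recip_power_Suc[of T 11] T by simp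
  ultimately have eta: "1 / real T ^ 13 * real T + 2 / real (T ^ 32) \<le> 1 / real T ^ 11"
    using budget_sum[of "1 / real T ^ 32" "1 / real T ^ 12" "1 / real T ^ 11"] by simp
  have T32: "0 < T ^ 32" using T by simp
  have nT: "2 ^ h \<le> T" using n by simp
  have e13: "0 \<le> 1 / real T ^ 13" "1 / real T ^ 13 \<le> 1" using recip_small[OF T, of 13] by simp_all
  have "apx (T ^ 32) (3 * eF T l + 1 / real T ^ 11) (2 * m * q)
    (fR (int (T ^ 32)) m gr gi x y) (fI (int (T ^ 32)) m gr gi x y) (ex a m (2 * q))"
    by (rule forward_step[OF T32 m x[folded q(2)] g order_trans[OF qn n(2)] e13 eF_bounds(1)[OF T nT l] M eta])
  moreover have "3 * eF T l + 1 / real T ^ 11 \<le> eF T (Suc l)" by (simp add: eF_def divide_right_mono)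
  ultimately show ?thesis unfolding q(2) by (rule apx_mono)
qed

text \<open>The scaled entries are at most \<open>m * (2 * q) * n = n ^ 2 \<le> T ^ 2\<close>, so
  the table error counts as \<open>1 / T ^ 11\<close>; doubled and with rounding it stays below
  \<open>1 / T ^ 10\<close>.\<close>

lemma inverse_level:
  assumes tab: "table_ok T gr gi" and n: "n = 2 ^ h" "n \<le> T" and m: "m = 2 ^ l" "2 * m * q = n"
    and a: "\<And>i. cmod (a i) \<le> real n" and x: "apx (T ^ 32) (eI T l) n x y (\<lambda>i. of_nat m * ex a m (2 * q) i)"
  shows "apx (T ^ 32) (eI T (Suc l)) n (iR (int (T ^ 32)) m gr gi x y) (iI (int (T ^ 32)) m gr gi x y)
    (\<lambda>i. of_nat (2 * m) * ex a (2 * m) q i)"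
proof -
  have T: "8 \<le> T" and g: "apx (T ^ 32) (1 / real T ^ 13) T gr gi g" using tab by (auto simp: table_ok_def)
  have n0: "0 < n" using n by simp
  then have m0: "0 < m" and q0: "0 < q" using m(2) by (auto intro: Nat.gr0I)
  then have qn: "q \<le> n" and mn: "m \<le> n" using m(2) by auto
  have "2 ^ l \<le> (2::nat) ^ h" using mn n m(1) by simp
  then have l: "l \<le> h" by simp
  have M: "cmod (of_nat m * ex a m (2 * q) i) \<le> real T ^ 2" for i
  proof -
    have "cmod (ex a m (2 * q) i) \<le> real (2 * q) * real n" by (rule norm_ex[OF a])
    then have "real m * cmod (ex a m (2 * q) i) \<le> real m * (real (2 * q) * real n)" by (intro mult_left_mono) auto
    also have "\<dots> = real (2 * m * q) * real n" by simp
    also have "\<dots> = real n * real n" unfolding m(2) ..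
    also have "\<dots> \<le> real T ^ 2" unfolding power2_eq_square using n(2) by (intro mult_mono) auto
    finally show ?thesis by (simp add: norm_mult)
  qed
  have "1 / real T ^ 13 * real T ^ 2 = 1 / real T ^ 11" using recip_mult[of T 2 11] T by (simp add: mult.commute)
  moreover have "1 / real T ^ 32 \<le> 1 / real T ^ 11" by (rule recip_power) (use T in auto)
  moreover have "8 * (1 / real T ^ 11) \<le> 1 / real T ^ 10" using recip_power_Suc[of T 10] T by simp
  ultimately have eta: "2 * (1 / real T ^ 13) * real T ^ 2 + 2 / real (T ^ 32) \<le> 1 / real T ^ 10"
    using budget_sum[of "1 / real T ^ 32" "1 / real T ^ 11" "1 / real T ^ 10"] by (simp add: mult.assoc)
  have T32: "0 < T ^ 32" using T by simp
  have nT: "2 ^ h \<le> T" using n by simp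
  have e13: "0 \<le> 1 / real T ^ 13" "1 / real T ^ 13 \<le> 1 / 2" using recip_small[OF T, of 13] by simp_all
  have "apx (T ^ 32) (3 * eI T l + 1 / real T ^ 10) (2 * m * q)
    (iR (int (T ^ 32)) m gr gi x y) (iI (int (T ^ 32)) m gr gi x y) (\<lambda>i. (2 * of_nat m) * ex a (2 * m) q i)"
    by (rule inverse_step[OF T32 m0 x[folded m(2)] g order_trans[OF qn n(2)] e13 eI_bounds(1)[OF T nT l] M eta])
  moreover have "3 * eI T l + 1 / real T ^ 10 \<le> eI T (Suc l)"
  proof -
    have "0 \<le> 1 / real T ^ 10" by simp
    then show ?thesis by (simp add: eI_def algebra_simps)
  qed
  ultimately show ?thesis unfolding m(2) by (simp add: apx_mono)
qed

text \<open>Both factors are at most \<open>T\<close> and accurate to \<open>1 / T ^ 9\<close>,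
  which makes the product accurate to \<open>3 / T ^ 8\<close> plus rounding, and this is below
  \<open>1 / T ^ 7\<close>.\<close>

lemma product_level:
  assumes T: "8 \<le> T" and n: "n = 2 ^ h" "n \<le> T"
    and a: "\<And>i. cmod (a i) \<le> 1" and b: "\<And>i. cmod (b i) \<le> 1"
    and x: "apx (T ^ 32) (eF T h) n x y (ex a 1 n)" and x': "apx (T ^ 32) (eF T h) n x' y' (ex b 1 n)"
  shows "apx (T ^ 32) (eI T 0) n (\<lambda>i. (x i * x' i - y i * y' i) div int (T ^ 32))
    (\<lambda>i. (x i * y' i + y i * x' i) div int (T ^ 32)) (\<lambda>i. of_nat 1 * ex (cyc n a b) 1 n i)"
  unfolding apx_def
proof (intro allI impI)
  fix i assume i: "i < n"
  let ?e = "eF T h"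
  have e: "0 \<le> ?e" "?e \<le> 1 / real T ^ 9" using eF_bounds[OF T, of h h] n by auto
  have T0: "0 < T ^ 32" using T by simp
  have M: "cmod (ex a 1 n i) \<le> real T" "cmod (ex b 1 n i) \<le> real T"
    using norm_ex[of a 1 1 n i] norm_ex[of b 1 1 n i] a b n(2) by auto
  have "cmod (zc (T ^ 32) (x i) (y i) - ex a 1 n i) \<le> ?e" "cmod (zc (T ^ 32) (x' i) (y' i) - ex b 1 n i) \<le> ?e"
    using x x' i by (auto simp: apx_def)
  from zc_mult_error[OF T0 this M]
  have 1: "cmod (zc (T ^ 32) ((x i * x' i - y i * y' i) div int (T ^ 32)) ((x i * y' i + y i * x' i) div int (T ^ 32)) -
     ex (cyc n a b) 1 n i) \<le> ?e * (real T + ?e) + ?e * real T + 2 / real (T ^ 32)"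
    unfolding ex_cyc[OF n(1) i] .
  have e1: "?e \<le> real T" using e(2) recip_small[OF T, of 9] T by linarith
  have "?e * (real T + ?e) + ?e * real T \<le> ?e * (3 * real T)"
    using mult_left_mono[OF e1 e(1)] by (simp add: algebra_simps)
  also have "\<dots> \<le> (1 / real T ^ 9) * (3 * real T)" using e by (intro mult_right_mono) auto
  also have "\<dots> = 3 * (real T ^ 1 * (1 / real T ^ (1 + 8)))" by simp
  also have "\<dots> = 3 * (1 / real T ^ 8)" using T by (subst recip_mult) auto
  finally have 2: "?e * (real T + ?e) + ?e * real T \<le> 3 * (1 / real T ^ 8)" .
  have 3: "1 / real T ^ 32 \<le> 1 / real T ^ 8" by (rule recip_power) (use T in auto)
  have 4: "8 * (1 / real T ^ 8) \<le> 1 / real T ^ 7" using recip_power_Suc[of T 7] T by simp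
  have 5: "2 / real (T ^ 32) = 2 * (1 / real T ^ 32)" by simp
  have 6: "0 \<le> 1 / real T ^ 8" by simp
  have "eI T 0 = 1 / real T ^ 7" by (simp add: eI_def)
  then show "cmod (zc (T ^ 32) ((x i * x' i - y i * y' i) div int (T ^ 32)) ((x i * y' i + y i * x' i) div int (T ^ 32)) -
     of_nat 1 * ex (cyc n a b) 1 n i) \<le> eI T 0"
    using 1 2 3 4 5 6 by (simp only: of_nat_1 mult_1)
qed

text \<open>Adding half of the divisor turns the floor into rounding to the nearest integer. What
  \<open>x / S\<close> approximates is \<open>n * c\<close>, because the inverse transform leaves a
  factor \<open>n\<close>.\<close>

lemma round_quotient:
  fixes x S n c :: int
  assumes "0 < S" "0 < n" "\<bar>real_of_int x / real_of_int S - real_of_int (n * c)\<bar> \<le> 1 / 4"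
  shows "(2 * x + S * n) div (2 * S * n) = c"
proof -
  have "\<bar>real_of_int x - real_of_int (S * (n * c))\<bar> \<le> real_of_int S / 4"
  proof -
    have "real_of_int x - real_of_int (S * (n * c)) =
      real_of_int S * (real_of_int x / real_of_int S - real_of_int (n * c))" using assms(1) by (simp add: field_simps)
    then have "\<bar>real_of_int x - real_of_int (S * (n * c))\<bar> =
      real_of_int S * \<bar>real_of_int x / real_of_int S - real_of_int (n * c)\<bar>" using assms(1) by (simp add: abs_mult)
    also have "\<dots> \<le> real_of_int S * (1 / 4)" using assms by (intro mult_left_mono) auto
    finally show ?thesis by simp
  qed
  then have "real_of_int (4 * \<bar>x - S * (n * c)\<bar>) \<le> real_of_int S" by simp
  then have a: "4 * \<bar>x - S * (n * c)\<bar> \<le> S" by (simp only: of_int_le_iff)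
  have b: "S \<le> S * n" using assms by simp
  define D where "D = x - S * (n * c)"
  define P where "P = S * n"
  have P: "4 * \<bar>D\<bar> \<le> P" "0 < P" unfolding D_def P_def using order_trans[OF a b] assms by auto
  have "2 * x + S * n = c * (2 * P) + (2 * D + P)" by (simp add: D_def P_def algebra_simps)
  also have "\<dots> div (2 * P) = c + (2 * D + P) div (2 * P)" using P by simp
  also have "(2 * D + P) div (2 * P) = 0" using P by (intro div_pos_pos_trivial) linarith+
  finally show ?thesis by (simp add: P_def mult.assoc)
qed

lemma of_int_cyc: "(of_int (cyc n a b i) :: complex) = cyc n (\<lambda>i. of_int (a i)) (\<lambda>i. of_int (b i)) i"
  unfolding cyc_def by (simp add: if_distrib[of of_int] cong: if_cong)

text \<open>The terms are nonnegative, so a coefficient vanishes only if all its terms do. For each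
  \<open>j\<close> at most one \<open>k < n\<close> satisfies the congruence, which gives the bound
  \<open>n\<close>.\<close>

lemma cyc_01:
  fixes a b :: "nat \<Rightarrow> int"
  assumes "\<And>i. a i \<in> {0, 1}" "\<And>i. b i \<in> {0, 1}"
  shows "0 \<le> cyc n a b i" "cyc n a b i \<le> int n"
    "cyc n a b i \<noteq> 0 \<longleftrightarrow> (\<exists>j<n. \<exists>k<n. a j = 1 \<and> b k = 1 \<and> (j + k) mod n = i)"
proof -
  let ?f = "\<lambda>j k. if (j + k) mod n = i then a j * b k else 0"
  have f: "0 \<le> ?f j k" for j k using assms(1)[of j] assms(2)[of k] by auto
  show "0 \<le> cyc n a b i" unfolding cyc_def by (intro sum_nonneg f)
  have "cyc n a b i = 0 \<longleftrightarrow> (\<forall>j<n. \<forall>k<n. ?f j k = 0)"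
    unfolding cyc_def using f by (subst sum_nonneg_eq_0_iff; (simp add: sum_nonneg)?) (auto simp: sum_nonneg_eq_0_iff)
  moreover have "?f j k = 0 \<longleftrightarrow> \<not> (a j = 1 \<and> b k = 1 \<and> (j + k) mod n = i)" for j k
    using assms(1)[of j] assms(2)[of k] by auto
  ultimately show "cyc n a b i \<noteq> 0 \<longleftrightarrow> (\<exists>j<n. \<exists>k<n. a j = 1 \<and> b k = 1 \<and> (j + k) mod n = i)" by blast
  have "(\<Sum>k<n. ?f j k) \<le> 1" if "j < n" for j
  proof -
    have *: "k = k'" if "k < n" "k' < n" "(j + k) mod n = i" "(j + k') mod n = i" for k k'
    proof -
      have "k mod n = k' mod n"
      proof -
        have "int (j + k) mod int n = int (j + k') mod int n" using that by (metis of_nat_mod)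
        then have "(int (j + k) - int j) mod int n = (int (j + k') - int j) mod int n" by (metis mod_diff_left_eq)
        then have "int (k mod n) = int (k' mod n)" by (simp add: of_nat_mod)
        then show ?thesis by simp
      qed
      then show ?thesis using that by simp
    qed
    show ?thesis
    proof (cases "\<exists>k<n. (j + k) mod n = i")
      case True
      then obtain k where k: "k < n" "(j + k) mod n = i" by blast
      have "(\<Sum>k'<n. ?f j k') = (\<Sum>k'\<in>{k}. ?f j k')"
        using k * by (intro sum.mono_neutral_right) auto
      also have "\<dots> \<le> 1" using assms(1)[of j] assms(2)[of k] by auto
      finally show ?thesis .
    qed (simp add: sum.neutral)
  qed
  then have "cyc n a b i \<le> (\<Sum>j<n. 1)" unfolding cyc_def by (intro sum_mono) auto
  then show "cyc n a b i \<le> int n" by simp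
qed

subsection \<open>Proof rules\<close>

fun mv :: "com \<Rightarrow> var set" where
  "mv (x ::= e) = {x}"
| "mv (Sto k i e) = {}"
| "mv (c ;; c') = mv c \<union> mv c'"
| "mv (While e e' c) = mv c"

fun ma :: "com \<Rightarrow> arr set" where
  "ma (x ::= e) = {}"
| "ma (Sto k i e) = {k}"
| "ma (c ;; c') = ma c \<union> ma c'"
| "ma (While e e' c) = ma c"

definition fr :: "com \<Rightarrow> st \<Rightarrow> st \<Rightarrow> bool" where
  "fr c s s' \<longleftrightarrow> (\<forall>x. x \<notin> mv c \<longrightarrow> fst s' x = fst s x) \<and> (\<forall>k. k \<notin> ma c \<longrightarrow> snd s' k = snd s k)"

lemma fr_trans: "fr c s s' \<Longrightarrow> fr c s' s'' \<Longrightarrow> fr c s s''"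
  by (simp add: fr_def)

lemma fr_refl: "fr c s s" by (simp add: fr_def)

lemma big_fr: "big B lm c s t s' \<Longrightarrow> fr c s s'"
  by (induction rule: big.induct) (auto simp: fr_def upd_def)

text \<open>Total correctness from one explicitly given start state, within \<open>T\<close> steps.
  \<open>Q\<close> may mention that state, which takes the place of auxiliary variables.\<close>

definition tri :: "int \<Rightarrow> int \<Rightarrow> com \<Rightarrow> st \<Rightarrow> nat \<Rightarrow> (st \<Rightarrow> bool) \<Rightarrow> bool" where
  "tri B lm c s T Q \<longleftrightarrow> (\<exists>t s'. big B lm c s t s' \<and> t \<le> T \<and> Q s')"

lemma tri_assign:
  assumes "eok lm e (v, a)" "\<bar>aval e (v, a)\<bar> \<le> B" "Q (v(x := aval e (v, a)), a)"
  shows "tri B lm (x ::= e) (v, a) 1 Q"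
  unfolding tri_def using big.Assign[OF assms(1,2)] assms(3) by blast

lemma tri_sto:
  assumes "eok lm i (v, a)" "eok lm e (v, a)" "idx_ok lm k (aval i (v, a))" "\<bar>aval e (v, a)\<bar> \<le> B"
    "Q (v, upd k (nat (aval i (v, a))) (aval e (v, a)) a)"
  shows "tri B lm (Sto k i e) (v, a) 1 Q"
  unfolding tri_def using big.Sto[OF assms(1-4)] assms(5) by blast

lemma tri_seq:
  assumes "tri B lm c s Ta (\<lambda>s'. tri B lm c' s' Tb Q)" "Ta + Tb \<le> T"
  shows "tri B lm (c ;; c') s T Q"
proof -
  obtain t s' where 1: "big B lm c s t s'" "t \<le> Ta" "tri B lm c' s' Tb Q" using assms(1) unfolding tri_def[of B lm c s] by blast
  then obtain t' s'' where 2: "big B lm c' s' t' s''" "t' \<le> Tb" "Q s''" unfolding tri_def by blast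
  have "t + t' \<le> T" using 1(2) 2(2) assms(2) by linarith
  then show ?thesis unfolding tri_def using big.Seq[OF 1(1) 2(1)] 2(3) by blast
qed

text \<open>Hands the frame condition to the proof of \<open>Q'\<close>, so that postconditions do
  not have to repeat what a command leaves alone.\<close>

lemma tri_conseq:
  assumes "tri B lm c s T Q" "\<And>s'. fr c s s' \<Longrightarrow> Q s' \<Longrightarrow> Q' s'" "T \<le> T'"
  shows "tri B lm c s T' Q'"
proof -
  obtain t s' where 1: "big B lm c s t s'" "t \<le> T" "Q s'" using assms(1) by (auto simp: tri_def)
  have "t \<le> T'" using 1(2) assms(3) by linarith
  then show ?thesis unfolding tri_def using 1(1) assms(2)[OF big_fr[OF 1(1)] 1(3)] by blast
qed

text \<open>The invariant is indexed by the number of completed iterations, which also serves as the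
  variant. Each iteration has its own cost \<open>t i\<close>, since residue classes and doublings
  of the table are unequally expensive.\<close>

lemma tri_while:
  assumes init: "Inv 0 s"
    and step: "\<And>i s'. i < n \<Longrightarrow> Inv i s' \<Longrightarrow> fr c s s' \<Longrightarrow>
      eok lm e s' \<and> eok lm e' s' \<and> aval e s' < aval e' s' \<and> tri B lm c s' (t i) (Inv (Suc i))"
    and exit: "\<And>s'. Inv n s' \<Longrightarrow> fr c s s' \<Longrightarrow> eok lm e s' \<and> eok lm e' s' \<and> \<not> aval e s' < aval e' s' \<and> Q s'"
    and T: "(\<Sum>i<n. t i + 1) + 1 \<le> T"
  shows "tri B lm (While e e' c) s T Q"
proof -
  have "\<exists>\<tau> s''. big B lm (While e e' c) s' \<tau> s'' \<and> \<tau> \<le> (\<Sum>j\<in>{i..<n}. t j + 1) + 1 \<and> Q s''"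
    if "i \<le> n" "Inv i s'" "fr c s s'" for i s'
    using that
  proof (induction "n - i" arbitrary: i s')
    case 0
    then have "i = n" by simp
    then have "big B lm (While e e' c) s' 1 s'" "Q s'" using exit[of s'] 0 big.WhileF by blast+
    then show ?case using \<open>i = n\<close> by (intro exI[of _ 1] exI[of _ s']) simp
  next
    case (Suc d)
    then have i: "i < n" by simp
    note st = step[OF i Suc.prems(2,3)]
    then obtain \<tau> s1 where 1: "big B lm c s' \<tau> s1" "\<tau> \<le> t i" "Inv (Suc i) s1" by (auto simp: tri_def)
    have "d = n - Suc i" "Suc i \<le> n" using Suc.hyps(2) i by auto
    from Suc.hyps(1)[OF this 1(3) fr_trans[OF Suc.prems(3) big_fr[OF 1(1)]]]
    obtain \<tau>' s2 where 2: "big B lm (While e e' c) s1 \<tau>' s2" "\<tau>' \<le> (\<Sum>j\<in>{Suc i..<n}. t j + 1) + 1" "Q s2" by blast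
    have "(\<Sum>j\<in>{i..<n}. t j + 1) = (t i + 1) + (\<Sum>j\<in>{Suc i..<n}. t j + 1)"
      using i by (simp only: sum.atLeast_Suc_lessThan)
    then have "Suc (\<tau> + \<tau>') \<le> (\<Sum>j\<in>{i..<n}. t j + 1) + 1" using 1(2) 2(2) by linarith
    moreover have "big B lm (While e e' c) s' (Suc (\<tau> + \<tau>')) s2" using st 1(1) 2(1) big.WhileT by blast
    ultimately show ?case using 2(3) by blast
  qed
  from this[OF _ init fr_refl] obtain \<tau> s'' where
    *: "big B lm (While e e' c) s \<tau> s''" "\<tau> \<le> (\<Sum>j\<in>{0..<n}. t j + 1) + 1" "Q s''" by blast
  have "\<tau> \<le> T" using *(2) T by (simp add: lessThan_atLeast0)
  then show ?thesis unfolding tri_def using * by blast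
qed

abbreviation eplus (infixl \<open>\<oplus>\<close> 65) where "x \<oplus> y \<equiv> Bop Plus x y"
abbreviation eminus (infixl \<open>\<ominus>\<close> 65) where "x \<ominus> y \<equiv> Bop Minus x y"
abbreviation etimes (infixl \<open>\<otimes>\<close> 70) where "x \<otimes> y \<equiv> Bop Times x y"
abbreviation equot (infixl \<open>\<oslash>\<close> 70) where "x \<oslash> y \<equiv> Bop Quot x y"
abbreviation erem (infixl \<open>\<odot>\<close> 70) where "x \<odot> y \<equiv> Bop Rem x y"

text \<open>Since \<open>0 div 0 = 0\<close>, the expression \<open>e \<oslash> e\<close> is the indicator of \<open>e \<noteq> 0\<close>.\<close>
definition nz :: "exp \<Rightarrow> exp" where "nz e = e \<oslash> e"
definition isz :: "exp \<Rightarrow> exp" where "isz e = N 1 \<ominus> e \<oslash> e"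

lemma nz_simps [simp]: "aval (nz e) s = (if aval e s = 0 then 0 else 1)" "eok lm (nz e) s = eok lm e s"
  "aval (isz e) s = (if aval e s = 0 then 1 else 0)" "eok lm (isz e) s = eok lm e s"
  by (auto simp: nz_def isz_def)

definition fill :: "arr \<Rightarrow> exp \<Rightarrow> exp \<Rightarrow> exp \<Rightarrow> com" where
  "fill k off e m = Vi ::= N 0 ;; While (V Vi) m (Sto k (off \<oplus> V Vi) e ;; Vi ::= V Vi \<oplus> N 1)"

lemma mv_fill [simp]: "mv (fill k off e m) = {Vi}" and ma_fill [simp]: "ma (fill k off e m) = {k}"
  by (simp_all add: fill_def)

definition mix :: "nat \<Rightarrow> nat \<Rightarrow> (nat \<Rightarrow> int) \<Rightarrow> (nat \<Rightarrow> int) \<Rightarrow> nat \<Rightarrow> int" where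
  "mix off n f x j = (if off \<le> j \<and> j < off + n then f (j - off) else x j)"

lemma mix_0: "mix off 0 f x = x" by (auto simp: mix_def)

lemma mix_Suc: "mix off (Suc n) f x = (mix off n f x)(off + n := f n)"
  by (auto simp: mix_def fun_eq_iff less_Suc_eq)

text \<open>\<open>mix\<close> describes the partially filled array. The expressions are judged in
  all these intermediate states, because they may read the array that is being overwritten.\<close>

lemma tri_fill:
  assumes k: "k = RAW \<longrightarrow> int (off + n) \<le> lm" and nB: "int n \<le> B" "1 \<le> B"
    and m: "\<And>i. i \<le> n \<Longrightarrow> eok lm me (v(Vi := int i), a(k := mix off i f (a k)))"
      "\<And>i. i \<le> n \<Longrightarrow> aval me (v(Vi := int i), a(k := mix off i f (a k))) = int n"
    and o: "\<And>i. i < n \<Longrightarrow> eok lm oe (v(Vi := int i), a(k := mix off i f (a k)))"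
      "\<And>i. i < n \<Longrightarrow> aval oe (v(Vi := int i), a(k := mix off i f (a k))) = int off"
    and e: "\<And>i. i < n \<Longrightarrow> eok lm e (v(Vi := int i), a(k := mix off i f (a k)))"
      "\<And>i. i < n \<Longrightarrow> aval e (v(Vi := int i), a(k := mix off i f (a k))) = f i"
    and fB: "\<And>i. i < n \<Longrightarrow> \<bar>f i\<bar> \<le> B"
    and Q: "Q (v(Vi := int n), a(k := mix off n f (a k)))"
  shows "tri B lm (fill k oe e me) (v, a) (3 * n + 2) Q"
proof -
  define Inv where "Inv = (\<lambda>i s. s = (v(Vi := int i), a(k := mix off i f (a k))))"
  have 1: "tri B lm (While (V Vi) me (Sto k (oe \<oplus> V Vi) e ;; Vi ::= V Vi \<oplus> N 1)) (v(Vi := 0), a) (3 * n + 1) Q"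
  proof (rule tri_while[where Inv = Inv and n = n and t = "\<lambda>_. 2"])
    show "Inv 0 (v(Vi := 0), a)" by (simp add: Inv_def mix_0)
  next
    fix i s' assume i: "i < n" and "Inv i s'"
    then have s': "s' = (v(Vi := int i), a(k := mix off i f (a k)))" by (simp add: Inv_def)
    have "tri B lm (Sto k (oe \<oplus> V Vi) e ;; Vi ::= V Vi \<oplus> N 1) s' 2 (Inv (Suc i))"
      unfolding s'
    proof (rule tri_seq[where Ta = 1 and Tb = 1], rule tri_sto)
      show "idx_ok lm k (aval (oe \<oplus> V Vi) (v(Vi := int i), a(k := mix off i f (a k))))"
        using i k o(2)[OF i] by (auto simp: idx_ok_def)
      show "tri B lm (Vi ::= V Vi \<oplus> N 1) (v(Vi := int i), upd k (nat (aval (oe \<oplus> V Vi) (v(Vi := int i), a(k := mix off i f (a k)))))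
             (aval e (v(Vi := int i), a(k := mix off i f (a k)))) (a(k := mix off i f (a k)))) 1 (Inv (Suc i))"
        by (rule tri_assign) (use i nB o(2)[OF i] e(2)[OF i] in
          \<open>auto simp: Inv_def upd_def mix_Suc nat_add_distrib add.commute\<close>)
    qed (use o[OF i] e[OF i] fB[OF i] in auto)
    then show "eok lm (V Vi) s' \<and> eok lm me s' \<and> aval (V Vi) s' < aval me s' \<and>
      tri B lm (Sto k (oe \<oplus> V Vi) e ;; Vi ::= V Vi \<oplus> N 1) s' 2 (Inv (Suc i))"
      using i m(1,2)[of i] by (simp add: s')
  next
    fix s' assume "Inv n s'"
    then have s': "s' = (v(Vi := int n), a(k := mix off n f (a k)))" by (simp add: Inv_def)
    show "eok lm (V Vi) s' \<and> eok lm me s' \<and> \<not> aval (V Vi) s' < aval me s' \<and> Q s'"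
      using m(1,2)[of n] Q by (simp add: s')
  qed simp
  show ?thesis unfolding fill_def
    by (rule tri_seq[where Ta = 1 and Tb = "3 * n + 1"], rule tri_assign) (use 1 nB in auto)
qed

text \<open>A butterfly needs both old entries of a pair, so the new values are collected in
  \<open>BR\<close> and \<open>BI\<close> and copied back only when all of them are known.\<close>

definition level :: "arr \<Rightarrow> arr \<Rightarrow> exp \<Rightarrow> exp \<Rightarrow> com" where
  "level x y e e' = fill BR (N 0) e (V VN) ;; fill BI (N 0) e' (V VN) ;;
     fill x (N 0) (Ld BR (V Vi)) (V VN) ;; fill y (N 0) (Ld BI (V Vi)) (V VN)"

lemma mv_level [simp]: "mv (level x y e e') = {Vi}" and ma_level [simp]: "ma (level x y e e') = {BR, BI, x, y}"
  by (auto simp: level_def)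

lemma tri_level:
  assumes xy: "x \<noteq> y" "x \<notin> {BR, BI, RAW}" "y \<notin> {BR, BI, RAW}" and n: "v VN = int n" "int n \<le> B" "1 \<le> B"
    and e: "\<And>i a'. i < n \<Longrightarrow> (\<And>k. k \<notin> {BR, BI} \<Longrightarrow> a' k = a k) \<Longrightarrow> eok lm e (v(Vi := int i), a') \<and> aval e (v(Vi := int i), a') = f i"
    and e': "\<And>i a'. i < n \<Longrightarrow> (\<And>k. k \<notin> {BR, BI} \<Longrightarrow> a' k = a k) \<Longrightarrow> eok lm e' (v(Vi := int i), a') \<and> aval e' (v(Vi := int i), a') = f' i"
    and f: "\<And>i. i < n \<Longrightarrow> \<bar>f i\<bar> \<le> B" "\<And>i. i < n \<Longrightarrow> \<bar>f' i\<bar> \<le> B"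
  shows "tri B lm (level x y e e') (v, a) (12 * n + 8) (\<lambda>(v', a'). \<forall>i<n. a' x i = f i \<and> a' y i = f' i)"
proof -
  define a1 where "a1 = a(BR := mix 0 n f (a BR))"
  define a2 where "a2 = a1(BI := mix 0 n f' (a1 BI))"
  define a3 where "a3 = a2(x := mix 0 n (a2 BR) (a2 x))"
  define a4 where "a4 = a3(y := mix 0 n (a3 BI) (a3 y))"
  define w where "w = v(Vi := int n)"
  have w: "w(Vi := i) = v(Vi := i)" for i by (simp add: w_def)
  have wN: "w VN = int n" using n by (simp add: w_def)
  have b: "a2 BR i = f i" "a2 BI i = f' i" "a3 BI i = f' i" if "i < n" for i
    using xy that by (auto simp: a3_def a2_def a1_def mix_def)
  let ?Q = "\<lambda>(v', a'). \<forall>i<n. a' x i = f i \<and> a' y i = f' i"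
  have 4: "tri B lm (fill y (N 0) (Ld BI (V Vi)) (V VN)) (w, a3) (3 * n + 2) ?Q"
  proof (rule tri_fill[where f = "a3 BI" and n = n and off = 0])
    show "?Q (w(Vi := int n), a3(y := mix 0 n (a3 BI) (a3 y)))"
      using xy b by (auto simp: mix_def a3_def)
  qed (use n wN xy b f in \<open>auto simp: idx_ok_def w_def\<close>)
  have 3: "tri B lm (fill x (N 0) (Ld BR (V Vi)) (V VN)) (w, a2) (3 * n + 2)
     (\<lambda>s. tri B lm (fill y (N 0) (Ld BI (V Vi)) (V VN)) s (3 * n + 2) ?Q)"
  proof (rule tri_fill[where f = "a2 BR" and n = n and off = 0])
    show "tri B lm (fill y (N 0) (Ld BI (V Vi)) (V VN)) (w(Vi := int n), a2(x := mix 0 n (a2 BR) (a2 x))) (3 * n + 2) ?Q"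
      using 4 by (simp add: a3_def w_def)
  qed (use n wN xy b f in \<open>auto simp: idx_ok_def w_def\<close>)
  have 2: "tri B lm (fill BI (N 0) e' (V VN)) (w, a1) (3 * n + 2)
     (\<lambda>s. tri B lm (fill x (N 0) (Ld BR (V Vi)) (V VN) ;; fill y (N 0) (Ld BI (V Vi)) (V VN)) s (6 * n + 4) ?Q)"
  proof (rule tri_fill[where f = f' and n = n and off = 0])
    show "tri B lm (fill x (N 0) (Ld BR (V Vi)) (V VN) ;; fill y (N 0) (Ld BI (V Vi)) (V VN))
      (w(Vi := int n), a1(BI := mix 0 n f' (a1 BI))) (6 * n + 4) ?Q"
      by (rule tri_seq[where Ta = "3 * n + 2" and Tb = "3 * n + 2"]) (use 3 in \<open>auto simp: a2_def w_def\<close>)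
  next
    fix i assume i: "i < n"
    show "eok lm e' (w(Vi := int i), a1(BI := mix 0 i f' (a1 BI)))"
      "aval e' (w(Vi := int i), a1(BI := mix 0 i f' (a1 BI))) = f' i"
      unfolding w using e'[OF i, of "a1(BI := mix 0 i f' (a1 BI))"] by (auto simp: a1_def)
  qed (use n wN f in \<open>auto simp: w_def\<close>)
  have 1: "tri B lm (fill BR (N 0) e (V VN)) (v, a) (3 * n + 2)
     (\<lambda>s. tri B lm (fill BI (N 0) e' (V VN) ;; fill x (N 0) (Ld BR (V Vi)) (V VN) ;; fill y (N 0) (Ld BI (V Vi)) (V VN)) s (9 * n + 6) ?Q)"
  proof (rule tri_fill[where f = f and n = n and off = 0])
    show "tri B lm (fill BI (N 0) e' (V VN) ;; fill x (N 0) (Ld BR (V Vi)) (V VN) ;; fill y (N 0) (Ld BI (V Vi)) (V VN))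
      (v(Vi := int n), a(BR := mix 0 n f (a BR))) (9 * n + 6) ?Q"
      by (rule tri_seq[where Ta = "3 * n + 2" and Tb = "6 * n + 4"]) (use 2 in \<open>auto simp: a1_def w_def\<close>)
  next
    fix i assume i: "i < n"
    show "eok lm e (v(Vi := int i), a(BR := mix 0 i f (a BR)))"
      "aval e (v(Vi := int i), a(BR := mix 0 i f (a BR))) = f i"
      using e[OF i, of "a(BR := mix 0 i f (a BR))"] by auto
  qed (use n f in auto)
  show ?thesis unfolding level_def
    by (rule tri_seq[where Ta = "3 * n + 2" and Tb = "9 * n + 6"]) (use 1 in auto)
qed

subsection \<open>Convolution\<close>

definition loE :: exp where "loE = V Vi \<oslash> (N 2 \<otimes> V Vh) \<otimes> (N 2 \<otimes> V Vh) \<oplus> V Vi \<odot> V Vh"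
definition hiE :: exp where "hiE = V Vi \<oslash> V Vh \<odot> N 2"
definition tE :: exp where "tE = V Vi \<oslash> (N 2 \<otimes> V Vh)"

lemma index_exps:
  assumes "fst s Vi = int i" "fst s Vh = int m"
  shows "aval loE s = int (lo m i)" "aval hiE s = int (hi m i)" "aval tE s = int (i div (2 * m))"
    "eok lm loE s" "eok lm hiE s" "eok lm tE s"
  using assms by (simp_all add: loE_def hiE_def tE_def lo_def hi_def zdiv_int zmod_int)

definition fftR :: "arr \<Rightarrow> arr \<Rightarrow> exp" where
  "fftR x y = Ld x loE \<oplus> (N 1 \<ominus> N 2 \<otimes> hiE) \<otimes>
     ((Ld GR tE \<otimes> Ld x (loE \<oplus> V Vh) \<ominus> Ld GI tE \<otimes> Ld y (loE \<oplus> V Vh)) \<oslash> V Vs)"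

definition fftI :: "arr \<Rightarrow> arr \<Rightarrow> exp" where
  "fftI x y = Ld y loE \<oplus> (N 1 \<ominus> N 2 \<otimes> hiE) \<otimes>
     ((Ld GR tE \<otimes> Ld y (loE \<oplus> V Vh) \<oplus> Ld GI tE \<otimes> Ld x (loE \<oplus> V Vh)) \<oslash> V Vs)"

definition ifftR :: "arr \<Rightarrow> arr \<Rightarrow> exp" where
  "ifftR x y = (N 1 \<ominus> hiE) \<otimes> (Ld x loE \<oplus> Ld x (loE \<oplus> V Vh)) \<oplus> hiE \<otimes>
     (((Ld x loE \<ominus> Ld x (loE \<oplus> V Vh)) \<otimes> Ld GR tE \<oplus> (Ld y loE \<ominus> Ld y (loE \<oplus> V Vh)) \<otimes> Ld GI tE) \<oslash> V Vs)"

definition ifftI :: "arr \<Rightarrow> arr \<Rightarrow> exp" where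
  "ifftI x y = (N 1 \<ominus> hiE) \<otimes> (Ld y loE \<oplus> Ld y (loE \<oplus> V Vh)) \<oplus> hiE \<otimes>
     (((Ld y loE \<ominus> Ld y (loE \<oplus> V Vh)) \<otimes> Ld GR tE \<ominus> (Ld x loE \<ominus> Ld x (loE \<oplus> V Vh)) \<otimes> Ld GI tE) \<oslash> V Vs)"

lemma fft_exps:
  assumes "fst s Vi = int i" "fst s Vh = int m" "x \<noteq> RAW" "y \<noteq> RAW"
  shows "aval (fftR x y) s = fR (fst s Vs) m (snd s GR) (snd s GI) (snd s x) (snd s y) i"
    "aval (fftI x y) s = fI (fst s Vs) m (snd s GR) (snd s GI) (snd s x) (snd s y) i"
    "aval (ifftR x y) s = iR (fst s Vs) m (snd s GR) (snd s GI) (snd s x) (snd s y) i"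
    "aval (ifftI x y) s = iI (fst s Vs) m (snd s GR) (snd s GI) (snd s x) (snd s y) i"
    "eok lm (fftR x y) s" "eok lm (fftI x y) s" "eok lm (ifftR x y) s" "eok lm (ifftI x y) s"
proof -
  have *: "nat (int p + int q) = p + q" for p q by (simp add: nat_add_distrib)
  note [simp] = index_exps[OF assms(1,2)] * idx_ok_def
  show "aval (fftR x y) s = fR (fst s Vs) m (snd s GR) (snd s GI) (snd s x) (snd s y) i"
    "aval (fftI x y) s = fI (fst s Vs) m (snd s GR) (snd s GI) (snd s x) (snd s y) i"
    "aval (ifftR x y) s = iR (fst s Vs) m (snd s GR) (snd s GI) (snd s x) (snd s y) i"
    "aval (ifftI x y) s = iI (fst s Vs) m (snd s GR) (snd s GI) (snd s x) (snd s y) i"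
    "eok lm (fftR x y) s" "eok lm (fftI x y) s" "eok lm (ifftR x y) s" "eok lm (ifftI x y) s"
    unfolding fftR_def fftI_def ifftR_def ifftI_def fR_def fI_def iR_def iI_def
    using assms by simp_all
qed

definition fft :: "arr \<Rightarrow> arr \<Rightarrow> com" where
  "fft x y = Vh ::= V VN ;; While (N 1) (V Vh) (Vh ::= V Vh \<oslash> N 2 ;; level x y (fftR x y) (fftI x y))"

definition ifft :: "arr \<Rightarrow> arr \<Rightarrow> com" where
  "ifft x y = Vh ::= N 1 ;; While (V Vh) (V VN) (level x y (ifftR x y) (ifftI x y) ;; Vh ::= V Vh \<otimes> N 2)"

lemma mv_fft [simp]: "mv (fft x y) = {Vh, Vi}" "mv (ifft x y) = {Vh, Vi}"
  and ma_fft [simp]: "ma (fft x y) = {BR, BI, x, y}" "ma (ifft x y) = {BR, BI, x, y}"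
  by (auto simp: fft_def ifft_def)

lemma T_power_bounds:
  assumes "8 \<le> T" "int T ^ 35 \<le> B"
  shows "int T \<le> B" "1 \<le> B"
proof -
  have "int T \<le> int T ^ 35" using assms(1) by (intro self_le_power) auto
  then show "int T \<le> B" using assms(2) by linarith
  then show "1 \<le> B" using assms(1) by linarith
qed

text \<open>The origin of the exponent 35: exact values up to \<open>T ^ 2\<close> plus an error of
  at most 1 are below \<open>T ^ 3\<close>, and the scale contributes \<open>T ^ 32\<close>.\<close>

lemma apx_int_bound:
  assumes "apx (T ^ 32) d n x y e" "\<And>i. cmod (e i) \<le> real T ^ 2" "d \<le> 1" "i < n" "8 \<le> T" "int T ^ 35 \<le> B"
  shows "\<bar>x i\<bar> \<le> B" "\<bar>y i\<bar> \<le> B"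
proof -
  have T32: "0 < real (T ^ 32)" using assms(5) by simp
  have "cmod (zc (T ^ 32) (x i) (y i) - e i) \<le> d" using assms(1,4) by (simp add: apx_def)
  note b = zc_int_bound[OF T32 this assms(2)]
  have "real T ^ 2 + d \<le> real T ^ 3"
  proof -
    have "8 * real T ^ 2 \<le> real T * real T ^ 2" using assms(5) by (intro mult_right_mono) auto
    moreover have "1 \<le> real T ^ 2" using assms(5) by simp
    ultimately show ?thesis using assms(3) by (simp add: power3_eq_cube power2_eq_square)
  qed
  then have "real (T ^ 32) * (real T ^ 2 + d) \<le> real (T ^ 32) * real T ^ 3" by (intro mult_left_mono) auto
  also have "\<dots> = real_of_int (int T ^ 35)" by (simp add: power_add[symmetric])
  finally have c: "real (T ^ 32) * (real T ^ 2 + d) \<le> real_of_int (int T ^ 35)" .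
  have "real_of_int \<bar>x i\<bar> \<le> real_of_int (int T ^ 35)" "real_of_int \<bar>y i\<bar> \<le> real_of_int (int T ^ 35)"
    using order_trans[OF b(1) c] order_trans[OF b(2) c] by simp_all
  then show "\<bar>x i\<bar> \<le> B" "\<bar>y i\<bar> \<le> B" using assms(6) by (simp_all only: of_int_le_iff)
qed

text \<open>After \<open>l\<close> passes the blocks have length \<open>2 ^ (h - l)\<close>. That
  the new entries fit into \<open>B\<close> is concluded from their accuracy, through
  \<open>apx_int_bound\<close>, and not by tracing the integer arithmetic.\<close>

lemma tri_fft:
  assumes xy: "x \<noteq> y" "x \<notin> {BR, BI, RAW, GR, GI}" "y \<notin> {BR, BI, RAW, GR, GI}"
    and n: "v VN = int n" "n = 2 ^ h" "n \<le> T" and S: "v Vs = int (T ^ 32)"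
    and tab: "table_ok T (a GR) (a GI)" and B: "int T ^ 35 \<le> B"
    and c: "\<And>i. cmod (c i) \<le> 1" and x: "apx (T ^ 32) 0 n (a x) (a y) c"
  shows "tri B lm (fft x y) (v, a) (22 * n * h + 2) (\<lambda>(v', a'). apx (T ^ 32) (eF T h) n (a' x) (a' y) (ex c 1 n))"
proof -
  have T: "8 \<le> T" using tab by (simp add: table_ok_def)
  note B' = T_power_bounds[OF T B]
  have nB: "int n \<le> B" using n(3) B' by linarith
  let ?body = "Vh ::= V Vh \<oslash> N 2 ;; level x y (fftR x y) (fftI x y)"
  define Inv where "Inv = (\<lambda>l s. fst s Vh = int (2 ^ (h - l)) \<and>
     apx (T ^ 32) (eF T l) n (snd s x) (snd s y) (ex c (2 ^ (h - l)) (2 ^ l)))"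
  have "tri B lm (While (N 1) (V Vh) ?body) (v(Vh := int n), a) (22 * n * h + 1)
    (\<lambda>(v', a'). apx (T ^ 32) (eF T h) n (a' x) (a' y) (ex c 1 n))"
  proof (rule tri_while[where Inv = Inv and n = h and t = "\<lambda>_. 12 * n + 9"])
    have "apx (T ^ 32) (eF T 0) n (a x) (a y) (ex c n 1)"
      using x unfolding apx_def by (simp add: ex_one[simplified] eF_def)
    then show "Inv 0 (v(Vh := int n), a)" by (simp add: Inv_def n(2))
  next
    fix l s' assume l: "l < h" and I: "Inv l s'" and F: "fr ?body (v(Vh := int n), a) s'"
    obtain v' a' where s': "s' = (v', a')" by (cases s')
    define m :: nat where "m = 2 ^ (h - Suc l)"
    have hl: "2 ^ (h - l) = 2 * m" using l by (simp add: m_def power_Suc[symmetric] Suc_diff_Suc del: power_Suc)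
    have m0: "0 < m" by (simp add: m_def)
    have v': "v' Vh = int (2 * m)" and ax: "apx (T ^ 32) (eF T l) n (a' x) (a' y) (ex c (2 * m) (2 ^ l))"
      using I unfolding Inv_def s' hl by auto
    have vN: "v' VN = int n" "v' Vs = int (T ^ 32)" using F n S unfolding s' by (auto simp: fr_def)
    have g: "a' GR = a GR" "a' GI = a GI" using F xy unfolding s' by (auto simp: fr_def)
    have mq: "2 * m * 2 ^ l = n"
      unfolding n(2) hl[symmetric] using l by (simp add: power_add[symmetric])
    let ?fR = "fR (int (T ^ 32)) m (a GR) (a GI) (a' x) (a' y)" and ?fI = "fI (int (T ^ 32)) m (a GR) (a GI) (a' x) (a' y)"
    have new: "apx (T ^ 32) (eF T (Suc l)) n ?fR ?fI (ex c m (2 * 2 ^ l))"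
      by (rule forward_level[OF tab n(2,3) refl mq c ax])
    have cb: "cmod (ex c m (2 * 2 ^ l) i) \<le> real T ^ 2" for i
    proof -
      have "cmod (ex c m (2 * 2 ^ l) i) \<le> real (2 * 2 ^ l) * 1" by (rule norm_ex[OF c])
      also have "2 * 2 ^ l \<le> n" using m0 unfolding mq[symmetric] by simp
      then have "real (2 * 2 ^ l) * 1 \<le> real T" using n(3) by linarith
      also have "real T \<le> real T ^ 2" using T by (intro self_le_power) auto
      finally show ?thesis .
    qed
    have eb: "eF T (Suc l) \<le> 1"
    proof -
      have "eF T (Suc l) \<le> 1 / real T ^ 9" by (rule eF_bounds(2)[OF T _ Suc_leI[OF l]]) (use n in simp)
      then show ?thesis using recip_small[OF T, of 9] by simp
    qed
    have bd: "\<bar>?fR i\<bar> \<le> B" "\<bar>?fI i\<bar> \<le> B" if "i < n" for i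
      using apx_int_bound[OF new cb eb that T B] by auto
    have lev: "tri B lm (level x y (fftR x y) (fftI x y)) (v'(Vh := int m), a') (12 * n + 8)
      (\<lambda>(w, b). \<forall>i<n. b x i = ?fR i \<and> b y i = ?fI i)"
    proof (rule tri_level)
      fix i b assume i: "i < n" and b: "\<And>k. k \<notin> {BR, BI} \<Longrightarrow> b k = a' k"
      show "eok lm (fftR x y) ((v'(Vh := int m))(Vi := int i), b) \<and> aval (fftR x y) ((v'(Vh := int m))(Vi := int i), b) = ?fR i"
        "eok lm (fftI x y) ((v'(Vh := int m))(Vi := int i), b) \<and> aval (fftI x y) ((v'(Vh := int m))(Vi := int i), b) = ?fI i"
        using fft_exps(1,2)[of "((v'(Vh := int m))(Vi := int i), b)" i m x y]
          fft_exps(5,6)[of "((v'(Vh := int m))(Vi := int i), b)" i m x y lm] xy b g vN by auto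
    qed (use xy vN nB B' bd in auto)
    have "tri B lm ?body (v', a') (12 * n + 9) (Inv (Suc l))"
    proof (rule tri_seq[where Ta = 1 and Tb = "12 * n + 8"], rule tri_assign)
      have vm: "aval (V Vh \<oslash> N 2) (v', a') = int m" using v' by simp
      show "tri B lm (level x y (fftR x y) (fftI x y)) (v'(Vh := aval (V Vh \<oslash> N 2) (v', a')), a') (12 * n + 8) (Inv (Suc l))"
        unfolding vm
      proof (rule tri_conseq[OF lev])
        fix s'' assume F': "fr (level x y (fftR x y) (fftI x y)) (v'(Vh := int m), a') s''"
          and Q: "case s'' of (w, b) \<Rightarrow> \<forall>i<n. b x i = ?fR i \<and> b y i = ?fI i"
        have "fst s'' Vh = int m" using F' by (auto simp: fr_def)
        moreover have "apx (T ^ 32) (eF T (Suc l)) n (snd s'' x) (snd s'' y) (ex c m (2 ^ Suc l))"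
          using new Q by (auto simp: apx_def)
        ultimately show "Inv (Suc l) s''" by (simp add: Inv_def m_def)
      qed simp
      have "m \<le> n" using mq by (metis le_add1 mult.commute mult_2 mult_le_mono nat_mult_1_right one_le_numeral one_le_power order_trans)
      then show "\<bar>aval (V Vh \<oslash> N 2) (v', a')\<bar> \<le> B" unfolding vm using nB by linarith
    qed auto
    then show "eok lm (N 1) s' \<and> eok lm (V Vh) s' \<and> aval (N 1) s' < aval (V Vh) s' \<and> tri B lm ?body s' (12 * n + 9) (Inv (Suc l))"
      unfolding s' using v' m0 by simp
  next
    fix s' assume I: "Inv h s'"
    then show "eok lm (N 1) s' \<and> eok lm (V Vh) s' \<and> \<not> aval (N 1) s' < aval (V Vh) s' \<and>
      (case s' of (v', a') \<Rightarrow> apx (T ^ 32) (eF T h) n (a' x) (a' y) (ex c 1 n))"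
      by (auto simp: Inv_def n(2))
  next
    have "1 \<le> n" using n(2) by simp
    then have "12 * n + 9 + 1 \<le> 22 * n" by linarith
    then have "h * (12 * n + 9 + 1) \<le> h * (22 * n)" by (rule mult_le_mono2)
    then show "(\<Sum>i<h. 12 * n + 9 + 1) + 1 \<le> 22 * n * h + 1" by (simp add: mult.commute mult.left_commute)
  qed
  then show ?thesis unfolding fft_def
    by (intro tri_seq[where Ta = 1 and Tb = "22 * n * h + 1"] tri_assign) (use n nB in auto)
qed

text \<open>After \<open>l\<close> passes \<open>2 ^ l\<close> is both the block length and the
  factor that the unnormalised steps have accumulated.\<close>

lemma tri_ifft:
  assumes xy: "x \<noteq> y" "x \<notin> {BR, BI, RAW, GR, GI}" "y \<notin> {BR, BI, RAW, GR, GI}"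
    and n: "v VN = int n" "n = 2 ^ h" "n \<le> T" and S: "v Vs = int (T ^ 32)"
    and tab: "table_ok T (a GR) (a GI)" and B: "int T ^ 35 \<le> B"
    and c: "\<And>i. cmod (c i) \<le> real n" and x: "apx (T ^ 32) (eI T 0) n (a x) (a y) (\<lambda>i. of_nat 1 * ex c 1 n i)"
  shows "tri B lm (ifft x y) (v, a) (22 * n * h + 2)
    (\<lambda>(v', a'). apx (T ^ 32) (eI T h) n (a' x) (a' y) (\<lambda>i. of_nat n * ex c n 1 i))"
proof -
  have T: "8 \<le> T" using tab by (simp add: table_ok_def)
  note B' = T_power_bounds[OF T B]
  have nB: "int n \<le> B" using n(3) B' by linarith
  let ?body = "level x y (ifftR x y) (ifftI x y) ;; Vh ::= V Vh \<otimes> N 2"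
  define Inv where "Inv = (\<lambda>l s. fst s Vh = int (2 ^ l) \<and>
     apx (T ^ 32) (eI T l) n (snd s x) (snd s y) (\<lambda>i. of_nat (2 ^ l) * ex c (2 ^ l) (2 ^ (h - l)) i))"
  have "tri B lm (While (V Vh) (V VN) ?body) (v(Vh := 1), a) (22 * n * h + 1)
    (\<lambda>(v', a'). apx (T ^ 32) (eI T h) n (a' x) (a' y) (\<lambda>i. of_nat n * ex c n 1 i))"
  proof (rule tri_while[where Inv = Inv and n = h and t = "\<lambda>_. 12 * n + 9"])
    show "Inv 0 (v(Vh := 1), a)" using x by (simp add: Inv_def n(2))
  next
    fix l s' assume l: "l < h" and I: "Inv l s'" and F: "fr ?body (v(Vh := 1), a) s'"
    obtain v' a' where s': "s' = (v', a')" by (cases s')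
    define m :: nat where "m = 2 ^ l"
    define q :: nat where "q = 2 ^ (h - Suc l)"
    have hl: "2 ^ (h - l) = 2 * q" using l by (simp add: q_def power_Suc[symmetric] Suc_diff_Suc del: power_Suc)
    have m0: "0 < m" "0 < q" by (simp_all add: m_def q_def)
    have v': "v' Vh = int m" and ax: "apx (T ^ 32) (eI T l) n (a' x) (a' y) (\<lambda>i. of_nat m * ex c m (2 * q) i)"
      using I unfolding Inv_def s' hl m_def by auto
    have vN: "v' VN = int n" "v' Vs = int (T ^ 32)" using F n S unfolding s' by (auto simp: fr_def)
    have g: "a' GR = a GR" "a' GI = a GI" using F xy unfolding s' by (auto simp: fr_def)
    have mq: "2 * m * q = n"
    proof -
      have "2 * m * q = 2 ^ l * 2 ^ (h - l)" unfolding hl by (simp add: m_def)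
      also have "\<dots> = n" unfolding n(2) using l by (simp add: power_add[symmetric])
      finally show ?thesis .
    qed
    let ?fR = "iR (int (T ^ 32)) m (a GR) (a GI) (a' x) (a' y)" and ?fI = "iI (int (T ^ 32)) m (a GR) (a GI) (a' x) (a' y)"
    have new: "apx (T ^ 32) (eI T (Suc l)) n ?fR ?fI (\<lambda>i. of_nat (2 * m) * ex c (2 * m) q i)"
      by (rule inverse_level[OF tab n(2,3) m_def mq c ax])
    have cb: "cmod (of_nat (2 * m) * ex c (2 * m) q i) \<le> real T ^ 2" for i
    proof -
      have "cmod (ex c (2 * m) q i) \<le> real q * real n" by (rule norm_ex[OF c])
      then have "real (2 * m) * cmod (ex c (2 * m) q i) \<le> real (2 * m) * (real q * real n)"
        by (intro mult_left_mono) auto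
      also have "\<dots> = real (2 * m * q) * real n" by simp
      also have "\<dots> = real n * real n" unfolding mq ..
      also have "\<dots> \<le> real T ^ 2" unfolding power2_eq_square using n(3) by (intro mult_mono) auto
      finally show ?thesis by (simp add: norm_mult)
    qed
    have eb: "eI T (Suc l) \<le> 1"
    proof -
      have "eI T (Suc l) \<le> 1 / 4" by (rule eI_bounds(2)[OF T _ Suc_leI[OF l]]) (use n in simp)
      then show ?thesis by simp
    qed
    have bd: "\<bar>?fR i\<bar> \<le> B" "\<bar>?fI i\<bar> \<le> B" if "i < n" for i
      using apx_int_bound[OF new cb eb that T B] by auto
    have lev: "tri B lm (level x y (ifftR x y) (ifftI x y)) (v', a') (12 * n + 8)
      (\<lambda>(w, b). \<forall>i<n. b x i = ?fR i \<and> b y i = ?fI i)"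
    proof (rule tri_level)
      fix i b assume i: "i < n" and b: "\<And>k. k \<notin> {BR, BI} \<Longrightarrow> b k = a' k"
      show "eok lm (ifftR x y) (v'(Vi := int i), b) \<and> aval (ifftR x y) (v'(Vi := int i), b) = ?fR i"
        "eok lm (ifftI x y) (v'(Vi := int i), b) \<and> aval (ifftI x y) (v'(Vi := int i), b) = ?fI i"
        using fft_exps(3,4)[of "(v'(Vi := int i), b)" i m x y]
          fft_exps(7,8)[of "(v'(Vi := int i), b)" i m x y lm] xy b g vN v' by auto
    qed (use xy vN nB B' bd in auto)
    have m2: "2 * m \<le> n" using m0 unfolding mq[symmetric] by simp
    have "tri B lm ?body (v', a') (12 * n + 9) (Inv (Suc l))"
    proof (rule tri_seq[where Ta = "12 * n + 8" and Tb = 1], rule tri_conseq[OF lev])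
      fix s'' assume F': "fr (level x y (ifftR x y) (ifftI x y)) (v', a') s''"
        and Q: "case s'' of (w, b) \<Rightarrow> \<forall>i<n. b x i = ?fR i \<and> b y i = ?fI i"
      obtain w b where s'': "s'' = (w, b)" by (cases s'')
      have w: "w Vh = int m" using F' v' unfolding s'' by (auto simp: fr_def)
      have b: "apx (T ^ 32) (eI T (Suc l)) n (b x) (b y) (\<lambda>i. of_nat (2 * m) * ex c (2 * m) q i)"
        using new Q unfolding s'' by (auto simp: apx_def)
      show "tri B lm (Vh ::= V Vh \<otimes> N 2) s'' 1 (Inv (Suc l))" unfolding s''
      proof (rule tri_assign)
        show "Inv (Suc l) (w(Vh := aval (V Vh \<otimes> N 2) (w, b)), b)"
          using b w by (simp add: Inv_def m_def q_def mult.commute)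
        show "\<bar>aval (V Vh \<otimes> N 2) (w, b)\<bar> \<le> B" using m2 nB w by simp
      qed simp
    qed auto
    moreover have "m < n" using m2 m0 by linarith
    ultimately show "eok lm (V Vh) s' \<and> eok lm (V VN) s' \<and> aval (V Vh) s' < aval (V VN) s' \<and>
      tri B lm ?body s' (12 * n + 9) (Inv (Suc l))"
      unfolding s' using v' vN by simp
  next
    fix s' assume I: "Inv h s'" and F: "fr ?body (v(Vh := 1), a) s'"
    have "fst s' VN = int n" using F n by (auto simp: fr_def)
    then show "eok lm (V Vh) s' \<and> eok lm (V VN) s' \<and> \<not> aval (V Vh) s' < aval (V VN) s' \<and>
      (case s' of (v', a') \<Rightarrow> apx (T ^ 32) (eI T h) n (a' x) (a' y) (\<lambda>i. of_nat n * ex c n 1 i))"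
      using I by (auto simp: Inv_def n(2))
  next
    have "1 \<le> n" using n(2) by simp
    then have "12 * n + 9 + 1 \<le> 22 * n" by linarith
    then have "h * (12 * n + 9 + 1) \<le> h * (22 * n)" by (rule mult_le_mono2)
    then show "(\<Sum>i<h. 12 * n + 9 + 1) + 1 \<le> 22 * n * h + 1" by (simp add: mult.commute mult.left_commute)
  qed
  then show ?thesis unfolding ifft_def
    by (intro tri_seq[where Ta = 1 and Tb = "22 * n * h + 1"] tri_assign) (use n B' in auto)
qed

lemma tri_seqI:
  assumes "tri B lm c s Ta P" "\<And>s'. fr c s s' \<Longrightarrow> P s' \<Longrightarrow> tri B lm c' s' Tb Q" "Ta + Tb \<le> T"
  shows "tri B lm (c ;; c') s T Q"
  by (rule tri_seq[OF tri_conseq[OF assms(1)] assms(3)]) (use assms(2) in auto)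

text \<open>Inputs are scaled by \<open>Vs\<close> to fixed point. The last fill divides by
  \<open>Vs\<close> and by the factor \<open>VN\<close> left by \<open>ifft\<close>, rounds, and
  reduces the count to an indicator by \<open>nz\<close>, so that the result can be convolved
  again.\<close>

definition conv :: com where
  "conv = fill XR (N 0) (Ld XR (V Vi) \<otimes> V Vs) (V VN) ;; fill XI (N 0) (N 0) (V VN) ;;
     fill YR (N 0) (Ld YR (V Vi) \<otimes> V Vs) (V VN) ;; fill YI (N 0) (N 0) (V VN) ;;
     fft XR XI ;; fft YR YI ;;
     level XR XI ((Ld XR (V Vi) \<otimes> Ld YR (V Vi) \<ominus> Ld XI (V Vi) \<otimes> Ld YI (V Vi)) \<oslash> V Vs)
       ((Ld XR (V Vi) \<otimes> Ld YI (V Vi) \<oplus> Ld XI (V Vi) \<otimes> Ld YR (V Vi)) \<oslash> V Vs) ;;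
     ifft XR XI ;;
     fill XR (N 0) (nz ((N 2 \<otimes> Ld XR (V Vi) \<oplus> V Vs \<otimes> V VN) \<oslash> (N 2 \<otimes> V Vs \<otimes> V VN))) (V VN)"

lemma mv_conv [simp]: "mv conv = {Vi, Vh}" and ma_conv [simp]: "ma conv = {XR, XI, YR, YI, BR, BI}"
  by (auto simp: conv_def)

lemma tri_conv:
  assumes n: "v VN = int n" "n = 2 ^ h" "n \<le> T" and S: "v Vs = int (T ^ 32)"
    and tab: "table_ok T (a GR) (a GI)" and B: "int T ^ 35 \<le> B"
    and x01: "\<And>i. i < n \<Longrightarrow> a XR i \<in> {0, 1}" and y01: "\<And>i. i < n \<Longrightarrow> a YR i \<in> {0, 1}"
  shows "tri B lm conv (v, a) (66 * n * (h + 1)) (\<lambda>(v', a'). \<forall>i<n. a' XR i =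
    (if \<exists>j<n. \<exists>k<n. a XR j = 1 \<and> a YR k = 1 \<and> (j + k) mod n = i then 1 else 0))"
proof -
  have T: "8 \<le> T" using tab by (simp add: table_ok_def)
  note B' = T_power_bounds[OF T B]
  have nB: "int n \<le> B" using n(3) B' by linarith
  have n0: "0 < n" using n by simp
  \<comment> \<open>Cells from \<open>n\<close> on hold leftovers; cutting them off gives sequences
    bounded at every index, as the transform lemmas demand.\<close>
  define x where "x i = (if i < n then a XR i else 0)" for i
  define y where "y i = (if i < n then a YR i else 0)" for i
  have xy: "x i \<in> {0, 1}" "y i \<in> {0, 1}" for i using x01 y01 by (auto simp: x_def y_def)
  define cx :: "nat \<Rightarrow> complex" where "cx i = of_int (x i)" for i
  define cy :: "nat \<Rightarrow> complex" where "cy i = of_int (y i)" for i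
  have c1: "cmod (cx i) \<le> 1" "cmod (cy i) \<le> 1" for i using xy[of i] by (auto simp: cx_def cy_def)
  define C where "C = cyc n x y"
  define cC :: "nat \<Rightarrow> complex" where "cC = cyc n cx cy"
  have CC: "cC i = of_int (C i)" for i unfolding cC_def C_def of_int_cyc cx_def cy_def ..
  have Cb: "0 \<le> C i" "C i \<le> int n" "C i \<noteq> 0 \<longleftrightarrow> (\<exists>j<n. \<exists>k<n. x j = 1 \<and> y k = 1 \<and> (j + k) mod n = i)" for i
    unfolding C_def using cyc_01[of x y n i, OF xy] by auto
  have cCn: "cmod (cC i) \<le> real n" for i using Cb(1,2)[of i] unfolding CC by simp
  have T32: "0 < T ^ 32" "0 < int (T ^ 32)" using T by auto
  have SB: "int (T ^ 32) \<le> B"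
  proof -
    have "int T ^ 32 \<le> int T ^ 35" using T by (intro power_increasing) auto
    then show ?thesis using B by simp
  qed
  let ?Q = "\<lambda>(v', a'). \<forall>i<n. a' XR i = (if \<exists>j<n. \<exists>k<n. a XR j = 1 \<and> a YR k = 1 \<and> (j + k) mod n = i then 1 else 0)"
  define ok where "ok = (\<lambda>s :: st. fst s VN = int n \<and> fst s Vs = int (T ^ 32) \<and> table_ok T (snd s GR) (snd s GI))"
  \<comment> \<open>Final segments of \<open>conv\<close> are treated first, so that each preceding
    command can use their triples as its postcondition.\<close>
  have last: "tri B lm (fill XR (N 0) (nz ((N 2 \<otimes> Ld XR (V Vi) \<oplus> V Vs \<otimes> V VN) \<oslash> (N 2 \<otimes> V Vs \<otimes> V VN))) (V VN)) (w, b) (3 * n + 2) ?Q"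
    if o: "ok (w, b)" and ap: "apx (T ^ 32) (eI T h) n (b XR) (b XI) (\<lambda>i. of_nat n * ex cC n 1 i)" for w b
  proof (rule tri_fill[where f = "\<lambda>i. if C i = 0 then 0 else 1" and n = n and off = 0])
    have w: "w VN = int n" "w Vs = int (T ^ 32)" using o by (auto simp: ok_def)
    show "?Q (w(Vi := int n), b(XR := mix 0 n (\<lambda>i. if C i = 0 then 0 else 1) (b XR)))"
    proof -
      have "C i \<noteq> 0 \<longleftrightarrow> (\<exists>j<n. \<exists>k<n. a XR j = 1 \<and> a YR k = 1 \<and> (j + k) mod n = i)" for i
        unfolding Cb(3) x_def y_def by auto
      then show ?thesis by (auto simp: mix_def)
    qed
    fix i assume i: "i < n"
    have "cmod (zc (T ^ 32) (b XR i) (b XI i) - of_nat n * of_int (C i)) \<le> eI T h"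
      using ap i unfolding apx_def by (simp add: ex_one[simplified] CC)
    moreover have "eI T h \<le> 1 / 4" by (rule eI_bounds(2)[OF T, of h]) (use n in auto)
    moreover have "\<bar>Re (zc (T ^ 32) (b XR i) (b XI i) - of_nat n * of_int (C i))\<bar> \<le> cmod (zc (T ^ 32) (b XR i) (b XI i) - of_nat n * of_int (C i))"
      by (rule abs_Re_le_cmod)
    ultimately have "\<bar>Re (zc (T ^ 32) (b XR i) (b XI i) - of_nat n * of_int (C i))\<bar> \<le> 1 / 4" by linarith
    then have "\<bar>real_of_int (b XR i) / real_of_int (int (T ^ 32)) - real_of_int (int n * C i)\<bar> \<le> 1 / 4"
      by (simp add: zc_def)
    from round_quotient[OF T32(2) _ this] have "(2 * b XR i + int (T ^ 32) * int n) div (2 * int (T ^ 32) * int n) = C i"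
      using n0 by simp
    then show "aval (nz ((N 2 \<otimes> Ld XR (V Vi) \<oplus> V Vs \<otimes> V VN) \<oslash> (N 2 \<otimes> V Vs \<otimes> V VN)))
        (w(Vi := int i), b(XR := mix 0 i (\<lambda>i. if C i = 0 then 0 else 1) (b XR))) = (if C i = 0 then 0 else 1)"
      using w by (simp add: mix_def)
  qed (use o nB B' in \<open>auto simp: ok_def idx_ok_def\<close>)
  have inv: "tri B lm (ifft XR XI ;; fill XR (N 0) (nz ((N 2 \<otimes> Ld XR (V Vi) \<oplus> V Vs \<otimes> V VN) \<oslash> (N 2 \<otimes> V Vs \<otimes> V VN))) (V VN)) (w, b) (22 * n * h + 2 + (3 * n + 2)) ?Q"
    if o: "ok (w, b)" and ap: "apx (T ^ 32) (eI T 0) n (b XR) (b XI) (\<lambda>i. of_nat 1 * ex cC 1 n i)" for w b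
  proof (rule tri_seqI[OF tri_ifft])
    fix s' assume F: "fr (ifft XR XI) (w, b) s'"
      and P: "case s' of (v', a') \<Rightarrow> apx (T ^ 32) (eI T h) n (a' XR) (a' XI) (\<lambda>i. of_nat n * ex cC n 1 i)"
    obtain w' b' where s': "s' = (w', b')" by (cases s')
    have "ok (w', b')" using F o unfolding s' by (auto simp: fr_def ok_def)
    then show "tri B lm (fill XR (N 0) (nz ((N 2 \<otimes> Ld XR (V Vi) \<oplus> V Vs \<otimes> V VN) \<oslash> (N 2 \<otimes> V Vs \<otimes> V VN))) (V VN)) s' (3 * n + 2) ?Q"
      using last P unfolding s' by simp
  qed (use o ap n B cCn in \<open>auto simp: ok_def\<close>)
  let ?pR = "(Ld XR (V Vi) \<otimes> Ld YR (V Vi) \<ominus> Ld XI (V Vi) \<otimes> Ld YI (V Vi)) \<oslash> V Vs"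
  let ?pI = "(Ld XR (V Vi) \<otimes> Ld YI (V Vi) \<oplus> Ld XI (V Vi) \<otimes> Ld YR (V Vi)) \<oslash> V Vs"
  let ?c3 = "ifft XR XI ;; fill XR (N 0) (nz ((N 2 \<otimes> Ld XR (V Vi) \<oplus> V Vs \<otimes> V VN) \<oslash> (N 2 \<otimes> V Vs \<otimes> V VN))) (V VN)"
  have prod: "tri B lm (level XR XI ?pR ?pI ;; ?c3) (w, b) (12 * n + 8 + (22 * n * h + 2 + (3 * n + 2))) ?Q"
    if o: "ok (w, b)" and ax: "apx (T ^ 32) (eF T h) n (b XR) (b XI) (ex cx 1 n)"
      and ay: "apx (T ^ 32) (eF T h) n (b YR) (b YI) (ex cy 1 n)" for w b
  proof -
    let ?f = "\<lambda>i. (b XR i * b YR i - b XI i * b YI i) div int (T ^ 32)"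
    let ?f' = "\<lambda>i. (b XR i * b YI i + b XI i * b YR i) div int (T ^ 32)"
    have ap: "apx (T ^ 32) (eI T 0) n ?f ?f' (\<lambda>i. of_nat 1 * ex cC 1 n i)"
      unfolding cC_def by (rule product_level[OF T n(2,3) c1 ax ay])
    have nn: "cmod (of_nat 1 * ex cC 1 n i) \<le> real T ^ 2" for i
    proof -
      have "cmod (ex cC 1 n i) \<le> real n * real n" by (rule norm_ex[OF cCn])
      also have "\<dots> \<le> real T ^ 2" unfolding power2_eq_square using n(3) by (intro mult_mono) auto
      finally show ?thesis by simp
    qed
    have e1: "eI T 0 \<le> 1" using eI_bounds(2)[OF T, of h 0] n by simp
    have w: "w VN = int n" "w Vs = int (T ^ 32)" using o by (auto simp: ok_def)
    have lev: "tri B lm (level XR XI ?pR ?pI) (w, b) (12 * n + 8) (\<lambda>(v', a'). \<forall>i<n. a' XR i = ?f i \<and> a' XI i = ?f' i)"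
      by (rule tri_level) (use w nB B' apx_int_bound[OF ap nn e1 _ T B] in \<open>auto simp: idx_ok_def\<close>)
    show ?thesis
    proof (rule tri_seqI[OF lev])
      fix s' assume F: "fr (level XR XI ?pR ?pI) (w, b) s'"
        and P: "case s' of (v', a') \<Rightarrow> \<forall>i<n. a' XR i = ?f i \<and> a' XI i = ?f' i"
      obtain w' b' where s': "s' = (w', b')" by (cases s')
      have "ok (w', b')" using F o unfolding s' by (auto simp: fr_def ok_def)
      moreover have "apx (T ^ 32) (eI T 0) n (b' XR) (b' XI) (\<lambda>i. of_nat 1 * ex cC 1 n i)"
        using ap P unfolding s' apx_def by auto
      ultimately show "tri B lm ?c3 s' (22 * n * h + 2 + (3 * n + 2)) ?Q" using inv unfolding s' by blast
    qed simp
  qed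
  let ?c4 = "level XR XI ?pR ?pI ;; ?c3"
  have fy: "tri B lm (fft YR YI ;; ?c4) (w, b) (22 * n * h + 2 + (12 * n + 8 + (22 * n * h + 2 + (3 * n + 2)))) ?Q"
    if o: "ok (w, b)" and ax: "apx (T ^ 32) (eF T h) n (b XR) (b XI) (ex cx 1 n)"
      and ay: "apx (T ^ 32) 0 n (b YR) (b YI) cy" for w b
  proof (rule tri_seqI[OF tri_fft])
    fix s' assume F: "fr (fft YR YI) (w, b) s'"
      and P: "case s' of (v', a') \<Rightarrow> apx (T ^ 32) (eF T h) n (a' YR) (a' YI) (ex cy 1 n)"
    obtain w' b' where s': "s' = (w', b')" by (cases s')
    have "ok (w', b')" "b' XR = b XR" "b' XI = b XI" using F o unfolding s' by (auto simp: fr_def ok_def)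
    then show "tri B lm ?c4 s' (12 * n + 8 + (22 * n * h + 2 + (3 * n + 2))) ?Q"
      using prod P ax unfolding s' by simp
  qed (use o ay n B c1 in \<open>auto simp: ok_def\<close>)
  let ?c5 = "fft YR YI ;; ?c4"
  have fx: "tri B lm (fft XR XI ;; ?c5) (w, b) (22 * n * h + 2 + (22 * n * h + 2 + (12 * n + 8 + (22 * n * h + 2 + (3 * n + 2))))) ?Q"
    if o: "ok (w, b)" and ax: "apx (T ^ 32) 0 n (b XR) (b XI) cx"
      and ay: "apx (T ^ 32) 0 n (b YR) (b YI) cy" for w b
  proof (rule tri_seqI[OF tri_fft])
    fix s' assume F: "fr (fft XR XI) (w, b) s'"
      and P: "case s' of (v', a') \<Rightarrow> apx (T ^ 32) (eF T h) n (a' XR) (a' XI) (ex cx 1 n)"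
    obtain w' b' where s': "s' = (w', b')" by (cases s')
    have "ok (w', b')" "b' YR = b YR" "b' YI = b YI" using F o unfolding s' by (auto simp: fr_def ok_def)
    then show "tri B lm ?c5 s' (22 * n * h + 2 + (12 * n + 8 + (22 * n * h + 2 + (3 * n + 2)))) ?Q"
      using fy P ay unfolding s' by simp
  qed (use o ax n B c1 in \<open>auto simp: ok_def\<close>)
  let ?c6 = "fft XR XI ;; ?c5"
  define T6 where "T6 = 22 * n * h + 2 + (22 * n * h + 2 + (12 * n + 8 + (22 * n * h + 2 + (3 * n + 2))))"
  define f1 where "f1 i = x i * int (T ^ 32)" for i
  define f2 where "f2 i = y i * int (T ^ 32)" for i
  have fb: "\<bar>f1 i\<bar> \<le> B" "\<bar>f2 i\<bar> \<le> B" for i using xy[of i] SB B' by (auto simp: f1_def f2_def)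
  have fe: "a XR i * int T ^ 32 = f1 i" "a YR i * int T ^ 32 = f2 i" if "i < n" for i
    using that by (simp_all add: f1_def f2_def x_def y_def)
  define a1 where "a1 = a(XR := mix 0 n f1 (a XR))"
  define a2 where "a2 = a1(XI := mix 0 n (\<lambda>_. 0) (a1 XI))"
  define a3 where "a3 = a2(YR := mix 0 n f2 (a2 YR))"
  define a4 where "a4 = a3(YI := mix 0 n (\<lambda>_. 0) (a3 YI))"
  define w where "w = v(Vi := int n)"
  have ww: "w VN = int n" "w Vs = int (T ^ 32)" "w(Vi := int n) = w" using n S by (auto simp: w_def)
  have p6: "tri B lm ?c6 (w, a4) T6 ?Q" unfolding T6_def
  proof (rule fx)
    show "ok (w, a4)" using ww tab by (simp add: ok_def a4_def a3_def a2_def a1_def)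
    show "apx (T ^ 32) 0 n (a4 XR) (a4 XI) cx" "apx (T ^ 32) 0 n (a4 YR) (a4 YI) cy" using T32
      by (auto simp: apx_def a4_def a3_def a2_def a1_def mix_def zc_def f1_def f2_def cx_def cy_def complex_eq_iff)
  qed
  have p5: "tri B lm (fill YI (N 0) (N 0) (V VN) ;; ?c6) (w, a3) (3 * n + 2 + T6) ?Q"
    by (rule tri_seq[OF tri_fill[where f = "\<lambda>_. 0" and n = n and off = 0] order_refl])
      (use p6 ww nB B' in \<open>auto simp: a4_def\<close>)
  have p4: "tri B lm (fill YR (N 0) (Ld YR (V Vi) \<otimes> V Vs) (V VN) ;; fill YI (N 0) (N 0) (V VN) ;; ?c6) (w, a2) (3 * n + 2 + (3 * n + 2 + T6)) ?Q"
    by (rule tri_seq[OF tri_fill[where f = f2 and n = n and off = 0] order_refl])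
      (use p5 ww nB B' fb in \<open>auto simp: a3_def a2_def a1_def idx_ok_def mix_def fe\<close>)
  have p3: "tri B lm (fill XI (N 0) (N 0) (V VN) ;; fill YR (N 0) (Ld YR (V Vi) \<otimes> V Vs) (V VN) ;; fill YI (N 0) (N 0) (V VN) ;; ?c6) (w, a1) (3 * n + 2 + (3 * n + 2 + (3 * n + 2 + T6))) ?Q"
    by (rule tri_seq[OF tri_fill[where f = "\<lambda>_. 0" and n = n and off = 0] order_refl])
      (use p4 ww nB B' in \<open>auto simp: a2_def\<close>)
  have p2: "tri B lm conv (v, a) (3 * n + 2 + (3 * n + 2 + (3 * n + 2 + (3 * n + 2 + T6)))) ?Q"
    unfolding conv_def
    by (rule tri_seq[OF tri_fill[where f = f1 and n = n and off = 0] order_refl])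
      (use p3 n S nB B' fb in \<open>auto simp: a1_def w_def idx_ok_def mix_def fe\<close>)
  \<comment> \<open>The three transforms cost \<open>66 * n * h\<close>; all linear passes together,
    \<open>27 * n + 24\<close>, are within \<open>66 * n\<close>.\<close>
  show ?thesis
    by (rule tri_conseq[OF p2]) (use n0 in \<open>auto simp: T6_def algebra_simps\<close>)
qed

subsection \<open>Doubling loops and integer square roots\<close>

text \<open>The binary logarithm rounded up, with value 0 at 0.\<close>

definition cl :: "nat \<Rightarrow> nat" where "cl e = (LEAST h. e \<le> 2 ^ h)"

lemma cl_ge: "e \<le> 2 ^ cl e"
  unfolding cl_def by (rule LeastI[of _ e]) (simp add: less_imp_le less_exp)

lemma cl_less: "l < cl e \<Longrightarrow> 2 ^ l < e"
  unfolding cl_def using not_less_Least not_le by blast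

lemma cl_le: "e \<le> 2 ^ h \<Longrightarrow> cl e \<le> h"
  unfolding cl_def by (rule Least_le)

lemma cl_upper: "1 \<le> e \<Longrightarrow> 2 ^ cl e < 2 * e"
  using cl_less[of "cl e - 1" e] by (cases "cl e") auto

definition dbl :: "var \<Rightarrow> exp \<Rightarrow> com" where
  "dbl x e = x ::= N 1 ;; While (V x) e (x ::= V x \<otimes> N 2)"

lemma mv_dbl [simp]: "mv (dbl x e) = {x}" and ma_dbl [simp]: "ma (dbl x e) = {}"
  by (simp_all add: dbl_def)

lemma tri_dbl:
  assumes e: "\<And>w. eok lm e (v(x := w), a)" "\<And>w. aval e (v(x := w), a) = int E"
    and E: "1 \<le> B" "2 * int E \<le> B" and Q: "Q (v(x := int (2 ^ cl E)), a)"
  shows "tri B lm (dbl x e) (v, a) (2 * cl E + 2) Q"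
proof -
  define Inv where "Inv = (\<lambda>l s. s = (v(x := int (2 ^ l)), a))"
  have "tri B lm (While (V x) e (x ::= V x \<otimes> N 2)) (v(x := 1), a) (2 * cl E + 1) Q"
  proof (rule tri_while[where Inv = Inv and n = "cl E" and t = "\<lambda>_. 1"])
    fix l s' assume l: "l < cl E" and "Inv l s'"
    then have s': "s' = (v(x := int (2 ^ l)), a)" by (simp add: Inv_def)
    have le: "int (2 ^ l) < int E" using cl_less[OF l] by (simp only: of_nat_less_iff)
    have le2: "int (2 ^ l) * 2 \<le> B" using le E(2) by linarith
    have "tri B lm (x ::= V x \<otimes> N 2) s' 1 (Inv (Suc l))" unfolding s'
      by (rule tri_assign) (use le2 in \<open>auto simp: Inv_def mult.commute\<close>)
    then show "eok lm (V x) s' \<and> eok lm e s' \<and> aval (V x) s' < aval e s' \<and> tri B lm (x ::= V x \<otimes> N 2) s' 1 (Inv (Suc l))"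
      unfolding s' using le e by simp
  next
    fix s' assume "Inv (cl E) s'"
    then have s': "s' = (v(x := int (2 ^ cl E)), a)" by (simp add: Inv_def)
    have "int E \<le> int (2 ^ cl E)" using cl_ge[of E] by (simp only: of_nat_le_iff)
    then show "eok lm (V x) s' \<and> eok lm e s' \<and> \<not> aval (V x) s' < aval e s' \<and> Q s'"
      unfolding s' using e Q by simp
  qed (auto simp: Inv_def)
  then show ?thesis unfolding dbl_def
    by (intro tri_seq[where Ta = 1 and Tb = "2 * cl E + 1"] tri_assign) (use E in auto)
qed

text \<open>The root is found bit by bit from the top: the factor \<open>isz\<close> lets the bit
  \<open>Vt\<close> be added exactly if \<open>(r + t) ^ 2 \<le> X\<close>.\<close>

definition isq :: com where
  "isq = Vr ::= N 0 ;; Vt ::= V Vs ;; While (N 0) (V Vt)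
     (Vr ::= V Vr \<oplus> V Vt \<otimes> isz ((V Vr \<oplus> V Vt) \<otimes> (V Vr \<oplus> V Vt) \<oslash> (V Vx \<oplus> N 1)) ;; Vt ::= V Vt \<oslash> N 2)"

lemma mv_isq [simp]: "mv isq = {Vr, Vt}" and ma_isq [simp]: "ma isq = {}"
  by (auto simp: isq_def)

lemma tri_isq:
  assumes S: "v Vs = 2 ^ p" and X: "v Vx = X" "0 \<le> X" "X \<le> 2 ^ p * 2 ^ p" and B: "2 ^ p \<le> B"
  shows "tri B lm isq (v, a) (3 * p + 6) (\<lambda>(v', a'). 0 \<le> v' Vr \<and> v' Vr * v' Vr \<le> X \<and> X < (v' Vr + 1) * (v' Vr + 1))"
proof -
  let ?b = "Vr ::= V Vr \<oplus> V Vt \<otimes> isz ((V Vr \<oplus> V Vt) \<otimes> (V Vr \<oplus> V Vt) \<oslash> (V Vx \<oplus> N 1)) ;; Vt ::= V Vt \<oslash> N 2"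
  let ?Q = "\<lambda>(v', a'). 0 \<le> v' Vr \<and> v' Vr * v' Vr \<le> X \<and> X < (v' Vr + 1) * (v' Vr + 1)"
  \<comment> \<open>The root is confined to an interval of length \<open>2 ^ (Suc p - i)\<close>.
    After \<open>Suc p\<close> rounds this length is 1, and \<open>1 div 2 = 0\<close> ends the
    loop.\<close>
  define Inv where "Inv = (\<lambda>i (s::st). fst s Vt = 2 ^ (Suc p - i) div 2 \<and> 0 \<le> fst s Vr \<and> fst s Vr * fst s Vr \<le> X \<and>
     X < (fst s Vr + 2 ^ (Suc p - i)) * (fst s Vr + 2 ^ (Suc p - i)))"
  have "tri B lm (While (N 0) (V Vt) ?b) (v(Vr := 0, Vt := 2 ^ p), a) (3 * p + 4) ?Q"
  proof (rule tri_while[where Inv = Inv and n = "Suc p" and t = "\<lambda>_. 2"])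
    have "X < 2 ^ Suc p * 2 ^ Suc p" using X(3) by (simp add: power_add[symmetric])
        (smt (verit) zero_less_power)
    then show "Inv 0 (v(Vr := 0, Vt := 2 ^ p), a)" using X by (simp add: Inv_def)
  next
    fix i s' assume i: "i < Suc p" and I: "Inv i s'" and F: "fr ?b (v(Vr := 0, Vt := 2 ^ p), a) s'"
    obtain w b where s': "s' = (w, b)" by (cases s')
    define t :: int where "t = 2 ^ (p - i)"
    define r where "r = w Vr"
    have pi: "Suc p - i = Suc (p - i)" using i by simp
    have w: "w Vt = t" "w Vr = r" "0 \<le> r" "r * r \<le> X" "X < (r + 2 * t) * (r + 2 * t)"
      using I unfolding Inv_def s' pi t_def r_def by auto
    have wX: "w Vx = X" using F X unfolding s' by (auto simp: fr_def)
    have t0: "0 < t" by (simp add: t_def)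
    define r' where "r' = (if (r + t) * (r + t) \<le> X then r + t else r)"
    have val: "aval (V Vr \<oplus> V Vt \<otimes> isz ((V Vr \<oplus> V Vt) \<otimes> (V Vr \<oplus> V Vt) \<oslash> (V Vx \<oplus> N 1))) (w, b) = r'"
    proof -
      have "0 \<le> (r + t) * (r + t)" by simp
      then have "(r + t) * (r + t) div (X + 1) = 0 \<longleftrightarrow> (r + t) * (r + t) < X + 1"
        using X(2) zdiv_eq_0_iff[of "(r + t) * (r + t)" "X + 1"] by auto
      then show ?thesis using w wX by (auto simp: r'_def)
    qed
    have r': "0 \<le> r'" "r' * r' \<le> X" "X < (r' + t) * (r' + t)"
      using w t0 by (auto simp: r'_def algebra_simps)
    have "r' \<le> 2 ^ p" by (rule floor_sqrt_le[OF r'(1,2) X(3)]) simp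
    then have r'B: "\<bar>r'\<bar> \<le> B" using r'(1) B by simp
    have tB: "\<bar>t div 2\<bar> \<le> B"
    proof -
      have "t \<le> 2 ^ p" unfolding t_def by (intro power_increasing) auto
      then show ?thesis using t0 B by linarith
    qed
    have "tri B lm ?b (w, b) 2 (Inv (Suc i))"
    proof (rule tri_seq[where Ta = 1 and Tb = 1], rule tri_assign)
      show "tri B lm (Vt ::= V Vt \<oslash> N 2) (w(Vr := aval (V Vr \<oplus> V Vt \<otimes> isz ((V Vr \<oplus> V Vt) \<otimes> (V Vr \<oplus> V Vt) \<oslash> (V Vx \<oplus> N 1))) (w, b)), b) 1 (Inv (Suc i))"
        unfolding val by (rule tri_assign) (use w tB r' in \<open>auto simp: Inv_def t_def\<close>)
    qed (use r'B in \<open>simp_all only: val\<close>, auto)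
    then show "eok lm (N 0) s' \<and> eok lm (V Vt) s' \<and> aval (N 0) s' < aval (V Vt) s' \<and> tri B lm ?b s' 2 (Inv (Suc i))"
      unfolding s' using w t0 by simp
  next
    fix s' assume "Inv (Suc p) s'"
    then show "eok lm (N 0) s' \<and> eok lm (V Vt) s' \<and> \<not> aval (N 0) s' < aval (V Vt) s' \<and> ?Q s'"
      by (auto simp: Inv_def)
  qed simp
  moreover have "0 \<le> B" using B zero_le_power[of "2::int" p] by linarith
  ultimately show ?thesis unfolding isq_def
    by (intro tri_seq[where Ta = 1 and Tb = "3 * p + 5"] tri_seq[where Ta = 1 and Tb = "3 * p + 4"] tri_assign)
      (use S B in auto)
qed

section \<open>Construction of the table of roots\<close>

definition tabbody :: com where
  "tabbody = fill GR (V Vk) ((V Vcs \<otimes> Ld GR (V Vi) \<ominus> V Vsn \<otimes> Ld GI (V Vi)) \<oslash> V Vs) (V Vk) ;;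
     fill GI (V Vk) ((V Vcs \<otimes> Ld GI (V Vi) \<oplus> V Vsn \<otimes> Ld GR (V Vi)) \<oslash> V Vs) (V Vk) ;;
     Vx ::= V Vs \<otimes> (V Vs \<ominus> V Vcs) \<oslash> N 2 ;; isq ;; Vsn ::= V Vr ;;
     Vx ::= V Vs \<otimes> (V Vs \<oplus> V Vcs) \<oslash> N 2 ;; isq ;; Vcs ::= V Vr ;; Vk ::= V Vk \<otimes> N 2"

definition mktab :: com where
  "mktab = Sto GR (N 0) (V Vs) ;; Sto GI (N 0) (N 0) ;; Vcs ::= N 0 ;; Vsn ::= V Vs ;; Vk ::= N 1 ;;
     While (V Vk) (V Vtl) tabbody"

lemma mv_tabbody [simp]: "mv tabbody = {Vi, Vx, Vr, Vt, Vsn, Vcs, Vk}" and ma_tabbody [simp]: "ma tabbody = {GR, GI}"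
  by (auto simp: tabbody_def)

lemma mv_mktab [simp]: "mv mktab = {Vi, Vx, Vr, Vt, Vsn, Vcs, Vk}" and ma_mktab [simp]: "ma mktab = {GR, GI}"
  by (auto simp: mktab_def)

lemma T_square: "T ^ 16 * T ^ 16 = (T::nat) ^ 32" by (simp add: power_add[symmetric])

text \<open>\<open>T ^ 64\<close> is the square of the scale, within which the radicands have to
  fit. Two square roots over \<open>32 * L + 1\<close> bits with three steps per bit give the term
  \<open>192 * L\<close>. The sine is taken first because both radicands refer to the old
  cosine.\<close>

lemma tri_tabbody:
  assumes T: "T = 2 ^ L" "8 \<le> T" and k: "k < L" and w: "w = T ^ 16"
    and v: "v Vs = int (T ^ 32)" "v Vk = int (2 ^ k)"
    and ok: "root_ok w k (v Vcs) (v Vsn)" and ap: "apx (T ^ 32) (24 * real k / real w) (2 ^ k) (a GR) (a GI) g"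
    and B: "int T ^ 64 \<le> B"
  shows "tri B lm tabbody (v, a) (6 * 2 ^ k + 192 * L + 21) (\<lambda>(v', a'). v' Vk = int (2 ^ Suc k) \<and>
    root_ok w (Suc k) (v' Vcs) (v' Vsn) \<and> apx (T ^ 32) (24 * real (Suc k) / real w) (2 ^ Suc k) (a' GR) (a' GI) g)"
proof -
  let ?Q = "\<lambda>(v', a'). v' Vk = int (2 ^ Suc k) \<and>
    root_ok w (Suc k) (v' Vcs) (v' Vsn) \<and> apx (T ^ 32) (24 * real (Suc k) / real w) (2 ^ Suc k) (a' GR) (a' GI) g"
  define S where "S = int (T ^ 32)"
  have S2: "S = 2 ^ (32 * L)" unfolding S_def T by (simp add: power_mult[symmetric] mult.commute)
  have ww: "w * w = T ^ 32" unfolding w by (rule T_square)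
  have Sw: "S = int (w * w)" by (simp add: S_def ww)
  have B35: "int T ^ 35 \<le> B"
  proof -
    have "int T ^ 35 \<le> int T ^ 64" using T by (intro power_increasing) auto
    then show ?thesis using B by linarith
  qed
  note B' = T_power_bounds[OF T(2) B35]
  have SS: "S * S \<le> B" using B by (simp add: S_def power_add[symmetric])
  have S1: "1 \<le> S" using T by (simp add: S_def)
  then have SB: "S \<le> B" using SS mult_left_mono[of 1 S S] by linarith
  have kT: "2 ^ Suc k \<le> T" unfolding T(1) using k by (intro power_increasing) auto
  have kB: "int (2 ^ k) \<le> B" "int (2 ^ k) * 2 \<le> B"
  proof -
    have "int (2 ^ Suc k) \<le> int T" using kT by (simp only: of_nat_le_iff)
    then show "int (2 ^ k) * 2 \<le> B" using B'(1) by simp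
    then show "int (2 ^ k) \<le> B" using of_nat_0_le_iff[of "2 ^ k"] by linarith
  qed
  have w2: "2 \<le> w"
  proof -
    have "T \<le> T ^ 16" using T(2) by (intro self_le_power) auto
    then show ?thesis unfolding w using T(2) by linarith
  qed
  have kw: "24 * Suc k \<le> w"
  proof -
    have "Suc k \<le> 2 ^ Suc k" using less_exp[of "Suc k"] by linarith
    then have "Suc k \<le> T" using kT by linarith
    then have "24 * Suc k \<le> 24 * T" by (rule mult_le_mono2)
    also have "\<dots> \<le> 64 * T" by simp
    also have "\<dots> \<le> T * T * T" using T(2) mult_le_mono[OF T(2) T(2)] by (intro mult_le_mono1) auto
    also have "\<dots> = T ^ 3" by (simp add: power3_eq_cube)
    also have "\<dots> \<le> T ^ 16" using T(2) by (intro power_increasing) auto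
    finally show ?thesis unfolding w .
  qed
  have cs: "0 \<le> v Vcs" "v Vcs \<le> S" using ok by (auto simp: root_ok_def Sw)
  define gr where "gr i = (v Vcs * a GR i - v Vsn * a GI i) div S" for i
  define gi where "gi i = (v Vcs * a GI i + v Vsn * a GR i) div S" for i
  define GR' where "GR' = mix (2 ^ k) (2 ^ k) gr (a GR)"
  define GI' where "GI' = mix (2 ^ k) (2 ^ k) gi (a GI)"
  have new: "apx (T ^ 32) (24 * real (Suc k) / real w) (2 ^ Suc k) GR' GI' g"
    using table_step[OF w2 ok _ _ Sw, of "a GR" "a GI" GR' GI'] ap kw
    unfolding ww by (auto simp: GR'_def GI'_def mix_def gr_def gi_def)
  have e1: "24 * real (Suc k) / real w \<le> 1"
  proof -
    have "real (24 * Suc k) \<le> real w" using kw by (simp only: of_nat_le_iff)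
    then show ?thesis using w2 by (simp add: field_simps)
  qed
  have g2: "cmod (g i) \<le> real T ^ 2" for i using T by (simp add: norm_g)
  have bd: "\<bar>gr i\<bar> \<le> B" "\<bar>gi i\<bar> \<le> B" if "i < 2 ^ k" for i
  proof -
    have i: "2 ^ k + i < 2 ^ Suc k" using that by simp
    have "GR' (2 ^ k + i) = gr i" "GI' (2 ^ k + i) = gi i" using that by (auto simp: GR'_def GI'_def mix_def)
    then show "\<bar>gr i\<bar> \<le> B" "\<bar>gi i\<bar> \<le> B" using apx_int_bound[OF new g2 e1 i T(2) B35] by auto
  qed
  define a1 where "a1 = a(GR := GR')"
  define a2 where "a2 = a1(GI := GI')"
  define w0 where "w0 = v(Vi := int (2 ^ k))"
  define X1 where "X1 = S * (S - v Vcs) div 2"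
  define X2 where "X2 = S * (S + v Vcs) div 2"
  have X: "0 \<le> X1" "X1 \<le> S * S" "0 \<le> X2" "X2 \<le> S * S"
  proof -
    have "0 \<le> S * (S - v Vcs)" "0 \<le> S * (S + v Vcs)" using cs S1 by auto
    then show "0 \<le> X1" "0 \<le> X2" by (simp_all add: X1_def X2_def)
    have "S * (S + v Vcs) \<le> S * (2 * S)" "S * (S - v Vcs) \<le> S * (2 * S)"
      using cs S1 by (intro mult_left_mono; linarith)+
    then show "X1 \<le> S * S" "X2 \<le> S * S" unfolding X1_def X2_def by linarith+
  qed
  define p where "p = 32 * L"
  let ?c4 = "Vcs ::= V Vr ;; Vk ::= V Vk \<otimes> N 2"
  have q4: "tri B lm ?c4 (u, a2) 2 ?Q" if u: "u Vk = int (2 ^ k)" "0 \<le> u Vr" "u Vr * u Vr \<le> X2" "X2 < (u Vr + 1) * (u Vr + 1)"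
    "0 \<le> u Vsn" "u Vsn * u Vsn \<le> X1" "X1 < (u Vsn + 1) * (u Vsn + 1)" for u
  proof -
    have "root_ok w (Suc k) (u Vr) (u Vsn)"
      by (rule root_ok_Suc[OF w2 ok Sw]) (use u in \<open>simp_all add: X1_def X2_def\<close>)
    moreover have "u Vr \<le> S" by (rule floor_sqrt_le[OF u(2,3) X(4)]) (use S1 in simp)
    ultimately show ?thesis using u kB SB new
      by (intro tri_seq[where Ta = 1 and Tb = 1] tri_assign) (auto simp: a2_def a1_def)
  qed
  let ?c3 = "isq ;; ?c4"
  have q3: "tri B lm ?c3 (u, a2) (3 * p + 6 + 2) ?Q" if u: "u Vk = int (2 ^ k)" "u Vs = S" "u Vx = X2"
    "0 \<le> u Vsn" "u Vsn * u Vsn \<le> X1" "X1 < (u Vsn + 1) * (u Vsn + 1)" for u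
  proof (rule tri_seqI[OF tri_isq[where p = p and X = X2]])
    fix s' assume F: "fr isq (u, a2) s'"
      and P: "case s' of (v', a') \<Rightarrow> 0 \<le> v' Vr \<and> v' Vr * v' Vr \<le> X2 \<and> X2 < (v' Vr + 1) * (v' Vr + 1)"
    obtain u' b where s': "s' = (u', b)" by (cases s')
    have f: "b = a2" "u' Vk = int (2 ^ k)" "u' Vsn = u Vsn" using F u unfolding s' by (auto simp: fr_def)
    show "tri B lm ?c4 s' 2 ?Q" unfolding s' f(1) by (rule q4) (use P s' f u in auto)
  qed (use u X S2 SB in \<open>auto simp: p_def\<close>)
  let ?c2 = "Vsn ::= V Vr ;; Vx ::= V Vs \<otimes> (V Vs \<oplus> V Vcs) \<oslash> N 2 ;; ?c3"
  have q2: "tri B lm ?c2 (u, a2) (3 * p + 10) ?Q" if u: "u Vk = int (2 ^ k)" "u Vs = S" "u Vcs = v Vcs"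
    "0 \<le> u Vr" "u Vr * u Vr \<le> X1" "X1 < (u Vr + 1) * (u Vr + 1)" for u
  proof -
    have "u Vr \<le> S" by (rule floor_sqrt_le[OF u(4,5) X(2)]) (use S1 in simp)
    have e: "aval (V Vs \<otimes> (V Vs \<oplus> V Vcs) \<oslash> N 2) (u(Vsn := u Vr), a2) = X2" using u by (simp add: X2_def)
    have x2: "\<bar>X2\<bar> \<le> B" using X SS by linarith
    have t: "tri B lm (Vx ::= V Vs \<otimes> (V Vs \<oplus> V Vcs) \<oslash> N 2 ;; ?c3) (u(Vsn := u Vr), a2) (1 + (3 * p + 6 + 2)) ?Q"
    proof (rule tri_seq[OF tri_assign order_refl])
      show "tri B lm ?c3 (u(Vsn := u Vr, Vx := aval (V Vs \<otimes> (V Vs \<oplus> V Vcs) \<oslash> N 2) (u(Vsn := u Vr), a2)), a2) (3 * p + 6 + 2) ?Q"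
        unfolding e by (rule q3) (use u in auto)
      show "\<bar>aval (V Vs \<otimes> (V Vs \<oplus> V Vcs) \<oslash> N 2) (u(Vsn := u Vr), a2)\<bar> \<le> B" unfolding e by (rule x2)
    qed simp
    show ?thesis
      by (rule tri_seq[where Ta = 1 and Tb = "1 + (3 * p + 6 + 2)", OF tri_assign])
        (use t u SB \<open>u Vr \<le> S\<close> in auto)
  qed
  let ?c1 = "Vx ::= V Vs \<otimes> (V Vs \<ominus> V Vcs) \<oslash> N 2 ;; isq ;; ?c2"
  have q1: "tri B lm ?c1 (w0, a2) (1 + (3 * p + 6 + (3 * p + 10))) ?Q"
  proof (rule tri_seq[OF tri_assign order_refl])
    have e: "aval (V Vs \<otimes> (V Vs \<ominus> V Vcs) \<oslash> N 2) (w0, a2) = X1" using v by (simp add: w0_def X1_def S_def)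
    show "\<bar>aval (V Vs \<otimes> (V Vs \<ominus> V Vcs) \<oslash> N 2) (w0, a2)\<bar> \<le> B" unfolding e using X SS by linarith
    let ?u = "w0(Vx := X1)"
    show "tri B lm (isq ;; ?c2) (w0(Vx := aval (V Vs \<otimes> (V Vs \<ominus> V Vcs) \<oslash> N 2) (w0, a2)), a2) (3 * p + 6 + (3 * p + 10)) ?Q"
      unfolding e
    proof (rule tri_seqI[OF tri_isq[where p = p and X = X1]])
      fix s' assume F: "fr isq (?u, a2) s'"
        and P: "case s' of (v', a') \<Rightarrow> 0 \<le> v' Vr \<and> v' Vr * v' Vr \<le> X1 \<and> X1 < (v' Vr + 1) * (v' Vr + 1)"
      obtain u' b where s': "s' = (u', b)" by (cases s')
      have f: "b = a2" "u' Vk = int (2 ^ k)" "u' Vs = S" "u' Vcs = v Vcs"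
        using F v unfolding s' by (auto simp: fr_def w0_def S_def)
      show "tri B lm ?c2 s' (3 * p + 10) ?Q" unfolding s' f(1) by (rule q2) (use P s' f in auto)
    next
      show "?u Vs = 2 ^ p" using v S2 by (simp add: w0_def S_def p_def)
    qed (use X S2 SB in \<open>auto simp: p_def\<close>)
  qed simp
  have qb: "tri B lm (fill GI (V Vk) ((V Vcs \<otimes> Ld GI (V Vi) \<oplus> V Vsn \<otimes> Ld GR (V Vi)) \<oslash> V Vs) (V Vk) ;; ?c1)
     (w0, a1) (3 * 2 ^ k + 2 + (1 + (3 * p + 6 + (3 * p + 10)))) ?Q"
    by (rule tri_seq[OF tri_fill[where f = gi and n = "2 ^ k" and off = "2 ^ k"] order_refl])
      (use q1 v kB B' bd in \<open>auto simp: w0_def a1_def a2_def GR'_def GI'_def gi_def idx_ok_def mix_def S_def\<close>)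
  have qa: "tri B lm tabbody (v, a) (3 * 2 ^ k + 2 + (3 * 2 ^ k + 2 + (1 + (3 * p + 6 + (3 * p + 10))))) ?Q"
    unfolding tabbody_def
    by (rule tri_seq[OF tri_fill[where f = gr and n = "2 ^ k" and off = "2 ^ k"] order_refl])
      (use qb v kB B' bd in \<open>auto simp: w0_def a1_def GR'_def gr_def idx_ok_def mix_def S_def\<close>)
  show ?thesis by (rule tri_conseq[OF qa]) (auto simp: p_def)
qed

lemma tri_mktab:
  assumes T: "T = 2 ^ L" "8 \<le> T" and v: "v Vs = int (T ^ 32)" "v Vtl = int T" and B: "int T ^ 64 \<le> B"
  shows "tri B lm mktab (v, a) (6 * T + L * (192 * L + 22) + 6) (\<lambda>(v', a'). table_ok T (a' GR) (a' GI))"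
proof -
  define w where "w = T ^ 16"
  have ww: "w * w = T ^ 32" unfolding w_def by (rule T_square)
  have w0: "0 < w" using T by (simp add: w_def)
  let ?Q = "\<lambda>(v', a'). table_ok T (a' GR) (a' GI)"
  have B1: "int T ^ 32 \<le> B" "1 \<le> B"
  proof -
    have "int T ^ 32 \<le> int T ^ 64" using T by (intro power_increasing) auto
    then show "int T ^ 32 \<le> B" using B by linarith
    moreover have "1 \<le> int T ^ 32" using T by simp
    ultimately show "1 \<le> B" by linarith
  qed
  define Inv where "Inv = (\<lambda>k (s::st). fst s Vk = int (2 ^ k) \<and> root_ok w k (fst s Vcs) (fst s Vsn) \<and>
     apx (T ^ 32) (24 * real k / real w) (2 ^ k) (snd s GR) (snd s GI) g)"
  let ?a = "upd GI 0 0 (upd GR 0 (int (T ^ 32)) a)"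
  let ?v = "v(Vcs := 0, Vsn := int (T ^ 32), Vk := 1)"
  have loop: "tri B lm (While (V Vk) (V Vtl) tabbody) (?v, ?a) (6 * T + L * (192 * L + 22) + 1) ?Q"
  proof (rule tri_while[where Inv = Inv and n = L and t = "\<lambda>k. 6 * 2 ^ k + 192 * L + 21"])
    show "Inv 0 (?v, ?a)" using root_ok_0[OF w0] T unfolding ww
      by (simp add: Inv_def apx_def upd_def zc_def g_0 complex_eq_iff)
  next
    fix k s' assume k: "k < L" and I: "Inv k s'" and F: "fr tabbody (?v, ?a) s'"
    obtain u b where s': "s' = (u, b)" by (cases s')
    have u: "u Vs = int (T ^ 32)" "u Vtl = int T" using F v unfolding s' by (auto simp: fr_def)
    have uk: "u Vk = int (2 ^ k)" using I unfolding s' Inv_def by simp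
    have "tri B lm tabbody (u, b) (6 * 2 ^ k + 192 * L + 21) (Inv (Suc k))"
      by (rule tri_conseq[OF tri_tabbody[OF T k w_def u(1) uk _ _ B]]) (use I in \<open>auto simp: Inv_def s'\<close>)
    moreover have "int (2 ^ k) < int T" unfolding T(1) of_nat_less_iff using k by (intro power_strict_increasing) auto
    ultimately show "eok lm (V Vk) s' \<and> eok lm (V Vtl) s' \<and> aval (V Vk) s' < aval (V Vtl) s' \<and>
      tri B lm tabbody s' (6 * 2 ^ k + 192 * L + 21) (Inv (Suc k))"
      unfolding s' using u uk by simp
  next
    fix s' assume I: "Inv L s'" and F: "fr tabbody (?v, ?a) s'"
    obtain u b where s': "s' = (u, b)" by (cases s')
    have u: "u Vtl = int T" using F v unfolding s' by (auto simp: fr_def)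
    have ap: "apx (T ^ 32) (24 * real L / real w) T (b GR) (b GI) g" using I unfolding Inv_def s' T(1) by simp
    \<comment> \<open>Divided by \<open>w = T ^ 16\<close>, this gives the accuracy
      \<open>1 / T ^ 13\<close> demanded by \<open>table_ok\<close>.\<close>
    have "24 * L \<le> T ^ 3"
    proof -
      have "L \<le> T" unfolding T(1) using less_exp[of L] by linarith
      then have "24 * L \<le> 64 * T" by linarith
      also have "\<dots> \<le> T * T * T" using T(2) mult_le_mono[OF T(2) T(2)] by (intro mult_le_mono1) auto
      finally show ?thesis by (simp add: power3_eq_cube)
    qed
    then have "real (24 * L) \<le> real (T ^ 3)" by (simp only: of_nat_le_iff)
    then have "24 * real L / real w \<le> real T ^ 3 / real w" by (intro divide_right_mono) auto
    also have "\<dots> = real T ^ 3 * (1 / real T ^ (3 + 13))" by (simp add: w_def)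
    also have "\<dots> = 1 / real T ^ 13" using T(2) by (intro recip_mult) simp
    finally have "table_ok T (b GR) (b GI)" using ap T(2) by (auto simp: table_ok_def intro: apx_mono)
    then show "eok lm (V Vk) s' \<and> eok lm (V Vtl) s' \<and> \<not> aval (V Vk) s' < aval (V Vtl) s' \<and> ?Q s'"
      using I u unfolding Inv_def s' T(1) by simp
  next
    have "(\<Sum>k<L. 6 * 2 ^ k + 192 * L + 21 + 1) = 6 * (\<Sum>k<L. 2 ^ k) + L * (192 * L + 22)"
      by (simp add: sum.distrib sum_distrib_left algebra_simps)
    also have "(\<Sum>k<L. (2::nat) ^ k) \<le> T" unfolding T(1) by (induction L) auto
    finally show "(\<Sum>k<L. 6 * 2 ^ k + 192 * L + 21 + 1) + 1 \<le> 6 * T + L * (192 * L + 22) + 1" by simp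
  qed
  define R where "R = 6 * T + L * (192 * L + 22) + 1"
  have p1: "tri B lm (Vk ::= N 1 ;; While (V Vk) (V Vtl) tabbody) (v(Vcs := 0, Vsn := int (T ^ 32)), ?a) (1 + R) ?Q"
    by (rule tri_seq[OF tri_assign order_refl]) (use loop B1 in \<open>auto simp: R_def\<close>)
  have p2: "tri B lm (Vsn ::= V Vs ;; Vk ::= N 1 ;; While (V Vk) (V Vtl) tabbody) (v(Vcs := 0), ?a) (1 + (1 + R)) ?Q"
    by (rule tri_seq[OF tri_assign order_refl]) (use p1 v B1 in auto)
  have p3: "tri B lm (Vcs ::= N 0 ;; Vsn ::= V Vs ;; Vk ::= N 1 ;; While (V Vk) (V Vtl) tabbody) (v, ?a) (1 + (1 + (1 + R))) ?Q"
    by (rule tri_seq[OF tri_assign order_refl]) (use p2 v B1 in auto)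
  have p4: "tri B lm (Sto GI (N 0) (N 0) ;; Vcs ::= N 0 ;; Vsn ::= V Vs ;; Vk ::= N 1 ;; While (V Vk) (V Vtl) tabbody)
     (v, upd GR 0 (int (T ^ 32)) a) (1 + (1 + (1 + (1 + R)))) ?Q"
    by (rule tri_seq[OF tri_sto order_refl]) (use p3 v B1 in \<open>auto simp: idx_ok_def\<close>)
  have p5: "tri B lm mktab (v, a) (1 + (1 + (1 + (1 + (1 + R))))) ?Q" unfolding mktab_def
    by (rule tri_seq[OF tri_sto order_refl]) (use p4 v B1 in \<open>auto simp: idx_ok_def\<close>)
  show ?thesis by (rule tri_conseq[OF p5]) (auto simp: R_def)
qed

subsection \<open>Sums with cardinalities\<close>

text \<open>If \<open>2 * q < W\<close>, adding the codes \<open>c * W + s\<close> adds the pairs \<open>(c, s)\<close>.\<close>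
definition rs :: "nat \<Rightarrow> nat \<Rightarrow> (nat \<Rightarrow> nat) \<Rightarrow> nat set \<Rightarrow> nat set" where
  "rs W q w I = {card Y * W + sum w Y | Y. Y \<subseteq> I \<and> sum w Y \<le> q}"

lemma rs_less:
  assumes "x \<in> rs W q w I" "q < W" "finite I" "card I \<le> c"
  shows "x < (c + 1) * W"
proof -
  obtain Y where Y: "x = card Y * W + sum w Y" "Y \<subseteq> I" "sum w Y \<le> q" using assms(1) by (auto simp: rs_def)
  have "card Y \<le> c" using card_mono[OF assms(3) Y(2)] assms(4) by linarith
  then have "card Y * W \<le> c * W" by (rule mult_le_mono1)
  moreover have "(c + 1) * W = c * W + W" by simp
  ultimately show ?thesis using Y assms(2) by linarith
qed

text \<open>A subset splits into its parts in \<open>I\<close> and \<open>J\<close>. Both sums are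
  at most \<open>q\<close>, so their total stays below \<open>W\<close>, no carry reaches the count,
  and \<open>mod W\<close> reads off the total for the test.\<close>

lemma rs_union:
  assumes fin: "finite I" "finite J" and disj: "I \<inter> J = {}" and W: "2 * q < W"
  shows "rs W q w (I \<union> J) = {x + y | x y. x \<in> rs W q w I \<and> y \<in> rs W q w J \<and> (x + y) mod W \<le> q}"
proof (intro set_eqI iffI)
  fix z assume "z \<in> rs W q w (I \<union> J)"
  then obtain Y where Y: "z = card Y * W + sum w Y" "Y \<subseteq> I \<union> J" "sum w Y \<le> q" by (auto simp: rs_def)
  let ?Y1 = "Y \<inter> I" and ?Y2 = "Y \<inter> J"
  have f: "finite ?Y1" "finite ?Y2" using fin by auto
  have YY: "Y = ?Y1 \<union> ?Y2" "?Y1 \<inter> ?Y2 = {}" using Y(2) disj by auto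
  have c: "card Y = card ?Y1 + card ?Y2" using card_Un_disjoint[OF f YY(2)] YY(1) by simp
  have s: "sum w Y = sum w ?Y1 + sum w ?Y2" using sum.union_disjoint[OF f YY(2), of w] YY(1) by simp
  have z: "z = (card ?Y1 * W + sum w ?Y1) + (card ?Y2 * W + sum w ?Y2)" unfolding Y(1) c s by (simp add: algebra_simps)
  have "z mod W = sum w Y" using Y(1,3) W by simp
  then have "z mod W \<le> q" using Y(3) by simp
  moreover have "card ?Y1 * W + sum w ?Y1 \<in> rs W q w I" "card ?Y2 * W + sum w ?Y2 \<in> rs W q w J"
    unfolding rs_def using s Y(3) by auto
  ultimately show "z \<in> {x + y | x y. x \<in> rs W q w I \<and> y \<in> rs W q w J \<and> (x + y) mod W \<le> q}" using z by blast
next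
  fix z assume "z \<in> {x + y | x y. x \<in> rs W q w I \<and> y \<in> rs W q w J \<and> (x + y) mod W \<le> q}"
  then obtain Y1 Y2 where Y: "z = (card Y1 * W + sum w Y1) + (card Y2 * W + sum w Y2)" "z mod W \<le> q"
    "Y1 \<subseteq> I" "sum w Y1 \<le> q" "Y2 \<subseteq> J" "sum w Y2 \<le> q" by (auto simp: rs_def)
  have f: "finite Y1" "finite Y2" "Y1 \<inter> Y2 = {}" using Y fin disj finite_subset by blast+
  have c: "card (Y1 \<union> Y2) = card Y1 + card Y2" by (rule card_Un_disjoint[OF f])
  have s: "sum w (Y1 \<union> Y2) = sum w Y1 + sum w Y2" by (rule sum.union_disjoint[OF f])
  have z: "z = card (Y1 \<union> Y2) * W + sum w (Y1 \<union> Y2)" unfolding c s Y(1) by (simp add: algebra_simps)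
  have "sum w (Y1 \<union> Y2) < W" unfolding s using Y W by linarith
  then have "z mod W = sum w (Y1 \<union> Y2)" unfolding z by simp
  then show "z \<in> rs W q w (I \<union> J)" unfolding rs_def using z Y by auto
qed

lemma rs_empty: "rs W q w {} = {0}"
  by (auto simp: rs_def)

lemma rs_singleton: "w i \<le> q \<Longrightarrow> rs W q w {i} = {0, W + w i}"
  by (auto simp: rs_def subset_singleton_iff intro: exI[of _ "{}"] exI[of _ "{i}"])

text \<open>A subset with sum at most \<open>u\<close> has \<open>sum w Y * b \<le> u\<close>, so
  cutting the quotients off at \<open>q = u div b\<close> loses nothing. Codes are below
  \<open>(c + 1) * W\<close>, hence below \<open>2 * c * W\<close> for \<open>c \<ge> 1\<close>; the
  union with \<open>{0}\<close> covers \<open>c = 0\<close>, where the range of codes is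
  empty.\<close>

lemma class_sums:
  fixes ys :: "nat list"
  assumes ys: "distinct ys" "\<And>x. x \<in> set ys \<Longrightarrow> x mod b = l" and b: "0 < b" and q: "q = u div b" and W: "q < W"
    and c: "length ys \<le> c"
  shows "{v. v \<le> u \<and> (\<exists>i < 2 * c * W. i \<in> rs W q (\<lambda>i. ys ! i div b) {..<length ys} \<and> i mod W * b + i div W * l = v)} \<union> {0}
    = {\<Sum>Y | Y. Y \<subseteq> set ys \<and> \<Sum>Y \<le> u}" (is "?L \<union> {0} = ?R")
proof -
  let ?w = "\<lambda>i. ys ! i div b"
  have W0: "0 < W" using W by simp
  have el: "ys ! i = ?w i * b + l" if "i < length ys" for i
    using ys(2)[OF nth_mem[OF that]] div_mult_mod_eq[of "ys ! i" b] by simp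
  have sm: "\<Sum>((!) ys ` Y) = sum ?w Y * b + card Y * l" if "Y \<subseteq> {..<length ys}" for Y
  proof -
    have "inj_on ((!) ys) Y" using ys(1) that by (intro inj_on_nth) auto
    then have "\<Sum>((!) ys ` Y) = (\<Sum>i\<in>Y. ys ! i)" by (simp add: sum.reindex)
    also have "\<dots> = (\<Sum>i\<in>Y. ?w i * b + l)" using that el by (intro sum.cong) auto
    finally show ?thesis by (simp add: sum.distrib sum_distrib_right)
  qed
  have dec: "(card Y * W + sum ?w Y) mod W = sum ?w Y" "(card Y * W + sum ?w Y) div W = card Y"
    if "sum ?w Y \<le> q" for Y using that W by simp_all
  show ?thesis
  proof (intro set_eqI iffI)
    fix v assume "v \<in> ?L \<union> {0}"
    then consider "v = 0" | "v \<in> ?L" by blast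
    then show "v \<in> ?R"
    proof cases
      case 1 then show ?thesis by (auto intro: exI[of _ "{}"])
    next
      case 2
      then obtain i where i: "v \<le> u" "i \<in> rs W q ?w {..<length ys}" "i mod W * b + i div W * l = v" by blast
      then obtain Y where Y: "i = card Y * W + sum ?w Y" "Y \<subseteq> {..<length ys}" "sum ?w Y \<le> q" by (auto simp: rs_def)
      have "v = \<Sum>((!) ys ` Y)" unfolding sm[OF Y(2)] i(3)[symmetric] Y(1) dec[OF Y(3)] ..
      moreover have "(!) ys ` Y \<subseteq> set ys" using Y(2) by auto
      ultimately show ?thesis using i(1) by blast
    qed
  next
    fix v assume "v \<in> ?R"
    then obtain Z where Z: "v = \<Sum>Z" "Z \<subseteq> set ys" "v \<le> u" by blast
    define Y where "Y = {i. i < length ys \<and> ys ! i \<in> Z}"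
    have Y: "Y \<subseteq> {..<length ys}" by (auto simp: Y_def)
    have "x \<in> (!) ys ` Y" if x: "x \<in> Z" for x
    proof -
      obtain i where "i < length ys" "ys ! i = x" using x Z(2) by (meson in_set_conv_nth subsetD)
      then show ?thesis using x by (auto simp: Y_def)
    qed
    then have im: "(!) ys ` Y = Z" by (auto simp: Y_def)
    have v: "v = sum ?w Y * b + card Y * l" using sm[OF Y] im Z(1) by simp
    have "sum ?w Y * b \<le> u" using v Z(3) by simp
    then have s: "sum ?w Y \<le> q" unfolding q using b by (simp add: less_eq_div_iff_mult_less_eq)
    let ?i = "card Y * W + sum ?w Y"
    have r: "?i \<in> rs W q ?w {..<length ys}" using Y s by (auto simp: rs_def)
    have cY: "card Y \<le> length ys" using card_mono[OF _ Y] by simp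
    show "v \<in> ?L \<union> {0}"
    proof (cases "Y = {}")
      case True
      then show ?thesis using v by simp
    next
      case False
      then have "1 \<le> card Y" using finite_subset[OF Y] by (simp add: Suc_le_eq card_gt_0_iff)
      then have c1: "1 \<le> c" using cY c by linarith
      have "?i < (c + 1) * W" using rs_less[OF r W] c by simp
      also have "\<dots> \<le> 2 * c * W" using c1 by (intro mult_le_mono1) simp
      finally have "?i < 2 * c * W" .
      then show ?thesis using r v dec[OF s] Z(3) by auto
    qed
  qed
qed

text \<open>The parts of a subset have sums no larger than the whole, so truncating at
  \<open>u\<close> after each class does no harm.\<close>

lemma sums_union:
  fixes A B :: "nat set"
  assumes "finite A" "finite B" "A \<inter> B = {}"
  shows "{\<Sum>Y | Y. Y \<subseteq> A \<union> B \<and> \<Sum>Y \<le> u} =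
    {x + y | x y. x \<in> {\<Sum>Y | Y. Y \<subseteq> A \<and> \<Sum>Y \<le> u} \<and> y \<in> {\<Sum>Y | Y. Y \<subseteq> B \<and> \<Sum>Y \<le> u} \<and> x + y \<le> u}"
proof (intro set_eqI iffI)
  fix z assume "z \<in> {\<Sum>Y | Y. Y \<subseteq> A \<union> B \<and> \<Sum>Y \<le> u}"
  then obtain Y where Y: "z = \<Sum>Y" "Y \<subseteq> A \<union> B" "z \<le> u" by blast
  have "Y = (Y \<inter> A) \<union> (Y \<inter> B)" using Y(2) by blast
  then have "z = \<Sum>((Y \<inter> A) \<union> (Y \<inter> B))" using Y(1) by simp
  also have "\<dots> = \<Sum>(Y \<inter> A) + \<Sum>(Y \<inter> B)" by (rule sum.union_disjoint) (use assms in auto)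
  finally have z: "z = \<Sum>(Y \<inter> A) + \<Sum>(Y \<inter> B)" .
  then have "\<Sum>(Y \<inter> A) \<le> u" "\<Sum>(Y \<inter> B) \<le> u" using Y(3) by auto
  then show "z \<in> {x + y | x y. x \<in> {\<Sum>Y | Y. Y \<subseteq> A \<and> \<Sum>Y \<le> u} \<and> y \<in> {\<Sum>Y | Y. Y \<subseteq> B \<and> \<Sum>Y \<le> u} \<and> x + y \<le> u}"
    using z Y(3) by blast
next
  fix z assume "z \<in> {x + y | x y. x \<in> {\<Sum>Y | Y. Y \<subseteq> A \<and> \<Sum>Y \<le> u} \<and> y \<in> {\<Sum>Y | Y. Y \<subseteq> B \<and> \<Sum>Y \<le> u} \<and> x + y \<le> u}"
  then obtain X Y where XY: "z = \<Sum>X + \<Sum>Y" "X \<subseteq> A" "Y \<subseteq> B" "z \<le> u" by blast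
  have "\<Sum>(X \<union> Y) = \<Sum>X + \<Sum>Y"
    by (rule sum.union_disjoint) (use XY assms finite_subset in blast)+
  then show "z \<in> {\<Sum>Y | Y. Y \<subseteq> A \<union> B \<and> \<Sum>Y \<le> u}" using XY by (intro CollectI exI[of _ "X \<union> Y"]) auto
qed

section \<open>The merge tree over the positions of a class\<close>

definition blkI :: "nat \<Rightarrow> nat \<Rightarrow> nat \<Rightarrow> nat set" where
  "blkI c j p = {p * 2 ^ j..<(p + 1) * 2 ^ j} \<inter> {..<c}"

lemma blkI_facts: "finite (blkI c j p)" "card (blkI c j p) \<le> 2 ^ j" "blkI c j (2 * p) \<inter> blkI c j (2 * p + 1) = {}"
  "blkI c j (2 * p) \<union> blkI c j (2 * p + 1) = blkI c (Suc j) p"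
proof -
  show "finite (blkI c j p)" by (simp add: blkI_def)
  have "card (blkI c j p) \<le> card {p * 2 ^ j..<(p + 1) * 2 ^ j}" unfolding blkI_def by (intro card_mono) auto
  then show "card (blkI c j p) \<le> 2 ^ j" by simp
  show "blkI c j (2 * p) \<inter> blkI c j (2 * p + 1) = {}" by (auto simp: blkI_def)
  show "blkI c j (2 * p) \<union> blkI c j (2 * p + 1) = blkI c (Suc j) p"
    by (auto simp: blkI_def algebra_simps)
qed

text \<open>The contents of \<open>ZS\<close> after \<open>j\<close> rounds of merging.\<close>
definition zlev :: "nat \<Rightarrow> nat \<Rightarrow> (nat \<Rightarrow> nat) \<Rightarrow> nat \<Rightarrow> nat \<Rightarrow> nat \<Rightarrow> int" where
  "zlev W q w c j i = (if i mod (2 ^ Suc j * W) \<in> rs W q w (blkI c j (i div (2 ^ Suc j * W))) then 1 else 0)"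

lemma zlev_01: "zlev W q w c j i \<in> {0, 1}" by (simp add: zlev_def)

text \<open>A leaf occupies \<open>2 * W\<close> cells and holds at most two codes: 0 for the empty
  set, and \<open>W + w p\<close>, with a count of one, for the element. Positions from
  \<open>c\<close> on are padding and hold only the code 0.\<close>

lemma zlev_0:
  assumes W: "q < W" and w: "\<And>p. p < c \<Longrightarrow> w p \<le> q"
  shows "zlev W q w c 0 i = (if i mod (2 * W) = 0 then 1 else 0) +
    (if i div (2 * W) < c \<and> i mod (2 * W) = W + w (i div (2 * W)) then 1 else 0)"
proof -
  let ?p = "i div (2 * W)"
  have "blkI c 0 ?p = (if ?p < c then {?p} else {})" by (auto simp: blkI_def)
  then show ?thesis using W w[of ?p] by (auto simp: zlev_def rs_empty rs_singleton)
qed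

text \<open>Neighbouring blocks of length \<open>D\<close> merge by a cyclic convolution of length
  \<open>2 * D\<close>. Nothing wraps around, because the codes of \<open>2 ^ j\<close> elements are
  below \<open>(2 ^ j + 1) * W \<le> D\<close>. The test \<open>i mod W \<le> q\<close> discards
  sums that have grown too large.\<close>

lemma zlev_Suc:
  assumes W: "2 * q < W" and D: "D = 2 ^ Suc j * W" and i: "i < 2 * D"
  shows "zlev W q w c (Suc j) (P * (2 * D) + i) =
    (if (\<exists>x<2 * D. \<exists>y<2 * D. (x < D \<and> zlev W q w c j (P * (2 * D) + x) = 1) \<and>
        (y < D \<and> zlev W q w c j (P * (2 * D) + D + y) = 1) \<and> (x + y) mod (2 * D) = i) \<and> i mod W \<le> q then 1 else 0)"
proof -
  have D0: "0 < D" using W D by simp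
  have DS: "2 ^ Suc (Suc j) * W = 2 * D" by (simp add: D)
  have dm: "(P * (2 * D) + x) div D = 2 * P" "(P * (2 * D) + x) mod D = x"
    "(P * (2 * D) + D + x) div D = 2 * P + 1" "(P * (2 * D) + D + x) mod D = x" if "x < D" for x
  proof -
    have e: "P * (2 * D) + x = x + (2 * P) * D" "P * (2 * D) + D + x = x + (2 * P + 1) * D" by (simp_all add: algebra_simps)
    have a: "(x + k * D) div D = k" "(x + k * D) mod D = x" for k using that D0 by simp_all
    show "(P * (2 * D) + x) div D = 2 * P" "(P * (2 * D) + x) mod D = x"
      "(P * (2 * D) + D + x) div D = 2 * P + 1" "(P * (2 * D) + D + x) mod D = x"
      unfolding e by (rule a)+
  qed
  have z: "zlev W q w c j (P * (2 * D) + x) = 1 \<longleftrightarrow> x \<in> rs W q w (blkI c j (2 * P))"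
    "zlev W q w c j (P * (2 * D) + D + x) = 1 \<longleftrightarrow> x \<in> rs W q w (blkI c j (2 * P + 1))" if "x < D" for x
    unfolding zlev_def D[symmetric] using dm[OF that] by auto
  have lt: "x < D" if "x \<in> rs W q w (blkI c j p)" for x p
  proof -
    have "x < (2 ^ j + 1) * W" using rs_less[OF that _ blkI_facts(1,2)] W by simp
    also have "\<dots> \<le> 2 ^ Suc j * W" by (intro mult_le_mono1) simp
    finally show ?thesis by (simp add: D)
  qed
  have dmS: "(P * (2 * D) + i) mod (2 * D) = i" "(P * (2 * D) + i) div (2 * D) = P" using i by simp_all
  have "i \<in> rs W q w (blkI c (Suc j) P) \<longleftrightarrow>
    (\<exists>x y. x \<in> rs W q w (blkI c j (2 * P)) \<and> y \<in> rs W q w (blkI c j (2 * P + 1)) \<and> x + y = i) \<and> i mod W \<le> q"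
    unfolding blkI_facts(4)[symmetric] rs_union[OF blkI_facts(1) blkI_facts(1) blkI_facts(3) W] by auto
  also have "\<dots> \<longleftrightarrow> (\<exists>x<2 * D. \<exists>y<2 * D. (x < D \<and> zlev W q w c j (P * (2 * D) + x) = 1) \<and>
        (y < D \<and> zlev W q w c j (P * (2 * D) + D + y) = 1) \<and> (x + y) mod (2 * D) = i) \<and> i mod W \<le> q" (is "?A \<and> _ \<longleftrightarrow> ?B \<and> _")
  proof -
    have "?A \<longleftrightarrow> ?B"
    proof
      assume ?A
      then obtain x y where xy: "x \<in> rs W q w (blkI c j (2 * P))" "y \<in> rs W q w (blkI c j (2 * P + 1))" "x + y = i" by blast
      have l: "x < D" "y < D" using lt xy by auto
      then have "(x + y) mod (2 * D) = i" using xy(3) by simp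
      moreover have "x < 2 * D" "y < 2 * D" using l by auto
      ultimately show ?B using l xy z[OF l(1)] z[OF l(2)] by blast
    next
      assume ?B
      then obtain x y where xy: "x < D" "zlev W q w c j (P * (2 * D) + x) = 1" "y < D"
        "zlev W q w c j (P * (2 * D) + D + y) = 1" "(x + y) mod (2 * D) = i" by blast
      have "x + y < 2 * D" using xy by linarith
      then have "x + y = i" using xy(5) by simp
      then show ?A using xy z[OF xy(1)] z[OF xy(3)] by blast
    qed
    then show ?thesis by simp
  qed
  finally show ?thesis unfolding zlev_def[of W q w c "Suc j"] DS dmS by simp
qed

subsection \<open>One residue class\<close>

text \<open>The language has no conditional, so every quotient is written to the next free cell, and
  the counter advances only if the element belongs to the class. A wrong entry is overwritten later
  or remains past the end.\<close>

definition clsfilter :: com where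
  "clsfilter = Vcnt ::= N 0 ;; Vi ::= N 0 ;; While (V Vi) (V Vn)
     (Sto QS (V Vcnt) (Ld XS (V Vi) \<oslash> V Vb) ;;
      Vcnt ::= V Vcnt \<oplus> isz (Ld XS (V Vi) \<odot> V Vb \<ominus> V Vcl) ;; Vi ::= V Vi \<oplus> N 1)"

text \<open>Evaluates the right-hand side of \<open>zlev_0\<close>. The comparison
  \<open>p < c\<close> is expressed as \<open>(p + 1) div (c + 1) = 0\<close>.\<close>

definition leafE :: exp where
  "leafE = isz (V Vi \<odot> (N 2 \<otimes> V Vw)) \<oplus> isz ((V Vi \<oslash> (N 2 \<otimes> V Vw) \<oplus> N 1) \<oslash> (V Vcnt \<oplus> N 1)) \<otimes>
     isz (V Vi \<odot> (N 2 \<otimes> V Vw) \<ominus> V Vw \<ominus> Ld QS (V Vi \<oslash> (N 2 \<otimes> V Vw)))"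

text \<open>Both operands are padded with zeros to length \<open>2 * D\<close> by the factor
  \<open>isz (V Vi \<oslash> V Vd)\<close>; the remainder in the index keeps the suppressed loads
  inside the block. The result takes the place of the two operands in \<open>ZS\<close>.\<close>

definition mergebody :: com where
  "mergebody = VN ::= N 2 \<otimes> V Vd ;;
     fill XR (N 0) (Ld ZS (V Vp \<oplus> V Vi \<odot> V Vd) \<otimes> isz (V Vi \<oslash> V Vd)) (V VN) ;;
     fill YR (N 0) (Ld ZS (V Vp \<oplus> V Vd \<oplus> V Vi \<odot> V Vd) \<otimes> isz (V Vi \<oslash> V Vd)) (V VN) ;;
     conv ;;
     fill ZS (V Vp) (Ld XR (V Vi) \<otimes> isz (V Vi \<odot> V Vw \<oslash> (V Vq \<oplus> N 1))) (V VN) ;;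
     Vp ::= V Vp \<oplus> V VN"

definition merges :: com where
  "merges = While (V Vd) (V Ve) (Vp ::= N 0 ;; While (V Vp) (V Ve) mergebody ;; Vd ::= N 2 \<otimes> V Vd)"

lemma mv_clsfilter [simp]: "mv clsfilter = {Vcnt, Vi}" and ma_clsfilter [simp]: "ma clsfilter = {QS}"
  by (auto simp: clsfilter_def)
lemma mv_mergebody [simp]: "mv mergebody = {VN, Vi, Vh, Vp}"
  and ma_mergebody [simp]: "ma mergebody = {XR, YR, XI, YI, BR, BI, ZS}"
  by (auto simp: mergebody_def)
lemma mv_merges [simp]: "mv merges = {VN, Vi, Vh, Vp, Vd}"
  and ma_merges [simp]: "ma merges = {XR, YR, XI, YI, BR, BI, ZS}"
  by (auto simp: merges_def)

lemma tri_clsfilter: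
  assumes v: "v Vn = int (length xs)" "v Vb = int b" "v Vcl = int l"
    and xs: "\<And>i. i < length xs \<Longrightarrow> a XS i = int (xs ! i)" and b: "0 < b"
    and B: "int (length xs) \<le> B" "1 \<le> B" "\<And>x. x \<in> set xs \<Longrightarrow> int x \<le> B"
    and ys: "ys = filter (\<lambda>x. x mod b = l) xs"
  shows "tri B lm clsfilter (v, a) (4 * length xs + 3) (\<lambda>(v', a'). v' Vcnt = int (length ys) \<and>
    (\<forall>i<length ys. a' QS i = int (ys ! i div b)))"
proof -
  let ?Q = "\<lambda>(v', a'). v' Vcnt = int (length ys) \<and> (\<forall>i<length ys. a' QS i = int (ys ! i div b))"
  let ?b1 = "Sto QS (V Vcnt) (Ld XS (V Vi) \<oslash> V Vb)" and ?b2 = "Vcnt ::= V Vcnt \<oplus> isz (Ld XS (V Vi) \<odot> V Vb \<ominus> V Vcl)"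
    and ?b3 = "Vi ::= V Vi \<oplus> N 1"
  let ?n = "length xs"
  define Y where "Y i = filter (\<lambda>x. x mod b = l) (take i xs)" for i
  have YS: "Y (Suc i) = Y i @ (if xs ! i mod b = l then [xs ! i] else [])" if "i < ?n" for i
    using that by (simp add: Y_def take_Suc_conv_app_nth)
  have Ylen: "length (Y i) \<le> i" for i unfolding Y_def by (rule le_trans[OF length_filter_le]) simp
  define Inv where "Inv = (\<lambda>i (s::st). fst s Vi = int i \<and> fst s Vcnt = int (length (Y i)) \<and>
     (\<forall>j<length (Y i). snd s QS j = int (Y i ! j div b)))"
  have loop: "tri B lm (While (V Vi) (V Vn) (?b1 ;; ?b2 ;; ?b3)) (v(Vcnt := 0, Vi := 0), a) (4 * ?n + 1) ?Q"
  proof (rule tri_while[where Inv = Inv and n = ?n and t = "\<lambda>_. 3"])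
    show "Inv 0 (v(Vcnt := 0, Vi := 0), a)" by (simp add: Inv_def Y_def)
  next
    fix i s' assume i: "i < ?n" and I: "Inv i s'" and F: "fr (?b1 ;; ?b2 ;; ?b3) (v(Vcnt := 0, Vi := 0), a) s'"
    obtain u d where s': "s' = (u, d)" by (cases s')
    have u: "u Vn = int ?n" "u Vb = int b" "u Vcl = int l" "d XS = a XS" using F v unfolding s' by (auto simp: fr_def)
    have I': "u Vi = int i" "u Vcnt = int (length (Y i))" "\<And>j. j < length (Y i) \<Longrightarrow> d QS j = int (Y i ! j div b)"
      using I unfolding Inv_def s' by auto
    let ?x = "xs ! i"
    have x: "d XS i = int ?x" using xs[OF i] u by simp
    have xB: "int ?x \<le> B" using B(3) i by simp
    have "int (?x div b) \<le> B" using xB by (meson div_le_dividend of_nat_le_iff order_trans)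
    then have dB: "\<bar>int ?x div int b\<bar> \<le> B" by (simp add: zdiv_int[symmetric])
    have YB: "int (length (Y i)) + 1 \<le> B" using Ylen[of i] i B(1) by linarith
    define d' where "d' = upd QS (length (Y i)) (int (?x div b)) d"
    define u' where "u' = u(Vcnt := int (length (Y (Suc i))))"
    have 3: "tri B lm ?b3 (u', d') 1 (Inv (Suc i))"
    proof (rule tri_assign)
      show "Inv (Suc i) (u'(Vi := aval (V Vi \<oplus> N 1) (u', d')), d')"
        using I' unfolding Inv_def u'_def d'_def upd_def YS[OF i] by (auto simp: nth_append less_Suc_eq)
    qed (use I' i B in \<open>auto simp: u'_def\<close>)
    have "aval (V Vcnt \<oplus> isz (Ld XS (V Vi) \<odot> V Vb \<ominus> V Vcl)) (u, d') = int (length (Y (Suc i)))"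
    proof -
      have "d' XS i = int ?x" using x by (simp add: d'_def upd_def)
      moreover have "int ?x mod int b = int l \<longleftrightarrow> ?x mod b = l" by (simp flip: of_nat_mod)
      ultimately show ?thesis using I' u unfolding YS[OF i] by auto
    qed
    then have 2: "tri B lm (?b2 ;; ?b3) (u, d') (1 + 1) (Inv (Suc i))"
      by (intro tri_seq[OF tri_assign order_refl])
        (use 3 I' Ylen[of "Suc i"] i B in \<open>auto simp: u'_def idx_ok_def\<close>)
    have "tri B lm (?b1 ;; ?b2 ;; ?b3) (u, d) (1 + (1 + 1)) (Inv (Suc i))"
      by (rule tri_seq[OF tri_sto order_refl])
        (use 2 I' u x dB in \<open>auto simp: d'_def idx_ok_def zdiv_int\<close>)
    then show "eok lm (V Vi) s' \<and> eok lm (V Vn) s' \<and> aval (V Vi) s' < aval (V Vn) s' \<and>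
      tri B lm (?b1 ;; ?b2 ;; ?b3) s' 3 (Inv (Suc i))" unfolding s' using u I' i by (simp add: numeral_3_eq_3)
  next
    fix s' assume I: "Inv ?n s'" and F: "fr (?b1 ;; ?b2 ;; ?b3) (v(Vcnt := 0, Vi := 0), a) s'"
    have "fst s' Vn = int ?n" using F v by (auto simp: fr_def)
    moreover have "Y ?n = ys" by (simp add: Y_def ys)
    ultimately show "eok lm (V Vi) s' \<and> eok lm (V Vn) s' \<and> \<not> aval (V Vi) s' < aval (V Vn) s' \<and> ?Q s'"
      using I by (auto simp: Inv_def)
  qed simp
  have t: "tri B lm (Vi ::= N 0 ;; While (V Vi) (V Vn) (?b1 ;; ?b2 ;; ?b3)) (v(Vcnt := 0), a) (1 + (4 * ?n + 1)) ?Q"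
    by (rule tri_seq[OF tri_assign order_refl]) (use loop B in auto)
  have "tri B lm clsfilter (v, a) (1 + (1 + (4 * ?n + 1))) ?Q" unfolding clsfilter_def
    by (rule tri_seq[OF tri_assign order_refl]) (use t B in auto)
  then show ?thesis by (rule tri_conseq) auto
qed

lemma aval_leafE:
  assumes v: "fst s Vi = int i" "fst s Vw = int W" "fst s Vcnt = int c" and W: "q < W"
    and Q: "\<And>p. p < c \<Longrightarrow> snd s QS p = int (w p)" and w: "\<And>p. p < c \<Longrightarrow> w p \<le> q"
  shows "aval leafE s = zlev W q w c 0 i" "eok lm leafE s"
proof -
  let ?p = "i div (2 * W)" and ?r = "i mod (2 * W)"
  have p: "int i div (2 * int W) = int ?p" and r: "int i mod (2 * int W) = int ?r"
    by (simp_all add: zdiv_int zmod_int)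
  have c: "(int ?p + 1) div (int c + 1) = 0 \<longleftrightarrow> ?p < c"
  proof -
    have "(int ?p + 1) div (int c + 1) = int ((?p + 1) div (c + 1))" by (simp add: zdiv_int add.commute)
    also have "\<dots> = 0 \<longleftrightarrow> (?p + 1) div (c + 1) = 0" by simp
    also have "\<dots> \<longleftrightarrow> ?p < c" by (auto simp: div_eq_0_iff)
    finally show ?thesis .
  qed
  have e: "int ?r - int W - snd s QS ?p = 0 \<longleftrightarrow> ?r = W + w ?p" if "?p < c" using Q[OF that] by linarith
  have z: "zlev W q w c 0 i = (if ?r = 0 then 1 else 0) + (if ?p < c \<and> ?r = W + w ?p then 1 else 0)"
    using W w by (rule zlev_0)
  show "aval leafE s = zlev W q w c 0 i"
    unfolding z leafE_def using v e Q[of ?p] by (simp add: p r c)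
  show "eok lm leafE s" unfolding leafE_def using v by (simp add: p idx_ok_def)
qed

lemma tri_mergebody:
  assumes D: "D = 2 ^ Suc j * W" and W: "2 * q < W" "W = 2 ^ e" and dT: "2 * D \<le> T" and TL: "T = 2 ^ L"
    and v: "v Vd = int D" "v Vp = int (P * (2 * D))" "v Vw = int W" "v Vq = int q" "v Vs = int (T ^ 32)"
    and tab: "table_ok T (a GR) (a GI)" and B: "int T ^ 35 \<le> B" "int (P * (2 * D) + 2 * D) \<le> B"
    and z: "\<And>i. P * (2 * D) \<le> i \<Longrightarrow> i < P * (2 * D) + 2 * D \<Longrightarrow> a ZS i = zlev W q w c j i"
  shows "tri B lm mergebody (v, a) (2 * D * (83 * (L + 1))) (\<lambda>(v', a'). v' Vp = int ((P + 1) * (2 * D)) \<and>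
    (\<forall>i. a' ZS i = (if P * (2 * D) \<le> i \<and> i < P * (2 * D) + 2 * D then zlev W q w c (Suc j) i else a ZS i)))"
proof -
  let ?Q = "\<lambda>(v', a'). v' Vp = int ((P + 1) * (2 * D)) \<and>
    (\<forall>i. a' ZS i = (if P * (2 * D) \<le> i \<and> i < P * (2 * D) + 2 * D then zlev W q w c (Suc j) i else a ZS i))"
  define n where "n = 2 * D"
  define o0 where "o0 = P * (2 * D)"
  have T: "8 \<le> T" using tab by (simp add: table_ok_def)
  note B' = T_power_bounds[OF T B(1)]
  have nB: "int n \<le> B" using dT B' n_def by linarith
  have D0: "0 < D" using D W by simp
  define hh where "hh = Suc (Suc j) + e"
  have nh: "n = 2 ^ hh" unfolding n_def D W(2) hh_def by (simp add: power_add)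
  have hL: "hh \<le> L"
  proof -
    have "(2::nat) ^ hh \<le> 2 ^ L" using dT unfolding TL nh[symmetric] n_def .
    then show ?thesis by simp
  qed
  define x where "x i = (if i < D then zlev W q w c j (o0 + i) else 0)" for i
  define y where "y i = (if i < D then zlev W q w c j (o0 + D + i) else 0)" for i
  have x01: "x i \<in> {0, 1}" "y i \<in> {0, 1}" for i using zlev_01 by (auto simp: x_def y_def)
  have xyB: "\<bar>x i\<bar> \<le> B" "\<bar>y i\<bar> \<le> B" for i using x01[of i] B' by auto
  define f where "f i = (if (\<exists>j<n. \<exists>k<n. x j = 1 \<and> y k = 1 \<and> (j + k) mod n = i) then 1 else (0::int))" for i
  have xe: "x i = 1 \<longleftrightarrow> i < D \<and> zlev W q w c j (P * (2 * D) + i) = 1"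
    "y i = 1 \<longleftrightarrow> i < D \<and> zlev W q w c j (P * (2 * D) + D + i) = 1" for i by (simp_all add: x_def y_def o0_def)
  have ite: "(if A then 1 else 0) * (if C then 1 else 0) = (if A \<and> C then 1 else (0::int))" for A C by simp
  have fz: "f i * (if i mod W \<le> q then 1 else 0) = zlev W q w c (Suc j) (o0 + i)" if "i < n" for i
    unfolding o0_def zlev_Suc[OF W(1) D that[unfolded n_def]] f_def xe n_def by (rule ite)
  have zB: "\<bar>f i * (if i mod W \<le> q then 1 else 0)\<bar> \<le> B" for i using B' by (simp add: f_def)
  define v1 where "v1 = v(VN := int n)"
  define v2 where "v2 = v1(Vi := int n)"
  define a1 where "a1 = a(XR := mix 0 n x (a XR))"
  define a2 where "a2 = a1(YR := mix 0 n y (a1 YR))"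
  let ?c5 = "Vp ::= V Vp \<oplus> V VN"
  let ?c4 = "fill ZS (V Vp) (Ld XR (V Vi) \<otimes> isz (V Vi \<odot> V Vw \<oslash> (V Vq \<oplus> N 1))) (V VN) ;; ?c5"
  have q4: "tri B lm ?c4 (u, b) (3 * n + 2 + 1) ?Q"
    if u: "u VN = int n" "u Vp = int o0" "u Vw = int W" "u Vq = int q" "b ZS = a ZS" "\<And>i. i < n \<Longrightarrow> b XR i = f i" for u b
  proof (rule tri_seq[OF tri_fill[where f = "\<lambda>i. f i * (if i mod W \<le> q then 1 else 0)" and n = n and off = o0] order_refl])
    fix i assume i: "i < n"
    have "int i mod int W div (int q + 1) = 0 \<longleftrightarrow> i mod W \<le> q"
    proof -
      have "int i mod int W div (int q + 1) = int (i mod W div (q + 1))" by (simp add: zdiv_int zmod_int add.commute)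
      also have "\<dots> = 0 \<longleftrightarrow> i mod W div (q + 1) = 0" by simp
      also have "\<dots> \<longleftrightarrow> i mod W \<le> q" by (auto simp: div_eq_0_iff)
      finally show ?thesis .
    qed
    then show "aval (Ld XR (V Vi) \<otimes> isz (V Vi \<odot> V Vw \<oslash> (V Vq \<oplus> N 1)))
      (u(Vi := int i), b(ZS := mix o0 i (\<lambda>i. f i * (if i mod W \<le> q then 1 else 0)) (b ZS))) = f i * (if i mod W \<le> q then 1 else 0)"
      using u i by simp
  next
    show "tri B lm ?c5 (u(Vi := int n), b(ZS := mix o0 n (\<lambda>i. f i * (if i mod W \<le> q then 1 else 0)) (b ZS))) 1 ?Q"
    proof (rule tri_assign)
      have "mix o0 n (\<lambda>i. f i * (if i mod W \<le> q then 1 else 0)) (b ZS) i =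
        (if P * (2 * D) \<le> i \<and> i < P * (2 * D) + 2 * D then zlev W q w c (Suc j) i else a ZS i)" for i
        using fz[of "i - o0"] u(5) unfolding mix_def by (auto simp: o0_def n_def)
      moreover have "int o0 + int n = int ((P + 1) * (2 * D))" by (simp add: o0_def n_def algebra_simps)
      ultimately show "?Q ((u(Vi := int n))(Vp := aval (V Vp \<oplus> V VN) (u(Vi := int n), b(ZS := mix o0 n (\<lambda>i. f i * (if i mod W \<le> q then 1 else 0)) (b ZS)))),
        b(ZS := mix o0 n (\<lambda>i. f i * (if i mod W \<le> q then 1 else 0)) (b ZS)))"
        using u(1,2) by simp
    qed (use u B in \<open>auto simp: o0_def n_def\<close>)
  qed (use u nB B' zB in \<open>auto simp: idx_ok_def\<close>)
  let ?c3 = "conv ;; ?c4"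
  have q3: "tri B lm ?c3 (v2, a2) (66 * n * (hh + 1) + (3 * n + 2 + 1)) ?Q"
  proof (rule tri_seqI[OF tri_conv])
    fix s' assume F: "fr conv (v2, a2) s'"
      and P': "case s' of (v', a') \<Rightarrow> \<forall>i<n. a' XR i = (if \<exists>j<n. \<exists>k<n. a2 XR j = 1 \<and> a2 YR k = 1 \<and> (j + k) mod n = i then 1 else 0)"
    obtain u b where s': "s' = (u, b)" by (cases s')
    have u: "u VN = int n" "u Vp = int o0" "u Vw = int W" "u Vq = int q" "b ZS = a ZS"
      using F v unfolding s' by (auto simp: fr_def v2_def v1_def a2_def a1_def o0_def)
    have "a2 XR i = x i" "a2 YR i = y i" if "i < n" for i using that by (auto simp: a2_def a1_def mix_def)
    then have "b XR i = f i" if "i < n" for i using P' that unfolding s' f_def by (auto cong: conj_cong)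
    then show "tri B lm ?c4 s' (3 * n + 2 + 1) ?Q" unfolding s' by (intro q4 u)
  next
    show "n \<le> T" using dT by (simp add: n_def)
    show "table_ok T (a2 GR) (a2 GI)" using tab by (simp add: a2_def a1_def)
    show "a2 XR i \<in> {0, 1}" "a2 YR i \<in> {0, 1}" if "i < n" for i
      using that x01 by (auto simp: a2_def a1_def mix_def)
  qed (use nh v B in \<open>auto simp: v2_def v1_def\<close>)
  have zx: "a ZS (o0 + i mod D) * (if i div D = 0 then 1 else 0) = x i"
    "a ZS (o0 + D + i mod D) * (if i div D = 0 then 1 else 0) = y i" if "i < n" for i
  proof -
    have m: "i mod D < D" using D0 by simp
    have "a ZS (o0 + i mod D) = zlev W q w c j (o0 + i mod D)" "a ZS (o0 + D + i mod D) = zlev W q w c j (o0 + D + i mod D)"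
      using m by (intro z; simp add: o0_def)+
    then show "a ZS (o0 + i mod D) * (if i div D = 0 then 1 else 0) = x i"
      "a ZS (o0 + D + i mod D) * (if i div D = 0 then 1 else 0) = y i"
      using D0 by (auto simp: x_def y_def div_eq_0_iff)
  qed
  have ix: "nat (int o0 + int i mod int D) = o0 + i mod D" "nat (int o0 + int D + int i mod int D) = o0 + D + i mod D"
    "int i div int D = 0 \<longleftrightarrow> i div D = 0" for i
    by (simp_all add: nat_add_distrib flip: of_nat_mod of_nat_div)
  have nn: "0 \<le> int P * (2 * int D) + int i mod int D" "0 \<le> int P * (2 * int D) + int D + int i mod int D" for i
    using D0 by (simp_all add: add_nonneg_nonneg)
  have q2: "tri B lm (fill YR (N 0) (Ld ZS (V Vp \<oplus> V Vd \<oplus> V Vi \<odot> V Vd) \<otimes> isz (V Vi \<oslash> V Vd)) (V VN) ;; ?c3) (v2, a1)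
     (3 * n + 2 + (66 * n * (hh + 1) + (3 * n + 2 + 1))) ?Q"
    by (rule tri_seq[OF tri_fill[where f = y and n = n and off = 0] order_refl])
      (use q3 v nB B' xyB zx(2) ix(2,3) nn in \<open>auto simp: v2_def v1_def a2_def a1_def idx_ok_def o0_def\<close>)
  have q1: "tri B lm (fill XR (N 0) (Ld ZS (V Vp \<oplus> V Vi \<odot> V Vd) \<otimes> isz (V Vi \<oslash> V Vd)) (V VN) ;;
       fill YR (N 0) (Ld ZS (V Vp \<oplus> V Vd \<oplus> V Vi \<odot> V Vd) \<otimes> isz (V Vi \<oslash> V Vd)) (V VN) ;; ?c3) (v1, a)
     (3 * n + 2 + (3 * n + 2 + (66 * n * (hh + 1) + (3 * n + 2 + 1)))) ?Q"
    by (rule tri_seq[OF tri_fill[where f = x and n = n and off = 0] order_refl])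
      (use q2 v nB B' xyB zx(1) ix(1,3) nn in \<open>auto simp: v2_def v1_def a1_def idx_ok_def o0_def\<close>)
  have q0: "tri B lm mergebody (v, a) (1 + (3 * n + 2 + (3 * n + 2 + (66 * n * (hh + 1) + (3 * n + 2 + 1))))) ?Q"
    unfolding mergebody_def
    by (rule tri_seq[OF tri_assign order_refl]) (use q1 v nB in \<open>auto simp: v1_def n_def\<close>)
  have "66 * n * (hh + 1) \<le> 66 * n * (L + 1)" using hL by (intro mult_le_mono2) simp
  \<comment> \<open>The work besides the convolution is \<open>9 * n + 8\<close>, at most
    \<open>17 * n\<close>.\<close>
  moreover have "17 * n \<le> 17 * n * (L + 1)" by simp
  moreover have "1 \<le> n" using D0 by (simp add: n_def)
  ultimately have "1 + (3 * n + 2 + (3 * n + 2 + (66 * n * (hh + 1) + (3 * n + 2 + 1)))) \<le> 66 * n * (L + 1) + 17 * n * (L + 1)"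
    by linarith
  also have "\<dots> = 2 * D * (83 * (L + 1))" by (simp add: n_def algebra_simps)
  finally show ?thesis by (intro tri_conseq[OF q0]) auto
qed

text \<open>A round consists of \<open>m\<close> merges with \<open>m * (2 * D) = E\<close>, so each
  of the \<open>h\<close> rounds costs \<open>E * (L + 1)\<close> up to a constant, whatever its
  block length.\<close>

lemma tri_merges:
  assumes W: "2 * q < W" "W = 2 ^ e" and E: "E = 2 ^ Suc h * W" "E \<le> T" and TL: "T = 2 ^ L"
    and v: "v Vd = int (2 * W)" "v Ve = int E" "v Vw = int W" "v Vq = int q" "v Vs = int (T ^ 32)"
    and tab: "table_ok T (a GR) (a GI)" and B: "int T ^ 35 \<le> B"
    and z: "\<And>i. i < E \<Longrightarrow> a ZS i = zlev W q w c 0 i"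
  shows "tri B lm merges (v, a) (h * (E * (89 * (L + 1))) + 1) (\<lambda>(v', a'). \<forall>i<E. a' ZS i = zlev W q w c h i)"
proof -
  have T: "8 \<le> T" using tab by (simp add: table_ok_def)
  note B' = T_power_bounds[OF T B]
  have EB: "int E \<le> B" using E(2) B' by linarith
  have W0: "0 < W" using W by simp
  have E0: "0 < E" using E W0 by simp
  let ?in = "While (V Vp) (V Ve) mergebody"
  let ?body = "Vp ::= N 0 ;; ?in ;; Vd ::= N 2 \<otimes> V Vd"
  let ?t = "E * (84 * (L + 1)) + 4"
  define Inv where "Inv = (\<lambda>j (s::st). fst s Vd = int (2 ^ Suc j * W) \<and> (\<forall>i<E. snd s ZS i = zlev W q w c j i))"
  show ?thesis unfolding merges_def
  proof (rule tri_while[where Inv = Inv and n = h and t = "\<lambda>_. ?t"])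
    show "Inv 0 (v, a)" using v z by (simp add: Inv_def)
  next
    fix j s' assume j: "j < h" and I: "Inv j s'" and F: "fr ?body (v, a) s'"
    obtain u b where s': "s' = (u, b)" by (cases s')
    define D where "D = 2 ^ Suc j * W"
    define m :: nat where "m = 2 ^ (h - Suc j)"
    have D0: "0 < D" using W0 by (simp add: D_def)
    have mE: "m * (2 * D) = E"
    proof -
      have "m * (2 * D) = (2 ^ (h - Suc j) * 2 ^ Suc (Suc j)) * W" by (simp add: m_def D_def)
      also have "2 ^ (h - Suc j) * 2 ^ Suc (Suc j) = (2::nat) ^ Suc h" using j by (simp only: power_add[symmetric]) simp
      finally show ?thesis using E by simp
    qed
    have m0: "0 < m" by (simp add: m_def)
    then have D2E: "2 * D \<le> E" unfolding mE[symmetric] by simp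
    have u: "u Ve = int E" "u Vw = int W" "u Vq = int q" "u Vs = int (T ^ 32)" "b GR = a GR" "b GI = a GI"
      using F v unfolding s' by (auto simp: fr_def)
    have ud: "u Vd = int D" and bz: "\<And>i. i < E \<Longrightarrow> b ZS i = zlev W q w c j i" using I unfolding Inv_def s' D_def by auto
    define Inv' where "Inv' = (\<lambda>P (s::st). fst s Vp = int (P * (2 * D)) \<and>
      (\<forall>i<E. snd s ZS i = (if i < P * (2 * D) then zlev W q w c (Suc j) i else zlev W q w c j i)))"
    have inner: "tri B lm ?in (u(Vp := 0), b) (E * (84 * (L + 1)) + 1) (\<lambda>s. \<forall>i<E. snd s ZS i = zlev W q w c (Suc j) i)"
    proof (rule tri_while[where Inv = Inv' and n = m and t = "\<lambda>_. 2 * D * (83 * (L + 1))"])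
      show "Inv' 0 (u(Vp := 0), b)" using bz by (simp add: Inv'_def)
    next
      fix P s'' assume P: "P < m" and I': "Inv' P s''" and F': "fr mergebody (u(Vp := 0), b) s''"
      obtain u' b' where s'': "s'' = (u', b')" by (cases s'')
      have u': "u' Ve = int E" "u' Vw = int W" "u' Vq = int q" "u' Vs = int (T ^ 32)" "u' Vd = int D" "b' GR = a GR" "b' GI = a GI"
        using F' u ud unfolding s'' by (auto simp: fr_def)
      have pp: "u' Vp = int (P * (2 * D))" using I' unfolding s'' Inv'_def by simp
      have bz': "b' ZS i = (if i < P * (2 * D) then zlev W q w c (Suc j) i else zlev W q w c j i)" if "i < E" for i
        using I' that unfolding s'' Inv'_def by simp
      have "(P + 1) * (2 * D) \<le> m * (2 * D)" using P by (intro mult_le_mono1) simp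
      then have PE: "P * (2 * D) + 2 * D \<le> E" unfolding mE by simp
      have "tri B lm mergebody (u', b') (2 * D * (83 * (L + 1))) (\<lambda>(v', a'). v' Vp = int ((P + 1) * (2 * D)) \<and>
        (\<forall>i. a' ZS i = (if P * (2 * D) \<le> i \<and> i < P * (2 * D) + 2 * D then zlev W q w c (Suc j) i else b' ZS i)))"
      proof (rule tri_mergebody[OF D_def W _ TL])
        show "2 * D \<le> T" using D2E E(2) by linarith
        show "int (P * (2 * D) + 2 * D) \<le> B" using PE EB by linarith
        show "b' ZS i = zlev W q w c j i" if "P * (2 * D) \<le> i" "i < P * (2 * D) + 2 * D" for i
          using bz'[of i] that PE by simp
      qed (use u' pp tab B in auto)
      then have "tri B lm mergebody s'' (2 * D * (83 * (L + 1))) (Inv' (Suc P))" unfolding s''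
        by (rule tri_conseq) (use bz' in \<open>auto simp: Inv'_def distrib_right\<close>)
      moreover have "P * (2 * D) < E" using PE D0 by linarith
      then have "u' Vp < u' Ve" unfolding u'(1) pp of_nat_less_iff .
      ultimately show "eok lm (V Vp) s'' \<and> eok lm (V Ve) s'' \<and> aval (V Vp) s'' < aval (V Ve) s'' \<and>
        tri B lm mergebody s'' (2 * D * (83 * (L + 1))) (Inv' (Suc P))" unfolding s'' by simp
    next
      fix s'' assume I': "Inv' m s''" and F': "fr mergebody (u(Vp := 0), b) s''"
      have "fst s'' Ve = int E" using F' u by (auto simp: fr_def)
      then show "eok lm (V Vp) s'' \<and> eok lm (V Ve) s'' \<and> \<not> aval (V Vp) s'' < aval (V Ve) s'' \<and>
        (\<forall>i<E. snd s'' ZS i = zlev W q w c (Suc j) i)" using I' unfolding Inv'_def mE by simp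
    next
      have "(\<Sum>i<m. 2 * D * (83 * (L + 1)) + 1) = m * (2 * D) * (83 * (L + 1)) + m" by (simp add: algebra_simps)
      also have "\<dots> = E * (83 * (L + 1)) + m" unfolding mE ..
      also have "m \<le> E" unfolding mE[symmetric] using D0 by simp
      finally show "(\<Sum>i<m. 2 * D * (83 * (L + 1)) + 1) + 1 \<le> E * (84 * (L + 1)) + 1" by (simp add: algebra_simps)
    qed
    have fin: "tri B lm (Vd ::= N 2 \<otimes> V Vd) (u', b') 1 (Inv (Suc j))"
      if "u' Vd = int D" "\<forall>i<E. b' ZS i = zlev W q w c (Suc j) i" for u' b'
    proof (rule tri_assign)
      show "\<bar>aval (N 2 \<otimes> V Vd) (u', b')\<bar> \<le> B" using that D2E EB by simp
      show "Inv (Suc j) (u'(Vd := aval (N 2 \<otimes> V Vd) (u', b')), b')" using that by (simp add: Inv_def D_def)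
    qed simp
    have rest: "tri B lm (?in ;; Vd ::= N 2 \<otimes> V Vd) (u(Vp := 0), b) (E * (84 * (L + 1)) + 1 + 1) (Inv (Suc j))"
    proof (rule tri_seqI[OF inner])
      fix s'' assume F': "fr ?in (u(Vp := 0), b) s''" and Q: "\<forall>i<E. snd s'' ZS i = zlev W q w c (Suc j) i"
      obtain u' b' where s'': "s'' = (u', b')" by (cases s'')
      show "tri B lm (Vd ::= N 2 \<otimes> V Vd) s'' 1 (Inv (Suc j))" unfolding s''
        by (rule fin) (use F' Q ud in \<open>auto simp: fr_def s''\<close>)
    qed simp
    have "tri B lm ?body s' (1 + (E * (84 * (L + 1)) + 1 + 1)) (Inv (Suc j))" unfolding s'
      by (rule tri_seq[OF tri_assign order_refl]) (use rest B' in auto)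
    then have "tri B lm ?body s' ?t (Inv (Suc j))" by (rule tri_conseq) auto
    moreover have "D < E" using D2E D0 by linarith
    ultimately show "eok lm (V Vd) s' \<and> eok lm (V Ve) s' \<and> aval (V Vd) s' < aval (V Ve) s' \<and> tri B lm ?body s' ?t (Inv (Suc j))"
      unfolding s' using u ud by simp
  next
    fix s' assume I: "Inv h s'" and F: "fr ?body (v, a) s'"
    have "fst s' Ve = int E" using F v by (auto simp: fr_def)
    then show "eok lm (V Vd) s' \<and> eok lm (V Ve) s' \<and> \<not> aval (V Vd) s' < aval (V Ve) s' \<and>
      (case s' of (v', a') \<Rightarrow> \<forall>i<E. a' ZS i = zlev W q w c h i)" using I by (auto simp: Inv_def E)
  next
    have "?t + 1 \<le> E * (89 * (L + 1))" using E0 by (simp add: algebra_simps)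
    then have "h * (?t + 1) \<le> h * (E * (89 * (L + 1)))" by (rule mult_le_mono2)
    then show "(\<Sum>i<h. ?t + 1) + 1 \<le> h * (E * (89 * (L + 1))) + 1" by simp
  qed
qed

text \<open>Decodes a code into the sum \<open>s * b + c * l\<close> that it stands for. Cells
  holding 0 and sums above \<open>u\<close> are sent to the dummy index \<open>Vnn\<close>, just
  past the range that is read, in place of a branch.\<close>

definition scatter :: com where
  "scatter = Vi ::= N 0 ;; While (V Vi) (V Ve)
     (Sto YR (Ld ZS (V Vi) \<otimes> isz ((V Vi \<odot> V Vw \<otimes> V Vb \<oplus> V Vi \<oslash> V Vw \<otimes> V Vcl) \<oslash> (V Vu \<oplus> N 1)) \<otimes>
          (V Vi \<odot> V Vw \<otimes> V Vb \<oplus> V Vi \<oslash> V Vw \<otimes> V Vcl) \<oplus>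
        (N 1 \<ominus> Ld ZS (V Vi) \<otimes> isz ((V Vi \<odot> V Vw \<otimes> V Vb \<oplus> V Vi \<oslash> V Vw \<otimes> V Vcl) \<oslash> (V Vu \<oplus> N 1))) \<otimes> V Vnn)
      (N 1) ;; Vi ::= V Vi \<oplus> N 1)"

lemma mv_scatter [simp]: "mv scatter = {Vi}" and ma_scatter [simp]: "ma scatter = {YR}"
  by (auto simp: scatter_def)

lemma tri_scatter:
  assumes v: "v Ve = int E" "v Vw = int W" "v Vb = int b" "v Vcl = int l" "v Vu = int u" "v Vnn = int n"
    and z: "\<And>i. i < E \<Longrightarrow> a ZS i \<in> {0, 1}" and y: "\<And>i. i < n \<Longrightarrow> a YR i = 0" and un: "u < n"
    and B: "int E \<le> B" "1 \<le> B"
  shows "tri B lm scatter (v, a) (3 * E + 2) (\<lambda>(v', a'). \<forall>j<n. a' YR j =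
    (if j \<le> u \<and> (\<exists>i<E. a ZS i = 1 \<and> i mod W * b + i div W * l = j) then 1 else 0))"
proof -
  let ?Q = "\<lambda>(v', a'). \<forall>j<n. a' YR j = (if j \<le> u \<and> (\<exists>i<E. a ZS i = 1 \<and> i mod W * b + i div W * l = j) then 1 else 0)"
  let ?val = "V Vi \<odot> V Vw \<otimes> V Vb \<oplus> V Vi \<oslash> V Vw \<otimes> V Vcl"
  let ?cond = "Ld ZS (V Vi) \<otimes> isz (?val \<oslash> (V Vu \<oplus> N 1))"
  let ?ix = "?cond \<otimes> ?val \<oplus> (N 1 \<ominus> ?cond) \<otimes> V Vnn"
  let ?b = "Sto YR ?ix (N 1) ;; Vi ::= V Vi \<oplus> N 1"
  define Inv where "Inv = (\<lambda>k (s::st). fst s Vi = int k \<and>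
    (\<forall>j<n. snd s YR j = (if j \<le> u \<and> (\<exists>i<k. a ZS i = 1 \<and> i mod W * b + i div W * l = j) then 1 else 0)))"
  have loop: "tri B lm (While (V Vi) (V Ve) ?b) (v(Vi := 0), a) (3 * E + 1) ?Q"
  proof (rule tri_while[where Inv = Inv and n = E and t = "\<lambda>_. 2"])
    show "Inv 0 (v(Vi := 0), a)" using y by (simp add: Inv_def)
  next
    fix k s' assume k: "k < E" and I: "Inv k s'" and F: "fr ?b (v(Vi := 0), a) s'"
    obtain w d where s': "s' = (w, d)" by (cases s')
    have w: "w Ve = int E" "w Vw = int W" "w Vb = int b" "w Vcl = int l" "w Vu = int u" "w Vnn = int n" "d ZS = a ZS"
      using F v unfolding s' by (auto simp: fr_def)
    have wi: "w Vi = int k" and yj: "\<And>j. j < n \<Longrightarrow> d YR j = (if j \<le> u \<and> (\<exists>i<k. a ZS i = 1 \<and> i mod W * b + i div W * l = j) then 1 else 0)"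
      using I unfolding Inv_def s' by auto
    define x where "x = k mod W * b + k div W * l"
    have val: "aval ?val (w, d) = int x" using w wi by (simp add: x_def zmod_int zdiv_int)
    have ge: "int x div (int u + 1) = 0 \<longleftrightarrow> x \<le> u"
    proof -
      have "int x div (int u + 1) = int (x div (u + 1))" by (simp add: zdiv_int add.commute)
      also have "\<dots> = 0 \<longleftrightarrow> x div (u + 1) = 0" by simp
      also have "\<dots> \<longleftrightarrow> x \<le> u" by (auto simp: div_eq_0_iff)
      finally show ?thesis .
    qed
    define C where "C \<longleftrightarrow> a ZS k = 1 \<and> x \<le> u"
    have "aval ?cond (w, d) = a ZS k * (if aval ?val (w, d) div (int u + 1) = 0 then 1 else 0)"
      using w wi by simp
    also have "\<dots> = a ZS k * (if int x div (int u + 1) = 0 then 1 else 0)" unfolding val ..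
    also have "\<dots> = (if C then 1 else 0)" unfolding ge using z[OF k] by (auto simp: C_def)
    finally have cond: "aval ?cond (w, d) = (if C then 1 else 0)" .
    have "aval ?ix (w, d) = aval ?cond (w, d) * aval ?val (w, d) + (1 - aval ?cond (w, d)) * int n" using w by simp
    then have ix: "aval ?ix (w, d) = int (if C then x else n)" unfolding cond val by simp
    let ?j = "if C then x else n"
    have 2: "tri B lm (Vi ::= V Vi \<oplus> N 1) (w, upd YR ?j 1 d) 1 (Inv (Suc k))"
    proof (rule tri_assign)
      have "upd YR ?j 1 d YR j = (if j \<le> u \<and> (\<exists>i<Suc k. a ZS i = 1 \<and> i mod W * b + i div W * l = j) then 1 else 0)"
        if "j < n" for j
        using yj[OF that] that un by (auto simp: upd_def C_def x_def less_Suc_eq)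
      then show "Inv (Suc k) (w(Vi := aval (V Vi \<oplus> N 1) (w, upd YR ?j 1 d)), upd YR ?j 1 d)" using wi by (simp add: Inv_def)
    qed (use wi k B in auto)
    have "tri B lm ?b (w, d) (1 + 1) (Inv (Suc k))"
    proof (rule tri_seq[OF tri_sto order_refl])
      show "tri B lm (Vi ::= V Vi \<oplus> N 1) (w, upd YR (nat (aval ?ix (w, d))) (aval (N 1) (w, d)) d) 1 (Inv (Suc k))"
        unfolding ix nat_int aval.simps(1) by (rule 2)
      show "idx_ok lm YR (aval ?ix (w, d))" unfolding ix by (simp add: idx_ok_def)
    qed (use B wi in \<open>auto simp: idx_ok_def\<close>)
    then show "eok lm (V Vi) s' \<and> eok lm (V Ve) s' \<and> aval (V Vi) s' < aval (V Ve) s' \<and> tri B lm ?b s' 2 (Inv (Suc k))"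
      unfolding s' using w wi k by (simp add: numeral_2_eq_2)
  next
    fix s' assume I: "Inv E s'" and F: "fr ?b (v(Vi := 0), a) s'"
    have "fst s' Ve = int E" using F v by (auto simp: fr_def)
    then show "eok lm (V Vi) s' \<and> eok lm (V Ve) s' \<and> \<not> aval (V Vi) s' < aval (V Ve) s' \<and> ?Q s'"
      using I by (auto simp: Inv_def)
  qed simp
  have "tri B lm scatter (v, a) (1 + (3 * E + 1)) ?Q" unfolding scatter_def
    by (rule tri_seq[OF tri_assign order_refl]) (use loop B in auto)
  then show ?thesis by (rule tri_conseq) auto
qed

definition cls :: com where
  "cls = clsfilter ;; dbl Vm (V Vcnt) ;; Vd ::= N 2 \<otimes> V Vw ;; Ve ::= N 2 \<otimes> V Vm \<otimes> V Vw ;;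
     fill ZS (N 0) leafE (V Ve) ;; merges ;; fill YR (N 0) (N 0) (V Vnn) ;; scatter ;;
     fill XR (N 0) (Ld ACC (V Vi)) (V Vnn) ;; VN ::= V Vnn ;; conv ;;
     fill ACC (N 0) (Ld XR (V Vi) \<otimes> isz (V Vi \<oslash> (V Vu \<oplus> N 1))) (V Vnn)"

lemma mv_cls [simp]: "mv cls = {Vcnt, Vi, Vm, Vd, Ve, VN, Vh, Vp}"
  and ma_cls [simp]: "ma cls = {QS, ZS, XR, YR, XI, YI, BR, BI, ACC}"
  by (auto simp: cls_def)

definition ind :: "bool \<Rightarrow> int" where "ind p = (if p then 1 else 0)"

text \<open>\<open>E\<close> is proportional to \<open>W\<close> times the size of the class up to
  rounding, so the merging costs of all classes add up as if the elements formed one class. The term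
  in \<open>n\<close>, for the convolution with the sums collected so far, is paid once per
  class.\<close>

lemma tri_cls:
  assumes v: "v Vn = int (length xs)" "v Vb = int b" "v Vcl = int l" "v Vu = int u" "v Vq = int q" "v Vw = int W"
      "v Vnn = int n" "v Vs = int (T ^ 32)"
    and xs: "\<And>i. i < length xs \<Longrightarrow> a XS i = int (xs ! i)" "distinct xs" "\<And>x. x \<in> set xs \<Longrightarrow> x \<le> u"
    and b: "0 < b" "q = u div b" and W: "2 * q < W" "W = 2 ^ e" and n: "n = 2 ^ hn" "2 * u < n" "n \<le> T" and TL: "T = 2 ^ L"
    and ys: "ys = filter (\<lambda>x. x mod b = l) xs" and h: "h = cl (length ys)" and E: "E = 2 ^ Suc h * W" "E \<le> T"
    and tab: "table_ok T (a GR) (a GI)" and B: "int T ^ 35 \<le> B" and lT: "2 * length xs \<le> T"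
    and A: "\<And>i. i < n \<Longrightarrow> a ACC i = ind (i \<in> A)" "\<And>x. x \<in> A \<Longrightarrow> x \<le> u"
  shows "tri B lm cls (v, a) (4 * length xs + E * (101 * (h + 1) * (L + 1)) + n * (90 * (L + 1)))
    (\<lambda>(v', a'). \<forall>i<n. a' ACC i = ind (i \<in> {x + y | x y. x \<in> A \<and> y \<in> {\<Sum>Y | Y. Y \<subseteq> set ys \<and> \<Sum>Y \<le> u} \<and> x + y \<le> u}))"
proof -
  have T: "8 \<le> T" using tab by (simp add: table_ok_def)
  note B' = T_power_bounds[OF T B]
  have W0: "0 < W" using W by simp
  have EB: "int E \<le> B" "int n \<le> B" using E(2) n(3) B' by linarith+
  have E0: "1 \<le> E" "W \<le> E" "2 * W \<le> E" "2 ^ h \<le> E" using E W0 by auto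
  have n0: "1 \<le> n" using n by simp
  define c where "c = length ys"
  define w where "w i = ys ! i div b" for i
  define R where "R = {\<Sum>Y | Y. Y \<subseteq> set ys \<and> \<Sum>Y \<le> u}"
  have cx: "c \<le> length xs" unfolding c_def ys by (rule length_filter_le)
  have ysu: "x \<le> u" "x mod b = l" if "x \<in> set ys" for x using that xs(3) by (auto simp: ys)
  have wq: "w p \<le> q" if "p < c" for p
    unfolding w_def b(2) using ysu(1)[of "ys ! p"] that by (intro div_le_mono) (simp add: c_def)
  have qW: "q < W" using W by linarith
  have ch: "c \<le> 2 ^ h" unfolding h c_def by (rule cl_ge)
  have hE: "E = 2 * 2 ^ h * W" using E by simp
  have zl: "zlev W q w c h i = ind (i \<in> rs W q w {..<c})" if "i < E" for i
  proof -
    have "blkI c h 0 = {..<c}" using ch by (auto simp: blkI_def)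
    then show ?thesis using that unfolding zlev_def E(1)[symmetric] ind_def by simp
  qed
  have Rset: "j \<le> u \<and> (\<exists>i<E. zlev W q w c h i = 1 \<and> i mod W * b + i div W * l = j) \<longleftrightarrow> j \<in> R" for j
  proof -
    have d: "distinct ys" using xs(2) by (simp add: ys)
    have "{v. v \<le> u \<and> (\<exists>i<2 * 2 ^ h * W. i \<in> rs W q (\<lambda>i. ys ! i div b) {..<length ys} \<and> i mod W * b + i div W * l = v)} \<union> {0} = R"
      unfolding R_def by (rule class_sums[OF d ysu(2) b(1,2) qW ch[unfolded c_def]])
    then have "j \<in> R \<longleftrightarrow> (j \<le> u \<and> (\<exists>i<E. i \<in> rs W q w {..<c} \<and> i mod W * b + i div W * l = j)) \<or> j = 0"
      unfolding hE w_def c_def by blast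
    moreover have "0 \<in> rs W q w {..<c}" unfolding rs_def by (auto intro: exI[of _ "{}"])
    then have "0 < E \<and> 0 \<in> rs W q w {..<c} \<and> 0 mod W * b + 0 div W * l = 0" using E0 by simp
    ultimately have "j \<in> R \<longleftrightarrow> j \<le> u \<and> (\<exists>i<E. i \<in> rs W q w {..<c} \<and> i mod W * b + i div W * l = j)" by blast
    moreover have "(zlev W q w c h i = 1) = (i \<in> rs W q w {..<c})" if "i < E" for i using zl[OF that] by (simp add: ind_def)
    ultimately show ?thesis by (auto cong: conj_cong)
  qed
  have Ru: "y \<le> u" if "y \<in> R" for y using that by (auto simp: R_def)
  let ?Q = "\<lambda>(v', a'). \<forall>i<n. a' ACC i = ind (i \<in> {x + y | x y. x \<in> A \<and> y \<in> R \<and> x + y \<le> u})"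
  define ok where "ok = (\<lambda>s :: st. fst s Vb = int b \<and> fst s Vcl = int l \<and> fst s Vu = int u \<and> fst s Vq = int q \<and> fst s Vw = int W \<and>
     fst s Vnn = int n \<and> fst s Vs = int (T ^ 32) \<and> snd s GR = a GR \<and> snd s GI = a GI \<and> snd s ACC = a ACC)"
  let ?c1 = "fill ACC (N 0) (Ld XR (V Vi) \<otimes> isz (V Vi \<oslash> (V Vu \<oplus> N 1))) (V Vnn)"
  have q1: "tri B lm ?c1 (w', b') (3 * n + 2) ?Q"
    if w': "ok (w', b')" and x: "\<And>i. i < n \<Longrightarrow> b' XR i = ind (\<exists>j<n. \<exists>k<n. j \<in> A \<and> k \<in> R \<and> (j + k) mod n = i)" for w' b'
  proof (rule tri_fill[where f = "\<lambda>i. ind (i \<in> {x + y | x y. x \<in> A \<and> y \<in> R \<and> x + y \<le> u})" and n = n and off = 0])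
    fix i assume i: "i < n"
    have "int i div (int u + 1) = 0 \<longleftrightarrow> i \<le> u"
    proof -
      have "int i div (int u + 1) = int (i div (u + 1))" by (simp add: zdiv_int add.commute)
      also have "\<dots> = 0 \<longleftrightarrow> i div (u + 1) = 0" by simp
      also have "\<dots> \<longleftrightarrow> i \<le> u" by (auto simp: div_eq_0_iff)
      finally show ?thesis .
    qed
    moreover have "(\<exists>j<n. \<exists>k<n. j \<in> A \<and> k \<in> R \<and> (j + k) mod n = i) \<longleftrightarrow> (\<exists>j k. j \<in> A \<and> k \<in> R \<and> j + k = i)"
    proof -
      \<comment> \<open>Both arguments are at most \<open>u\<close> and \<open>2 * u < n\<close>, so
        this convolution does not wrap around.\<close>
      have lt: "j < n" "k < n" "(j + k) mod n = j + k" if "j \<in> A" "k \<in> R" for j k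
        using A(2)[OF that(1)] Ru[OF that(2)] n(2) by auto
      show ?thesis
      proof
        assume "\<exists>j<n. \<exists>k<n. j \<in> A \<and> k \<in> R \<and> (j + k) mod n = i"
        then obtain j k where "j \<in> A" "k \<in> R" "(j + k) mod n = i" by blast
        then show "\<exists>j k. j \<in> A \<and> k \<in> R \<and> j + k = i" using lt(3) by metis
      next
        assume "\<exists>j k. j \<in> A \<and> k \<in> R \<and> j + k = i"
        then obtain j k where jk: "j \<in> A" "k \<in> R" "j + k = i" by blast
        then show "\<exists>j<n. \<exists>k<n. j \<in> A \<and> k \<in> R \<and> (j + k) mod n = i" using lt[OF jk(1,2)] by metis
      qed
    qed
    ultimately show "aval (Ld XR (V Vi) \<otimes> isz (V Vi \<oslash> (V Vu \<oplus> N 1)))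
       (w'(Vi := int i), b'(ACC := mix 0 i (\<lambda>i. ind (i \<in> {x + y | x y. x \<in> A \<and> y \<in> R \<and> x + y \<le> u})) (b' ACC))) =
       ind (i \<in> {x + y | x y. x \<in> A \<and> y \<in> R \<and> x + y \<le> u})"
      using w' x[OF i] by (auto simp: ok_def ind_def)
  qed (use w' EB B' in \<open>auto simp: ok_def idx_ok_def ind_def mix_def\<close>)
  have hL: "hn \<le> L"
  proof -
    have "(2::nat) ^ hn \<le> 2 ^ L" using n(1,3) TL by simp
    then show ?thesis by simp
  qed
  let ?c2 = "conv ;; ?c1"
  have q2: "tri B lm ?c2 (w', b') (66 * n * (hn + 1) + (3 * n + 2)) ?Q"
    if w': "ok (w', b')" "w' VN = int n" and x: "\<And>i. i < n \<Longrightarrow> b' XR i = ind (i \<in> A)" "\<And>i. i < n \<Longrightarrow> b' YR i = ind (i \<in> R)" for w' b'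
  proof (rule tri_seqI[OF tri_conv])
    fix s' assume F: "fr conv (w', b') s'"
      and P: "case s' of (v', a') \<Rightarrow> \<forall>i<n. a' XR i = (if \<exists>j<n. \<exists>k<n. b' XR j = 1 \<and> b' YR k = 1 \<and> (j + k) mod n = i then 1 else 0)"
    obtain w2 b2 where s': "s' = (w2, b2)" by (cases s')
    show "tri B lm ?c1 s' (3 * n + 2) ?Q" unfolding s'
    proof (rule q1)
      show "ok (w2, b2)" using F w' unfolding s' by (auto simp: fr_def ok_def)
      have "(b' XR j = 1) = (j \<in> A)" "(b' YR j = 1) = (j \<in> R)" if "j < n" for j using x that by (auto simp: ind_def)
      then show "b2 XR i = ind (\<exists>j<n. \<exists>k<n. j \<in> A \<and> k \<in> R \<and> (j + k) mod n = i)" if "i < n" for i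
        using P that unfolding s' ind_def by (auto cong: conj_cong)
    qed
  qed (use w' x n tab B in \<open>auto simp: ok_def ind_def\<close>)
  let ?c3 = "VN ::= V Vnn ;; ?c2"
  have q3: "tri B lm ?c3 (w', b') (1 + (66 * n * (hn + 1) + (3 * n + 2))) ?Q"
    if w': "ok (w', b')" and x: "\<And>i. i < n \<Longrightarrow> b' XR i = ind (i \<in> A)" "\<And>i. i < n \<Longrightarrow> b' YR i = ind (i \<in> R)" for w' b'
  proof (rule tri_seq[OF tri_assign order_refl])
    show "tri B lm ?c2 (w'(VN := aval (V Vnn) (w', b')), b') (66 * n * (hn + 1) + (3 * n + 2)) ?Q"
      by (rule q2) (use w' x in \<open>auto simp: ok_def\<close>)
  qed (use w' EB in \<open>auto simp: ok_def\<close>)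
  let ?c4 = "fill XR (N 0) (Ld ACC (V Vi)) (V Vnn) ;; ?c3"
  have q4: "tri B lm ?c4 (w', b') (3 * n + 2 + (1 + (66 * n * (hn + 1) + (3 * n + 2)))) ?Q"
    if w': "ok (w', b')" and x: "\<And>i. i < n \<Longrightarrow> b' YR i = ind (i \<in> R)" for w' b'
  proof (rule tri_seq[OF tri_fill[where f = "\<lambda>i. ind (i \<in> A)" and n = n and off = 0] order_refl])
    show "tri B lm ?c3 (w'(Vi := int n), b'(XR := mix 0 n (\<lambda>i. ind (i \<in> A)) (b' XR))) (1 + (66 * n * (hn + 1) + (3 * n + 2))) ?Q"
      by (rule q3) (use w' x in \<open>auto simp: ok_def mix_def\<close>)
  qed (use w' EB B' A in \<open>auto simp: ok_def idx_ok_def ind_def\<close>)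
  let ?T4 = "3 * n + 2 + (1 + (66 * n * (hn + 1) + (3 * n + 2)))"
  let ?c5 = "scatter ;; ?c4"
  have q5: "tri B lm ?c5 (w', b') (3 * E + 2 + ?T4) ?Q"
    if w': "ok (w', b')" "w' Ve = int E" and x: "\<And>i. i < n \<Longrightarrow> b' YR i = 0" "\<And>i. i < E \<Longrightarrow> b' ZS i = zlev W q w c h i" for w' b'
  proof (rule tri_seqI[OF tri_scatter])
    fix s' assume F: "fr scatter (w', b') s'"
      and P: "case s' of (v', a') \<Rightarrow> \<forall>j<n. a' YR j = (if j \<le> u \<and> (\<exists>i<E. b' ZS i = 1 \<and> i mod W * b + i div W * l = j) then 1 else 0)"
    obtain w2 b2 where s': "s' = (w2, b2)" by (cases s')
    show "tri B lm ?c4 s' ?T4 ?Q" unfolding s'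
    proof (rule q4)
      show "ok (w2, b2)" using F w' unfolding s' by (auto simp: fr_def ok_def)
      fix j assume j: "j < n"
      have "(\<exists>i<E. b' ZS i = 1 \<and> i mod W * b + i div W * l = j) \<longleftrightarrow> (\<exists>i<E. zlev W q w c h i = 1 \<and> i mod W * b + i div W * l = j)"
        using x(2) by (auto cong: conj_cong)
      then show "b2 YR j = ind (j \<in> R)" using P j Rset[of j] unfolding s' ind_def by simp
    qed
  qed (use w' x n EB B' zlev_01 in \<open>auto simp: ok_def\<close>)
  let ?c6 = "fill YR (N 0) (N 0) (V Vnn) ;; ?c5"
  have q6: "tri B lm ?c6 (w', b') (3 * n + 2 + (3 * E + 2 + ?T4)) ?Q"
    if w': "ok (w', b')" "w' Ve = int E" and x: "\<And>i. i < E \<Longrightarrow> b' ZS i = zlev W q w c h i" for w' b'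
  proof (rule tri_seq[OF tri_fill[where f = "\<lambda>i. 0" and n = n and off = 0] order_refl])
    show "tri B lm ?c5 (w'(Vi := int n), b'(YR := mix 0 n (\<lambda>i. 0) (b' YR))) (3 * E + 2 + ?T4) ?Q"
      by (rule q5) (use w' x in \<open>auto simp: ok_def mix_def\<close>)
  qed (use w' EB B' in \<open>auto simp: ok_def\<close>)
  let ?T6 = "3 * n + 2 + (3 * E + 2 + ?T4)"
  let ?TM = "h * (E * (89 * (L + 1))) + 1"
  let ?c7 = "merges ;; ?c6"
  have q7: "tri B lm ?c7 (w', b') (?TM + ?T6) ?Q"
    if w': "ok (w', b')" "w' Ve = int E" "w' Vd = int (2 * W)" and x: "\<And>i. i < E \<Longrightarrow> b' ZS i = zlev W q w c 0 i" for w' b'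
  proof (rule tri_seqI[OF tri_merges[OF W E TL]])
    fix s' assume F: "fr merges (w', b') s'" and P: "case s' of (v', a') \<Rightarrow> \<forall>i<E. a' ZS i = zlev W q w c h i"
    obtain w2 b2 where s': "s' = (w2, b2)" by (cases s')
    show "tri B lm ?c6 s' ?T6 ?Q" unfolding s'
      by (rule q6) (use F P w' in \<open>auto simp: fr_def ok_def s'\<close>)
  qed (use w' x tab B in \<open>auto simp: ok_def\<close>)
  let ?c8 = "fill ZS (N 0) leafE (V Ve) ;; ?c7"
  have q8: "tri B lm ?c8 (w', b') (3 * E + 2 + (?TM + ?T6)) ?Q"
    if w': "ok (w', b')" "w' Ve = int E" "w' Vd = int (2 * W)" "w' Vcnt = int c" and x: "\<And>i. i < c \<Longrightarrow> b' QS i = int (w i)" for w' b'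
  proof (rule tri_seq[OF tri_fill[where f = "zlev W q w c 0" and n = E and off = 0] order_refl])
    show "tri B lm ?c7 (w'(Vi := int E), b'(ZS := mix 0 E (zlev W q w c 0) (b' ZS))) (?TM + ?T6) ?Q"
      by (rule q7) (use w' in \<open>auto simp: ok_def mix_def\<close>)
    fix i assume i: "i < E"
    let ?s = "(w'(Vi := int i), b'(ZS := mix 0 i (zlev W q w c 0) (b' ZS)))"
    have p: "fst ?s Vi = int i" "fst ?s Vw = int W" "fst ?s Vcnt = int c" "\<And>p. p < c \<Longrightarrow> snd ?s QS p = int (w p)"
      using w' x by (auto simp: ok_def)
    show "aval leafE ?s = zlev W q w c 0 i" "eok lm leafE ?s" by (rule aval_leafE[OF p(1-3) qW p(4) wq]; assumption?)+
    show "\<bar>zlev W q w c 0 i\<bar> \<le> B" using zlev_01[of W q w c 0 i] B' by auto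
  qed (use w' EB B' in auto)
  let ?T8 = "3 * E + 2 + (?TM + ?T6)"
  let ?c9 = "Ve ::= N 2 \<otimes> V Vm \<otimes> V Vw ;; ?c8"
  have q9: "tri B lm ?c9 (w', b') (1 + ?T8) ?Q"
    if w': "ok (w', b')" "w' Vm = int (2 ^ h)" "w' Vd = int (2 * W)" "w' Vcnt = int c" and x: "\<And>i. i < c \<Longrightarrow> b' QS i = int (w i)" for w' b'
  proof (rule tri_seq[OF tri_assign order_refl])
    have e: "aval (N 2 \<otimes> V Vm \<otimes> V Vw) (w', b') = int E" using w' unfolding hE by (simp add: ok_def)
    show "tri B lm ?c8 (w'(Ve := aval (N 2 \<otimes> V Vm \<otimes> V Vw) (w', b')), b') ?T8 ?Q"
      unfolding e by (rule q8) (use w' x in \<open>auto simp: ok_def\<close>)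
    show "\<bar>aval (N 2 \<otimes> V Vm \<otimes> V Vw) (w', b')\<bar> \<le> B" unfolding e using EB by simp
  qed simp
  let ?c10 = "Vd ::= N 2 \<otimes> V Vw ;; ?c9"
  have q10: "tri B lm ?c10 (w', b') (1 + (1 + ?T8)) ?Q"
    if w': "ok (w', b')" "w' Vm = int (2 ^ h)" "w' Vcnt = int c" and x: "\<And>i. i < c \<Longrightarrow> b' QS i = int (w i)" for w' b'
  proof (rule tri_seq[OF tri_assign order_refl])
    show "tri B lm ?c9 (w'(Vd := aval (N 2 \<otimes> V Vw) (w', b')), b') (1 + ?T8) ?Q"
      by (rule q9) (use w' x in \<open>auto simp: ok_def\<close>)
    have "int (2 * W) \<le> B" using E0 EB by linarith
    then show "\<bar>aval (N 2 \<otimes> V Vw) (w', b')\<bar> \<le> B" using w' by (simp add: ok_def)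
  qed simp
  let ?c11 = "dbl Vm (V Vcnt) ;; ?c10"
  have q11: "tri B lm ?c11 (w', b') (2 * h + 2 + (1 + (1 + ?T8))) ?Q"
    if w': "ok (w', b')" "w' Vcnt = int c" and x: "\<And>i. i < c \<Longrightarrow> b' QS i = int (w i)" for w' b'
  proof -
    have c2: "2 * int c \<le> B" using cx lT B' by linarith
    show ?thesis unfolding h c_def[symmetric]
    proof (rule tri_seq[OF tri_dbl[where E = c] order_refl])
      show "tri B lm ?c10 (w'(Vm := int (2 ^ cl c)), b') (1 + (1 + (3 * E + 2 + (cl c * (E * (89 * (L + 1))) + 1 + ?T6)))) ?Q"
        using q10[of "w'(Vm := int (2 ^ cl c))" b'] w' x unfolding h c_def[symmetric] by (simp add: ok_def)
    qed (use w' c2 B' in auto)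
  qed
  have q12: "tri B lm cls (v, a) (4 * length xs + 3 + (2 * h + 2 + (1 + (1 + ?T8)))) ?Q" unfolding cls_def
  proof (rule tri_seqI[OF tri_clsfilter[where xs = xs and b = b and l = l and ys = ys]])
    fix s' assume F: "fr clsfilter (v, a) s'"
      and P: "case s' of (v', a') \<Rightarrow> v' Vcnt = int (length ys) \<and> (\<forall>i<length ys. a' QS i = int (ys ! i div b))"
    obtain w2 b2 where s': "s' = (w2, b2)" by (cases s')
    show "tri B lm ?c11 s' (2 * h + 2 + (1 + (1 + ?T8))) ?Q" unfolding s'
      by (rule q11) (use F P v in \<open>auto simp: fr_def ok_def s' c_def w_def\<close>)
  next
    show "int (length xs) \<le> B" using lT B' by linarith
    show "int x \<le> B" if "x \<in> set xs" for x using xs(3)[OF that] n(2) EB by linarith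
  qed (use v xs b ys B' in auto)
  have "h \<le> E" using E0(4) less_exp[of h] by linarith
  moreover have "h * (E * (89 * (L + 1))) \<le> E * (89 * (h + 1) * (L + 1))" by (simp add: algebra_simps)
  moreover have "12 * E \<le> E * (12 * (h + 1) * (L + 1))" by simp
  moreover have "66 * n * (hn + 1) \<le> n * (66 * (L + 1))"
  proof -
    have "66 * n * (hn + 1) \<le> 66 * n * (L + 1)" using hL by (intro mult_le_mono2) simp
    then show ?thesis by (simp add: algebra_simps)
  qed
  moreover have "24 * n \<le> n * (24 * (L + 1))" by simp
  ultimately have "4 * length xs + 3 + (2 * h + 2 + (1 + (1 + ?T8))) \<le> 4 * length xs +
     (E * (89 * (h + 1) * (L + 1)) + E * (12 * (h + 1) * (L + 1))) + (n * (66 * (L + 1)) + n * (24 * (L + 1)))"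
    using E0(1) n0 by linarith
  also have "\<dots> = 4 * length xs + E * (101 * (h + 1) * (L + 1)) + n * (90 * (L + 1))" by (simp add: algebra_simps)
  finally show ?thesis using q12 unfolding R_def by (rule tri_conseq[rotated 2]) auto
qed

subsection \<open>The whole program\<close>

text \<open>The logarithm is taken of \<open>n + 1\<close> to be positive even for
  \<open>n = 1\<close>; with a logarithm of 0 the number \<open>b\<close> of classes would be
  0.\<close>

definition lgcom :: com where
  "lgcom = Vpw ::= N 1 ;; Vlg ::= N 0 ;;
     While (V Vpw) (V Vn \<oplus> N 1) (Vpw ::= V Vpw \<otimes> N 2 ;; Vlg ::= V Vlg \<oplus> N 1)"

lemma cl_le_self: "cl e \<le> e"
  by (rule cl_le) (simp add: less_imp_le less_exp)

lemma tri_lgcom: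
  assumes v: "v Vn = int n" and B: "2 * int n + 2 \<le> B"
    and Q: "Q (v(Vpw := int (2 ^ cl (n + 1)), Vlg := int (cl (n + 1))), a)"
  shows "tri B lm lgcom (v, a) (3 * cl (n + 1) + 3) Q"
proof -
  let ?h = "cl (n + 1)"
  let ?b = "Vpw ::= V Vpw \<otimes> N 2 ;; Vlg ::= V Vlg \<oplus> N 1"
  define Inv where "Inv = (\<lambda>l (s::st). s = (v(Vpw := int (2 ^ l), Vlg := int l), a))"
  have loop: "tri B lm (While (V Vpw) (V Vn \<oplus> N 1) ?b) (v(Vpw := 1, Vlg := 0), a) (3 * ?h + 1) Q"
  proof (rule tri_while[where Inv = Inv and n = ?h and t = "\<lambda>_. 2"])
    fix l s' assume l: "l < ?h" and "Inv l s'"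
    then have s': "s' = (v(Vpw := int (2 ^ l), Vlg := int l), a)" by (simp add: Inv_def)
    have le: "int (2 ^ l) < int (n + 1)" using cl_less[OF l] by (simp only: of_nat_less_iff)
    have le2: "int (2 ^ l) * 2 \<le> B" using le B by simp
    have lB: "int l + 1 \<le> B" using l cl_le_self[of "n + 1"] B by simp
    have 1: "tri B lm (Vlg ::= V Vlg \<oplus> N 1) (v(Vpw := int (2 ^ l) * 2, Vlg := int l), a) 1 (Inv (Suc l))"
      by (rule tri_assign) (use lB in \<open>auto simp: Inv_def mult.commute add.commute\<close>)
    have 2: "tri B lm ?b s' (1 + 1) (Inv (Suc l))" unfolding s'
      by (rule tri_seq[OF tri_assign order_refl])
        (use 1 le2 in \<open>auto simp: fun_upd_twist[of Vpw Vlg]\<close>)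
    show "eok lm (V Vpw) s' \<and> eok lm (V Vn \<oplus> N 1) s' \<and> aval (V Vpw) s' < aval (V Vn \<oplus> N 1) s' \<and> tri B lm ?b s' 2 (Inv (Suc l))"
      using 2[unfolded one_add_one] cl_less[OF l] v unfolding s' by simp
  next
    fix s' assume "Inv ?h s'"
    then have s': "s' = (v(Vpw := int (2 ^ ?h), Vlg := int ?h), a)" by (simp add: Inv_def)
    have "\<not> 2 ^ ?h \<le> n" using cl_ge[of "n + 1"] by linarith
    then show "eok lm (V Vpw) s' \<and> eok lm (V Vn \<oplus> N 1) s' \<and> \<not> aval (V Vpw) s' < aval (V Vn \<oplus> N 1) s' \<and> Q s'"
      unfolding s' using v Q by simp
  qed (auto simp: Inv_def)
  have p: "tri B lm (Vlg ::= N 0 ;; While (V Vpw) (V Vn \<oplus> N 1) ?b) (v(Vpw := 1), a) (1 + (3 * ?h + 1)) Q"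
    by (rule tri_seq[OF tri_assign order_refl]) (use loop B in auto)
  have "tri B lm lgcom (v, a) (1 + (1 + (3 * ?h + 1))) Q" unfolding lgcom_def
    by (rule tri_seq[OF tri_assign order_refl]) (use p B in auto)
  then show ?thesis by (rule tri_conseq) auto
qed

text \<open>The square root rounded up.\<close>

definition bl :: "nat \<Rightarrow> nat" where "bl m = (LEAST b. m \<le> b * b)"

lemma bl_ge: "m \<le> bl m * bl m"
  unfolding bl_def by (rule LeastI[of _ m]) (cases m; simp)

lemma bl_less: "x < bl m \<Longrightarrow> x * x < m"
  unfolding bl_def using not_less_Least not_le by blast

lemma bl_le: "m \<le> x * x \<Longrightarrow> bl m \<le> x"
  unfolding bl_def by (rule Least_le)

text \<open>A linear search is affordable: it takes \<open>b\<close> rounds, against a total of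
  order \<open>b * u * log u\<close>.\<close>

definition bcom :: com where
  "bcom = Vb ::= N 0 ;; While (V Vb \<otimes> V Vb) (V Vn \<otimes> V Vlg) (Vb ::= V Vb \<oplus> N 1)"

lemma tri_bcom:
  assumes v: "v Vn = int n" "v Vlg = int l" and B: "int (bl (n * l)) \<le> B" and Q: "Q (v(Vb := int (bl (n * l))), a)"
  shows "tri B lm bcom (v, a) (2 * bl (n * l) + 2) Q"
proof -
  let ?b = "bl (n * l)"
  define Inv where "Inv = (\<lambda>i (s::st). s = (v(Vb := int i), a))"
  have loop: "tri B lm (While (V Vb \<otimes> V Vb) (V Vn \<otimes> V Vlg) (Vb ::= V Vb \<oplus> N 1)) (v(Vb := 0), a) (2 * ?b + 1) Q"
  proof (rule tri_while[where Inv = Inv and n = ?b and t = "\<lambda>_. 1"])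
    fix i s' assume i: "i < ?b" and "Inv i s'"
    then have s': "s' = (v(Vb := int i), a)" by (simp add: Inv_def)
    have le: "int (i * i) < int (n * l)" using bl_less[OF i] by (simp only: of_nat_less_iff)
    have "tri B lm (Vb ::= V Vb \<oplus> N 1) s' 1 (Inv (Suc i))" unfolding s'
      by (rule tri_assign) (use i B in \<open>auto simp: Inv_def add.commute\<close>)
    then show "eok lm (V Vb \<otimes> V Vb) s' \<and> eok lm (V Vn \<otimes> V Vlg) s' \<and> aval (V Vb \<otimes> V Vb) s' < aval (V Vn \<otimes> V Vlg) s' \<and>
      tri B lm (Vb ::= V Vb \<oplus> N 1) s' 1 (Inv (Suc i))" using le v unfolding s' by simp
  next
    fix s' assume "Inv ?b s'"
    then have s': "s' = (v(Vb := int ?b), a)" by (simp add: Inv_def)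
    have "int (n * l) \<le> int (?b * ?b)" using bl_ge[of "n * l"] by (simp only: of_nat_le_iff)
    then show "eok lm (V Vb \<otimes> V Vb) s' \<and> eok lm (V Vn \<otimes> V Vlg) s' \<and> \<not> aval (V Vb \<otimes> V Vb) s' < aval (V Vn \<otimes> V Vlg) s' \<and> Q s'"
      unfolding s' using v Q by simp
  qed (auto simp: Inv_def)
  have "0 \<le> B" using B by linarith
  then have "tri B lm bcom (v, a) (1 + (2 * ?b + 1)) Q" unfolding bcom_def
    by (intro tri_seq[OF tri_assign order_refl]) (use loop in auto)
  then show ?thesis by (rule tri_conseq) auto
qed

definition spow :: com where
  "spow = Vs ::= V Vtl \<otimes> V Vtl ;; Vs ::= V Vs \<otimes> V Vs ;; Vs ::= V Vs \<otimes> V Vs ;;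
     Vs ::= V Vs \<otimes> V Vs ;; Vs ::= V Vs \<otimes> V Vs"

lemma tri_spow:
  assumes v: "v Vtl = int T" and T: "1 \<le> T" and B: "int T ^ 32 \<le> B" and Q: "Q (v(Vs := int (T ^ 32)), a)"
  shows "tri B lm spow (v, a) 5 Q"
proof -
  have le: "\<bar>int T ^ k\<bar> \<le> B" if "k \<le> 32" for k
  proof -
    have "int T ^ k \<le> int T ^ 32" using T that by (intro power_increasing) auto
    then show ?thesis using B by simp
  qed
  have sq: "tri B lm (Vs ::= V Vs \<otimes> V Vs ;; c) (v(Vs := int T ^ k), a) (1 + t) Q"
    if "tri B lm c (v(Vs := int T ^ (2 * k)), a) t Q" "2 * k \<le> 32" for c k t
    by (rule tri_seq[OF tri_assign order_refl]) (use that le[of "2 * k"] in \<open>auto simp: power_add[symmetric] mult_2\<close>)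
  have 1: "tri B lm (Vs ::= V Vs \<otimes> V Vs) (v(Vs := int T ^ 16), a) 1 Q"
    by (rule tri_assign) (use Q le[of 32] in \<open>auto simp: power_add[symmetric]\<close>)
  have 2: "tri B lm (Vs ::= V Vs \<otimes> V Vs ;; Vs ::= V Vs \<otimes> V Vs) (v(Vs := int T ^ 8), a) (1 + 1) Q"
    by (rule sq) (use 1 in auto)
  have 3: "tri B lm (Vs ::= V Vs \<otimes> V Vs ;; Vs ::= V Vs \<otimes> V Vs ;; Vs ::= V Vs \<otimes> V Vs) (v(Vs := int T ^ 4), a) (1 + (1 + 1)) Q"
    by (rule sq) (use 2 in auto)
  have 4: "tri B lm (Vs ::= V Vs \<otimes> V Vs ;; Vs ::= V Vs \<otimes> V Vs ;; Vs ::= V Vs \<otimes> V Vs ;; Vs ::= V Vs \<otimes> V Vs) (v(Vs := int T ^ 2), a) (1 + (1 + (1 + 1))) Q"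
    by (rule sq) (use 3 in auto)
  have "tri B lm spow (v, a) (1 + (1 + (1 + (1 + 1)))) Q" unfolding spow_def
    by (rule tri_seq[OF tri_assign order_refl]) (use 4 v le[of 2] in \<open>auto simp: power2_eq_square\<close>)
  then show ?thesis by (rule tri_conseq) auto
qed

definition classes :: com where
  "classes = Vcl ::= N 0 ;; While (V Vcl) (V Vb) (cls ;; Vcl ::= V Vcl \<oplus> N 1)"

lemma mv_classes [simp]: "mv classes = {Vcnt, Vi, Vm, Vd, Ve, VN, Vh, Vp, Vcl}"
  and ma_classes [simp]: "ma classes = {QS, ZS, XR, YR, XI, YI, BR, BI, ACC}"
  by (auto simp: classes_def)

text \<open>Before class \<open>l\<close> is treated, \<open>ACC\<close> holds the sums of the
  elements with residue below \<open>l\<close>; \<open>sums_union\<close> brings in the next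
  class.\<close>

lemma tri_classes:
  assumes v: "v Vn = int (length xs)" "v Vb = int b" "v Vu = int u" "v Vq = int q" "v Vw = int W"
      "v Vnn = int n" "v Vs = int (T ^ 32)"
    and xs: "\<And>i. i < length xs \<Longrightarrow> a XS i = int (xs ! i)" "distinct xs" "\<And>x. x \<in> set xs \<Longrightarrow> x \<le> u"
    and b: "0 < b" "q = u div b" and W: "2 * q < W" "W = 2 ^ e" and n: "n = 2 ^ hn" "2 * u < n" "n \<le> T" and TL: "T = 2 ^ L"
    and E: "\<And>l. 2 ^ Suc (cl (length (filter (\<lambda>x. x mod b = l) xs))) * W \<le> T"
    and tab: "table_ok T (a GR) (a GI)" and B: "int T ^ 35 \<le> B" "int b \<le> B" and lT: "2 * length xs \<le> T"
    and A: "\<And>i. i < n \<Longrightarrow> a ACC i = ind (i = 0)"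
    and t: "\<And>l. t l = 4 * length xs + 2 ^ Suc (cl (length (filter (\<lambda>x. x mod b = l) xs))) * W *
        (101 * (cl (length (filter (\<lambda>x. x mod b = l) xs)) + 1) * (L + 1)) + n * (90 * (L + 1))"
  shows "tri B lm classes (v, a) ((\<Sum>l<b. t l + 2) + 2)
    (\<lambda>(v', a'). \<forall>i<n. a' ACC i = ind (i \<in> {\<Sum>Y | Y. Y \<subseteq> set xs \<and> \<Sum>Y \<le> u}))"
proof -
  let ?Q = "\<lambda>(v', a'). \<forall>i<n. a' ACC i = ind (i \<in> {\<Sum>Y | Y. Y \<subseteq> set xs \<and> \<Sum>Y \<le> u})"
  let ?b = "cls ;; Vcl ::= V Vcl \<oplus> N 1"
  define P where "P l = {x \<in> set xs. x mod b < l}" for l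
  define A' where "A' l = {\<Sum>Y | Y. Y \<subseteq> P l \<and> \<Sum>Y \<le> u}" for l
  define Inv where "Inv = (\<lambda>l (s::st). fst s Vcl = int l \<and> (\<forall>i<n. snd s ACC i = ind (i \<in> A' l)))"
  have loop: "tri B lm (While (V Vcl) (V Vb) ?b) (v(Vcl := 0), a) ((\<Sum>l<b. t l + 1 + 1) + 1) ?Q"
  proof (rule tri_while[where Inv = Inv and n = b and t = "\<lambda>l. t l + 1"])
    have "A' 0 = {0}" by (auto simp: A'_def P_def)
    then show "Inv 0 (v(Vcl := 0), a)" using A by (simp add: Inv_def)
  next
    fix l s' assume l: "l < b" and I: "Inv l s'" and F: "fr ?b (v(Vcl := 0), a) s'"
    obtain w d where s': "s' = (w, d)" by (cases s')
    let ?ys = "filter (\<lambda>x. x mod b = l) xs"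
    have w: "w Vn = int (length xs)" "w Vb = int b" "w Vu = int u" "w Vq = int q" "w Vw = int W"
      "w Vnn = int n" "w Vs = int (T ^ 32)" "d XS = a XS" "d GR = a GR" "d GI = a GI"
      using F v unfolding s' by (auto simp: fr_def)
    have wl: "w Vcl = int l" and dA: "\<And>i. i < n \<Longrightarrow> d ACC i = ind (i \<in> A' l)" using I unfolding s' Inv_def by auto
    have PS: "P (Suc l) = P l \<union> set ?ys" "P l \<inter> set ?ys = {}" by (auto simp: P_def)
    have AS: "A' (Suc l) = {x + y | x y. x \<in> A' l \<and> y \<in> {\<Sum>Y | Y. Y \<subseteq> set ?ys \<and> \<Sum>Y \<le> u} \<and> x + y \<le> u}"
      unfolding A'_def PS(1) by (rule sums_union[OF _ _ PS(2)]) (auto simp: P_def)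
    have "tri B lm cls (w, d) (t l) (\<lambda>(v', a'). \<forall>i<n. a' ACC i = ind (i \<in> A' (Suc l)))"
      unfolding AS t
      by (rule tri_cls[OF w(1,2) wl w(3-7) _ xs(2,3) b W n TL refl refl refl E _ B(1) lT])
        (use w tab dA xs(1) in \<open>auto simp: A'_def\<close>)
    then have "tri B lm ?b (w, d) (t l + 1) (Inv (Suc l))"
    proof (rule tri_seqI)
      fix s'' assume F': "fr cls (w, d) s''" and Q': "case s'' of (v', a') \<Rightarrow> \<forall>i<n. a' ACC i = ind (i \<in> A' (Suc l))"
      obtain w2 d2 where s'': "s'' = (w2, d2)" by (cases s'')
      have w2: "w2 Vcl = int l" using F' wl unfolding s'' by (auto simp: fr_def)
      show "tri B lm (Vcl ::= V Vcl \<oplus> N 1) s'' 1 (Inv (Suc l))" unfolding s''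
        by (rule tri_assign) (use w2 Q' l B in \<open>auto simp: Inv_def s''\<close>)
    qed simp
    then show "eok lm (V Vcl) s' \<and> eok lm (V Vb) s' \<and> aval (V Vcl) s' < aval (V Vb) s' \<and> tri B lm ?b s' (t l + 1) (Inv (Suc l))"
      unfolding s' using w wl l by simp
  next
    fix s' assume I: "Inv b s'" and F: "fr ?b (v(Vcl := 0), a) s'"
    have "fst s' Vb = int b" using F v by (auto simp: fr_def)
    moreover have "P b = set xs" using b(1) by (auto simp: P_def)
    ultimately show "eok lm (V Vcl) s' \<and> eok lm (V Vb) s' \<and> \<not> aval (V Vcl) s' < aval (V Vb) s' \<and> ?Q s'"
      using I by (auto simp: Inv_def A'_def)
  qed simp
  have "tri B lm classes (v, a) (1 + ((\<Sum>l<b. t l + 1 + 1) + 1)) ?Q" unfolding classes_def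
    by (rule tri_seq[OF tri_assign order_refl]) (use loop B in auto)
  then show ?thesis by (rule tri_conseq) auto
qed

section \<open>Total cost of the classes\<close>

lemma sum_filter_length:
  fixes xs :: "nat list"
  assumes "0 < b"
  shows "(\<Sum>l<b. length (filter (\<lambda>x. x mod b = l) xs)) = length xs"
proof (induction xs)
  case (Cons x xs)
  have "(\<Sum>l<b. length (filter (\<lambda>x. x mod b = l) (x # xs))) =
    (\<Sum>l<b. (if x mod b = l then 1 else 0) + length (filter (\<lambda>x. x mod b = l) xs))" by (intro sum.cong) auto
  also have "\<dots> = (\<Sum>l<b. if x mod b = l then 1 else 0) + length xs" by (simp add: sum.distrib Cons)
  also have "(\<Sum>l<b. if x mod b = l then 1 else 0) = (1::nat)" using assms by (simp add: sum.delta)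
  finally show ?case by simp
qed simp

lemma two_power_cl: "2 ^ cl c \<le> 2 * c + 1"
proof (cases "c = 0")
  case True
  have "cl 0 = 0" using cl_le[of 0 0] by simp
  then show ?thesis using True by simp
next
  case False
  then show ?thesis using cl_upper[of c] by simp
qed

text \<open>Rounding the size of a class up to a power of two costs a factor 2 and an additive
  constant, and the sizes sum to \<open>length xs\<close>. So the block sizes of all classes
  together are at most \<open>4 * length xs + 2 * b\<close> times \<open>W\<close>.\<close>

lemma classes_time:
  fixes xs :: "nat list"
  assumes b: "0 < b"
  shows "(\<Sum>l<b. 4 * length xs + 2 ^ Suc (cl (length (filter (\<lambda>x. x mod b = l) xs))) * W *
      (101 * (cl (length (filter (\<lambda>x. x mod b = l) xs)) + 1) * (L + 1)) + n * (90 * (L + 1)) + 2)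
    \<le> b * (4 * length xs + n * (90 * (L + 1)) + 2) + (4 * length xs + 2 * b) * W * (101 * (cl (length xs + 1) + 1) * (L + 1))"
proof -
  let ?c = "\<lambda>l. length (filter (\<lambda>x. x mod b = l) xs)"
  let ?K = "101 * (cl (length xs + 1) + 1) * (L + 1)"
  have gen: "(\<Sum>l<b. k + f l * W * K) = b * k + (\<Sum>l<b. f l) * W * K" for k K f
    by (simp add: sum.distrib sum_distrib_right)
  have "2 ^ Suc (cl (?c l)) * W * (101 * (cl (?c l) + 1) * (L + 1)) \<le> (4 * ?c l + 2) * W * ?K" for l
  proof (intro mult_le_mono)
    show "2 ^ Suc (cl (?c l)) \<le> 4 * ?c l + 2" using two_power_cl[of "?c l"] by simp
    have "?c l \<le> 2 ^ cl (length xs + 1)" using cl_ge[of "length xs + 1"] length_filter_le[of "\<lambda>x. x mod b = l" xs] by linarith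
    then show "cl (?c l) + 1 \<le> cl (length xs + 1) + 1" using cl_le by simp
  qed auto
  then have "(\<Sum>l<b. 4 * length xs + 2 ^ Suc (cl (?c l)) * W * (101 * (cl (?c l) + 1) * (L + 1)) + n * (90 * (L + 1)) + 2)
    \<le> (\<Sum>l<b. (4 * length xs + n * (90 * (L + 1)) + 2) + (4 * ?c l + 2) * W * ?K)"
    by (intro sum_mono) (simp add: algebra_simps)
  also have "\<dots> = b * (4 * length xs + n * (90 * (L + 1)) + 2) + (\<Sum>l<b. 4 * ?c l + 2) * W * ?K"
    by (rule gen)
  also have "(\<Sum>l<b. 4 * ?c l + 2) = 4 * length xs + 2 * b"
    by (simp only: sum.distrib sum_distrib_left[symmetric] sum_filter_length[OF b]) simp
  finally show ?thesis .
qed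

text \<open>Input element \<open>i\<close> was at address \<open>i + 2\<close>: below 64 that
  register has been saved into \<open>SV\<close>, from 64 on it is still in \<open>RAW\<close>. Both
  loads are evaluated in either case, so the index into \<open>RAW\<close> is multiplied by the same
  indicator, lest it become negative.\<close>

definition xsE :: exp where
  "xsE = isz (V Vi \<oslash> N 62) \<otimes> Ld SV (V Vi \<oplus> N 2) \<oplus>
     nz (V Vi \<oslash> N 62) \<otimes> Ld RAW (nz (V Vi \<oslash> N 62) \<otimes> (V Vi \<ominus> N 62))"

text \<open>The table length \<open>Vtl\<close> is a power of two at least
  \<open>8 * n * W + n2 + 8\<close>, where \<open>n2\<close> is the value of \<open>Vnn\<close>: the
  summands provide for the merges, for the convolutions with \<open>ACC\<close>, and for
  \<open>8 \<le> T\<close> in the error budget. The last fill moves the results from 64 to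
  \<open>u\<close>, and none if \<open>u < 64\<close>.\<close>

definition mainc :: com where
  "mainc = Vn ::= Ld SV (N 0) ;; fill XS (N 0) xsE (V Vn) ;; lgcom ;; bcom ;; Vq ::= V Vu \<oslash> V Vb ;;
     dbl Vw (N 2 \<otimes> V Vq \<oplus> N 1) ;; dbl Vnn (N 2 \<otimes> V Vu \<oplus> N 1) ;;
     dbl Vtl (N 8 \<otimes> V Vn \<otimes> V Vw \<oplus> V Vnn \<oplus> N 8) ;; spow ;; mktab ;;
     fill ACC (N 0) (isz (V Vi)) (V Vnn) ;; classes ;;
     fill SV (N 0) (Ld ACC (V Vi \<odot> V Vnn)) (N 64) ;;
     fill RAW (N 0) (Ld ACC (V Vi \<oplus> N 64)) (nz (V Vu \<oslash> N 64) \<otimes> (V Vu \<ominus> N 63))"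

text \<open>From \<open>n * lg \<le> b * b\<close> and \<open>W \<le> 4 * (u div b) + 2\<close> it
  follows that \<open>n * lg * W\<close> is at most \<open>4 * u * b + 2 * b * b\<close>, and
  \<open>b \<le> n \<le> 2 * u\<close> makes this \<open>O(u * b)\<close>. The choice of
  \<open>b\<close> thus brings the merges down to the cost of the \<open>b\<close> long
  convolutions.\<close>

lemma parameters:
  fixes n u :: nat
  assumes n: "1 \<le> n" "n \<le> u + 1" and u: "1 \<le> u"
    and lg: "lg = cl (n + 1)" and b: "b = bl (n * lg)" and q: "q = u div b"
    and W: "W = 2 ^ cl (2 * q + 1)" and n2: "n2 = 2 ^ cl (2 * u + 1)"
    and L: "L = cl (8 * n * W + n2 + 8)" and T: "T = 2 ^ L"
  shows "1 \<le> b" "b \<le> n" "1 \<le> lg" "lg \<le> b" "2 * q < W" "2 * u < n2" "n2 \<le> 4 * u + 1" "n2 \<le> T" "8 * n * W \<le> T" "8 \<le> T" "T \<le> 160 * (u * b)"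
    "(4 * n + 2 * b) * W * (lg + 1) \<le> 96 * (u * b)"
proof -
  show lg1: "1 \<le> lg"
  proof (rule ccontr)
    assume "\<not> 1 \<le> lg"
    then have "lg = 0" by simp
    then show False using cl_ge[of "n + 1"] n(1) lg by simp
  qed
  have lgn: "lg \<le> n" unfolding lg by (rule cl_le) (use less_exp[of n] in linarith)
  show b1: "1 \<le> b"
  proof (rule ccontr)
    assume "\<not> 1 \<le> b"
    then have "b = 0" by simp
    then show False using bl_ge[of "n * lg"] n(1) lg1 b by simp
  qed
  show bn: "b \<le> n" unfolding b by (rule bl_le) (use lgn in simp)
  have nb: "n * lg \<le> b * b" unfolding b by (rule bl_ge)
  show lb: "lg \<le> b"
  proof (rule ccontr)
    assume "\<not> lg \<le> b"
    then have "b * b < lg * lg" by (intro mult_strict_mono) auto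
    also have "\<dots> \<le> n * lg" using lgn by simp
    finally show False using nb by simp
  qed
  have bu: "b \<le> 2 * u" using bn n(2) u by linarith
  have qb: "q * b \<le> u" unfolding q by simp
  show "2 * q < W" using cl_ge[of "2 * q + 1"] W by linarith
  show "2 * u < n2" using cl_ge[of "2 * u + 1"] n2 by linarith
  have W4: "W \<le> 4 * q + 2" using cl_upper[of "2 * q + 1"] W by simp
  show n24: "n2 \<le> 4 * u + 1" using cl_upper[of "2 * u + 1"] n2 by simp
  have TE: "8 * n * W + n2 + 8 \<le> T" unfolding T L by (rule cl_ge)
  then show "n2 \<le> T" "8 * n * W \<le> T" "8 \<le> T" by linarith+
  have bbW: "b * b * W \<le> 8 * (u * b)"
  proof -
    have "b * b * W \<le> b * b * (4 * q + 2)" using W4 by (rule mult_le_mono2)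
    also have "\<dots> = 4 * ((q * b) * b) + 2 * (b * b)" by (simp add: algebra_simps)
    also have "(q * b) * b \<le> u * b" using qb by (rule mult_le_mono1)
    also have "b * b \<le> (2 * u) * b" using bu by (rule mult_le_mono1)
    finally show ?thesis by simp
  qed
  have nlW: "n * lg * W \<le> 8 * (u * b)" using mult_le_mono1[OF nb, of W] bbW by linarith
  have blW: "b * lg * W \<le> 8 * (u * b)"
  proof -
    have "b * lg * W \<le> b * b * W" using lb by simp
    then show ?thesis using bbW by linarith
  qed
  have nW: "n * W \<le> 8 * (u * b)"
  proof -
    have "n * W * 1 \<le> n * W * lg" using lg1 by (rule mult_le_mono2)
    also have "\<dots> = n * lg * W" by simp
    finally show ?thesis using nlW by linarith
  qed
  have ub: "u \<le> u * b" "1 \<le> u * b" using b1 u by auto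
  have "T < 2 * (8 * n * W + n2 + 8)" unfolding T L by (rule cl_upper) simp
  then have "T \<le> 16 * (n * W) + 2 * n2 + 16" by simp
  then show "T \<le> 160 * (u * b)" using nW n24 ub by linarith
  have "(4 * n + 2 * b) * W * (lg + 1) \<le> (4 * n + 2 * b) * W * (2 * lg)" using lg1 by (intro mult_le_mono2) simp
  also have "\<dots> = 8 * (n * lg * W) + 4 * (b * lg * W)" by (simp add: algebra_simps)
  finally show "(4 * n + 2 * b) * W * (lg + 1) \<le> 96 * (u * b)" using nlW blW by linarith
qed

text \<open>All terms are of order \<open>u * b * (L + 1)\<close>. Building the table contributes a
  multiple of \<open>L * L\<close>, which is harmless by
  \<open>L \<le> T \<le> 160 * (u * b)\<close>; 60000 generously covers the sum of the
  constants.\<close>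

lemma total_time:
  fixes n u :: nat
  assumes n: "1 \<le> n" "n \<le> u + 1" and u: "1 \<le> u"
    and lg: "lg = cl (n + 1)" and b: "b = bl (n * lg)" and q: "q = u div b"
    and W: "W = 2 ^ cl (2 * q + 1)" and n2: "n2 = 2 ^ cl (2 * u + 1)"
    and L: "L = cl (8 * n * W + n2 + 8)" and T: "T = 2 ^ L"
    and S: "S \<le> b * (4 * n + n2 * (90 * (L + 1)) + 2) + (4 * n + 2 * b) * W * (101 * (lg + 1) * (L + 1))"
  shows "1 + (3 * n + 2 + (3 * lg + 3 + (2 * b + 2 + (1 + (2 * cl (2 * q + 1) + 2 + (2 * cl (2 * u + 1) + 2 + (2 * L + 2 +
    (5 + (6 * T + L * (192 * L + 22) + 6 + (3 * n2 + 2 + (S + 2 + (194 + (3 * u + 2)))))))))))))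
    \<le> 60000 * (u * b * (L + 1))"
proof -
  note p = parameters[OF n u lg b q W n2 L T]
  define X where "X = u * b * (L + 1)"
  have ubX: "u * b \<le> X" by (simp add: X_def)
  have b1: "1 \<le> b" by (rule p(1))
  have u': "u \<le> u * b" and b': "b \<le> u * b" using b1 u by auto
  have X1: "1 \<le> X" "u \<le> X" "b \<le> X" using ubX u' b' u by linarith+
  have LX: "L + 1 \<le> X" unfolding X_def using mult_le_mono1[of 1 "u * b" "L + 1"] u' u by simp
  have qu: "q \<le> u" unfolding q by simp
  have LT: "L * L \<le> 160 * X"
  proof -
    have "L \<le> T" unfolding T using less_exp[of L] by linarith
    then have "L * L \<le> L * (160 * (u * b))" using p(11) by (intro mult_le_mono2) linarith
    also have "\<dots> \<le> 160 * X" by (simp add: X_def algebra_simps)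
    finally show ?thesis .
  qed
  have Sb: "S \<le> 11000 * X"
  proof -
    have "b * n \<le> 2 * (u * b)" using mult_le_mono1[of n "2 * u" b] n u by (simp add: mult.commute mult.left_commute)
    then have s1: "b * (4 * n) \<le> 8 * X" using ubX by linarith
    have "b * (n2 * (90 * (L + 1))) = 90 * (n2 * (b * (L + 1)))" by (simp add: algebra_simps)
    also have "\<dots> \<le> 90 * ((5 * u) * (b * (L + 1)))" using p(7) u by (intro mult_le_mono2 mult_le_mono1) linarith
    also have "\<dots> = 450 * X" by (simp add: X_def algebra_simps)
    finally have s2: "b * (n2 * (90 * (L + 1))) \<le> 450 * X" .
    have "(4 * n + 2 * b) * W * (101 * (lg + 1) * (L + 1)) = 101 * ((4 * n + 2 * b) * W * (lg + 1) * (L + 1))" by (simp add: algebra_simps)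
    also have "\<dots> \<le> 101 * (96 * (u * b) * (L + 1))" using p(12) by (intro mult_le_mono2 mult_le_mono1)
    also have "\<dots> = 9696 * X" by (simp add: X_def algebra_simps)
    finally have s3: "(4 * n + 2 * b) * W * (101 * (lg + 1) * (L + 1)) \<le> 9696 * X" .
    have "b * (4 * n + n2 * (90 * (L + 1)) + 2) = b * (4 * n) + b * (n2 * (90 * (L + 1))) + 2 * b" by (simp add: algebra_simps)
    then show ?thesis using S s1 s2 s3 X1 by linarith
  qed
  have c: "cl (2 * q + 1) \<le> 3 * X" "cl (2 * u + 1) \<le> 3 * X"
    using cl_le_self[of "2 * q + 1"] cl_le_self[of "2 * u + 1"] qu X1 by linarith+
  have LL: "L * (192 * L + 22) = 192 * (L * L) + 22 * L" by (simp add: algebra_simps)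
  show ?thesis unfolding X_def[symmetric] LL using Sb c LT LX X1 ubX n p(4,7,11) by linarith
qed

lemma aval_xsE:
  assumes s: "fst s Vi = int i" and i: "i < n" and sv: "\<And>j. 2 \<le> j \<Longrightarrow> j < 64 \<Longrightarrow> j - 2 < n \<Longrightarrow> snd s SV j = f (j - 2)"
    and raw: "\<And>j. j + 62 < n \<Longrightarrow> snd s RAW j = f (j + 62)" and lm: "int n \<le> lm + 62" "0 < lm"
  shows "aval xsE s = f i" "eok lm xsE s"
proof -
  have c: "int i div 62 = 0 \<longleftrightarrow> i < 62"
  proof -
    have "int i div 62 = int (i div 62)" by (simp add: zdiv_int)
    also have "\<dots> = 0 \<longleftrightarrow> i div 62 = 0" by simp
    also have "\<dots> \<longleftrightarrow> i < 62" by (auto simp: div_eq_0_iff)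
    finally show ?thesis .
  qed
  show "aval xsE s = f i"
  proof (cases "i < 62")
    case True
    have "nat (int i + 2) = i + 2" by simp
    then show ?thesis using True s c sv[of "i + 2"] i by (simp add: xsE_def)
  next
    case False
    have "nat (int i - 62) = i - 62" by simp
    then show ?thesis using False s c raw[of "i - 62"] i by (simp add: xsE_def)
  qed
  show "eok lm xsE s" unfolding xsE_def using s c i lm by (auto simp: idx_ok_def)
qed

lemma tri_mainc:
  assumes u: "1 \<le> u" and n: "n = length xs" "1 \<le> n" "distinct xs" "\<And>x. x \<in> set xs \<Longrightarrow> x \<le> u"
    and lg: "lg = cl (n + 1)" and b: "b = bl (n * lg)" and q: "q = u div b"
    and W: "W = 2 ^ cl (2 * q + 1)" and n2: "n2 = 2 ^ cl (2 * u + 1)"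
    and L: "L = cl (8 * n * W + n2 + 8)" and T: "T = 2 ^ L"
    and v: "v Vu = int u" and sv0: "a SV 0 = int n"
    and sv: "\<And>j. 2 \<le> j \<Longrightarrow> j < 64 \<Longrightarrow> j - 2 < n \<Longrightarrow> a SV j = int (xs ! (j - 2))"
    and raw: "\<And>j. j + 62 < n \<Longrightarrow> a RAW j = int (xs ! (j + 62))"
    and lm: "int n \<le> lm + 62" "0 < lm" "int u \<le> lm + 63" and B: "2 * int T ^ 64 \<le> B" "64 \<le> B"
    and SS: "SS = {\<Sum>Y | Y. Y \<subseteq> set xs \<and> \<Sum>Y \<le> u}"
  shows "tri B lm mainc (v, a) (60000 * (u * b * (L + 1))) (\<lambda>(v', a').
    (\<forall>i<64. i \<le> u \<longrightarrow> a' SV i = ind (i \<in> SS)) \<and> (\<forall>i. 64 \<le> i \<longrightarrow> i \<le> u \<longrightarrow> a' RAW (i - 64) = ind (i \<in> SS)))"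
proof -
  have nu: "n \<le> u + 1"
  proof -
    have "set xs \<subseteq> {0..u}" using n(4) by auto
    then have "card (set xs) \<le> card {0..u}" by (intro card_mono) auto
    then show ?thesis using distinct_card[OF n(3)] n(1) by simp
  qed
  note p = parameters[OF n(2) nu u lg b q W n2 L T]
  have T64: "int T ^ 64 \<le> B" "int T ^ 35 \<le> B" "int T ^ 32 \<le> B" "2 * int T \<le> B"
  proof -
    have T1: "1 \<le> int T" using p(10) by linarith
    then have "1 \<le> int T ^ 64" by (rule one_le_power)
    then show t: "int T ^ 64 \<le> B" using B(1) by linarith
    have "int T ^ 35 \<le> int T ^ 64" "int T ^ 32 \<le> int T ^ 64"
      using T1 by (intro power_increasing; simp)+
    then show "int T ^ 35 \<le> B" "int T ^ 32 \<le> B" using t by linarith+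
    have "int T \<le> int T ^ 64" using T1 by (intro self_le_power) auto
    then show "2 * int T \<le> B" using B(1) by linarith
  qed
  have dT: "2 * int x \<le> B" if "x \<le> T" for x
  proof -
    have "int x \<le> int T" using that by simp
    then show ?thesis using T64(4) by linarith
  qed
  have W1: "1 \<le> W" using p(5) by linarith
  have nT: "8 * n \<le> T"
  proof -
    have "8 * n * 1 \<le> 8 * n * W" using W1 by (rule mult_le_mono2)
    then show ?thesis using p(9) by linarith
  qed
  have qu: "q \<le> u" unfolding q by simp
  have EE: "8 * n * W + n2 + 8 \<le> T" unfolding T L by (rule cl_ge)
  let ?Q = "\<lambda>(v', a'). (\<forall>i<64. i \<le> u \<longrightarrow> a' SV i = ind (i \<in> SS)) \<and> (\<forall>i. 64 \<le> i \<longrightarrow> i \<le> u \<longrightarrow> a' RAW (i - 64) = ind (i \<in> SS))"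
  have indB: "\<bar>ind x\<bar> \<le> B" for x using B(2) by (simp add: ind_def)
  let ?c1 = "fill RAW (N 0) (Ld ACC (V Vi \<oplus> N 64)) (nz (V Vu \<oslash> N 64) \<otimes> (V Vu \<ominus> N 63))"
  have q1: "tri B lm ?c1 (w, d) (3 * u + 2) ?Q"
    if w: "w Vu = int u" and d: "\<And>i. i < n2 \<Longrightarrow> d ACC i = ind (i \<in> SS)" "\<And>i. i < 64 \<Longrightarrow> i \<le> u \<Longrightarrow> d SV i = ind (i \<in> SS)" for w d
  proof -
    define k where "k = u - 63"
    have ku: "k \<le> u" by (simp add: k_def)
    have c: "int u div 64 = 0 \<longleftrightarrow> u < 64"
    proof -
      have "int u div 64 = int (u div 64)" by (simp add: zdiv_int)
      also have "\<dots> = 0 \<longleftrightarrow> u div 64 = 0" by simp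
      also have "\<dots> \<longleftrightarrow> u < 64" by (auto simp: div_eq_0_iff)
      finally show ?thesis .
    qed
    have kv: "(if int u div 64 = 0 then 0 else 1) * (int u - 63) = int k" unfolding c by (auto simp: k_def)
    have "tri B lm ?c1 (w, d) (3 * k + 2) ?Q"
    proof (rule tri_fill[where f = "\<lambda>i. ind (i + 64 \<in> SS)" and n = k and off = 0])
      fix i assume i: "i < k"
      have "nat (int i + 64) = i + 64" by simp
      then show "aval (Ld ACC (V Vi \<oplus> N 64)) (w(Vi := int i), d(RAW := mix 0 i (\<lambda>i. ind (i + 64 \<in> SS)) (d RAW))) = ind (i + 64 \<in> SS)"
        using d(1)[of "i + 64"] i p(6) by (simp add: k_def)
    next
      show "?Q (w(Vi := int k), d(RAW := mix 0 k (\<lambda>i. ind (i + 64 \<in> SS)) (d RAW)))"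
        using d(2) by (auto simp: mix_def k_def)
      show "RAW = RAW \<longrightarrow> int (0 + k) \<le> lm" using lm by (auto simp: k_def)
      show "aval (nz (V Vu \<oslash> N 64) \<otimes> (V Vu \<ominus> N 63)) (w(Vi := int i), d(RAW := mix 0 i (\<lambda>i. ind (i + 64 \<in> SS)) (d RAW))) = int k" for i
        using kv w by simp
      show "int k \<le> B" using ku p(6,8) T64(4) by linarith
    qed (use B indB in \<open>auto simp: idx_ok_def\<close>)
    then show ?thesis by (rule tri_conseq) (use ku in auto)
  qed
  let ?c2 = "fill SV (N 0) (Ld ACC (V Vi \<odot> V Vnn)) (N 64) ;; ?c1"
  have q2: "tri B lm ?c2 (w, d) (194 + (3 * u + 2)) ?Q"
    if w: "w Vu = int u" "w Vnn = int n2" and d: "\<And>i. i < n2 \<Longrightarrow> d ACC i = ind (i \<in> SS)" for w d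
  proof -
    \<comment> \<open>Always 64 cells of \<open>SV\<close> are filled, possibly more than
      \<open>n2\<close>. The remainder keeps the reads inside the computed part of
      \<open>ACC\<close> and has no effect for \<open>i \<le> u < n2\<close>.\<close>
    have m: "i mod n2 < n2" for i using p(6) by simp
    have "tri B lm ?c2 (w, d) (3 * 64 + 2 + (3 * u + 2)) ?Q"
    proof (rule tri_seq[OF tri_fill[where f = "\<lambda>i. ind (i mod n2 \<in> SS)" and n = 64 and off = 0] order_refl])
      show "tri B lm ?c1 (w(Vi := int 64), d(SV := mix 0 64 (\<lambda>i. ind (i mod n2 \<in> SS)) (d SV))) (3 * u + 2) ?Q"
        by (rule q1) (use w d p(6) in \<open>auto simp: mix_def\<close>)
      fix i :: nat
      have "nat (int i mod int n2) = i mod n2" by (simp flip: of_nat_mod)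
      then show "aval (Ld ACC (V Vi \<odot> V Vnn)) (w(Vi := int i), d(SV := mix 0 i (\<lambda>i. ind (i mod n2 \<in> SS)) (d SV))) = ind (i mod n2 \<in> SS)"
        using w d[OF m] by simp
      show "eok lm (Ld ACC (V Vi \<odot> V Vnn)) (w(Vi := int i), d(SV := mix 0 i (\<lambda>i. ind (i mod n2 \<in> SS)) (d SV)))"
        using w p(6) by (simp add: idx_ok_def)
    qed (use B indB in auto)
    then show ?thesis by simp
  qed
  define tl where "tl l = 4 * length xs + 2 ^ Suc (cl (length (filter (\<lambda>x. x mod b = l) xs))) * W *
        (101 * (cl (length (filter (\<lambda>x. x mod b = l) xs)) + 1) * (L + 1)) + n2 * (90 * (L + 1))" for l
  define S where "S = (\<Sum>l<b. tl l + 2)"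
  define ok where "ok = (\<lambda>s :: st. fst s Vn = int n \<and> fst s Vb = int b \<and> fst s Vu = int u \<and> fst s Vq = int q \<and> fst s Vw = int W \<and>
     fst s Vnn = int n2 \<and> fst s Vtl = int T \<and> fst s Vs = int (T ^ 32) \<and> (\<forall>i<n. snd s XS i = int (xs ! i)))"
  let ?c3 = "classes ;; ?c2"
  have q3: "tri B lm ?c3 (w, d) (S + 2 + (194 + (3 * u + 2))) ?Q"
    if w: "ok (w, d)" "table_ok T (d GR) (d GI)" and d: "\<And>i. i < n2 \<Longrightarrow> d ACC i = ind (i = 0)" for w d
    unfolding S_def
  proof (rule tri_seqI[OF tri_classes[where n = n2 and u = u and q = q and W = W and T = T and xs = xs and b = b and L = L]])
    fix s' assume F: "fr classes (w, d) s'"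
      and P: "case s' of (v', a') \<Rightarrow> \<forall>i<n2. a' ACC i = ind (i \<in> {\<Sum>Y | Y. Y \<subseteq> set xs \<and> \<Sum>Y \<le> u})"
    obtain w2 d2 where s': "s' = (w2, d2)" by (cases s')
    show "tri B lm ?c2 s' (194 + (3 * u + 2)) ?Q" unfolding s'
      by (rule q2) (use F P w in \<open>auto simp: fr_def ok_def s' SS\<close>)
  next
    show "2 ^ Suc (cl (length (filter (\<lambda>x. x mod b = l) xs))) * W \<le> T" for l
    proof -
      let ?c = "length (filter (\<lambda>x. x mod b = l) xs)"
      have "?c \<le> n" unfolding n(1) by (rule length_filter_le)
      then have "2 ^ Suc (cl ?c) \<le> 8 * n" using two_power_cl[of ?c] n(2) by simp
      then have "2 ^ Suc (cl ?c) * W \<le> 8 * n * W" by (rule mult_le_mono1)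
      then show ?thesis using p(9) by linarith
    qed
    show "int b \<le> B" using p(2) nT T64(4) by linarith
    show "2 * length xs \<le> T" using nT n(1) by linarith
    show "W = 2 ^ cl (2 * q + 1)" by (rule W)
    show "n2 = 2 ^ cl (2 * u + 1)" by (rule n2)
    show "0 < b" using p(1) by simp
  qed (use w d n p T T64 q in \<open>auto simp: ok_def tl_def\<close>)
  let ?T3 = "S + 2 + (194 + (3 * u + 2))"
  let ?c4 = "fill ACC (N 0) (isz (V Vi)) (V Vnn) ;; ?c3"
  have q4: "tri B lm ?c4 (w, d) (3 * n2 + 2 + ?T3) ?Q" if w: "ok (w, d)" "table_ok T (d GR) (d GI)" for w d
  proof (rule tri_seq[OF tri_fill[where f = "\<lambda>i. ind (i = 0)" and n = n2 and off = 0] order_refl])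
    show "tri B lm ?c3 (w(Vi := int n2), d(ACC := mix 0 n2 (\<lambda>i. ind (i = 0)) (d ACC))) ?T3 ?Q"
      by (rule q3) (use w in \<open>auto simp: ok_def mix_def\<close>)
    show "int n2 \<le> B" using p(8) T64(4) by linarith
  qed (use w B indB in \<open>auto simp: ok_def ind_def\<close>)
  let ?T4 = "3 * n2 + 2 + ?T3"
  let ?c5 = "mktab ;; ?c4"
  have q5: "tri B lm ?c5 (w, d) (6 * T + L * (192 * L + 22) + 6 + ?T4) ?Q" if w: "ok (w, d)" for w d
  proof (rule tri_seqI[OF tri_mktab[OF T p(10)]])
    fix s' assume F: "fr mktab (w, d) s'" and P: "case s' of (v', a') \<Rightarrow> table_ok T (a' GR) (a' GI)"
    obtain w2 d2 where s': "s' = (w2, d2)" by (cases s')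
    show "tri B lm ?c4 s' ?T4 ?Q" unfolding s'
      by (rule q4) (use F P w in \<open>auto simp: fr_def ok_def s'\<close>)
  qed (use w T64 in \<open>auto simp: ok_def\<close>)
  let ?T5 = "6 * T + L * (192 * L + 22) + 6 + ?T4"
  define a' where "a' = a(XS := mix 0 n (\<lambda>i. int (xs ! i)) (a XS))"
  have xsa: "\<forall>i<n. a' XS i = int (xs ! i)" by (simp add: a'_def mix_def)
  let ?c6 = "spow ;; ?c5"
  have q6: "tri B lm ?c6 (w, a') (5 + ?T5) ?Q"
    if w: "w Vn = int n" "w Vb = int b" "w Vu = int u" "w Vq = int q" "w Vw = int W" "w Vnn = int n2" "w Vtl = int T" for w
  proof (rule tri_seq[OF tri_spow[where T = T] order_refl])
    show "tri B lm ?c5 (w(Vs := int (T ^ 32)), a') ?T5 ?Q"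
      by (rule q5) (use w xsa in \<open>auto simp: ok_def\<close>)
  qed (use w T64 p(10) in auto)
  let ?c7 = "dbl Vtl (N 8 \<otimes> V Vn \<otimes> V Vw \<oplus> V Vnn \<oplus> N 8) ;; ?c6"
  have q7: "tri B lm ?c7 (w, a') (2 * L + 2 + (5 + ?T5)) ?Q"
    if w: "w Vn = int n" "w Vb = int b" "w Vu = int u" "w Vq = int q" "w Vw = int W" "w Vnn = int n2" for w
    unfolding L
  proof (rule tri_seq[OF tri_dbl[where E = "8 * n * W + n2 + 8"] order_refl])
    show "tri B lm ?c6 (w(Vtl := int (2 ^ cl (8 * n * W + n2 + 8))), a') (5 + (6 * T + cl (8 * n * W + n2 + 8) * (192 * cl (8 * n * W + n2 + 8) + 22) + 6 + ?T4)) ?Q"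
      using q6[of "w(Vtl := int T)"] w unfolding T L by simp
    show "2 * int (8 * n * W + n2 + 8) \<le> B" by (rule dT[OF EE])
  qed (use w B in auto)
  let ?c8 = "dbl Vnn (N 2 \<otimes> V Vu \<oplus> N 1) ;; ?c7"
  have q8: "tri B lm ?c8 (w, a') (2 * cl (2 * u + 1) + 2 + (2 * L + 2 + (5 + ?T5))) ?Q"
    if w: "w Vn = int n" "w Vb = int b" "w Vu = int u" "w Vq = int q" "w Vw = int W" for w
  proof (rule tri_seq[OF tri_dbl[where E = "2 * u + 1"] order_refl])
    show "tri B lm ?c7 (w(Vnn := int (2 ^ cl (2 * u + 1))), a') (2 * L + 2 + (5 + ?T5)) ?Q"
      by (rule q7) (use w n2 in auto)
    show "2 * int (2 * u + 1) \<le> B" by (rule dT) (use p(6,8) in linarith)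
  qed (use w B in auto)
  let ?T8 = "2 * cl (2 * u + 1) + 2 + (2 * L + 2 + (5 + ?T5))"
  let ?c9 = "dbl Vw (N 2 \<otimes> V Vq \<oplus> N 1) ;; ?c8"
  have q9: "tri B lm ?c9 (w, a') (2 * cl (2 * q + 1) + 2 + ?T8) ?Q"
    if w: "w Vn = int n" "w Vb = int b" "w Vu = int u" "w Vq = int q" for w
  proof (rule tri_seq[OF tri_dbl[where E = "2 * q + 1"] order_refl])
    show "tri B lm ?c8 (w(Vw := int (2 ^ cl (2 * q + 1))), a') ?T8 ?Q"
      by (rule q8) (use w W in auto)
    show "2 * int (2 * q + 1) \<le> B" by (rule dT) (use p(6,8) qu in linarith)
  qed (use w B in auto)
  let ?T9 = "2 * cl (2 * q + 1) + 2 + ?T8"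
  let ?c10 = "Vq ::= V Vu \<oslash> V Vb ;; ?c9"
  have q10: "tri B lm ?c10 (w, a') (1 + ?T9) ?Q"
    if w: "w Vn = int n" "w Vb = int b" "w Vu = int u" for w
  proof (rule tri_seq[OF tri_assign order_refl])
    have e: "aval (V Vu \<oslash> V Vb) (w, a') = int q" using w q by (simp add: zdiv_int)
    show "tri B lm ?c9 (w(Vq := aval (V Vu \<oslash> V Vb) (w, a')), a') ?T9 ?Q" unfolding e by (rule q9) (use w in auto)
    show "\<bar>aval (V Vu \<oslash> V Vb) (w, a')\<bar> \<le> B" unfolding e using p(6,8) qu T64(4) by linarith
  qed simp
  let ?c11 = "bcom ;; ?c10"
  have q11: "tri B lm ?c11 (w, a') (2 * b + 2 + (1 + ?T9)) ?Q"
    if w: "w Vn = int n" "w Vlg = int lg" "w Vu = int u" for w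
  proof -
    have bB: "int (bl (n * lg)) \<le> B" using p(2) nT T64(4) b by linarith
    have "tri B lm bcom (w, a') (2 * bl (n * lg) + 2) (\<lambda>s. tri B lm ?c10 s (1 + ?T9) ?Q)"
    proof (rule tri_bcom[where v = w and n = n and l = lg, OF _ _ bB])
      show "w Vn = int n" "w Vlg = int lg" by (rule w)+
      show "tri B lm ?c10 (w(Vb := int (bl (n * lg))), a') (1 + ?T9) ?Q" by (rule q10) (use w b in auto)
    qed
    then have "tri B lm bcom (w, a') (2 * b + 2) (\<lambda>s. tri B lm ?c10 s (1 + ?T9) ?Q)" using b by simp
    then show ?thesis by (rule tri_seq) simp
  qed
  let ?c12 = "lgcom ;; ?c11"
  have q12: "tri B lm ?c12 (w, a') (3 * lg + 3 + (2 * b + 2 + (1 + ?T9))) ?Q"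
    if w: "w Vn = int n" "w Vu = int u" for w
  proof -
    have "tri B lm lgcom (w, a') (3 * cl (n + 1) + 3) (\<lambda>s. tri B lm ?c11 s (2 * b + 2 + (1 + ?T9)) ?Q)"
    proof (rule tri_lgcom[where v = w and n = n])
      show "w Vn = int n" by (rule w(1))
      show "2 * int n + 2 \<le> B" using nT n(2) T64(4) by linarith
      show "tri B lm ?c11 (w(Vpw := int (2 ^ cl (n + 1)), Vlg := int (cl (n + 1))), a') (2 * b + 2 + (1 + ?T9)) ?Q"
        by (rule q11) (use w lg in auto)
    qed
    then have "tri B lm lgcom (w, a') (3 * lg + 3) (\<lambda>s. tri B lm ?c11 s (2 * b + 2 + (1 + ?T9)) ?Q)" using lg by simp
    then show ?thesis by (rule tri_seq) simp
  qed
  let ?T12 = "3 * lg + 3 + (2 * b + 2 + (1 + ?T9))"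
  have nB: "int n \<le> B" using nT T64(4) by linarith
  have q13: "tri B lm (fill XS (N 0) xsE (V Vn) ;; ?c12) (v(Vn := int n), a) (3 * n + 2 + ?T12) ?Q"
  proof (rule tri_seq[OF tri_fill[where f = "\<lambda>i. int (xs ! i)" and n = n and off = 0] order_refl])
    show "tri B lm ?c12 (v(Vn := int n, Vi := int n), a(XS := mix 0 n (\<lambda>i. int (xs ! i)) (a XS))) ?T12 ?Q"
      unfolding a'_def[symmetric] by (rule q12) (use v in auto)
    fix i assume i: "i < n"
    let ?s = "(v(Vn := int n, Vi := int i), a(XS := mix 0 i (\<lambda>i. int (xs ! i)) (a XS)))"
    have "fst ?s Vi = int i" by simp
    then show "aval xsE ?s = int (xs ! i)" "eok lm xsE ?s"
      using aval_xsE[OF _ i, of ?s "\<lambda>i. int (xs ! i)" lm] sv raw lm by simp_all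
    have "xs ! i \<le> u" using n(1,4) i by simp
    then show "\<bar>int (xs ! i)\<bar> \<le> B" using p(6,8) T64(4) by linarith
  qed (use nB B in auto)
  have q14: "tri B lm mainc (v, a) (1 + (3 * n + 2 + ?T12)) ?Q" unfolding mainc_def
    by (rule tri_seq[OF tri_assign order_refl]) (use q13 sv0 nB in \<open>auto simp: idx_ok_def\<close>)
  have Sb: "S \<le> b * (4 * n + n2 * (90 * (L + 1)) + 2) + (4 * n + 2 * b) * W * (101 * (lg + 1) * (L + 1))"
    unfolding S_def tl_def using classes_time[of b xs W L n2] p(1) unfolding n(1)[symmetric] lg[symmetric] by simp
  show ?thesis
  proof (rule tri_conseq[OF q14])
    show "1 + (3 * n + 2 + ?T12) \<le> 60000 * (u * b * (L + 1))"
      by (rule total_time[OF n(2) nu u lg b q W n2 L T Sb])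
  qed
qed

subsection \<open>The running time in closed form\<close>

lemma ln_ge_1: "1 \<le> ln (real k + 2)" if "1 \<le> k"
proof -
  have "exp 1 \<le> real k + 2" using exp_le that by simp
  then show ?thesis using that by (simp add: ln_ge_iff)
qed

lemma half_le_ln_2: "1 / 2 \<le> ln (2::real)"
proof -
  have "1 \<le> ln (real 2 + 2)" by (rule ln_ge_1) simp
  also have "real 2 + 2 = 2 ^ 2" by simp
  also have "ln ((2::real) ^ 2) = 2 * ln 2" using ln_realpow[of 2 2] by simp
  finally show ?thesis by simp
qed

text \<open>The factor 2 is an upper bound for \<open>1 / ln 2\<close>, by
  \<open>half_le_ln_2\<close>.\<close>

lemma le_of_two_power_le:
  assumes "2 ^ k \<le> (x::real)"
  shows "real k \<le> 2 * ln x"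
proof -
  have "0 < (2::real) ^ k" by simp
  then have "ln ((2::real) ^ k) \<le> ln x" using assms by (intro ln_mono) auto
  then have "real k * ln 2 \<le> ln x" by (simp add: ln_realpow)
  moreover have "real k * (1 / 2) \<le> real k * ln 2" using half_le_ln_2 by (intro mult_left_mono) auto
  ultimately show ?thesis by linarith
qed

text \<open>The first claim comes from \<open>b \<le> 3 * s\<close> and
  \<open>L + 1 \<le> 323 * lam\<close>, whence the constant
  \<open>60000 * 3 * 323 = 58140000\<close>, rounded up. The second claim is what bounds the
  memory.\<close>

lemma time_bound:
  assumes n: "1 \<le> n" "n \<le> u + 1" and u: "1 \<le> u"
    and lg: "lg = cl (n + 1)" and b: "b = bl (n * lg)" and q: "q = u div b"
    and W: "W = 2 ^ cl (2 * q + 1)" and n2: "n2 = 2 ^ cl (2 * u + 1)"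
    and L: "L = cl (8 * n * W + n2 + 8)" and T: "T = 2 ^ L"
  shows "real (60000 * (u * b * (L + 1))) \<le> 60000000 * (sqrt (real n * ln (real n + 2)) * real u * ln (real u + 2))"
    "int T \<le> (int u + 2) ^ 7"
proof -
  note p = parameters[OF n u lg b q W n2 L T]
  define s where "s = sqrt (real n * ln (real n + 2))"
  define lam where "lam = ln (real u + 2)"
  have lam: "1 \<le> lam" unfolding lam_def by (rule ln_ge_1[OF u])
  have ln1: "1 \<le> ln (real n + 2)" by (rule ln_ge_1[OF n(1)])
  have "1 * 1 \<le> real n * ln (real n + 2)" using n(1) ln1 by (intro mult_mono) auto
  then have s1: "1 \<le> s" unfolding s_def by simp
  have ss: "s\<^sup>2 = real n * ln (real n + 2)" unfolding s_def using ln1 by simp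
  have lg3: "real lg \<le> 3 * ln (real n + 2)"
  proof -
    have "2 ^ (lg - 1) < n + 1" using cl_less[of "lg - 1" "n + 1"] p(3) lg by simp
    then have "real (2 ^ (lg - 1)) \<le> real (n + 2)" by (simp only: of_nat_le_iff)
    then have "real (lg - 1) \<le> 2 * ln (real (n + 2))" by (intro le_of_two_power_le) simp
    then have "real (lg - 1) \<le> 2 * ln (real n + 2)" by (simp add: add.commute)
    moreover have "real lg = real (lg - 1) + 1" using p(3) by simp
    ultimately show ?thesis using ln1 by linarith
  qed
  have b3: "real b \<le> 3 * s"
  proof -
    have "(b - 1) * (b - 1) < n * lg" using bl_less[of "b - 1" "n * lg"] p(1) b by simp
    then have "real ((b - 1) * (b - 1)) \<le> real (n * lg)" by (simp only: of_nat_le_iff)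
    also have "real (n * lg) \<le> real n * (3 * ln (real n + 2))" using lg3 by (simp add: mult_left_mono)
    also have "\<dots> = 3 * s\<^sup>2" unfolding ss by simp
    also have "\<dots> \<le> (2 * s)\<^sup>2" by (simp add: power2_eq_square)
    finally have "(real (b - 1))\<^sup>2 \<le> (2 * s)\<^sup>2" by (simp add: power2_eq_square)
    then have "real (b - 1) \<le> 2 * s" by (rule power2_le_imp_le) (use s1 in simp)
    moreover have "real b = real (b - 1) + 1" using p(1) by simp
    ultimately show ?thesis using s1 by linarith
  qed
  have "b \<le> u + 2" using p(2) n(2) by linarith
  then have "u * b \<le> (u + 2) * (u + 2)" by (intro mult_le_mono) auto
  then have Tu: "T \<le> 160 * ((u + 2) * (u + 2))" using p(11) by linarith
  have "T \<le> (u + 2) ^ 7"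
  proof -
    have pw: "x ^ 5 * (x * x) = x ^ 7" for x :: nat by (simp add: eval_nat_numeral)
    \<comment> \<open>Here \<open>u + 2 \<ge> 3\<close>, so five further factors
      \<open>u + 2\<close> replace the constant 160.\<close>
    have "160 \<le> (3::nat) ^ 5" by simp
    also have "\<dots> \<le> (u + 2) ^ 5" using u by (intro power_mono) auto
    finally have "160 * ((u + 2) * (u + 2)) \<le> (u + 2) ^ 5 * ((u + 2) * (u + 2))" by (rule mult_le_mono1)
    also have "\<dots> = (u + 2) ^ 7" by (rule pw)
    finally show ?thesis using Tu by linarith
  qed
  then have "int T \<le> int ((u + 2) ^ 7)" by (simp only: of_nat_le_iff)
  then show "int T \<le> (int u + 2) ^ 7" by (simp add: add.commute)
  have L3: "real (L + 1) \<le> 323 * lam"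
  proof -
    have "real T \<le> real (160 * ((u + 2) * (u + 2)))" using Tu by (simp only: of_nat_le_iff)
    also have "\<dots> = 160 * (real u + 2)\<^sup>2" by (simp add: power2_eq_square algebra_simps)
    finally have "2 ^ L \<le> 160 * (real u + 2)\<^sup>2" unfolding T by simp
    then have "real L \<le> 2 * ln (160 * (real u + 2)\<^sup>2)" by (rule le_of_two_power_le)
    also have "ln (160 * (real u + 2)\<^sup>2) = ln 160 + 2 * lam"
    proof -
      have u2: "0 < real u + 2" by simp
      have "ln (160 * (real u + 2)\<^sup>2) = ln 160 + ln ((real u + 2)\<^sup>2)"
        by (rule ln_mult_pos) (use u2 in auto)
      then show ?thesis using ln_realpow[of "real u + 2" 2] u2 by (simp add: lam_def)
    qed
    \<comment> \<open>The crude bound \<open>ln x \<le> x - 1\<close> is enough and explains the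
      size of 323.\<close>
    also have "ln (160::real) \<le> 160 - 1" by (rule ln_le_minus_one) simp
    finally have "real L \<le> 318 + 4 * lam" by simp
    then show ?thesis using lam by simp
  qed
  have "real (60000 * (u * b * (L + 1))) = 60000 * (real u * (real b * real (L + 1)))" by (simp add: algebra_simps)
  also have "\<dots> \<le> 60000 * (real u * ((3 * s) * (323 * lam)))"
    using b3 L3 s1 lam by (intro mult_left_mono mult_mono) auto
  also have "\<dots> = 58140000 * (s * real u * lam)" by simp
  also have "\<dots> \<le> 60000000 * (s * real u * lam)" using s1 lam by (intro mult_right_mono) auto
  finally show "real (60000 * (u * b * (L + 1))) \<le> 60000000 * (sqrt (real n * ln (real n + 2)) * real u * ln (real u + 2))"
    unfolding s_def lam_def .
qed

subsection \<open>Moving the input out of the registers and the output back\<close>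

text \<open>The input fills the registers that the program needs. Only registers 0 and 1, with \<open>u\<close> and \<open>n\<close>, can be used at first:
  \<open>256 * u\<close> is an address beyond the input, and storing \<open>n\<close> there frees register 1.\<close>
definition pre_save :: "nat \<Rightarrow> instr list" where
  "pre_save k = concat (map (\<lambda>j. [Const 1 (16 * int j), Add 1 1 0, Store j 1]) [2..<k])"

text \<open>Eight doublings make register 0 the base \<open>256 * u\<close> without a second
  register. Once the registers are saved, those from 2 on are free, and dividing by 256 puts
  \<open>u\<close> into register 1, which is \<open>vreg Vu\<close>.\<close>

definition pre :: "instr list" where
  "pre = replicate 8 (Add 0 0 0) @ [Store 1 0] @ pre_save 64 @ [Const 2 256, Div 1 0 2]"

definition post_load :: "nat \<Rightarrow> instr list" where
  "post_load k = concat (map (\<lambda>j. [Const j (16 * int j), Add j j 0, Load j j]) [1..<k])"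

text \<open>Register 0 is restored last because all other loads need the base address in it.\<close>

definition post :: "instr list" where
  "post = post_load 64 @ [Load 0 0]"

definition main_code :: "instr list" where
  "main_code = ccom (4 + length pre) mainc"

text \<open>The first four instructions treat \<open>n = 0\<close>, where the time bound is a
  constant: only cell 0 has to become 1, as the cells after it are 0 already.\<close>

definition subset_sum_prog :: prog where
  "subset_sum_prog = [Jz 1 2, Jmp 4, Const 0 1, Jmp (4 + length pre + length main_code + length post)] @
     pre @ main_code @ post"

lemma sl_doubling: "bdd M m \<Longrightarrow> \<bar>2 ^ k * m 0\<bar> \<le> M \<Longrightarrow> sl M (replicate k (Add 0 0 0)) m (m(0 := 2 ^ k * m 0))"
proof (induction k arbitrary: m)
  case 0
  then show ?case by (auto intro: sl.intros)
next
  case (Suc k)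
  let ?m = "mex (Add 0 0 0) m"
  have em: "?m = m(0 := 2 * m 0)" by (simp add: mex_simps)
  have "\<bar>2 * m 0\<bar> \<le> \<bar>2 ^ Suc k * m 0\<bar>"
  proof -
    have "1 * \<bar>2 * m 0\<bar> \<le> 2 ^ k * \<bar>2 * m 0\<bar>" by (intro mult_right_mono) auto
    then show ?thesis by (simp add: abs_mult)
  qed
  then have b: "bdd M ?m" unfolding em using Suc.prems by (intro bdd_upd) auto
  have "sl M (replicate k (Add 0 0 0)) ?m (?m(0 := 2 ^ k * ?m 0))"
    by (rule Suc.IH[OF b]) (use Suc.prems in \<open>simp add: em mult.commute mult.left_commute\<close>)
  moreover have "?m(0 := 2 ^ k * ?m 0) = m(0 := 2 ^ Suc k * m 0)" by (simp add: em algebra_simps)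
  ultimately have s: "sl M (replicate k (Add 0 0 0)) ?m (m(0 := 2 ^ Suc k * m 0))" by simp
  show ?case unfolding replicate_Suc by (rule sl.sl_Cons[OF _ b s]) simp
qed

text \<open>Register 1 is the scratch cell for addresses, hence the claims start at 2. All
  destinations lie above \<open>base\<close>, so registers not yet saved and the input stay
  intact.\<close>

lemma sl_pre_save:
  fixes base :: nat
  assumes m: "bdd M m" "m 0 = int base" and base: "64 \<le> base" "int base + 1024 \<le> M" and k: "2 \<le> k" "k \<le> 64"
  shows "\<exists>m'. sl M (pre_save k) m m' \<and> m' 0 = int base \<and> (\<forall>x. 2 \<le> x \<and> x \<le> base \<longrightarrow> m' x = m x) \<and>
    (\<forall>j. 2 \<le> j \<and> j < k \<longrightarrow> m' (base + 16 * j) = m j)"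
  using k
proof (induction k rule: dec_induct)
  case base
  show ?case using m by (intro exI[of _ m]) (auto simp: pre_save_def intro: sl.intros)
next
  case (step k)
  then obtain m1 where m1: "sl M (pre_save k) m m1" "m1 0 = int base" "\<And>x. 2 \<le> x \<Longrightarrow> x \<le> base \<Longrightarrow> m1 x = m x"
    "\<And>j. 2 \<le> j \<Longrightarrow> j < k \<Longrightarrow> m1 (base + 16 * j) = m j" by auto
  have b1: "bdd M m1" using m1(1) m(1) by (rule sl_bdd)
  have kk: "2 \<le> k" "k < 64" using step by auto
  let ?m2 = "mex (Const 1 (16 * int k)) m1"
  let ?m3 = "mex (Add 1 1 0) ?m2"
  let ?m4 = "mex (Store k 1) ?m3"
  have e2: "?m2 = m1(1 := 16 * int k)" by (simp add: mex_simps)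
  have e3: "?m3 = m1(1 := 16 * int k + int base)" by (simp add: mex_simps m1(2))
  have nt: "nat (16 * int k + int base) = base + 16 * k" by simp
  have e4: "?m4 = (m1(1 := 16 * int k + int base))(base + 16 * k := m k)"
    unfolding mex_simps(7) e3 using kk base(1) m1(3)[of k] by (simp add: nt)
  have b2: "bdd M ?m2" unfolding e2 using b1 kk base by (intro bdd_upd) auto
  have b3: "bdd M ?m3" unfolding e3 using b1 kk base by (intro bdd_upd) auto
  have "\<bar>m k\<bar> \<le> M" using m(1) by (simp add: bdd_def)
  then have b4: "bdd M ?m4" unfolding e4 e3[symmetric] by (rule bdd_upd[OF b3])
  have ps: "pre_save (Suc k) = pre_save k @ [Const 1 (16 * int k), Add 1 1 0, Store k 1]"
    using kk by (simp add: pre_save_def)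
  have "sl M [Const 1 (16 * int k), Add 1 1 0, Store k 1] m1 ?m4"
    by (intro sl.intros b2 b3 b4) auto
  then have "sl M (pre_save (Suc k)) m ?m4" unfolding ps using m1(1) by (rule sl_append[rotated])
  moreover have "?m4 0 = int base" unfolding e4 using m1(2) base(1) by simp
  moreover have "?m4 x = m x" if "2 \<le> x" "x \<le> base" for x unfolding e4 using that m1(3)[of x] kk by simp
  moreover have "?m4 (base + 16 * j) = m j" if "2 \<le> j" "j < Suc k" for j
    unfolding e4 using that m1(4)[of j] base(1) by (auto simp: less_Suc_eq)
  ultimately show ?case by blast
qed

lemma sl_pre:
  fixes u n :: nat
  assumes m: "bdd M m" "m 0 = int u" "m 1 = int n" and u: "1 \<le> u" and M: "256 * int u + 1024 \<le> M"
  shows "\<exists>m'. sl M pre m m' \<and> m' 0 = 256 * int u \<and> m' 1 = int u \<and> (\<forall>x. 3 \<le> x \<and> x < 256 * u \<longrightarrow> m' x = m x) \<and>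
    m' (256 * u) = int n \<and> (\<forall>j. 2 \<le> j \<and> j < 64 \<longrightarrow> m' (256 * u + 16 * j) = m j)"
proof -
  define m1 where "m1 = m(0 := 256 * int u)"
  have 1: "sl M (replicate 8 (Add 0 0 0)) m m1"
    using sl_doubling[OF m(1), of 8] m(2) M by (simp add: m1_def)
  have b1: "bdd M m1" using sl_bdd[OF 1 m(1)] .
  let ?m2 = "mex (Store 1 0) m1"
  have nt: "nat (256 * int u) = 256 * u" by simp
  have e2: "?m2 = m1(256 * u := int n)" unfolding mex_simps(7) using m(3) nt by (simp add: m1_def)
  have "\<bar>int n\<bar> \<le> M" using m(1,3) unfolding bdd_def by metis
  then have b2: "bdd M ?m2" unfolding e2 by (rule bdd_upd[OF b1])
  have 2: "sl M [Store 1 0] m1 ?m2" using b2 by (intro sl_single) auto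
  have z: "?m2 0 = int (256 * u)" unfolding e2 using u by (simp add: m1_def)
  obtain m3 where m3: "sl M (pre_save 64) ?m2 m3" "m3 0 = int (256 * u)" "\<And>x. 2 \<le> x \<Longrightarrow> x \<le> 256 * u \<Longrightarrow> m3 x = ?m2 x"
    "\<And>j. 2 \<le> j \<Longrightarrow> j < 64 \<Longrightarrow> m3 (256 * u + 16 * j) = ?m2 j"
    using sl_pre_save[OF b2 z, of 64] u M by auto
  have b3: "bdd M m3" using sl_bdd[OF m3(1) b2] .
  let ?m4 = "mex (Const 2 256) m3"
  let ?m5 = "mex (Div 1 0 2) ?m4"
  have e4: "?m4 = m3(2 := 256)" by (simp add: mex_simps)
  have e5: "?m5 = m3(2 := 256, 1 := int u)" by (simp add: mex_simps m3(2))
  have b4: "bdd M ?m4" unfolding e4 using b3 M u by (intro bdd_upd) auto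
  have b5: "bdd M ?m5" unfolding e5 using b3 M u by (intro bdd_upd) auto
  have 4: "sl M [Const 2 256, Div 1 0 2] m3 ?m5" by (intro sl.intros b4 b5) auto
  have "sl M pre m ?m5" unfolding pre_def by (rule sl_append[OF 1 sl_append[OF 2 sl_append[OF m3(1) 4]]])
  moreover have "?m5 0 = 256 * int u" "?m5 1 = int u" unfolding e5 using m3(2) by auto
  moreover have "?m5 x = m x" if "3 \<le> x" "x < 256 * u" for x
    unfolding e5 using that m3(3)[of x, unfolded e2] by (simp add: m1_def)
  moreover have "?m5 (256 * u) = int n" unfolding e5 using m3(3)[of "256 * u", unfolded e2] u by simp
  moreover have "?m5 (256 * u + 16 * j) = m j" if "2 \<le> j" "j < 64" for j
    unfolding e5 using m3(4)[of j, unfolded e2] that u by (simp add: m1_def)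
  ultimately show ?thesis by blast
qed

lemma sl_post_load:
  fixes base :: nat
  assumes m: "bdd M m" "m 0 = int base" and base: "64 \<le> base" "int base + 1024 \<le> M" and k: "1 \<le> k" "k \<le> 64"
  shows "\<exists>m'. sl M (post_load k) m m' \<and> m' 0 = int base \<and> (\<forall>x. 64 \<le> x \<longrightarrow> m' x = m x) \<and>
    (\<forall>j. 1 \<le> j \<and> j < k \<longrightarrow> m' j = m (base + 16 * j))"
  using k
proof (induction k rule: dec_induct)
  case base
  show ?case using m by (intro exI[of _ m]) (auto simp: post_load_def intro: sl.intros)
next
  case (step k)
  then obtain m1 where m1: "sl M (post_load k) m m1" "m1 0 = int base" "\<And>x. 64 \<le> x \<Longrightarrow> m1 x = m x"
    "\<And>j. 1 \<le> j \<Longrightarrow> j < k \<Longrightarrow> m1 j = m (base + 16 * j)" by auto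
  have b1: "bdd M m1" using m1(1) m(1) by (rule sl_bdd)
  have kk: "1 \<le> k" "k < 64" using step by auto
  let ?m2 = "mex (Const k (16 * int k)) m1"
  let ?m3 = "mex (Add k k 0) ?m2"
  let ?m4 = "mex (Load k k) ?m3"
  have e2: "?m2 = m1(k := 16 * int k)" by (simp add: mex_simps)
  have e3: "?m3 = m1(k := 16 * int k + int base)" using kk by (simp add: mex_simps m1(2))
  have nt: "nat (16 * int k + int base) = base + 16 * k" by simp
  have e4: "?m4 = m1(k := m (base + 16 * k))"
    unfolding mex_simps(5) e3 using kk base(1) m1(3)[of "base + 16 * k"] by (simp add: nt)
  have b2: "bdd M ?m2" unfolding e2 using b1 kk base by (intro bdd_upd) auto
  have b3: "bdd M ?m3" unfolding e3 using b1 kk base by (intro bdd_upd) auto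
  have "\<bar>m (base + 16 * k)\<bar> \<le> M" using m(1) by (simp add: bdd_def)
  then have b4: "bdd M ?m4" unfolding e4 by (rule bdd_upd[OF b1])
  have ps: "post_load (Suc k) = post_load k @ [Const k (16 * int k), Add k k 0, Load k k]"
    using kk by (simp add: post_load_def)
  have "sl M [Const k (16 * int k), Add k k 0, Load k k] m1 ?m4"
    by (intro sl.intros b2 b3 b4) auto
  then have "sl M (post_load (Suc k)) m ?m4" unfolding ps using m1(1) by (rule sl_append[rotated])
  moreover have "?m4 0 = int base" unfolding e4 using m1(2) kk by simp
  moreover have "?m4 x = m x" if "64 \<le> x" for x unfolding e4 using that m1(3)[of x] kk by simp
  moreover have "?m4 j = m (base + 16 * j)" if "1 \<le> j" "j < Suc k" for j
    unfolding e4 using that m1(4)[of j] by (auto simp: less_Suc_eq)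
  ultimately show ?case by blast
qed

lemma sl_post:
  fixes base :: nat
  assumes m: "bdd M m" "m 0 = int base" and base: "64 \<le> base" "int base + 1024 \<le> M"
  shows "\<exists>m'. sl M post m m' \<and> (\<forall>x. 64 \<le> x \<longrightarrow> m' x = m x) \<and> (\<forall>j<64. m' j = m (base + 16 * j))"
proof -
  obtain m1 where m1: "sl M (post_load 64) m m1" "m1 0 = int base" "\<And>x. 64 \<le> x \<Longrightarrow> m1 x = m x"
    "\<And>j. 1 \<le> j \<Longrightarrow> j < 64 \<Longrightarrow> m1 j = m (base + 16 * j)"
    using sl_post_load[OF m base, of 64] by auto
  have b1: "bdd M m1" using m1(1) m(1) by (rule sl_bdd)
  let ?m2 = "mex (Load 0 0) m1"
  have e2: "?m2 = m1(0 := m base)" using base m1(3)[of base] by (simp add: mex_simps m1(2))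
  have "\<bar>m base\<bar> \<le> M" using m(1) by (simp add: bdd_def)
  then have "bdd M ?m2" unfolding e2 by (rule bdd_upd[OF b1])
  then have "sl M [Load 0 0] m1 ?m2" by (intro sl_single) auto
  then have "sl M post m ?m2" unfolding post_def using m1(1) by (rule sl_append[rotated])
  moreover have "?m2 x = m x" if "64 \<le> x" for x unfolding e2 using that m1(3) by simp
  moreover have "?m2 j = m (base + 16 * j)" if "j < 64" for j unfolding e2 using that m1(4)[of j] by (cases "j = 0") auto
  ultimately show ?thesis by blast
qed

section \<open>The assembled program and its runs\<close>

lemma cwf_mainc: "cwf mainc"
  by (simp add: mainc_def xsE_def lgcom_def bcom_def spow_def dbl_def mktab_def tabbody_def isq_def classes_def
    cls_def clsfilter_def leafE_def merges_def mergebody_def scatter_def conv_def fft_def ifft_def level_def fill_def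
    fftR_def fftI_def ifftR_def ifftI_def loE_def hiE_def tE_def nz_def isz_def)

lemma subset_sums_eq: "subset_sums (real u) X = {\<Sum>Y | Y. Y \<subseteq> X \<and> \<Sum>Y \<le> u}"
  by (auto simp: subset_sums_def upto_set_def)

lemma subset_sum_prog_layout:
  "code_at subset_sum_prog 4 pre" "code_at subset_sum_prog (4 + length pre) main_code"
  "code_at subset_sum_prog (4 + length pre + length main_code) post"
  "length subset_sum_prog = 4 + length pre + length main_code + length post"
proof -
  let ?h = "[Jz 1 2, Jmp 4, Const 0 1, Jmp (4 + length pre + length main_code + length post)]"
  have e: "subset_sum_prog = ?h @ pre @ main_code @ post" "subset_sum_prog = (?h @ pre) @ main_code @ post"
    "subset_sum_prog = (?h @ pre @ main_code) @ post @ []"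
    by (simp_all add: subset_sum_prog_def)
  have l: "length ?h = 4" "length (?h @ pre) = 4 + length pre" "length (?h @ pre @ main_code) = 4 + length pre + length main_code"
    by simp_all
  show "code_at subset_sum_prog 4 pre" using code_at_middle[of ?h pre "main_code @ post"] unfolding e(1)[symmetric] l(1) .
  show "code_at subset_sum_prog (4 + length pre) main_code"
    using code_at_middle[of "?h @ pre" main_code post] unfolding e(2)[symmetric] l(2) .
  show "code_at subset_sum_prog (4 + length pre + length main_code) post"
    using code_at_middle[of "?h @ pre @ main_code" post "[]"] unfolding e(3)[symmetric] l(3) .
  show "length subset_sum_prog = 4 + length pre + length main_code + length post" by (simp add: subset_sum_prog_def)
qed

lemma subset_sum_prog_head:
  "subset_sum_prog ! 0 = Jz 1 2" "subset_sum_prog ! 1 = Jmp 4" "subset_sum_prog ! 2 = Const 0 1"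
  "subset_sum_prog ! 3 = Jmp (length subset_sum_prog)"
proof -
  show "subset_sum_prog ! 3 = Jmp (length subset_sum_prog)"
    unfolding subset_sum_prog_layout(4) by (simp add: subset_sum_prog_def)
qed (simp_all add: subset_sum_prog_def)

lemma run_empty:
  assumes u: "1 \<le> u" and M: "int u \<le> M"
  shows "reach subset_sum_prog M (init_config u []) 3 (length subset_sum_prog, (init_mem u [])(0 := 1))"
proof -
  let ?P = subset_sum_prog and ?m = "init_mem u []"
  have len: "4 \<le> length ?P" using subset_sum_prog_layout(4) by simp
  have b: "bdd M ?m" using M by (auto simp: bdd_def init_mem_def)
  have b': "bdd M (?m(0 := 1))" using b M u by (intro bdd_upd) auto
  have 1: "reach ?P M (0, ?m) 1 (2, ?m)"
    by (rule reach_step[OF b _ _ b]) (use len in \<open>auto simp: subset_sum_prog_head init_mem_def\<close>)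
  have 2: "reach ?P M (2, ?m) 1 (3, ?m(0 := 1))"
    by (rule reach_step[OF b _ _ b']) (use len in \<open>auto simp: subset_sum_prog_head\<close>)
  have 3: "reach ?P M (3, ?m(0 := 1)) 1 (length ?P, ?m(0 := 1))"
    by (rule reach_step[OF b' _ _ b']) (use len in \<open>auto simp: subset_sum_prog_head\<close>)
  have "(1::nat) + 1 + 1 = 3" by simp
  then show ?thesis using reach_trans[OF reach_trans[OF 1 2] 3] unfolding init_config_def by (simp only:)
qed

lemma run_nonempty:
  assumes u: "1 \<le> u" and xs: "xs \<noteq> []" "distinct xs" "\<And>x. x \<in> set xs \<Longrightarrow> x \<le> u"
    and M: "M = ((int u + 2) ^ 512) ^ (cwt mainc + 3)"
  shows "\<exists>t m. reach subset_sum_prog M (init_config u xs) t (length subset_sum_prog, m) \<and>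
    real t \<le> real (length main_code) * (60000000 * (sqrt (real (length xs) * ln (real (length xs) + 2)) * real u * ln (real u + 2)))
      + real (2 + length pre + length post) \<and>
    (\<forall>x\<le>u. m x = ind (x \<in> {\<Sum>Y | Y. Y \<subseteq> set xs \<and> \<Sum>Y \<le> u}))"
proof -
  let ?P = subset_sum_prog and ?m = "init_mem u xs"
  define n where "n = length xs"
  define SS where "SS = {\<Sum>Y | Y. Y \<subseteq> set xs \<and> \<Sum>Y \<le> u}"
  define lg where "lg = cl (n + 1)"
  define b where "b = bl (n * lg)"
  define q where "q = u div b"
  define W :: nat where "W = 2 ^ cl (2 * q + 1)"
  define n2 :: nat where "n2 = 2 ^ cl (2 * u + 1)"
  define L where "L = cl (8 * n * W + n2 + 8)"
  define T :: nat where "T = 2 ^ L"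
  have n1: "1 \<le> n" using xs(1) by (simp add: n_def Suc_le_eq)
  have nu: "n \<le> u + 1"
  proof -
    have "set xs \<subseteq> {0..u}" using xs(3) by auto
    then have "card (set xs) \<le> card {0..u}" by (intro card_mono) auto
    then show ?thesis using distinct_card[OF xs(2)] by (simp add: n_def)
  qed
  note tb = time_bound[OF n1 nu u lg_def b_def q_def W_def n2_def L_def T_def]
  \<comment> \<open>By \<open>T \<le> (u + 2) ^ 7\<close> the requirement
    \<open>2 * T ^ 64 \<le> B\<close> is met from exponent 449 on; 512 is the next power of
    two.\<close>
  define B where "B = (int u + 2) ^ 512"
  have u3: "3 \<le> int u + 2" using u by simp
  have B1: "2 * int T ^ 64 \<le> B"
  proof -
    have "int T ^ 64 \<le> ((int u + 2) ^ 7) ^ 64" using tb(2) by (intro power_mono) auto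
    also have "((int u + 2) ^ 7) ^ 64 = (int u + 2) ^ 448" by (simp flip: power_mult)
    finally have "2 * int T ^ 64 \<le> (int u + 2) * (int u + 2) ^ 448" using u3 by (intro mult_mono) auto
    also have "\<dots> = (int u + 2) ^ 449" by (simp flip: power_Suc)
    also have "\<dots> \<le> B" unfolding B_def using u3 by (intro power_increasing) auto
    finally show ?thesis .
  qed
  have B2: "256 * int u + 1024 \<le> B"
  proof -
    have "(1280::int) \<le> 3 ^ 7" by simp
    also have "\<dots> \<le> (int u + 2) ^ 7" using u3 by (intro power_mono) auto
    finally have "1280 * int u \<le> (int u + 2) ^ 7 * (int u + 2)" by (intro mult_mono) auto
    also have "\<dots> = (int u + 2) ^ 8" by (simp flip: power_Suc2)
    also have "\<dots> \<le> B" unfolding B_def using u3 by (intro power_increasing) auto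
    finally show ?thesis using u by linarith
  qed
  have BM: "B \<le> M" unfolding M B_def[symmetric] using B2 u by (intro self_le_power) auto
  have M0: "B ^ (cwt mainc + 3) \<le> M" unfolding M B_def ..
  have init: "?m 0 = int u" "?m 1 = int n" "\<And>j. 2 \<le> j \<Longrightarrow> j - 2 < n \<Longrightarrow> ?m j = int (xs ! (j - 2))"
    by (auto simp: init_mem_def n_def)
  have bB: "bdd B ?m"
  proof -
    have 1: "int (xs ! i) \<le> B" if "i < length xs" for i
    proof -
      have "xs ! i \<le> u" using xs(3) that by simp
      then show ?thesis using B2 by linarith
    qed
    have "int (length xs) \<le> B" "int u \<le> B" "0 \<le> B" using nu B2 unfolding n_def by linarith+
    then show ?thesis using 1 by (simp add: bdd_def init_mem_def)
  qed
  have bM: "bdd M' m" if "bdd B m" "B \<le> M'" for M' m using that unfolding bdd_def by (meson order_trans)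
  have slM: "sl M c m m'" if "sl B c m m'" for c m m' using that by (induction rule: sl.induct) (auto intro: sl.intros bM BM)
  define base where "base = 256 * u"
  \<comment> \<open>\<open>RAW\<close> thus fills the addresses from 64 to the last one before the
    base.\<close>
  define lm where "lm = 256 * int u - 64"
  obtain m1 where m1: "sl B pre ?m m1" "m1 0 = 256 * int u" "m1 1 = int u" "\<And>x. 3 \<le> x \<Longrightarrow> x < 256 * u \<Longrightarrow> m1 x = ?m x"
    "m1 (256 * u) = int n" "\<And>j. 2 \<le> j \<Longrightarrow> j < 64 \<Longrightarrow> m1 (256 * u + 16 * j) = ?m j"
    using sl_pre[OF bB init(1,2) u B2] by auto
  have b1: "bdd B m1" using sl_bdd[OF m1(1) bB] .
  \<comment> \<open>The source state is read off the machine memory, so that \<open>rep\<close>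
    holds by construction.\<close>
  define v where "v x = m1 (vreg x)" for x
  define a where "a k i = (if k = RAW \<longrightarrow> int i < lm then m1 (addr base k i) else 0)" for k i
  have rep: "rep base lm (v, a) m1" using m1(2) by (auto simp: rep_def v_def a_def base_def)
  have sb: "sbound B (v, a)" using b1 B2 by (auto simp: sbound_def bdd_def v_def a_def)
  have "tri B lm mainc (v, a) (60000 * (u * b * (L + 1))) (\<lambda>(v', a').
    (\<forall>i<64. i \<le> u \<longrightarrow> a' SV i = ind (i \<in> SS)) \<and> (\<forall>i. 64 \<le> i \<longrightarrow> i \<le> u \<longrightarrow> a' RAW (i - 64) = ind (i \<in> SS)))"
  proof (rule tri_mainc[OF u n_def n1 xs(2,3) lg_def b_def q_def W_def n2_def L_def T_def _ _ _ _ _ _ _ B1 _ SS_def])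
    show "v Vu = int u" using m1(3) by (simp add: v_def)
    show "a SV 0 = int n" using m1(5) by (simp add: a_def addr_def base_def)
    show "a SV j = int (xs ! (j - 2))" if "2 \<le> j" "j < 64" "j - 2 < n" for j
      using m1(6)[OF that(1,2)] init(3)[OF that(1,3)] by (simp add: a_def addr_def base_def)
    show "a RAW j = int (xs ! (j + 62))" if j: "j + 62 < n" for j
    proof -
      have lt: "64 + j < 256 * u" using j nu u by linarith
      have "m1 (64 + j) = ?m (64 + j)" using lt by (intro m1(4)) auto
      also have "\<dots> = int (xs ! (j + 62))" using init(3)[of "64 + j"] j by (simp add: add.commute)
      finally show ?thesis using lt by (simp add: a_def addr_def lm_def)
    qed
    show "int n \<le> lm + 62" "0 < lm" "int u \<le> lm + 63" "64 \<le> B" using nu u B2 by (simp_all add: lm_def)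
  qed
  then obtain t v' a' where t: "big B lm mainc (v, a) t (v', a')" "t \<le> 60000 * (u * b * (L + 1))"
    "\<And>i. i < 64 \<Longrightarrow> i \<le> u \<Longrightarrow> a' SV i = ind (i \<in> SS)" "\<And>i. 64 \<le> i \<Longrightarrow> i \<le> u \<Longrightarrow> a' RAW (i - 64) = ind (i \<in> SS)"
    unfolding tri_def by auto
  have bs: "64 \<le> B" "int base \<le> B" "64 \<le> base" "int 64 + lm \<le> int base" using B2 u by (auto simp: base_def lm_def)
  obtain t2 m2 where m2: "reach ?P M (4 + length pre, m1) t2 (4 + length pre + length main_code, m2)"
    "t2 \<le> length main_code * t" "rep base lm (v', a') m2" "bdd M m2"
    using ccom_correct[OF bs t(1) sb cwf_mainc subset_sum_prog_layout(2)[unfolded main_code_def] rep bM[OF b1 BM] M0 order_refl]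
    unfolding main_code_def by blast
  have m20: "m2 0 = int base" using m2(3) by (simp add: rep_def)
  have "int base + 1024 \<le> M" using B2 BM by (simp add: base_def)
  then obtain m3 where m3: "sl M post m2 m3" "\<And>x. 64 \<le> x \<Longrightarrow> m3 x = m2 x" "\<And>j. j < 64 \<Longrightarrow> m3 j = m2 (base + 16 * j)"
    using sl_post[OF m2(4) m20 bs(3)] by auto
  have len: "4 \<le> length ?P" using subset_sum_prog_layout(4) by simp
  have b0: "bdd M ?m" by (rule bM[OF bB BM])
  have r1: "reach ?P M (0, ?m) 1 (1, ?m)"
    by (rule reach_step[OF b0 _ _ b0]) (use len n1 init(2) in \<open>auto simp: subset_sum_prog_head\<close>)
  have r2: "reach ?P M (1, ?m) 1 (4, ?m)"
    by (rule reach_step[OF b0 _ _ b0]) (use len in \<open>auto simp: subset_sum_prog_head(2)[simplified]\<close>)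
  have r3: "reach ?P M (4, ?m) (length pre) (4 + length pre, m1)"
    by (rule sl_reach[OF slM[OF m1(1)] b0 subset_sum_prog_layout(1)])
  have r5: "reach ?P M (4 + length pre + length main_code, m2) (length post) (length ?P, m3)"
    using sl_reach[OF m3(1) m2(4) subset_sum_prog_layout(3)] unfolding subset_sum_prog_layout(4) .
  note R = reach_trans[OF reach_trans[OF reach_trans[OF reach_trans[OF r1 r2] r3] m2(1)] r5]
  have tt: "real (1 + 1 + length pre + t2 + length post) \<le> real (length main_code) *
    (60000000 * (sqrt (real n * ln (real n + 2)) * real u * ln (real u + 2))) + real (2 + length pre + length post)"
  proof -
    have "real t2 \<le> real (length main_code * t)" using m2(2) by (simp only: of_nat_le_iff)
    also have "\<dots> = real (length main_code) * real t" by simp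
    also have "real t \<le> 60000000 * (sqrt (real n * ln (real n + 2)) * real u * ln (real u + 2))"
      using t(2) tb(1) by (simp only: of_nat_le_iff[symmetric, where ?'a = real])
    finally have "real t2 \<le> real (length main_code) * (60000000 * (sqrt (real n * ln (real n + 2)) * real u * ln (real u + 2)))"
      by (simp add: mult_left_mono)
    then show ?thesis by simp
  qed
  have out: "m3 x = ind (x \<in> SS)" if x: "x \<le> u" for x
  proof (cases "x < 64")
    case True
    have "m2 (addr base SV x) = a' SV x" using m2(3) by (simp add: rep_def)
    then show ?thesis using m3(3)[OF True] t(3)[OF True x] by (simp add: addr_def)
  next
    case False
    have "int (x - 64) < lm" using x False u by (simp add: lm_def)
    then have "m2 (addr base RAW (x - 64)) = a' RAW (x - 64)" using m2(3) by (simp add: rep_def)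
    then show ?thesis using m3(2)[of x] t(4)[of x] False x by (simp add: addr_def)
  qed
  show ?thesis using R tt out unfolding init_config_def n_def[symmetric] SS_def[symmetric] by blast
qed

theorem theorem3p4:
  shows "\<exists>(P::prog) (C::real) (K::nat).
    \<forall>(u::nat) (xs::nat list). u > 0 \<longrightarrow> distinct xs \<longrightarrow> set xs \<subseteq> upto_set (real u) \<longrightarrow>
      (let n = length xs in
       \<exists>t::nat.
         halted P (run P t (init_config u xs)) \<and>
         real t \<le> C * (sqrt (real n * ln (real n + 2)) * real u * ln (real u + 2)) + C \<and>
         (\<forall>t'\<le>t. \<forall>a. \<bar>snd (run P t' (init_config u xs)) a\<bar> \<le> (int u + 2) ^ K) \<and>
         (\<forall>v\<le>u. snd (run P t (init_config u xs)) v =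
             (if v \<in> subset_sums (real u) (set xs) then 1 else 0)))"
proof -
  \<comment> \<open>The code length converts source steps into machine steps. The additive part is
    at least 3 and so also covers the run on an empty input.\<close>
  define C where "C = real (length main_code) * 60000000 + real (3 + length pre + length post)"
  define K where "K = 512 * (cwt mainc + 3)"
  have *: "\<exists>t. halted subset_sum_prog (run subset_sum_prog t (init_config u xs)) \<and>
         real t \<le> C * (sqrt (real (length xs) * ln (real (length xs) + 2)) * real u * ln (real u + 2)) + C \<and>
         (\<forall>t'\<le>t. \<forall>a. \<bar>snd (run subset_sum_prog t' (init_config u xs)) a\<bar> \<le> (int u + 2) ^ K) \<and>
         (\<forall>v\<le>u. snd (run subset_sum_prog t (init_config u xs)) v =
             (if v \<in> subset_sums (real u) (set xs) then 1 else 0))"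
    if u: "0 < u" and d: "distinct xs" and xs: "set xs \<subseteq> upto_set (real u)" for u :: nat and xs :: "nat list"
  proof -
    define F where "F = sqrt (real (length xs) * ln (real (length xs) + 2)) * real u * ln (real u + 2)"
    have F0: "0 \<le> F" unfolding F_def using u by simp
    have M: "(int u + 2) ^ K = ((int u + 2) ^ 512) ^ (cwt mainc + 3)" unfolding K_def power_mult ..
    have xu: "x \<le> u" if "x \<in> set xs" for x using xs that by (auto simp: upto_set_def)
    have "\<exists>t m. reach subset_sum_prog ((int u + 2) ^ K) (init_config u xs) t (length subset_sum_prog, m) \<and>
      real t \<le> C * F + C \<and> (\<forall>x\<le>u. m x = ind (x \<in> {\<Sum>Y | Y. Y \<subseteq> set xs \<and> \<Sum>Y \<le> u}))"
    proof (cases "xs = []")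
      case True
      have "int u + 2 \<le> (int u + 2) ^ K" by (rule self_le_power) (auto simp: K_def)
      then have r: "reach subset_sum_prog ((int u + 2) ^ K) (init_config u xs) 3 (length subset_sum_prog, (init_mem u [])(0 := 1))"
        unfolding True using u by (intro run_empty) auto
      have "real 3 \<le> C * F + C"
      proof -
        have "0 \<le> C" "3 \<le> C" by (simp_all add: C_def)
        moreover from this have "0 \<le> C * F" using F0 by (intro mult_nonneg_nonneg)
        ultimately show ?thesis by simp
      qed
      moreover have "((init_mem u [])(0 := 1)) x = ind (x \<in> {\<Sum>Y | Y. Y \<subseteq> set xs \<and> \<Sum>Y \<le> u})" for x
        unfolding True by (auto simp: init_mem_def ind_def)
      ultimately show ?thesis using r by blast
    next
      case False
      have "1 \<le> u" using u by simp
      from run_nonempty[OF this False d xu M]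
      obtain t m where t: "reach subset_sum_prog ((int u + 2) ^ K) (init_config u xs) t (length subset_sum_prog, m)"
        "real t \<le> real (length main_code) * (60000000 * F) + real (2 + length pre + length post)"
        "\<forall>x\<le>u. m x = ind (x \<in> {\<Sum>Y | Y. Y \<subseteq> set xs \<and> \<Sum>Y \<le> u})" unfolding F_def by blast
      have "real (length main_code) * (60000000 * F) + real (2 + length pre + length post) \<le> C * F + C"
      proof -
        have "real (length main_code) * 60000000 * F \<le> C * F" using F0 by (intro mult_right_mono) (auto simp: C_def)
        moreover have "real (2 + length pre + length post) \<le> C" by (simp add: C_def)
        ultimately show ?thesis by (simp add: mult.assoc)
      qed
      then show ?thesis using t by (meson order_trans)
    qed
    then obtain t m where t: "reach subset_sum_prog ((int u + 2) ^ K) (init_config u xs) t (length subset_sum_prog, m)"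
      "real t \<le> C * F + C" "\<And>x. x \<le> u \<Longrightarrow> m x = ind (x \<in> {\<Sum>Y | Y. Y \<subseteq> set xs \<and> \<Sum>Y \<le> u})" by blast
    have r: "run subset_sum_prog t (init_config u xs) = (length subset_sum_prog, m)" using t(1) by (simp add: reach_def)
    show ?thesis unfolding F_def[symmetric]
    proof (intro exI[of _ t] conjI)
      show "halted subset_sum_prog (run subset_sum_prog t (init_config u xs))" unfolding r by (simp add: halted_def)
      show "\<forall>t'\<le>t. \<forall>a. \<bar>snd (run subset_sum_prog t' (init_config u xs)) a\<bar> \<le> (int u + 2) ^ K"
        using t(1) by (simp add: reach_def bdd_def)
      show "\<forall>v\<le>u. snd (run subset_sum_prog t (init_config u xs)) v = (if v \<in> subset_sums (real u) (set xs) then 1 else 0)"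
        unfolding r subset_sums_eq using t(3) by (simp add: ind_def)
    qed (rule t(2))
  qed
  then show ?thesis unfolding Let_def by blast
qed

end
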